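(* Let $k$ be a commutative ring, $(A,1)$ a graded $k$-module with split element, and $\overline\mu+h+\mu_{\mathrm{su}}\in CC^\bullet(A,A)_{-1}$ a strictly unital element, with $\overline\mu\in CC^\bullet(\overline A,\overline A)_{-1}$ and $h\in CC^\bullet(\overline A,k)_{-1}$. Then $\overline\mu+h+\mu_{\mathrm{su}}$ is an $A_\infty$-algebra structure on $A$ if and only if the triple $$\left(T_{\mathsf{co}}(\Pi\overline A),\ \Phi^{-1}(\overline\mu),\ -s^{-1}h\right)$$ is a curved dg-coalgebra. This is moreover equivalent to the following equations holding for all $n\ge1$ on $(\Pi\overline A)^{\otimes n}$ (with $h^0=0$): $$\sum_{i=1}^n\sum_{j=0}^{i-1}\overline\mu^{\,i}(1^{\otimes j}\otimes\overline\mu^{\,n-i+1}\otimes1^{\otimes i-j-1})+\mu_{\mathrm{su}}^2(h^{n-1}\otimes1)+\mu_{\mathrm{su}}^2(1\otimes h^{n-1})=0,$$ $$\sum_{i=1}^n\sum_{j=0}^{i-1}h^{i}(1^{\otimes j}\otimes\overline\mu^{\,n-i+1}\otimes1^{\otimes i-j-1})=0.$$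
   Context: Conventions: modules, maps, tensor products are over $k$; graded means $\mathbb Z$-graded without boundedness assumptions. $\mathrm{Hom}(M,N)_n=\prod_i\mathrm{Hom}(M_i,N_{i+n})$. $(\Pi M)_n=M_{n-1}$, $s:M\to\Pi M$ is the degree $1$ identity map, $[x]=s(x)$, $[x_1|\dots|x_n]=[x_1]\otimes\dots\otimes[x_n]$. Koszul sign rule: $(f\otimes g)(x\otimes y)=(-1)^{|g||x|}f(x)\otimes g(y)$. $CC^n(A,B)=\mathrm{Hom}((\Pi A)^{\otimes n},\Pi B)$ and $CC^\bullet(A,B)=\prod_{n\ge1}CC^n(A,B)$, $f=(f^n)$; $CC^\bullet(A,B)_i$ is the degree $i$ part. Gerstenhaber product: $(g\circ f)^n=\sum_{i=1}^n\sum_{j=0}^{i-1}g^i(1^{\otimes j}\otimes f^{n-i+1}\otimes1^{\otimes i-j-1})$. An $A_\infty$-algebra structure on $A$ is $\nu\in CC^\bullet(A,A)_{-1}$ with $\nu\circ\nu=0$. A graded module with split element is a pair $(A,1)$, where $1\in A_0$ generates a free rank one submodule, together with a fixed graded splitting $A\to k$ of $k\to A$, $1\mapsto1$. Put $\overline A=A/(k\cdot1)\subseteq A$ via the splitting, so $A=\overline A\oplus k$. $CC^\bullet(\overline A,A)=CC^\bullet(\overline A,\overline A)\oplus CC^\bullet(\overline A,k)$ is a submodule of $CC^\bullet(A,A)$ via $A\to\overline A$ (extension by zero to tensors having an entry $[1]$). $\mu_{\mathrm{su}}\in CC^\bullet(A,A)_{-1}$ has $\mu_{\mathrm{su}}^n=0$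 for $n\ne2$, $\mu_{\mathrm{su}}^2[1|a]=[a]$, $\mu_{\mathrm{su}}^2[a|1]=(-1)^{|a|}[a]$ for $a\in A$, and $\mu_{\mathrm{su}}^2=0$ on $\Pi\overline A\otimes\Pi\overline A$. An element $\nu\in CC^\bullet(A,A)_{-1}$ is strictly unital if $\nu^2[1|a]=[a]=(-1)^{|a|}\nu^2[a|1]$ and $\nu^n$, $n\neq2$, vanishes whenever an entry is $1$; these are exactly the elements $\overline\mu+h+\mu_{\mathrm{su}}$. $T_{\mathsf{co}}(V)=\bigoplus_{n\ge1}V^{\otimes n}$ is the nonunital tensor coalgebra with $\Delta(v_1\otimes\dots\otimes v_n)=\sum_{i=1}^{n-1}(v_1\otimes\dots\otimes v_i)\otimes(v_{i+1}\otimes\dots\otimes v_n)$. A coderivation of a graded coalgebra $C$ is a homogeneous $d:C\to C$ with $(d\otimes1+1\otimes d)\Delta=\Delta d$. For $f\in CC^\bullet(\overline A,\overline A)$, $\Phi^{-1}(f)$ is the unique coderivation of $T_{\mathsf{co}}(\Pi\overline A)$ whose projection to $\Pi\overline A$ is $f$; explicitly on $(\Pi\overline A)^{\otimes n}$ it is $\sum_{i=1}^n\sum_{j=0}^{n-i}1^{\otimes j}\otimes f^i\otimes1^{\otimes n-i-j}$. The map $-s^{-1}h:T_{\mathsf{co}}(\Pi\overline A)\to k$ is $h$ followed by $-s^{-1}:\Pi k\to k$. For a graded coalgebra $C$ and homogeneous $\xi\in\mathrm{Hom}(C,k)$, $\mathrm{ad}(\xi)=(\xi\otimes1)\Delta-(1\otimes\xi)\Delta:C\to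 C$ (identifying $k\otimes C\cong C\cong C\otimes k$). A curved dg-coalgebra is a triple $(C,d,\xi)$ with $C$ a graded coalgebra, $d$ a degree $-1$ coderivation, $\xi:C\to k$ a degree $-2$ linear map, such that $d^2=\mathrm{ad}(\xi)$ and $\xi d=0$. *)

theory Defs
  imports "HOL-Algebra.Module" "HOL-Algebra.AbelCoset"
begin

section \<open>Graded modules\<close>

text \<open>
  A graded module is given by its total module \<open>M = \<Oplus>i\<in>\<int>. M\<^sub>i\<close> together with the submodules
  \<open>M\<^sub>i = grade M i\<close>. The ring fields \<open>mult\<close> and \<open>one\<close> that the library record of modules
  carries play no role for a graded module.
\<close>

record ('k, 'a) graded_module = "('k, 'a) module" +
  grade :: "int \<Rightarrow> 'a set"

locale graded_module = module R M
  for R :: "('k, 'r) ring_scheme" (structure)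
  and M :: "('k, 'a, 'm) graded_module_scheme" (structure) +
  assumes grade_submodule: "submodule (grade M i) R M"
    and grade_decomposition:
      "x \<in> carrier M \<Longrightarrow>
        \<exists>!c :: int \<Rightarrow> 'a. (\<forall>i. c i \<in> grade M i) \<and> finite {i. c i \<noteq> \<zero>\<^bsub>M\<^esub>} \<and>
          x = (\<Oplus>\<^bsub>M\<^esub>i\<in>{i. c i \<noteq> \<zero>\<^bsub>M\<^esub>}. c i)"

definition linear_maps ::
  "('k, 'r) ring_scheme \<Rightarrow> ('k, 'a, 'm) module_scheme \<Rightarrow> ('k, 'b, 'n) module_scheme \<Rightarrow> ('a \<Rightarrow> 'b) set"
  where "linear_maps R M N =
    {f \<in> hom (add_monoid M) (add_monoid N).
      \<forall>a\<in>carrier R. \<forall>x\<in>carrier M. f (a \<odot>\<^bsub>M\<^esub> x) = a \<odot>\<^bsub>N\<^esub> f x}"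

text \<open>
  A family in \<open>\<Prod>i. Hom(M\<^sub>i, N\<^bsub>i+d\<^esub>)\<close> is the same as a linear map on the total module
  that raises degrees by \<open>d\<close>.
\<close>

definition Hom_deg ::
  "('k, 'r) ring_scheme \<Rightarrow> ('k, 'a, 'm) graded_module_scheme \<Rightarrow> ('k, 'b, 'n) graded_module_scheme
    \<Rightarrow> int \<Rightarrow> ('a \<Rightarrow> 'b) set"
  where "Hom_deg R M N d =
    {f \<in> linear_maps R M N. \<forall>i. \<forall>x\<in>grade M i. f x \<in> grade N (i + d)}"

text \<open>
  The suspension has the same underlying module, so that \<open>s\<close> and \<open>[\<cdot>]\<close> are the identity of the
  underlying set; only the degrees change.
\<close>

definition suspension :: "('k, 'a) graded_module \<Rightarrow> ('k, 'a) graded_module" (\<open>\<Pi>\<close>)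
  where "\<Pi> M = M\<lparr>grade := (\<lambda>n. grade M (n - 1))\<rparr>"

definition ground :: "('k, 'r) ring_scheme \<Rightarrow> ('k, 'k) graded_module"
  where "ground R =
    \<lparr>carrier = carrier R, mult = mult R, one = one R, zero = zero R, add = add R, smult = mult R,
     grade = (\<lambda>i. if i = 0 then carrier R else {\<zero>\<^bsub>R\<^esub>})\<rparr>"

definition koszul_sign :: "('k, 'r) ring_scheme \<Rightarrow> int \<Rightarrow> 'k"
  where "koszul_sign R n = (if even n then \<one>\<^bsub>R\<^esub> else \<ominus>\<^bsub>R\<^esub> \<one>\<^bsub>R\<^esub>)"

section \<open>Tensor products\<close>

definition free_module :: "('k, 'r) ring_scheme \<Rightarrow> 'x set \<Rightarrow> ('k, 'x \<Rightarrow> 'k) module"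
  where "free_module R X =
    \<lparr>carrier = {f. (\<forall>x. f x \<in> carrier R) \<and> (\<forall>x. x \<notin> X \<longrightarrow> f x = \<zero>\<^bsub>R\<^esub>) \<and> finite {x. f x \<noteq> \<zero>\<^bsub>R\<^esub>}},
     mult = undefined, one = undefined,
     zero = (\<lambda>x. \<zero>\<^bsub>R\<^esub>), add = (\<lambda>f g x. f x \<oplus>\<^bsub>R\<^esub> g x), smult = (\<lambda>a f x. a \<otimes>\<^bsub>R\<^esub> f x)\<rparr>"

definition free_gen :: "('k, 'r) ring_scheme \<Rightarrow> 'x \<Rightarrow> 'x \<Rightarrow> 'k"
  where "free_gen R x = (\<lambda>y. if y = x then \<one>\<^bsub>R\<^esub> else \<zero>\<^bsub>R\<^esub>)"

definition submodule_span ::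
  "('k, 'r) ring_scheme \<Rightarrow> ('k, 'a, 'm) module_scheme \<Rightarrow> 'a set \<Rightarrow> 'a set"
  where "submodule_span R M S = \<Inter>{H. submodule H R M \<and> S \<subseteq> H}"

definition quotient_module :: "('k, 'a, 'm) module_scheme \<Rightarrow> 'a set \<Rightarrow> ('k, 'a set) module"
  where "quotient_module M N =
    \<lparr>carrier = a_rcosets\<^bsub>M\<^esub> N, mult = undefined, one = undefined,
     zero = N, add = set_add M, smult = (\<lambda>a X. \<Union>x\<in>X. N +>\<^bsub>M\<^esub> (a \<odot>\<^bsub>M\<^esub> x))\<rparr>"

text \<open>The tensor product of two graded modules.\<close>

definition tensor_relations ::
  "('k, 'r) ring_scheme \<Rightarrow> ('k, 'a, 'm) module_scheme \<Rightarrow> ('k, 'b, 'n) module_scheme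
    \<Rightarrow> ('a \<times> 'b \<Rightarrow> 'k) set"
  where "tensor_relations R M N = (let F = free_module R (carrier M \<times> carrier N) in submodule_span R F
    ({free_gen R (x \<oplus>\<^bsub>M\<^esub> x', y) \<ominus>\<^bsub>F\<^esub> (free_gen R (x, y) \<oplus>\<^bsub>F\<^esub> free_gen R (x', y)) | x x' y.
        x \<in> carrier M \<and> x' \<in> carrier M \<and> y \<in> carrier N} \<union>
     {free_gen R (x, y \<oplus>\<^bsub>N\<^esub> y') \<ominus>\<^bsub>F\<^esub> (free_gen R (x, y) \<oplus>\<^bsub>F\<^esub> free_gen R (x, y')) | x y y'.
        x \<in> carrier M \<and> y \<in> carrier N \<and> y' \<in> carrier N} \<union>
     {free_gen R (a \<odot>\<^bsub>M\<^esub> x, y) \<ominus>\<^bsub>F\<^esub> a \<odot>\<^bsub>F\<^esub> free_gen R (x, y) | a x y.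
        a \<in> carrier R \<and> x \<in> carrier M \<and> y \<in> carrier N} \<union>
     {free_gen R (x, a \<odot>\<^bsub>N\<^esub> y) \<ominus>\<^bsub>F\<^esub> a \<odot>\<^bsub>F\<^esub> free_gen R (x, y) | a x y.
        a \<in> carrier R \<and> x \<in> carrier M \<and> y \<in> carrier N}))"

definition pure_tensor ::
  "('k, 'r) ring_scheme \<Rightarrow> ('k, 'a, 'm) module_scheme \<Rightarrow> ('k, 'b, 'n) module_scheme
    \<Rightarrow> 'a \<Rightarrow> 'b \<Rightarrow> ('a \<times> 'b \<Rightarrow> 'k) set"
  where "pure_tensor R M N x y =
    tensor_relations R M N +>\<^bsub>free_module R (carrier M \<times> carrier N)\<^esub> free_gen R (x, y)"

definition tensor ::
  "('k, 'r) ring_scheme \<Rightarrow> ('k, 'a, 'm) graded_module_scheme \<Rightarrow> ('k, 'b, 'n) graded_module_scheme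
    \<Rightarrow> ('k, ('a \<times> 'b \<Rightarrow> 'k) set) graded_module"
  where "tensor R M N =
    (let Q = quotient_module (free_module R (carrier M \<times> carrier N)) (tensor_relations R M N) in
     module.extend Q (graded_module.fields (\<lambda>n. submodule_span R Q
       {pure_tensor R M N x y | x y. \<exists>i j. x \<in> grade M i \<and> y \<in> grade N j \<and> i + j = n})))"

text \<open>
  The tensor power \<open>V\<^sup>\<otimes>\<^sup>n\<close>, with all powers living in one type: it is generated by the words
  \<open>xs = [x\<^sub>1, \<dots>, x\<^sub>n]\<close>, whose classes are the tensors \<open>x\<^sub>1 \<otimes> \<dots> \<otimes> x\<^sub>n = word_tensor R V xs\<close>.
\<close>

definition words :: "('k, 'a, 'm) module_scheme \<Rightarrow> nat \<Rightarrow> 'a list set"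
  where "words V n = {xs. length xs = n \<and> set xs \<subseteq> carrier V}"

definition tensor_power_relations ::
  "('k, 'r) ring_scheme \<Rightarrow> ('k, 'a, 'm) module_scheme \<Rightarrow> nat \<Rightarrow> ('a list \<Rightarrow> 'k) set"
  where "tensor_power_relations R V n = (let F = free_module R (words V n) in submodule_span R F
    ({free_gen R (us @ [x \<oplus>\<^bsub>V\<^esub> y] @ vs) \<ominus>\<^bsub>F\<^esub>
        (free_gen R (us @ [x] @ vs) \<oplus>\<^bsub>F\<^esub> free_gen R (us @ [y] @ vs)) | us x y vs.
        us @ [x] @ vs \<in> words V n \<and> us @ [y] @ vs \<in> words V n} \<union>
     {free_gen R (us @ [a \<odot>\<^bsub>V\<^esub> x] @ vs) \<ominus>\<^bsub>F\<^esub> a \<odot>\<^bsub>F\<^esub> free_gen R (us @ [x] @ vs) | a us x vs.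
        a \<in> carrier R \<and> us @ [x] @ vs \<in> words V n}))"

definition word_tensor ::
  "('k, 'r) ring_scheme \<Rightarrow> ('k, 'a, 'm) module_scheme \<Rightarrow> 'a list \<Rightarrow> ('a list \<Rightarrow> 'k) set"
  where "word_tensor R V xs =
    tensor_power_relations R V (length xs) +>\<^bsub>free_module R (words V (length xs))\<^esub> free_gen R xs"

definition homogeneous_word :: "('k, 'a, 'm) graded_module_scheme \<Rightarrow> 'a list \<Rightarrow> int list \<Rightarrow> bool"
  where "homogeneous_word V xs ds \<longleftrightarrow> list_all2 (\<lambda>x d. x \<in> grade V d) xs ds"

definition tensor_power ::
  "('k, 'r) ring_scheme \<Rightarrow> ('k, 'a, 'm) graded_module_scheme \<Rightarrow> nat
    \<Rightarrow> ('k, ('a list \<Rightarrow> 'k) set) graded_module"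
  where "tensor_power R V n =
    (let Q = quotient_module (free_module R (words V n)) (tensor_power_relations R V n) in
     module.extend Q (graded_module.fields (\<lambda>m. submodule_span R Q
       {word_tensor R V xs | xs. length xs = n \<and> (\<exists>ds. homogeneous_word V xs ds \<and> sum_list ds = m)})))"

section \<open>Tensor products of maps\<close>

text \<open>
  Maps out of tensor products are defined as the unique linear maps with prescribed values on pure
  tensors of homogeneous elements (as functions they are \<open>undefined\<close> outside the carrier).
\<close>

definition the_linear_map ::
  "('k, 'r) ring_scheme \<Rightarrow> ('k, 'a, 'm) module_scheme \<Rightarrow> ('k, 'b, 'n) module_scheme
    \<Rightarrow> (('a \<Rightarrow> 'b) \<Rightarrow> bool) \<Rightarrow> 'a \<Rightarrow> 'b"
  where "the_linear_map R M N P =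
    (THE F. F \<in> linear_maps R M N \<and> F \<in> extensional (carrier M) \<and> P F)"

text \<open>\<open>f \<otimes> g : M \<otimes> N \<rightarrow> M' \<otimes> N'\<close> for \<open>g\<close> of degree \<open>e\<close>.\<close>

definition tensor_map ::
  "('k, 'r) ring_scheme \<Rightarrow> ('k, 'a) graded_module \<Rightarrow> ('k, 'b) graded_module
    \<Rightarrow> ('k, 'c) graded_module \<Rightarrow> ('k, 'd) graded_module \<Rightarrow> int \<Rightarrow> ('a \<Rightarrow> 'c) \<Rightarrow> ('b \<Rightarrow> 'd)
    \<Rightarrow> ('a \<times> 'b \<Rightarrow> 'k) set \<Rightarrow> ('c \<times> 'd \<Rightarrow> 'k) set"
  where "tensor_map R M N M' N' e f g =
    the_linear_map R (tensor R M N) (tensor R M' N')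
      (\<lambda>F. \<forall>i. \<forall>x\<in>grade M i. \<forall>y\<in>carrier N.
        F (pure_tensor R M N x y) =
          koszul_sign R (e * i) \<odot>\<^bsub>tensor R M' N'\<^esub> pure_tensor R M' N' (f x) (g y))"

definition left_unitor ::
  "('k, 'r) ring_scheme \<Rightarrow> ('k, 'a) graded_module \<Rightarrow> ('k \<times> 'a \<Rightarrow> 'k) set \<Rightarrow> 'a"
  where "left_unitor R M = the_linear_map R (tensor R (ground R) M) M
    (\<lambda>F. \<forall>c\<in>carrier R. \<forall>x\<in>carrier M. F (pure_tensor R (ground R) M c x) = c \<odot>\<^bsub>M\<^esub> x)"

definition right_unitor ::
  "('k, 'r) ring_scheme \<Rightarrow> ('k, 'a) graded_module \<Rightarrow> ('a \<times> 'k \<Rightarrow> 'k) set \<Rightarrow> 'a"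
  where "right_unitor R M = the_linear_map R (tensor R M (ground R)) M
    (\<lambda>F. \<forall>c\<in>carrier R. \<forall>x\<in>carrier M. F (pure_tensor R M (ground R) x c) = c \<odot>\<^bsub>M\<^esub> x)"

definition associator ::
  "('k, 'r) ring_scheme \<Rightarrow> ('k, 'a) graded_module \<Rightarrow> ('k, 'b) graded_module \<Rightarrow> ('k, 'c) graded_module
    \<Rightarrow> (('a \<times> 'b \<Rightarrow> 'k) set \<times> 'c \<Rightarrow> 'k) set \<Rightarrow> ('a \<times> ('b \<times> 'c \<Rightarrow> 'k) set \<Rightarrow> 'k) set"
  where "associator R L M N =
    the_linear_map R (tensor R (tensor R L M) N) (tensor R L (tensor R M N))
      (\<lambda>F. \<forall>x\<in>carrier L. \<forall>y\<in>carrier M. \<forall>z\<in>carrier N.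
        F (pure_tensor R (tensor R L M) N (pure_tensor R L M x y) z) =
          pure_tensor R L (tensor R M N) x (pure_tensor R M N y z))"

text \<open>\<open>\<phi>\<^sup>\<otimes>\<^sup>n : V\<^sup>\<otimes>\<^sup>n \<rightarrow> W\<^sup>\<otimes>\<^sup>n\<close> for \<open>\<phi>\<close> of degree 0.\<close>

definition tensor_power_map ::
  "('k, 'r) ring_scheme \<Rightarrow> ('k, 'a) graded_module \<Rightarrow> ('k, 'b) graded_module \<Rightarrow> nat \<Rightarrow> ('a \<Rightarrow> 'b)
    \<Rightarrow> ('a list \<Rightarrow> 'k) set \<Rightarrow> ('b list \<Rightarrow> 'k) set"
  where "tensor_power_map R V W n \<phi> =
    the_linear_map R (tensor_power R V n) (tensor_power R W n)
      (\<lambda>F. \<forall>xs\<in>words V n. F (word_tensor R V xs) = word_tensor R W (map \<phi> xs))"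

text \<open>
  The map \<open>1\<^sup>\<otimes>\<^sup>j \<otimes> g \<otimes> 1\<^sup>\<otimes>\<^sup>m : V\<^bsup>\<otimes>(j+i+m)\<^esup> \<rightarrow> W\<^bsup>\<otimes>(j+1+m)\<^esup>\<close> for \<open>g : V\<^sup>\<otimes>\<^sup>i \<rightarrow> W\<close> of degree \<open>e\<close>,
  where \<open>V\<close> is a graded submodule of \<open>W\<close> and \<open>1\<close> denotes the inclusion. By the Koszul rule
  the sign is that of moving \<open>g\<close> past the first \<open>j\<close> factors.
\<close>

definition insert_map ::
  "('k, 'r) ring_scheme \<Rightarrow> ('k, 'a) graded_module \<Rightarrow> ('k, 'a) graded_module \<Rightarrow> int
    \<Rightarrow> nat \<Rightarrow> nat \<Rightarrow> nat \<Rightarrow> (('a list \<Rightarrow> 'k) set \<Rightarrow> 'a) \<Rightarrow> ('a list \<Rightarrow> 'k) set \<Rightarrow> ('a list \<Rightarrow> 'k) set"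
  where "insert_map R V W e j i m g =
    the_linear_map R (tensor_power R V (j + i + m)) (tensor_power R W (j + 1 + m))
      (\<lambda>F. \<forall>us xs vs ds. length us = j \<longrightarrow> length xs = i \<longrightarrow> length vs = m \<longrightarrow>
        homogeneous_word V (us @ xs @ vs) ds \<longrightarrow>
        F (word_tensor R V (us @ xs @ vs)) =
          koszul_sign R (e * sum_list (take j ds)) \<odot>\<^bsub>tensor_power R W (j + 1 + m)\<^esub>
            word_tensor R W (us @ [g (word_tensor R V xs)] @ vs))"

section \<open>Hochschild cochains and \<open>A\<^sub>\<infinity>\<close>-structures\<close>

text \<open>
  The component \<open>f 0\<close> of a cochain is irrelevant: only the \<open>f n\<close> with \<open>n \<ge> 1\<close> are part of it.
\<close>

type_synonym ('k, 'a, 'b) cochain = "nat \<Rightarrow> ('a list \<Rightarrow> 'k) set \<Rightarrow> 'b"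

definition CC ::
  "('k, 'r) ring_scheme \<Rightarrow> ('k, 'a) graded_module \<Rightarrow> ('k, 'b) graded_module \<Rightarrow> int
    \<Rightarrow> ('k, 'a, 'b) cochain set"
  where "CC R A B d = {f. \<forall>n\<ge>1. f n \<in> Hom_deg R (tensor_power R (\<Pi> A) n) (\<Pi> B) d}"

text \<open>The Gerstenhaber product \<open>g \<circ> f\<close> of \<open>g \<in> CC(A, B)\<close> with \<open>f \<in> CC(A, A)\<close> of degree \<open>e\<close>.\<close>

definition gerstenhaber ::
  "('k, 'r) ring_scheme \<Rightarrow> ('k, 'a) graded_module \<Rightarrow> ('k, 'b) graded_module \<Rightarrow> int
    \<Rightarrow> ('k, 'a, 'b) cochain \<Rightarrow> ('k, 'a, 'a) cochain \<Rightarrow> ('k, 'a, 'b) cochain"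
  where "gerstenhaber R A B e g f n x =
    (\<Oplus>\<^bsub>\<Pi> B\<^esub>i\<in>{1..n}. \<Oplus>\<^bsub>\<Pi> B\<^esub>j\<in>{0..<i}.
      g i (insert_map R (\<Pi> A) (\<Pi> A) e j (n - i + 1) (i - j - 1) (f (n - i + 1)) x))"

definition A_infinity_structure ::
  "('k, 'r) ring_scheme \<Rightarrow> ('k, 'a) graded_module \<Rightarrow> ('k, 'a, 'a) cochain \<Rightarrow> bool"
  where "A_infinity_structure R A \<nu> \<longleftrightarrow>
    \<nu> \<in> CC R A A (- 1) \<and>
    (\<forall>n\<ge>1. \<forall>x\<in>carrier (tensor_power R (\<Pi> A) n). gerstenhaber R A A (- 1) \<nu> \<nu> n x = \<zero>\<^bsub>A\<^esub>)"

section \<open>Split elements and strict unitality\<close>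

locale graded_module_with_split_element = graded_module R A
  for R :: "('k, 'r) ring_scheme" (structure)
  and A :: "('k, 'a) graded_module" (structure) +
  fixes u :: 'a and \<epsilon> :: "'a \<Rightarrow> 'k"
  assumes split_element_degree: "u \<in> grade A 0"
    and split_element_free: "\<lbrakk>c \<in> carrier R; c \<odot>\<^bsub>A\<^esub> u = \<zero>\<^bsub>A\<^esub>\<rbrakk> \<Longrightarrow> c = \<zero>\<^bsub>R\<^esub>"
    and splitting: "\<epsilon> \<in> Hom_deg R A (ground R) 0"
    and splitting_split_element: "\<epsilon> u = \<one>\<^bsub>R\<^esub>"

text \<open>
  Via the splitting \<open>\<epsilon>\<close>, the quotient \<open>A/(k\<cdot>1)\<close> is identified with the submodule \<open>ker \<epsilon>\<close> of \<open>A\<close>,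
  and the quotient map with the projection \<open>a \<mapsto> a - \<epsilon>(a)\<cdot>1\<close>.
\<close>

definition reduced ::
  "('k, 'r) ring_scheme \<Rightarrow> ('k, 'a) graded_module \<Rightarrow> ('a \<Rightarrow> 'k) \<Rightarrow> ('k, 'a) graded_module"
  where "reduced R A \<epsilon> =
    A\<lparr>carrier := {a \<in> carrier A. \<epsilon> a = \<zero>\<^bsub>R\<^esub>}, grade := (\<lambda>i. {a \<in> grade A i. \<epsilon> a = \<zero>\<^bsub>R\<^esub>})\<rparr>"

definition reduction ::
  "('k, 'a) graded_module \<Rightarrow> 'a \<Rightarrow> ('a \<Rightarrow> 'k) \<Rightarrow> 'a \<Rightarrow> 'a"
  where "reduction A u \<epsilon> a = a \<ominus>\<^bsub>A\<^esub> \<epsilon> a \<odot>\<^bsub>A\<^esub> u"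

definition extend_by_zero ::
  "('k, 'r) ring_scheme \<Rightarrow> ('k, 'a) graded_module \<Rightarrow> 'a \<Rightarrow> ('a \<Rightarrow> 'k)
    \<Rightarrow> ('k, 'a, 'b) cochain \<Rightarrow> ('k, 'a, 'b) cochain"
  where "extend_by_zero R A u \<epsilon> f n x =
    f n (tensor_power_map R (\<Pi> A) (\<Pi> (reduced R A \<epsilon>)) n (reduction A u \<epsilon>) x)"

definition mu_su ::
  "('k, 'r) ring_scheme \<Rightarrow> ('k, 'a) graded_module \<Rightarrow> 'a \<Rightarrow> ('a \<Rightarrow> 'k) \<Rightarrow> ('k, 'a, 'a) cochain"
  where "mu_su R A u \<epsilon> n =
    (if n = 2 then
       the_linear_map R (tensor_power R (\<Pi> A) 2) (\<Pi> A)
         (\<lambda>F. (\<forall>i. \<forall>a\<in>grade A i.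
                 F (word_tensor R (\<Pi> A) [u, a]) = a \<and>
                 F (word_tensor R (\<Pi> A) [a, u]) = koszul_sign R i \<odot>\<^bsub>A\<^esub> a) \<and>
              (\<forall>a\<in>carrier (reduced R A \<epsilon>). \<forall>b\<in>carrier (reduced R A \<epsilon>).
                 F (word_tensor R (\<Pi> A) [a, b]) = \<zero>\<^bsub>A\<^esub>))
     else (\<lambda>x. \<zero>\<^bsub>A\<^esub>))"

definition strictly_unital ::
  "('k, 'r) ring_scheme \<Rightarrow> ('k, 'a) graded_module \<Rightarrow> 'a \<Rightarrow> ('k, 'a, 'a) cochain \<Rightarrow> bool"
  where "strictly_unital R A u \<nu> \<longleftrightarrow>
    \<nu> \<in> CC R A A (- 1) \<and>
    (\<forall>i. \<forall>a\<in>grade A i.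
      \<nu> 2 (word_tensor R (\<Pi> A) [u, a]) = a \<and>
      koszul_sign R i \<odot>\<^bsub>A\<^esub> \<nu> 2 (word_tensor R (\<Pi> A) [a, u]) = a) \<and>
    (\<forall>n\<ge>1. n \<noteq> 2 \<longrightarrow> (\<forall>xs\<in>words (\<Pi> A) n. u \<in> set xs \<longrightarrow> \<nu> n (word_tensor R (\<Pi> A) xs) = \<zero>\<^bsub>A\<^esub>))"

text \<open>
  The element \<open>\<mu> + h + \<mu>\<^sub>s\<^sub>u\<close> of \<open>CC(A, A)\<close>; the values of \<open>h\<close> lie in \<open>k\<close>, which is embedded
  in \<open>A\<close> as \<open>k\<cdot>1\<close>.
\<close>

definition unital_sum ::
  "('k, 'r) ring_scheme \<Rightarrow> ('k, 'a) graded_module \<Rightarrow> 'a \<Rightarrow> ('a \<Rightarrow> 'k)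
    \<Rightarrow> ('k, 'a, 'a) cochain \<Rightarrow> ('k, 'a, 'k) cochain \<Rightarrow> ('k, 'a, 'a) cochain"
  where "unital_sum R A u \<epsilon> \<mu> h n x =
    extend_by_zero R A u \<epsilon> \<mu> n x \<oplus>\<^bsub>A\<^esub> extend_by_zero R A u \<epsilon> h n x \<odot>\<^bsub>A\<^esub> u \<oplus>\<^bsub>A\<^esub> mu_su R A u \<epsilon> n x"

section \<open>Curved dg-coalgebras\<close>

definition graded_coalgebra ::
  "('k, 'r) ring_scheme \<Rightarrow> ('k, 'c) graded_module \<Rightarrow> ('c \<Rightarrow> ('c \<times> 'c \<Rightarrow> 'k) set) \<Rightarrow> bool"
  where "graded_coalgebra R C \<Delta> \<longleftrightarrow>
    graded_module R C \<and> \<Delta> \<in> Hom_deg R C (tensor R C C) 0 \<and>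
    (\<forall>x\<in>carrier C.
      associator R C C C (tensor_map R C C (tensor R C C) C 0 \<Delta> id (\<Delta> x)) =
      tensor_map R C C C (tensor R C C) 0 id \<Delta> (\<Delta> x))"

definition coderivation ::
  "('k, 'r) ring_scheme \<Rightarrow> ('k, 'c) graded_module \<Rightarrow> ('c \<Rightarrow> ('c \<times> 'c \<Rightarrow> 'k) set) \<Rightarrow> int
    \<Rightarrow> ('c \<Rightarrow> 'c) \<Rightarrow> bool"
  where "coderivation R C \<Delta> e d \<longleftrightarrow>
    d \<in> Hom_deg R C C e \<and>
    (\<forall>x\<in>carrier C.
      tensor_map R C C C C 0 d id (\<Delta> x) \<oplus>\<^bsub>tensor R C C\<^esub> tensor_map R C C C C e id d (\<Delta> x) = \<Delta> (d x))"

text \<open>\<open>ad(\<xi>)\<close> for \<open>\<xi>\<close> of degree \<open>e\<close>.\<close>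

definition coalgebra_ad ::
  "('k, 'r) ring_scheme \<Rightarrow> ('k, 'c) graded_module \<Rightarrow> ('c \<Rightarrow> ('c \<times> 'c \<Rightarrow> 'k) set) \<Rightarrow> int
    \<Rightarrow> ('c \<Rightarrow> 'k) \<Rightarrow> 'c \<Rightarrow> 'c"
  where "coalgebra_ad R C \<Delta> e \<xi> x =
    left_unitor R C (tensor_map R C C (ground R) C 0 \<xi> id (\<Delta> x)) \<ominus>\<^bsub>C\<^esub>
    right_unitor R C (tensor_map R C C C (ground R) e id \<xi> (\<Delta> x))"

definition curved_dg_coalgebra ::
  "('k, 'r) ring_scheme \<Rightarrow> ('k, 'c) graded_module \<Rightarrow> ('c \<Rightarrow> ('c \<times> 'c \<Rightarrow> 'k) set)
    \<Rightarrow> ('c \<Rightarrow> 'c) \<Rightarrow> ('c \<Rightarrow> 'k) \<Rightarrow> bool"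
  where "curved_dg_coalgebra R C \<Delta> d \<xi> \<longleftrightarrow>
    graded_coalgebra R C \<Delta> \<and> coderivation R C \<Delta> (- 1) d \<and> \<xi> \<in> Hom_deg R C (ground R) (- 2) \<and>
    (\<forall>x\<in>carrier C. d (d x) = coalgebra_ad R C \<Delta> (- 2) \<xi> x) \<and>
    (\<forall>x\<in>carrier C. \<xi> (d x) = \<zero>\<^bsub>R\<^esub>)"

section \<open>The nonunital tensor coalgebra\<close>

definition direct_sum ::
  "'i set \<Rightarrow> ('i \<Rightarrow> ('k, 'a) graded_module) \<Rightarrow> ('k, 'i \<Rightarrow> 'a) graded_module"
  where "direct_sum I M =
    (let S = {f \<in> (\<Pi>\<^sub>E i\<in>I. carrier (M i)). finite {i \<in> I. f i \<noteq> \<zero>\<^bsub>M i\<^esub>}} in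
     \<lparr>carrier = S, mult = undefined, one = undefined,
      zero = (\<lambda>i\<in>I. \<zero>\<^bsub>M i\<^esub>), add = (\<lambda>f g. \<lambda>i\<in>I. f i \<oplus>\<^bsub>M i\<^esub> g i),
      smult = (\<lambda>a f. \<lambda>i\<in>I. a \<odot>\<^bsub>M i\<^esub> f i),
      grade = (\<lambda>d. {f \<in> S. \<forall>i\<in>I. f i \<in> grade (M i) d})\<rparr>)"

definition T_co ::
  "('k, 'r) ring_scheme \<Rightarrow> ('k, 'a) graded_module \<Rightarrow> ('k, nat \<Rightarrow> ('a list \<Rightarrow> 'k) set) graded_module"
  where "T_co R V = direct_sum {1..} (tensor_power R V)"

definition T_co_inj ::
  "('k, 'r) ring_scheme \<Rightarrow> ('k, 'a) graded_module \<Rightarrow> nat \<Rightarrow> ('a list \<Rightarrow> 'k) set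
    \<Rightarrow> nat \<Rightarrow> ('a list \<Rightarrow> 'k) set"
  where "T_co_inj R V n x = (\<lambda>m\<in>{1..}. if m = n then x else \<zero>\<^bsub>tensor_power R V m\<^esub>)"

definition T_co_comult ::
  "('k, 'r) ring_scheme \<Rightarrow> ('k, 'a) graded_module \<Rightarrow> (nat \<Rightarrow> ('a list \<Rightarrow> 'k) set)
    \<Rightarrow> ((nat \<Rightarrow> ('a list \<Rightarrow> 'k) set) \<times> (nat \<Rightarrow> ('a list \<Rightarrow> 'k) set) \<Rightarrow> 'k) set"
  where "T_co_comult R V =
    (let C = T_co R V in the_linear_map R C (tensor R C C)
      (\<lambda>F. \<forall>n\<ge>1. \<forall>xs\<in>words V n.
        F (T_co_inj R V n (word_tensor R V xs)) =
          (\<Oplus>\<^bsub>tensor R C C\<^esub>i\<in>{1..<n}.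
            pure_tensor R C C (T_co_inj R V i (word_tensor R V (take i xs)))
                              (T_co_inj R V (n - i) (word_tensor R V (drop i xs))))))"

text \<open>
  \<open>\<Phi>\<^sup>-\<^sup>1(f)\<close>, for a cochain \<open>f\<close> of degree \<open>e\<close> with values in \<open>V\<close>, by its explicit formula
  \<open>\<Sum>i=1..n. \<Sum>j=0..n-i. 1\<^sup>\<otimes>\<^sup>j \<otimes> f\<^sup>i \<otimes> 1\<^bsup>\<otimes>(n-i-j)\<^esup>\<close> on the summand \<open>V\<^sup>\<otimes>\<^sup>n\<close>, extended linearly to
  \<open>t = (t\<^sub>n)\<close> in the direct sum.
\<close>

definition Phi_inv ::
  "('k, 'r) ring_scheme \<Rightarrow> ('k, 'a) graded_module \<Rightarrow> int \<Rightarrow> ('k, 'a, 'a) cochain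
    \<Rightarrow> (nat \<Rightarrow> ('a list \<Rightarrow> 'k) set) \<Rightarrow> (nat \<Rightarrow> ('a list \<Rightarrow> 'k) set)"
  where "Phi_inv R V e f t =
    (\<Oplus>\<^bsub>T_co R V\<^esub>n\<in>{n \<in> {1..}. t n \<noteq> \<zero>\<^bsub>tensor_power R V n\<^esub>}.
      \<Oplus>\<^bsub>T_co R V\<^esub>i\<in>{1..n}. \<Oplus>\<^bsub>T_co R V\<^esub>j\<in>{0..n - i}.
        T_co_inj R V (n - i + 1) (insert_map R V V e j i (n - i - j) (f i) (t n)))"

text \<open>\<open>-s\<^sup>-\<^sup>1h\<close> on the direct sum; \<open>s\<^sup>-\<^sup>1\<close> is the identity of the underlying set.\<close>

definition neg_desuspension ::
  "('k, 'r) ring_scheme \<Rightarrow> ('k, 'a) graded_module \<Rightarrow> ('k, 'a, 'k) cochain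
    \<Rightarrow> (nat \<Rightarrow> ('a list \<Rightarrow> 'k) set) \<Rightarrow> 'k"
  where "neg_desuspension R V h t =
    \<ominus>\<^bsub>R\<^esub> (\<Oplus>\<^bsub>R\<^esub>n\<in>{n \<in> {1..}. t n \<noteq> \<zero>\<^bsub>tensor_power R V n\<^esub>}. h n (t n))"

end

theory Submission
  imports Defs
begin

text \<open>
  Everything is computed on pure tensors. The Koszul signs are absorbed into the linear involution
  \<open>\<tau>\<close> that multiplies an element of degree \<open>i\<close> by \<open>(-1)\<^sup>i\<close>, so that an odd map \<open>F\<close>
  inserted at a block of a word acts by applying \<open>\<tau>\<close> to all letters to the left of the block and
  no homogeneity has to be assumed. If \<open>d\<close> is the coderivation of \<open>\<mu>\<close>, then \<open>d\<^sup>2\<close> of a word is a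
  sum over pairs of insertions: those at disjoint blocks cancel because \<open>\<mu>\<close> is odd, and the nested
  ones insert the Gerstenhaber square \<open>\<mu> \<circ> \<mu>\<close> at every block. Inserting the curvature terms of the
  first equation at every block telescopes to \<open>-ad(\<xi>)\<close>. Hence \<open>d\<^sup>2 - ad(\<xi>)\<close> inserts the left
  side of the first equation at every block, and that left side is recovered as the component of
  tensor length one; \<open>\<xi> d\<close> is minus the left side of the second equation. On the other hand, on a
  word of elements of the reduced module the square of \<open>\<mu> + h + \<mu>\<^sub>s\<^sub>u\<close> has the left side
  of the first equation as its reduced component and that of the second equation as its scalar
  component, while on a word containing \<open>1\<close> its terms cancel by strict unitality.
\<close>

section \<open>Linear maps\<close>

text \<open>All maps out of tensor products are given by description, as unique linear maps with
  prescribed values, so nothing can be computed before existence and uniqueness are known. The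
  Koszul prescriptions make sense on homogeneous words only; moving the sign into
  \<open>\<tau>\<close> gives a formula that is multilinear on all words, which is what existence
  needs.

  The telescoping comes from a coincidence. On a block of l + 1 letters the curvature terms feed
  either the first l or the last l letters to \<open>h\<close> and delete them. The result depends
  only on which l consecutive letters disappear, and the last l letters of one block are the first l
  letters of the next. For fixed l only the deletions at the two ends of the word remain, and these
  are the cuts seen by \<open>ad\<close>.

  An insertion at a block of i letters shortens the word by i - 1, so only the block formed by the
  whole word contributes to tensor length one. On the side of the algebra, \<open>\<epsilon>\<close>
  kills the reduced module and takes \<open>u\<close> to 1, which separates the two
  components.\<close>

lemma (in abelian_monoid) finsum_Sigma:
  assumes "finite A" "\<And>x. x \<in> A \<Longrightarrow> finite (B x)"
    and "\<And>x y. \<lbrakk>x \<in> A; y \<in> B x\<rbrakk> \<Longrightarrow> f x y \<in> carrier G"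
  shows "finsum G (\<lambda>x. finsum G (f x) (B x)) A = finsum G (\<lambda>(x, y). f x y) (Sigma A B)"
  using assms
proof (induction A rule: finite_induct)
  case empty
  then show ?case by simp
next
  case (insert a A)
  have S: "Sigma (insert a A) B = Pair a ` B a \<union> Sigma A B"
    by auto
  have inj: "inj_on (Pair a) (B a)"
    by (auto simp: inj_on_def)
  have "finsum G (\<lambda>(x, y). f x y) (Sigma (insert a A) B) =
      finsum G (\<lambda>(x, y). f x y) (Pair a ` B a) \<oplus> finsum G (\<lambda>(x, y). f x y) (Sigma A B)"
    unfolding S by (rule finsum_Un_disjoint) (use insert in auto)
  also have "finsum G (\<lambda>(x, y). f x y) (Pair a ` B a) = finsum G (f a) (B a)"
    by (subst finsum_reindex[OF _ inj]) (use insert.prems in auto)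
  also have "\<dots> \<oplus> finsum G (\<lambda>(x, y). f x y) (Sigma A B) = finsum G (\<lambda>x. finsum G (f x) (B x)) (insert a A)"
    by (subst finsum_insert) (use insert in \<open>auto intro!: finsum_closed\<close>)
  finally show ?case ..
qed

lemma (in abelian_monoid) finsum_bij_betw:
  assumes "bij_betw \<sigma> A B" "\<And>x. x \<in> A \<Longrightarrow> f x = g (\<sigma> x)" "\<And>x. x \<in> B \<Longrightarrow> g x \<in> carrier G"
  shows "finsum G f A = finsum G g B"
proof -
  have B: "B = \<sigma> ` A" and inj: "inj_on \<sigma> A"
    using assms(1) by (auto simp: bij_betw_def)
  have "finsum G g B = finsum G (\<lambda>x. g (\<sigma> x)) A"
    unfolding B by (rule finsum_reindex[OF _ inj]) (use assms(3) B in auto)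
  also have "\<dots> = finsum G f A"
    by (rule finsum_cong') (use assms B in auto)
  finally show ?thesis ..
qed

text \<open>Decompositions are sums over supports, and supports change under addition and scaling.
  Such sums are compared after enlarging them to a common finite index set.\<close>

lemma (in abelian_monoid) finsum_eq_superset:
  assumes "finite B" "A \<subseteq> B" "\<And>x. x \<in> B - A \<Longrightarrow> f x = \<zero>" "\<And>x. x \<in> A \<Longrightarrow> f x \<in> carrier G"
  shows "finsum G f A = finsum G f B"
proof (rule add.finprod_mono_neutral_cong_left)
  show "f \<in> B \<rightarrow> carrier G"
  proof
    fix x assume "x \<in> B"
    then show "f x \<in> carrier G" using assms(3,4)[of x] by (cases "x \<in> A") auto
  qed
qed (use assms in auto)

lemma (in abelian_monoid) finsum_single:
  assumes "finite A" "a \<in> A" "\<And>x. x \<in> A \<Longrightarrow> x \<noteq> a \<Longrightarrow> f x = \<zero>" "f a \<in> carrier G"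
  shows "finsum G f A = f a"
proof -
  have "finsum G f {a} = finsum G f A"
    by (rule finsum_eq_superset) (use assms in auto)
  then show ?thesis using assms(4) by (simp add: finsum_insert)
qed

lemma (in abelian_group) a_inv_zero [simp]: "\<ominus> \<zero> = \<zero>"
  by (rule minus_equality) auto

lemma (in abelian_group) finsum_neg:
  assumes "f \<in> A \<rightarrow> carrier G"
  shows "finsum G (\<lambda>x. \<ominus> f x) A = \<ominus> finsum G f A"
proof (cases "finite A")
  case True
  then show ?thesis using assms
    by (induction A rule: finite_induct) (auto simp: minus_add Pi_def)
qed (simp add: finsum_infinite)

lemma (in abelian_group) finsum_minus:
  assumes "f \<in> A \<rightarrow> carrier G" "g \<in> A \<rightarrow> carrier G"
  shows "finsum G (\<lambda>x. f x \<ominus> g x) A = finsum G f A \<ominus> finsum G g A"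
  using assms unfolding a_minus_def
  by (subst finsum_addf) (auto simp: finsum_neg[OF assms(2)] Pi_def)

section \<open>Linear maps between modules\<close>

lemma linear_mapsI:
  assumes "\<And>x. x \<in> carrier M \<Longrightarrow> f x \<in> carrier N"
    and "\<And>x y. \<lbrakk>x \<in> carrier M; y \<in> carrier M\<rbrakk> \<Longrightarrow> f (x \<oplus>\<^bsub>M\<^esub> y) = f x \<oplus>\<^bsub>N\<^esub> f y"
    and "\<And>a x. \<lbrakk>a \<in> carrier R; x \<in> carrier M\<rbrakk> \<Longrightarrow> f (a \<odot>\<^bsub>M\<^esub> x) = a \<odot>\<^bsub>N\<^esub> f x"
  shows "f \<in> linear_maps R M N"
  using assms by (auto simp: linear_maps_def hom_def)

lemma linear_maps_closed: "\<lbrakk>f \<in> linear_maps R M N; x \<in> carrier M\<rbrakk> \<Longrightarrow> f x \<in> carrier N"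
  and linear_maps_add: "\<lbrakk>f \<in> linear_maps R M N; x \<in> carrier M; y \<in> carrier M\<rbrakk>
      \<Longrightarrow> f (x \<oplus>\<^bsub>M\<^esub> y) = f x \<oplus>\<^bsub>N\<^esub> f y"
  and linear_maps_smult: "\<lbrakk>f \<in> linear_maps R M N; a \<in> carrier R; x \<in> carrier M\<rbrakk>
      \<Longrightarrow> f (a \<odot>\<^bsub>M\<^esub> x) = a \<odot>\<^bsub>N\<^esub> f x"
  by (auto simp: linear_maps_def hom_def)

text \<open>Membership in \<open>linear_maps\<close> looks only at the carrier of the domain, so a
  map may be exchanged for its extensional restriction.\<close>

lemma linear_maps_cong:
  assumes "f \<in> linear_maps R M N" "\<And>x. x \<in> carrier M \<Longrightarrow> g x = f x" "module R M"
  shows "g \<in> linear_maps R M N"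
proof -
  interpret module R M by fact
  show ?thesis
    using assms(1,2) by (intro linear_mapsI) (auto simp: linear_maps_closed linear_maps_add linear_maps_smult)
qed

lemma linear_maps_comp:
  assumes "f \<in> linear_maps R M N" "g \<in> linear_maps R N P"
  shows "(\<lambda>x. g (f x)) \<in> linear_maps R M P"
  using assms
  by (intro linear_mapsI) (auto simp: linear_maps_closed linear_maps_add linear_maps_smult)

lemma linear_maps_id: "(\<lambda>x. x) \<in> linear_maps R M M"
  by (rule linear_mapsI) auto

locale two_modules = M: module R M + N: module R N
  for R :: "('k, 'r) ring_scheme"
  and M :: "('k, 'a, 'm) module_scheme" and N :: "('k, 'b, 'n) module_scheme"

context two_modules
begin

lemma linear_maps_0: "f \<in> linear_maps R M N \<Longrightarrow> f \<zero>\<^bsub>M\<^esub> = \<zero>\<^bsub>N\<^esub>"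
proof -
  assume f: "f \<in> linear_maps R M N"
  have "f \<zero>\<^bsub>M\<^esub> \<oplus>\<^bsub>N\<^esub> f \<zero>\<^bsub>M\<^esub> = f \<zero>\<^bsub>M\<^esub>"
    using linear_maps_add[OF f, of "\<zero>\<^bsub>M\<^esub>" "\<zero>\<^bsub>M\<^esub>"] by simp
  then show ?thesis
    using linear_maps_closed[OF f M.zero_closed] by simp
qed

lemma linear_maps_neg: "\<lbrakk>f \<in> linear_maps R M N; x \<in> carrier M\<rbrakk> \<Longrightarrow> f (\<ominus>\<^bsub>M\<^esub> x) = \<ominus>\<^bsub>N\<^esub> f x"
proof -
  assume f: "f \<in> linear_maps R M N" and x: "x \<in> carrier M"
  have "f (\<ominus>\<^bsub>M\<^esub> x) \<oplus>\<^bsub>N\<^esub> f x = \<zero>\<^bsub>N\<^esub>"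
    using linear_maps_add[OF f, of "\<ominus>\<^bsub>M\<^esub> x" x] x by (simp add: M.l_neg linear_maps_0[OF f])
  then show ?thesis
    using N.minus_equality linear_maps_closed[OF f] x by (metis M.a_inv_closed)
qed

lemma linear_maps_minus:
  "\<lbrakk>f \<in> linear_maps R M N; x \<in> carrier M; y \<in> carrier M\<rbrakk> \<Longrightarrow> f (x \<ominus>\<^bsub>M\<^esub> y) = f x \<ominus>\<^bsub>N\<^esub> f y"
  by (simp add: a_minus_def linear_maps_add linear_maps_neg)

lemma linear_maps_finsum:
  assumes f: "f \<in> linear_maps R M N" and g: "\<And>i. i \<in> I \<Longrightarrow> g i \<in> carrier M"
  shows "f (finsum M g I) = finsum N (\<lambda>i. f (g i)) I"
proof (cases "finite I")
  case True
  then show ?thesis using g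
    by (induction I rule: finite_induct)
       (auto simp: linear_maps_0[OF f] M.finsum_insert N.finsum_insert linear_maps_add[OF f]
          linear_maps_closed[OF f] Pi_def intro!: M.finsum_closed)
qed (simp add: M.finsum_infinite N.finsum_infinite linear_maps_0[OF f])

lemma linear_maps_const_0: "(\<lambda>x. \<zero>\<^bsub>N\<^esub>) \<in> linear_maps R M N"
  by (rule linear_mapsI) auto

lemma linear_maps_sum_pair:
  assumes "f \<in> linear_maps R M N" "g \<in> linear_maps R M N"
  shows "(\<lambda>x. f x \<oplus>\<^bsub>N\<^esub> g x) \<in> linear_maps R M N"
  using assms
  by (intro linear_mapsI)
    (auto simp: linear_maps_closed linear_maps_add linear_maps_smult N.smult_r_distr N.a_ac)

lemma linear_maps_scale:
  assumes "f \<in> linear_maps R M N" "c \<in> carrier R"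
  shows "(\<lambda>x. c \<odot>\<^bsub>N\<^esub> f x) \<in> linear_maps R M N"
  using assms
  by (intro linear_mapsI)
    (auto simp: linear_maps_closed linear_maps_add linear_maps_smult N.smult_r_distr
       N.smult_assoc1[symmetric] M.m_comm)

lemma linear_maps_uminus:
  assumes "f \<in> linear_maps R M N"
  shows "(\<lambda>x. \<ominus>\<^bsub>N\<^esub> f x) \<in> linear_maps R M N"
  using assms
  by (intro linear_mapsI)
    (auto simp: linear_maps_closed linear_maps_add linear_maps_smult N.minus_add N.smult_r_minus)

lemma linear_maps_diff:
  assumes "f \<in> linear_maps R M N" "g \<in> linear_maps R M N"
  shows "(\<lambda>x. f x \<ominus>\<^bsub>N\<^esub> g x) \<in> linear_maps R M N"
  unfolding a_minus_def by (intro linear_maps_sum_pair linear_maps_uminus assms)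

lemma linear_maps_sum:
  assumes "\<And>i. i \<in> I \<Longrightarrow> f i \<in> linear_maps R M N"
  shows "(\<lambda>x. finsum N (\<lambda>i. f i x) I) \<in> linear_maps R M N"
proof (cases "finite I")
  case True
  have cl: "f i x \<in> carrier N" if "i \<in> I" "x \<in> carrier M" for i x
    using linear_maps_closed[OF assms] that by blast
  have ad: "f i (x \<oplus>\<^bsub>M\<^esub> y) = f i x \<oplus>\<^bsub>N\<^esub> f i y" if "i \<in> I" "x \<in> carrier M" "y \<in> carrier M" for i x y
    using linear_maps_add[OF assms] that by blast
  have sm: "f i (a \<odot>\<^bsub>M\<^esub> x) = a \<odot>\<^bsub>N\<^esub> f i x" if "i \<in> I" "a \<in> carrier R" "x \<in> carrier M" for i a x
    using linear_maps_smult[OF assms] that by blast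
  show ?thesis
  proof (rule linear_mapsI)
    fix a x assume "a \<in> carrier R" "x \<in> carrier M"
    then show "finsum N (\<lambda>i. f i (a \<odot>\<^bsub>M\<^esub> x)) I = a \<odot>\<^bsub>N\<^esub> finsum N (\<lambda>i. f i x) I"
      using True
      by (subst N.finsum_smult_ldistr) (auto intro!: N.finsum_cong' simp: sm cl)
  next
    fix x y assume "x \<in> carrier M" "y \<in> carrier M"
    then show "finsum N (\<lambda>i. f i (x \<oplus>\<^bsub>M\<^esub> y)) I = finsum N (\<lambda>i. f i x) I \<oplus>\<^bsub>N\<^esub> finsum N (\<lambda>i. f i y) I"
      by (subst N.finsum_addf[symmetric]) (auto intro!: N.finsum_cong' simp: ad cl simp del: N.finsum_addf)
  qed (auto intro!: N.finsum_closed simp: cl)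
\<comment> \<open>Over an infinite index set \<open>finsum\<close> is zero by convention, which
  leaves the zero map.\<close>
qed (use linear_maps_const_0 in \<open>simp add: N.finsum_infinite\<close>)

end

lemma two_modulesI: "\<lbrakk>module R M; module R N\<rbrakk> \<Longrightarrow> two_modules R M N"
  by (rule two_modules.intro)

text \<open>Carries the module structure from a quotient to its extension by a grading, and from a
  module to its suspension or to a submodule with a new grading.\<close>

lemma module_cong:
  assumes "module R M" "carrier M' = carrier M" "add M' = add M" "zero M' = zero M" "smult M' = smult M"
  shows "module R M'"
proof -
  interpret module R M by fact
  have "abelian_group M'"
    by (rule abelian_groupI) (use assms in \<open>auto simp: M.a_ac intro!: bexI[of _ "\<ominus>\<^bsub>M\<^esub> x" for x] M.l_neg\<close>)
  then show ?thesis
    using assms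
    by (intro moduleI) (auto simp: smult_l_distr smult_r_distr smult_assoc1 R.is_cring)
qed

section \<open>Spans\<close>

context module
begin

lemma submodule_zero: "submodule H R M \<Longrightarrow> \<zero>\<^bsub>M\<^esub> \<in> H"
  using subgroup.one_closed[OF submodule.axioms(1)] by fastforce

lemma submodule_span_submodule:
  assumes "S \<subseteq> carrier M"
  shows "submodule (submodule_span R M S) R M"
proof (rule submoduleI)
  show "submodule_span R M S \<subseteq> carrier M"
    using carrier_is_submodule assms by (auto simp: submodule_span_def)
qed (auto simp: submodule_span_def submodule_zero submoduleE(3-5))

lemma submodule_span_superset: "S \<subseteq> submodule_span R M S"
  by (auto simp: submodule_span_def)

lemma submodule_span_minimal: "\<lbrakk>submodule H R M; S \<subseteq> H\<rbrakk> \<Longrightarrow> submodule_span R M S \<subseteq> H"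
  by (auto simp: submodule_span_def)

lemma submodule_span_carrier: "S \<subseteq> carrier M \<Longrightarrow> submodule_span R M S \<subseteq> carrier M"
  by (rule submodule_span_minimal[OF carrier_is_submodule])

text \<open>The span is an intersection, so induction is minimality applied to the submodule of
  those elements of the span that satisfy \<open>P\<close>. There is no case for negation because
  negation is scaling by -1.\<close>

lemma submodule_span_induct [consumes 2, case_names zero base add smult]:
  assumes "x \<in> submodule_span R M S" "S \<subseteq> carrier M"
    and "P \<zero>\<^bsub>M\<^esub>" "\<And>s. s \<in> S \<Longrightarrow> P s"
    and add: "\<And>x y. \<lbrakk>x \<in> submodule_span R M S; y \<in> submodule_span R M S; P x; P y\<rbrakk> \<Longrightarrow> P (x \<oplus>\<^bsub>M\<^esub> y)"
    and smult: "\<And>a x. \<lbrakk>a \<in> carrier R; x \<in> submodule_span R M S; P x\<rbrakk> \<Longrightarrow> P (a \<odot>\<^bsub>M\<^esub> x)"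
  shows "P x"
proof -
  note sub = submodule_span_submodule[OF assms(2)]
  have "submodule {x \<in> submodule_span R M S. P x} R M"
  proof (rule submoduleI)
    fix a assume a: "a \<in> {x \<in> submodule_span R M S. P x}"
    have aM: "a \<in> carrier M"
      using a submodule_span_carrier[OF assms(2)] by auto
    have "\<ominus>\<^bsub>M\<^esub> a = (\<ominus> \<one>) \<odot>\<^bsub>M\<^esub> a"
      using aM by (simp add: smult_l_minus)
    then show "\<ominus>\<^bsub>M\<^esub> a \<in> {x \<in> submodule_span R M S. P x}"
      using a smult[of "\<ominus> \<one>" a] submoduleE(3)[OF sub, of a] by auto
  qed (use assms sub submodule_span_carrier[OF assms(2)] submodule_zero submoduleE(4,5)[OF sub] in auto)
  then have "submodule_span R M S \<subseteq> {x \<in> submodule_span R M S. P x}"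
    by (rule submodule_span_minimal) (use assms(4) submodule_span_superset in auto)
  then show ?thesis using assms(1) by auto
qed

lemma submodule_finsum:
  assumes "submodule H R M" "\<And>i. i \<in> I \<Longrightarrow> f i \<in> H"
  shows "finsum M f I \<in> H"
proof (cases "finite I")
  case True
  have H: "H \<subseteq> carrier M" using submoduleE(1)[OF assms(1)] .
  show ?thesis using True assms(2)
  proof (induction I rule: finite_induct)
    case (insert i I)
    then show ?case
      using H by (subst finsum_insert) (auto intro!: submoduleE(5)[OF assms(1)])
  qed (simp add: submodule_zero[OF assms(1)])
qed (simp add: finsum_infinite submodule_zero[OF assms(1)])

end

lemma linear_maps_eq_on_span:
  assumes M: "module R M" "module R N" and f: "f \<in> linear_maps R M N" and g: "g \<in> linear_maps R M N"
    and S: "S \<subseteq> carrier M" and eq: "\<And>s. s \<in> S \<Longrightarrow> f s = g s"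
    and x: "x \<in> submodule_span R M S"
  shows "f x = g x"
proof -
  interpret two_modules R M N using M by (rule two_modulesI)
  have "x \<in> carrier M \<and> f x = g x"
    using x S
  proof (induction rule: M.submodule_span_induct)
    case zero
    then show ?case by (simp add: linear_maps_0[OF f] linear_maps_0[OF g])
  next
    case (base s)
    then show ?case using S eq by auto
  next
    case (add x y)
    then show ?case by (simp add: linear_maps_add[OF f] linear_maps_add[OF g])
  next
    case (smult a x)
    then show ?case by (simp add: linear_maps_smult[OF f] linear_maps_smult[OF g])
  qed
  then show ?thesis by simp
qed

text \<open>The bridge from definite description to computation. \<open>G\<close> is a model
  constructed by a universal property; \<open>ex\<close> says that \<open>P\<close> depends only on
  values on the carrier and holds for \<open>G\<close>, and \<open>det\<close> that \<open>P\<close>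
  forces the values on a spanning set. The set \<open>S\<close> can be chosen apart from the
  elements that \<open>P\<close> mentions.\<close>

lemma the_linear_map_eq:
  assumes M: "module R M" "module R N" and S: "S \<subseteq> carrier M" "submodule_span R M S = carrier M"
    and G: "G \<in> linear_maps R M N"
    and ex: "\<And>F. (\<And>x. x \<in> carrier M \<Longrightarrow> F x = G x) \<Longrightarrow> P F"
    and det: "\<And>F s. \<lbrakk>F \<in> linear_maps R M N; P F; s \<in> S\<rbrakk> \<Longrightarrow> F s = G s"
  shows "the_linear_map R M N P \<in> linear_maps R M N \<and> (\<forall>x\<in>carrier M. the_linear_map R M N P x = G x)"
proof -
  \<comment> \<open>The description asks for an extensional function, which is what makes equality
    on the carrier an equality of functions.\<close>
  let ?G = "restrict G (carrier M)"
  have lin: "?G \<in> linear_maps R M N"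
    by (rule linear_maps_cong[OF G _ M(1)]) simp
  have "the_linear_map R M N P = ?G"
    unfolding the_linear_map_def
  proof (rule the_equality)
    show "?G \<in> linear_maps R M N \<and> ?G \<in> extensional (carrier M) \<and> P ?G"
      using lin ex[of ?G] by simp
  next
    fix F assume F: "F \<in> linear_maps R M N \<and> F \<in> extensional (carrier M) \<and> P F"
    show "F = ?G"
    proof (rule extensionalityI)
      fix x assume "x \<in> carrier M"
      then show "F x = ?G x"
        using linear_maps_eq_on_span[OF M, of F G S x] F G S det by auto
    qed (use F in auto)
  qed
  then show ?thesis
    using lin by simp
qed

section \<open>Free modules and quotients\<close>

lemma free_module_simps:
  "carrier (free_module R X) =
     {f. (\<forall>x. f x \<in> carrier R) \<and> (\<forall>x. x \<notin> X \<longrightarrow> f x = \<zero>\<^bsub>R\<^esub>) \<and> finite {x. f x \<noteq> \<zero>\<^bsub>R\<^esub>}}"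
  "zero (free_module R X) = (\<lambda>x. \<zero>\<^bsub>R\<^esub>)"
  "add (free_module R X) = (\<lambda>f g x. f x \<oplus>\<^bsub>R\<^esub> g x)"
  "smult (free_module R X) = (\<lambda>a f x. a \<otimes>\<^bsub>R\<^esub> f x)"
  by (auto simp: free_module_def)

lemma (in cring) free_module: "module R (free_module R X)"
proof (rule moduleI)
  note [simp] = free_module_simps
  have fin: "finite {x. f x \<oplus> g x \<noteq> \<zero>}" if "finite {x. f x \<noteq> \<zero>}" "finite {x. g x \<noteq> \<zero>}"
    for f g :: "'x \<Rightarrow> 'a"
    by (rule finite_subset[OF _ finite_UnI[OF that]]) auto
  have fin': "finite {x. a \<otimes> f x \<noteq> \<zero>}" if "finite {x. f x \<noteq> \<zero>}" "a \<in> carrier R"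
    for a and f :: "'x \<Rightarrow> 'a"
    by (rule finite_subset[OF _ that(1)]) (use that in auto)
  have fin'': "finite {x. \<ominus> f x \<noteq> \<zero>}" if "finite {x. f x \<noteq> \<zero>}" for f :: "'x \<Rightarrow> 'a"
    by (rule finite_subset[OF _ that]) auto
  show "abelian_group (free_module R X)"
  proof (rule abelian_groupI)
    fix f assume f: "f \<in> carrier (free_module R X)"
    then have "(\<lambda>x. \<ominus> f x) \<in> carrier (free_module R X)"
      using fin'' by auto
    then show "\<exists>y\<in>carrier (free_module R X). y \<oplus>\<^bsub>free_module R X\<^esub> f = \<zero>\<^bsub>free_module R X\<^esub>"
      using f by (intro bexI[of _ "\<lambda>x. \<ominus> f x"]) (auto simp: l_neg)
  qed (auto simp: a_ac fin)
  show "cring R" ..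
qed (auto simp: free_module_simps l_distr r_distr m_assoc fun_eq_iff
    intro: finite_subset[of "{x. a \<otimes> f x \<noteq> \<zero>}" "{x. f x \<noteq> \<zero>}" for a f])

lemma (in cring) free_gen_closed: "x \<in> X \<Longrightarrow> free_gen R x \<in> carrier (free_module R X)"
  by (auto simp: free_module_simps free_gen_def intro!: finite_subset[of "{y. (if y = x then \<one> else \<zero>) \<noteq> \<zero>}" "{x}"])

text \<open>Induction on a finite set containing the support: clearing the value at one point
  changes a function by a multiple of the generator at that point.\<close>

lemma (in cring) free_module_span:
  "submodule_span R (free_module R X) (free_gen R ` X) = carrier (free_module R X)"
proof -
  interpret F: module R "free_module R X" by (rule free_module)
  have gens: "free_gen R ` X \<subseteq> carrier (free_module R X)"
    by (rule image_subsetI) (erule free_gen_closed)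
  let ?H = "submodule_span R (free_module R X) (free_gen R ` X)"
  note H = F.submodule_span_submodule[OF gens]
  have "f \<in> ?H" if "f \<in> carrier (free_module R X)" "{x. f x \<noteq> \<zero>} \<subseteq> T" "finite T" for f T
    using that(3,1,2)
  proof (induction T arbitrary: f rule: finite_induct)
    case empty
    then have "f = \<zero>\<^bsub>free_module R X\<^esub>" by (auto simp: free_module_simps)
    then show ?case using F.submodule_zero[OF H] by simp
  next
    case (insert x T)
    let ?g = "f(x := \<zero>)"
    have "?g \<in> carrier (free_module R X)"
      using insert.prems by (auto simp: free_module_simps intro: finite_subset[of _ "{x. f x \<noteq> \<zero>}"])
    moreover have "{y. ?g y \<noteq> \<zero>} \<subseteq> T"
      using insert.prems by auto
    ultimately have g: "?g \<in> ?H"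
      by (rule insert.IH)
    show ?case
    proof (cases "f x = \<zero>")
      case True
      then show ?thesis using g by (simp add: fun_upd_idem)
    next
      case False
      then have "x \<in> X" using insert.prems by (auto simp: free_module_simps)
      then have gx: "free_gen R x \<in> ?H"
        using F.submodule_span_superset by blast
      have "f = ?g \<oplus>\<^bsub>free_module R X\<^esub> f x \<odot>\<^bsub>free_module R X\<^esub> free_gen R x"
        using insert.prems by (auto simp: free_module_simps free_gen_def fun_eq_iff)
      moreover have "f x \<in> carrier R" using insert.prems by (auto simp: free_module_simps)
      then have "?g \<oplus>\<^bsub>free_module R X\<^esub> f x \<odot>\<^bsub>free_module R X\<^esub> free_gen R x \<in> ?H"
        by (intro F.submoduleE(5)[OF H] F.submoduleE(4)[OF H] g gx)
      ultimately show ?thesis by (simp only:)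
    qed
  qed
  moreover have "finite {x. f x \<noteq> \<zero>}" if "f \<in> carrier (free_module R X)" for f
    using that by (simp add: free_module_simps)
  ultimately have "carrier (free_module R X) \<subseteq> ?H"
    by (intro subsetI) (rule; assumption?; blast)
  then show ?thesis
    using F.submodule_span_carrier[OF gens] by (rule equalityI[rotated])
qed

lemma (in cring) free_module_lift:
  assumes "module R P" and \<phi>: "\<And>x. x \<in> X \<Longrightarrow> \<phi> x \<in> carrier P"
  shows "\<exists>G\<in>linear_maps R (free_module R X) P. \<forall>x\<in>X. G (free_gen R x) = \<phi> x"
proof -
  note [simp] = free_module_simps
  interpret P: module R P by fact
  interpret F: module R "free_module R X" by (rule free_module)
  define G where "G = (\<lambda>f. finsum P (\<lambda>x. f x \<odot>\<^bsub>P\<^esub> \<phi> x) {x. f x \<noteq> \<zero>})"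
  \<comment> \<open>Freedom in the index set is needed because the supports of two functions and of
    their sum differ.\<close>
  have G: "G f = finsum P (\<lambda>x. f x \<odot>\<^bsub>P\<^esub> \<phi> x) T"
    if "f \<in> carrier (free_module R X)" "{x. f x \<noteq> \<zero>} \<subseteq> T" "finite T" "T \<subseteq> X" for f T
    unfolding G_def by (rule P.finsum_eq_superset) (use that \<phi> in auto)
  have sub: "{x. f x \<noteq> \<zero>} \<subseteq> X" if "f \<in> carrier (free_module R X)" for f
    using that by auto
  have "G \<in> linear_maps R (free_module R X) P"
  proof (rule linear_mapsI)
    fix f assume f: "f \<in> carrier (free_module R X)"
    then show "G f \<in> carrier P"
      unfolding G_def using \<phi> sub[OF f] by (intro P.finsum_closed) auto
  next
    fix f g assume f: "f \<in> carrier (free_module R X)" and g: "g \<in> carrier (free_module R X)"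
    let ?T = "{x. f x \<noteq> \<zero>} \<union> {x. g x \<noteq> \<zero>}"
    have T: "finite ?T" "?T \<subseteq> X" using f g by auto
    have fg: "f \<oplus>\<^bsub>free_module R X\<^esub> g \<in> carrier (free_module R X)"
      using f g by (rule F.a_closed)
    have "G (f \<oplus>\<^bsub>free_module R X\<^esub> g) = finsum P (\<lambda>x. (f x \<oplus> g x) \<odot>\<^bsub>P\<^esub> \<phi> x) ?T"
      by (subst G[OF fg _ T]) auto
    also have "\<dots> = finsum P (\<lambda>x. f x \<odot>\<^bsub>P\<^esub> \<phi> x \<oplus>\<^bsub>P\<^esub> g x \<odot>\<^bsub>P\<^esub> \<phi> x) ?T"
      by (rule P.finsum_cong') (use f g \<phi> T in \<open>auto simp: P.smult_l_distr\<close>)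
    also have "\<dots> = finsum P (\<lambda>x. f x \<odot>\<^bsub>P\<^esub> \<phi> x) ?T \<oplus>\<^bsub>P\<^esub> finsum P (\<lambda>x. g x \<odot>\<^bsub>P\<^esub> \<phi> x) ?T"
      by (rule P.finsum_addf) (use f g \<phi> T in auto)
    also have "\<dots> = G f \<oplus>\<^bsub>P\<^esub> G g"
      by (subst (1 2) G[OF _ _ T]) (use f g in auto)
    finally show "G (f \<oplus>\<^bsub>free_module R X\<^esub> g) = G f \<oplus>\<^bsub>P\<^esub> G g" .
  next
    fix a f assume a: "a \<in> carrier R" and f: "f \<in> carrier (free_module R X)"
    let ?T = "{x. f x \<noteq> \<zero>}"
    have T: "finite ?T" "?T \<subseteq> X" using f by auto
    have af: "a \<odot>\<^bsub>free_module R X\<^esub> f \<in> carrier (free_module R X)"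
      using a f by (rule F.smult_closed)
    have "G (a \<odot>\<^bsub>free_module R X\<^esub> f) = finsum P (\<lambda>x. (a \<otimes> f x) \<odot>\<^bsub>P\<^esub> \<phi> x) ?T"
      by (subst G[OF af _ T]) (use a in auto)
    also have "\<dots> = finsum P (\<lambda>x. a \<odot>\<^bsub>P\<^esub> (f x \<odot>\<^bsub>P\<^esub> \<phi> x)) ?T"
      by (rule P.finsum_cong') (use a f \<phi> T in \<open>auto simp: P.smult_assoc1\<close>)
    also have "\<dots> = a \<odot>\<^bsub>P\<^esub> G f"
      unfolding G_def by (rule P.finsum_smult_ldistr[symmetric]) (use a f \<phi> T in auto)
    finally show "G (a \<odot>\<^bsub>free_module R X\<^esub> f) = a \<odot>\<^bsub>P\<^esub> G f" .
  qed
  moreover have "G (free_gen R x) = \<phi> x" if x: "x \<in> X" for x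
  proof -
    have "G (free_gen R x) = finsum P (\<lambda>y. free_gen R x y \<odot>\<^bsub>P\<^esub> \<phi> y) {x}"
      by (rule G[OF free_gen_closed[OF x]]) (use x in \<open>auto simp: free_gen_def\<close>)
    also have "\<dots> = \<phi> x"
      using \<phi>[OF x] by (simp add: free_gen_def P.finsum_insert)
    finally show ?thesis .
  qed
  ultimately show ?thesis by (intro bexI[of _ G] ballI)
qed

section \<open>Quotient modules\<close>

context module
begin

context
  fixes N assumes N: "submodule N R M"
begin

lemma abelian_subgroup_submodule: "abelian_subgroup N M"
  using submodule.axioms(1)[OF N] M.abelian_group_axioms
  by (intro abelian_subgroupI3) (auto simp: additive_subgroup_def)

interpretation N: abelian_subgroup N M by (rule abelian_subgroup_submodule)

lemma coset_eq_iff: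
  assumes x: "x \<in> carrier M" and y: "y \<in> carrier M"
  shows "N +>\<^bsub>M\<^esub> x = N +>\<^bsub>M\<^esub> y \<longleftrightarrow> x \<ominus>\<^bsub>M\<^esub> y \<in> N"
proof
  assume "N +>\<^bsub>M\<^esub> x = N +>\<^bsub>M\<^esub> y"
  then have "x \<in> N +>\<^bsub>M\<^esub> y" using N.a_rcos_self[OF x] by simp
  then show "x \<ominus>\<^bsub>M\<^esub> y \<in> N"
    using N.a_rcos_module_imp[OF y] by (simp add: a_minus_def)
next
  assume "x \<ominus>\<^bsub>M\<^esub> y \<in> N"
  then have "x \<in> N +>\<^bsub>M\<^esub> y"
    using N.a_rcos_module_rev[OF y x] by (simp add: a_minus_def)
  then show "N +>\<^bsub>M\<^esub> x = N +>\<^bsub>M\<^esub> y"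
    using M.a_repr_independence[OF _ y] N.a_subgroup by blast
qed

lemma quotient_module_carrier: "carrier (quotient_module M N) = (\<lambda>x. N +>\<^bsub>M\<^esub> x) ` carrier M"
  by (auto simp: quotient_module_def A_RCOSETS_def' )

lemma quotient_module_zero: "\<zero>\<^bsub>quotient_module M N\<^esub> = N +>\<^bsub>M\<^esub> \<zero>\<^bsub>M\<^esub>"
  using N.a_subset by (simp add: quotient_module_def)

lemma quotient_module_add:
  "\<lbrakk>x \<in> carrier M; y \<in> carrier M\<rbrakk> \<Longrightarrow>
    (N +>\<^bsub>M\<^esub> x) \<oplus>\<^bsub>quotient_module M N\<^esub> (N +>\<^bsub>M\<^esub> y) = N +>\<^bsub>M\<^esub> (x \<oplus>\<^bsub>M\<^esub> y)"
  by (simp add: quotient_module_def N.a_rcos_sum)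

text \<open>Scaling in the quotient is a union over all representatives. The united cosets all
  coincide because the submodule is stable under scaling, and there is at least one of them because
  a coset is not empty.\<close>

lemma quotient_module_smult:
  assumes "a \<in> carrier R" "x \<in> carrier M"
  shows "a \<odot>\<^bsub>quotient_module M N\<^esub> (N +>\<^bsub>M\<^esub> x) = N +>\<^bsub>M\<^esub> (a \<odot>\<^bsub>M\<^esub> x)"
proof -
  have const: "N +>\<^bsub>M\<^esub> (a \<odot>\<^bsub>M\<^esub> y) = N +>\<^bsub>M\<^esub> (a \<odot>\<^bsub>M\<^esub> x)" if "y \<in> N +>\<^bsub>M\<^esub> x" for y
  proof -
    have y: "y \<in> carrier M"
      using that assms(2) N.a_subset by (meson M.a_r_coset_subset_G subsetD)
    have "N +>\<^bsub>M\<^esub> y = N +>\<^bsub>M\<^esub> x"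
      using M.a_repr_independence[OF that assms(2) N.a_subgroup] by simp
    then have "y \<ominus>\<^bsub>M\<^esub> x \<in> N"
      using coset_eq_iff[OF y assms(2)] by simp
    then have "a \<odot>\<^bsub>M\<^esub> (y \<ominus>\<^bsub>M\<^esub> x) \<in> N"
      by (rule submoduleE(4)[OF N assms(1)])
    then show ?thesis
      using coset_eq_iff y assms by (simp add: a_minus_def smult_r_distr smult_r_minus)
  qed
  have "N +>\<^bsub>M\<^esub> x \<noteq> {}" using N.a_rcos_self[OF assms(2)] by blast
  then have "(\<Union>y\<in>N +>\<^bsub>M\<^esub> x. N +>\<^bsub>M\<^esub> (a \<odot>\<^bsub>M\<^esub> y)) = N +>\<^bsub>M\<^esub> (a \<odot>\<^bsub>M\<^esub> x)"
    by (rule SUP_eq_const) (rule const)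
  then show ?thesis
    by (simp add: quotient_module_def)
qed

lemma quotient_module: "module R (quotient_module M N)"
proof -
  let ?Q = "quotient_module M N"
  have "abelian_group ?Q"
  proof (rule abelian_groupI)
    fix X assume "X \<in> carrier ?Q"
    then obtain x where x: "x \<in> carrier M" "X = N +>\<^bsub>M\<^esub> x" by (auto simp: quotient_module_carrier)
    then show "\<exists>Y\<in>carrier ?Q. Y \<oplus>\<^bsub>?Q\<^esub> X = \<zero>\<^bsub>?Q\<^esub>"
      by (intro bexI[of _ "N +>\<^bsub>M\<^esub> (\<ominus>\<^bsub>M\<^esub> x)"])
        (auto simp: quotient_module_carrier quotient_module_add quotient_module_zero M.l_neg
          simp del: M.a_coset_add_zero)
  qed (auto simp: quotient_module_carrier quotient_module_add quotient_module_zero M.a_ac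
        simp del: M.a_coset_add_zero)
  then show ?thesis
    by (intro moduleI)
      (auto simp: quotient_module_carrier quotient_module_add quotient_module_smult
        smult_l_distr smult_r_distr smult_assoc1 R.is_cring)
qed

text \<open>The value at a coset is taken at a chosen representative; two representatives differ by
  an element of \<open>N\<close>, which \<open>F\<close> kills.\<close>

lemma quotient_module_lift:
  assumes P: "module R P" and F: "F \<in> linear_maps R M P" and ker: "\<And>x. x \<in> N \<Longrightarrow> F x = \<zero>\<^bsub>P\<^esub>"
  shows "\<exists>G\<in>linear_maps R (quotient_module M N) P. \<forall>x\<in>carrier M. G (N +>\<^bsub>M\<^esub> x) = F x"
proof -
  interpret two_modules R M P by (intro two_modulesI module_axioms P)
  define G where "G X = F (SOME x. x \<in> carrier M \<and> X = N +>\<^bsub>M\<^esub> x)" for X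
  have G: "G (N +>\<^bsub>M\<^esub> x) = F x" if x: "x \<in> carrier M" for x
  proof -
    define y where "y = (SOME y. y \<in> carrier M \<and> N +>\<^bsub>M\<^esub> x = N +>\<^bsub>M\<^esub> y)"
    have y: "y \<in> carrier M \<and> N +>\<^bsub>M\<^esub> x = N +>\<^bsub>M\<^esub> y"
      unfolding y_def by (rule someI[of _ x]) (use x in simp)
    then have "F (x \<ominus>\<^bsub>M\<^esub> y) = \<zero>\<^bsub>P\<^esub>"
      using ker coset_eq_iff x by blast
    then have "F x \<ominus>\<^bsub>P\<^esub> F y = \<zero>\<^bsub>P\<^esub>"
      using linear_maps_minus[OF F] x y by simp
    then have "F x = F y"
      using linear_maps_closed[OF F] x y by (simp add: N.add.inv_solve_right' N.minus_eq)
    then show ?thesis by (simp add: G_def y_def)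
  qed
  have "G \<in> linear_maps R (quotient_module M N) P"
    by (rule linear_mapsI)
      (auto simp: quotient_module_carrier quotient_module_add quotient_module_smult G
        linear_maps_closed[OF F] linear_maps_add[OF F] linear_maps_smult[OF F])
  then show ?thesis using G by (intro bexI[of _ G] ballI)
qed

end
end

text \<open>
  Tensor products and tensor powers are both quotients of a free module, presented by generators
  \<open>X\<close> and relations \<open>S\<close>.
\<close>

locale presented_module = cring R for R :: "('k, 'r) ring_scheme" (structure) +
  fixes X :: "'x set" and S :: "('x \<Rightarrow> 'k) set"
  assumes relations: "S \<subseteq> carrier (free_module R X)"
begin

abbreviation "F \<equiv> free_module R X"
abbreviation "N \<equiv> submodule_span R F S"
abbreviation "Q \<equiv> quotient_module F N"
abbreviation "gen x \<equiv> N +>\<^bsub>F\<^esub> free_gen R x"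

sublocale F: module R F by (rule free_module)

lemma N: "submodule N R F"
  by (rule F.submodule_span_submodule[OF relations])

sublocale Q: module R Q by (rule F.quotient_module[OF N])

lemma gen_closed: "x \<in> X \<Longrightarrow> gen x \<in> carrier Q"
  unfolding F.quotient_module_carrier[OF N] using free_gen_closed by (rule imageI)

lemma gen_span: "submodule_span R Q (gen ` X) = carrier Q"
proof -
  have gens: "gen ` X \<subseteq> carrier Q" by (rule image_subsetI) (erule gen_closed)
  have fgens: "free_gen R ` X \<subseteq> carrier F" by (rule image_subsetI) (erule free_gen_closed)
  have "N +>\<^bsub>F\<^esub> f \<in> submodule_span R Q (gen ` X)" if "f \<in> submodule_span R F (free_gen R ` X)" for f
    using that fgens
  proof (induction rule: F.submodule_span_induct)
    case zero
    then show ?case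
      using Q.submodule_zero[OF Q.submodule_span_submodule[OF gens]]
      by (simp add: F.quotient_module_zero[OF N])
  next
    case (base f)
    then obtain x where "f = free_gen R x" "x \<in> X" by (rule imageE)
    then show ?case
      by (auto intro!: subsetD[OF Q.submodule_span_superset])
  next
    case (add f g)
    then have "f \<in> carrier F" "g \<in> carrier F"
      using subsetD[OF F.submodule_span_carrier[OF fgens]] by auto
    then show ?case
      using Q.submoduleE(5)[OF Q.submodule_span_submodule[OF gens] add(3,4)]
      by (simp add: F.quotient_module_add[OF N])
  next
    case (smult a f)
    then have "f \<in> carrier F"
      using subsetD[OF F.submodule_span_carrier[OF fgens]] by auto
    then show ?case
      using Q.submoduleE(4)[OF Q.submodule_span_submodule[OF gens] smult(1,3)] smult(1)
      by (simp add: F.quotient_module_smult[OF N])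
  qed
  then have "carrier Q \<subseteq> submodule_span R Q (gen ` X)"
    unfolding F.quotient_module_carrier[OF N] free_module_span by (rule image_subsetI)
  then show ?thesis
    using Q.submodule_span_carrier[OF gens] by (rule equalityI[rotated])
qed

text \<open>The relations are written as differences of the two sides, so each of them identifies
  two cosets.\<close>

lemma relation_eq:
  assumes "x \<ominus>\<^bsub>F\<^esub> y \<in> S" "x \<in> carrier F" "y \<in> carrier F"
  shows "N +>\<^bsub>F\<^esub> x = N +>\<^bsub>F\<^esub> y"
  using F.coset_eq_iff[OF N assms(2,3)] subsetD[OF F.submodule_span_superset assms(1)] by simp

text \<open>Only the generating relations have to be checked, since a linear map that kills them
  kills their span. The condition \<open>rel\<close> quantifies over every linear map with the right
  values on generators, so it can be verified without knowing how the map on the free module was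
  built.\<close>

lemma lift:
  assumes P: "module R P" and \<phi>: "\<And>x. x \<in> X \<Longrightarrow> \<phi> x \<in> carrier P"
    and rel: "\<And>G s. \<lbrakk>G \<in> linear_maps R F P; \<And>x. x \<in> X \<Longrightarrow> G (free_gen R x) = \<phi> x; s \<in> S\<rbrakk> \<Longrightarrow> G s = \<zero>\<^bsub>P\<^esub>"
  shows "\<exists>G\<in>linear_maps R Q P. \<forall>x\<in>X. G (gen x) = \<phi> x"
proof -
  interpret two_modules R F P by (intro two_modulesI F.module_axioms P)
  obtain G where G: "G \<in> linear_maps R F P" "\<And>x. x \<in> X \<Longrightarrow> G (free_gen R x) = \<phi> x"
    using free_module_lift[of P X \<phi>, OF P \<phi>] by auto
  have ker: "G x = \<zero>\<^bsub>P\<^esub>" if "x \<in> N" for x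
    by (rule linear_maps_eq_on_span[OF F.module_axioms P G(1) linear_maps_const_0 relations _ that])
      (rule rel[OF G])
  obtain H where "H \<in> linear_maps R Q P" "\<And>x. x \<in> carrier F \<Longrightarrow> H (N +>\<^bsub>F\<^esub> x) = G x"
    using F.quotient_module_lift[OF N P G(1) ker] by auto
  then show ?thesis
    using G(2) by (intro bexI[of _ H] ballI) (simp_all add: free_gen_closed)
qed

end

section \<open>Tensor products and tensor powers\<close>

lemma module_extend_simps [simp]:
  "carrier (module.extend Q (graded_module.fields g)) = carrier Q"
  "zero (module.extend Q (graded_module.fields g)) = zero Q"
  "add (module.extend Q (graded_module.fields g)) = add Q"
  "smult (module.extend Q (graded_module.fields g)) = smult Q"
  "grade (module.extend Q (graded_module.fields g)) = g"
  by (simp_all add: module.defs graded_module.defs)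

text \<open>Closure under negation follows by scaling with -1. What is left mentions only carrier,
  zero, sum and scaling, so it can be compared between two records.\<close>

lemma (in module) submodule_iff:
  "submodule H R M \<longleftrightarrow> H \<subseteq> carrier M \<and> \<zero>\<^bsub>M\<^esub> \<in> H \<and> (\<forall>x\<in>H. \<forall>y\<in>H. x \<oplus>\<^bsub>M\<^esub> y \<in> H) \<and>
     (\<forall>a\<in>carrier R. \<forall>x\<in>H. a \<odot>\<^bsub>M\<^esub> x \<in> H)"
proof
  assume H: "H \<subseteq> carrier M \<and> \<zero>\<^bsub>M\<^esub> \<in> H \<and> (\<forall>x\<in>H. \<forall>y\<in>H. x \<oplus>\<^bsub>M\<^esub> y \<in> H) \<and>
     (\<forall>a\<in>carrier R. \<forall>x\<in>H. a \<odot>\<^bsub>M\<^esub> x \<in> H)"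
  show "submodule H R M"
  proof (rule submoduleI)
    fix x assume "x \<in> H"
    then have "(\<ominus> \<one>) \<odot>\<^bsub>M\<^esub> x \<in> H" "x \<in> carrier M" using H by auto
    then show "\<ominus>\<^bsub>M\<^esub> x \<in> H" by (simp add: smult_l_minus)
  qed (use H in auto)
qed (auto simp: submodule_zero dest: submoduleE)

lemma submodule_span_cong:
  assumes "module R M" "carrier M' = carrier M" "add M' = add M" "zero M' = zero M" "smult M' = smult M"
  shows "submodule_span R M' S = submodule_span R M S"
proof -
  interpret M: module R M by fact
  interpret M': module R M' by (rule module_cong[OF assms])
  have "submodule H R M' \<longleftrightarrow> submodule H R M" for H
    unfolding M.submodule_iff M'.submodule_iff assms(2-) ..
  then show ?thesis by (simp add: submodule_span_def)
qed

lemma linear_maps_cong_domain: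
  assumes "carrier M' = carrier M" "add M' = add M" "smult M' = smult M"
  shows "linear_maps R M' P = linear_maps R M P"
  using assms by (simp add: linear_maps_def hom_def)

section \<open>Binary tensor products\<close>

definition tensor_rels ::
  "('k, 'r) ring_scheme \<Rightarrow> ('k, 'a, 'm) module_scheme \<Rightarrow> ('k, 'b, 'n) module_scheme
    \<Rightarrow> ('a \<times> 'b \<Rightarrow> 'k) set"
  where "tensor_rels R M N = (let F = free_module R (carrier M \<times> carrier N) in
    {free_gen R (x \<oplus>\<^bsub>M\<^esub> x', y) \<ominus>\<^bsub>F\<^esub> (free_gen R (x, y) \<oplus>\<^bsub>F\<^esub> free_gen R (x', y)) | x x' y.
        x \<in> carrier M \<and> x' \<in> carrier M \<and> y \<in> carrier N} \<union>
     {free_gen R (x, y \<oplus>\<^bsub>N\<^esub> y') \<ominus>\<^bsub>F\<^esub> (free_gen R (x, y) \<oplus>\<^bsub>F\<^esub> free_gen R (x, y')) | x y y'.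
        x \<in> carrier M \<and> y \<in> carrier N \<and> y' \<in> carrier N} \<union>
     {free_gen R (a \<odot>\<^bsub>M\<^esub> x, y) \<ominus>\<^bsub>F\<^esub> a \<odot>\<^bsub>F\<^esub> free_gen R (x, y) | a x y.
        a \<in> carrier R \<and> x \<in> carrier M \<and> y \<in> carrier N} \<union>
     {free_gen R (x, a \<odot>\<^bsub>N\<^esub> y) \<ominus>\<^bsub>F\<^esub> a \<odot>\<^bsub>F\<^esub> free_gen R (x, y) | a x y.
        a \<in> carrier R \<and> x \<in> carrier M \<and> y \<in> carrier N})"

context
  fixes R :: "('k, 'r) ring_scheme" and M :: "('k, 'a, 'm) graded_module_scheme"
    and N :: "('k, 'b, 'n) graded_module_scheme"
  assumes M: "module R M" and N: "module R N"
begin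

interpretation M: module R M by (rule M)
interpretation N: module R N by (rule N)

text \<open>\<open>tensor_rels\<close> holds the relations before their span is taken; in this form
  the tensor product is an instance of \<open>presented_module\<close>, and its universal property
  is that of a presentation.\<close>

lemma tensor_presented: "presented_module R (carrier M \<times> carrier N) (tensor_rels R M N)"
proof (unfold_locales, rule subsetI)
  fix s assume s: "s \<in> tensor_rels R M N"
  let ?F = "free_module R (carrier M \<times> carrier N)"
  interpret F: module R ?F by (rule M.R.free_module)
  show "s \<in> carrier ?F"
    using s M.R.free_gen_closed[of _ "carrier M \<times> carrier N"]
    by (auto simp: tensor_rels_def Let_def intro!: F.minus_closed F.a_closed F.smult_closed)
qed

interpretation T: presented_module R "carrier M \<times> carrier N" "tensor_rels R M N"
  by (rule tensor_presented)

lemma tensor_relations_eq: "tensor_relations R M N = T.N"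
  by (simp add: tensor_relations_def tensor_rels_def Let_def)

lemma tensor_simps:
  "carrier (tensor R M N) = carrier T.Q" "zero (tensor R M N) = zero T.Q"
  "add (tensor R M N) = add T.Q" "smult (tensor R M N) = smult T.Q"
  by (simp_all add: tensor_def Let_def tensor_relations_eq)

lemma pure_tensor_eq: "pure_tensor R M N x y = T.gen (x, y)"
  by (simp add: pure_tensor_def tensor_relations_eq)

lemma tensor_module: "module R (tensor R M N)"
  by (rule module_cong[OF T.Q.module_axioms tensor_simps(1,3,2,4)])

lemma tensor_grade:
  "grade (tensor R M N) n = submodule_span R (tensor R M N)
    {pure_tensor R M N x y | x y. \<exists>i j. x \<in> grade M i \<and> y \<in> grade N j \<and> i + j = n}"
  unfolding submodule_span_cong[OF T.Q.module_axioms tensor_simps(1,3,2,4)]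
  by (simp add: tensor_def Let_def tensor_relations_eq)

lemma pure_tensor_closed:
  "\<lbrakk>x \<in> carrier M; y \<in> carrier N\<rbrakk> \<Longrightarrow> pure_tensor R M N x y \<in> carrier (tensor R M N)"
  unfolding tensor_simps pure_tensor_eq by (rule T.gen_closed) simp

lemma pure_tensor_linear_left:
  assumes y: "y \<in> carrier N"
  shows "(\<lambda>x. pure_tensor R M N x y) \<in> linear_maps R M (tensor R M N)"
proof (rule linear_mapsI)
  fix x x' assume x: "x \<in> carrier M" "x' \<in> carrier M"
  have "free_gen R (x \<oplus>\<^bsub>M\<^esub> x', y) \<ominus>\<^bsub>T.F\<^esub> (free_gen R (x, y) \<oplus>\<^bsub>T.F\<^esub> free_gen R (x', y))
      \<in> tensor_rels R M N"
    using x y by (auto simp: tensor_rels_def Let_def)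
  from T.relation_eq[OF this] x y
  show "pure_tensor R M N (x \<oplus>\<^bsub>M\<^esub> x') y =
      pure_tensor R M N x y \<oplus>\<^bsub>tensor R M N\<^esub> pure_tensor R M N x' y"
    unfolding tensor_simps pure_tensor_eq
    by (simp add: T.F.quotient_module_add[OF T.N] M.R.free_gen_closed)
next
  fix a x assume x: "a \<in> carrier R" "x \<in> carrier M"
  have "free_gen R (a \<odot>\<^bsub>M\<^esub> x, y) \<ominus>\<^bsub>T.F\<^esub> a \<odot>\<^bsub>T.F\<^esub> free_gen R (x, y) \<in> tensor_rels R M N"
    using x y by (auto simp: tensor_rels_def Let_def)
  from T.relation_eq[OF this] x y
  show "pure_tensor R M N (a \<odot>\<^bsub>M\<^esub> x) y = a \<odot>\<^bsub>tensor R M N\<^esub> pure_tensor R M N x y"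
    unfolding tensor_simps pure_tensor_eq
    by (simp add: T.F.quotient_module_smult[OF T.N] M.R.free_gen_closed)
qed (use y in \<open>simp add: pure_tensor_closed\<close>)

lemma pure_tensor_linear_right:
  assumes x: "x \<in> carrier M"
  shows "(\<lambda>y. pure_tensor R M N x y) \<in> linear_maps R N (tensor R M N)"
proof (rule linear_mapsI)
  fix y y' assume y: "y \<in> carrier N" "y' \<in> carrier N"
  have "free_gen R (x, y \<oplus>\<^bsub>N\<^esub> y') \<ominus>\<^bsub>T.F\<^esub> (free_gen R (x, y) \<oplus>\<^bsub>T.F\<^esub> free_gen R (x, y'))
      \<in> tensor_rels R M N"
    using x y by (auto simp: tensor_rels_def Let_def)
  from T.relation_eq[OF this] x y
  show "pure_tensor R M N x (y \<oplus>\<^bsub>N\<^esub> y') =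
      pure_tensor R M N x y \<oplus>\<^bsub>tensor R M N\<^esub> pure_tensor R M N x y'"
    unfolding tensor_simps pure_tensor_eq
    by (simp add: T.F.quotient_module_add[OF T.N] M.R.free_gen_closed)
next
  fix a y assume y: "a \<in> carrier R" "y \<in> carrier N"
  have "free_gen R (x, a \<odot>\<^bsub>N\<^esub> y) \<ominus>\<^bsub>T.F\<^esub> a \<odot>\<^bsub>T.F\<^esub> free_gen R (x, y) \<in> tensor_rels R M N"
    using x y by (auto simp: tensor_rels_def Let_def)
  from T.relation_eq[OF this] x y
  show "pure_tensor R M N x (a \<odot>\<^bsub>N\<^esub> y) = a \<odot>\<^bsub>tensor R M N\<^esub> pure_tensor R M N x y"
    unfolding tensor_simps pure_tensor_eq
    by (simp add: T.F.quotient_module_smult[OF T.N] M.R.free_gen_closed)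
qed (use x in \<open>simp add: pure_tensor_closed\<close>)

lemma tensor_span:
  "submodule_span R (tensor R M N) {pure_tensor R M N x y | x y. x \<in> carrier M \<and> y \<in> carrier N} =
    carrier (tensor R M N)"
proof -
  have "{pure_tensor R M N x y | x y. x \<in> carrier M \<and> y \<in> carrier N} = T.gen ` (carrier M \<times> carrier N)"
    by (auto simp: pure_tensor_eq image_iff)
  then show ?thesis
    by (simp add: submodule_span_cong[OF T.Q.module_axioms tensor_simps(1,3,2,4)] T.gen_span tensor_simps)
qed

lemma tensor_lift:
  assumes P: "module R P"
    and l: "\<And>y. y \<in> carrier N \<Longrightarrow> (\<lambda>x. \<phi> x y) \<in> linear_maps R M P"
    and r: "\<And>x. x \<in> carrier M \<Longrightarrow> (\<lambda>y. \<phi> x y) \<in> linear_maps R N P"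
  shows "\<exists>G\<in>linear_maps R (tensor R M N) P. \<forall>x\<in>carrier M. \<forall>y\<in>carrier N. G (pure_tensor R M N x y) = \<phi> x y"
proof -
  interpret P: module R P by (rule P)
  have cl: "\<phi> x y \<in> carrier P" if "x \<in> carrier M" "y \<in> carrier N" for x y
    using linear_maps_closed[OF l] that by simp
  have "\<exists>G\<in>linear_maps R T.Q P. \<forall>z\<in>carrier M \<times> carrier N. G (T.gen z) = (\<lambda>(x, y). \<phi> x y) z"
  proof (rule T.lift[OF P])
    fix G s
    assume G: "G \<in> linear_maps R T.F P"
      and gen: "\<And>z. z \<in> carrier M \<times> carrier N \<Longrightarrow> G (free_gen R z) = (\<lambda>(x, y). \<phi> x y) z"
      and s: "s \<in> tensor_rels R M N"
    interpret two_modules R T.F P by (intro two_modulesI T.F.module_axioms P)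
    have gen': "G (free_gen R (x, y)) = \<phi> x y" if "x \<in> carrier M" "y \<in> carrier N" for x y
      using gen that by simp
    have fg: "free_gen R (x, y) \<in> carrier T.F" if "x \<in> carrier M" "y \<in> carrier N" for x y
      using that by (simp add: M.R.free_gen_closed)
    note sm = linear_maps_minus[OF G] linear_maps_add[OF G] linear_maps_smult[OF G]
      linear_maps_add[OF l] linear_maps_add[OF r] linear_maps_smult[OF l] linear_maps_smult[OF r]
    from s show "G s = \<zero>\<^bsub>P\<^esub>"
      by (auto simp: tensor_rels_def Let_def sm gen' fg cl P.r_neg a_minus_def[of P])
  qed (use cl in auto)
  then show ?thesis
    by (simp add: pure_tensor_eq linear_maps_cong_domain[OF tensor_simps(1,3,4)])
qed

end

section \<open>Tensor powers and multilinear maps\<close>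

lemma words_iff: "xs \<in> words V n \<longleftrightarrow> length xs = n \<and> set xs \<subseteq> carrier V"
  by (simp add: words_def)

text \<open>The separate closure condition carries the case n = 0, in which there is no slot to be
  linear in.\<close>

definition multilinear ::
  "('k, 'r) ring_scheme \<Rightarrow> ('k, 'a, 'm) module_scheme \<Rightarrow> ('k, 'b, 'n) module_scheme
    \<Rightarrow> nat \<Rightarrow> ('a list \<Rightarrow> 'b) \<Rightarrow> bool"
  where "multilinear R V P n \<phi> \<longleftrightarrow> (\<forall>xs\<in>words V n. \<phi> xs \<in> carrier P) \<and>
    (\<forall>us vs. set us \<subseteq> carrier V \<longrightarrow> set vs \<subseteq> carrier V \<longrightarrow> Suc (length us + length vs) = n \<longrightarrow>
      (\<lambda>x. \<phi> (us @ x # vs)) \<in> linear_maps R V P)"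

definition tensor_power_rels ::
  "('k, 'r) ring_scheme \<Rightarrow> ('k, 'a, 'm) module_scheme \<Rightarrow> nat \<Rightarrow> ('a list \<Rightarrow> 'k) set"
  where "tensor_power_rels R V n = (let F = free_module R (words V n) in
    {free_gen R (us @ [x \<oplus>\<^bsub>V\<^esub> y] @ vs) \<ominus>\<^bsub>F\<^esub>
        (free_gen R (us @ [x] @ vs) \<oplus>\<^bsub>F\<^esub> free_gen R (us @ [y] @ vs)) | us x y vs.
        us @ [x] @ vs \<in> words V n \<and> us @ [y] @ vs \<in> words V n} \<union>
     {free_gen R (us @ [a \<odot>\<^bsub>V\<^esub> x] @ vs) \<ominus>\<^bsub>F\<^esub> a \<odot>\<^bsub>F\<^esub> free_gen R (us @ [x] @ vs) | a us x vs.
        a \<in> carrier R \<and> us @ [x] @ vs \<in> words V n})"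

lemma tensor_power_rels_cases [consumes 1, case_names add smult]:
  fixes R (structure) and V (structure) and n defines "F \<equiv> free_module R (words V n)"
  assumes "s \<in> tensor_power_rels R V n"
  obtains us x y vs where "s = free_gen R (us @ [x \<oplus>\<^bsub>V\<^esub> y] @ vs) \<ominus>\<^bsub>F\<^esub>
        (free_gen R (us @ [x] @ vs) \<oplus>\<^bsub>F\<^esub> free_gen R (us @ [y] @ vs))"
        "us @ [x] @ vs \<in> words V n" "us @ [y] @ vs \<in> words V n"
    | a us x vs where "s = free_gen R (us @ [a \<odot>\<^bsub>V\<^esub> x] @ vs) \<ominus>\<^bsub>F\<^esub> a \<odot>\<^bsub>F\<^esub> free_gen R (us @ [x] @ vs)"
        "a \<in> carrier R" "us @ [x] @ vs \<in> words V n"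
  using assms(2) unfolding tensor_power_rels_def Let_def F_def by auto

context
  fixes R :: "('k, 'r) ring_scheme" and V :: "('k, 'a, 'm) graded_module_scheme"
  assumes V: "module R V"
begin

interpretation V: module R V by (rule V)

lemma tensor_power_presented: "presented_module R (words V n) (tensor_power_rels R V n)"
proof (unfold_locales, rule subsetI)
  fix s assume s: "s \<in> tensor_power_rels R V n"
  let ?F = "free_module R (words V n)"
  interpret F: module R ?F by (rule V.R.free_module)
  from s show "s \<in> carrier ?F"
  proof (cases rule: tensor_power_rels_cases)
    case (add us x y vs)
    then show ?thesis
      using V.R.free_gen_closed[of _ "words V n"]
      by (simp only:) (intro F.minus_closed F.a_closed, auto simp: words_iff)
  next
    case (smult a us x vs)
    then show ?thesis
      using V.R.free_gen_closed[of _ "words V n"]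
      by (simp only:) (intro F.minus_closed F.smult_closed, auto simp: words_iff)
  qed
qed

interpretation T: presented_module R "words V n" "tensor_power_rels R V n" for n
  by (rule tensor_power_presented)

lemma tensor_power_relations_eq: "tensor_power_relations R V n = T.N n"
  by (simp add: tensor_power_relations_def tensor_power_rels_def Let_def)

lemma tensor_power_simps:
  "carrier (tensor_power R V n) = carrier (T.Q n)" "zero (tensor_power R V n) = zero (T.Q n)"
  "add (tensor_power R V n) = add (T.Q n)" "smult (tensor_power R V n) = smult (T.Q n)"
  by (simp_all add: tensor_power_def Let_def tensor_power_relations_eq)

lemma word_tensor_eq: "word_tensor R V xs = T.gen (length xs) xs"
  by (simp add: word_tensor_def tensor_power_relations_eq)

lemma tensor_power_module: "module R (tensor_power R V n)"
  by (rule module_cong[OF T.Q.module_axioms tensor_power_simps(1,3,2,4)])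

lemma tensor_power_grade:
  "grade (tensor_power R V n) m = submodule_span R (tensor_power R V n)
    {word_tensor R V xs | xs. length xs = n \<and> (\<exists>ds. homogeneous_word V xs ds \<and> sum_list ds = m)}"
  unfolding submodule_span_cong[OF T.Q.module_axioms tensor_power_simps(1,3,2,4)]
  by (simp add: tensor_power_def Let_def tensor_power_relations_eq)

lemma word_tensor_closed:
  "xs \<in> words V n \<Longrightarrow> word_tensor R V xs \<in> carrier (tensor_power R V n)"
  unfolding tensor_power_simps word_tensor_eq by (simp add: words_iff T.gen_closed)

lemma word_tensor_linear:
  assumes us: "set us \<subseteq> carrier V" "set vs \<subseteq> carrier V" and n: "n = Suc (length us + length vs)"
  shows "(\<lambda>x. word_tensor R V (us @ x # vs)) \<in> linear_maps R V (tensor_power R V n)"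
proof (rule linear_mapsI)
  fix x y assume x: "x \<in> carrier V" "y \<in> carrier V"
  have w: "us @ z # vs \<in> words V n" if "z \<in> carrier V" for z
    using that us n by (simp add: words_iff)
  have "free_gen R (us @ [x \<oplus>\<^bsub>V\<^esub> y] @ vs) \<ominus>\<^bsub>T.F n\<^esub>
        (free_gen R (us @ [x] @ vs) \<oplus>\<^bsub>T.F n\<^esub> free_gen R (us @ [y] @ vs)) \<in> tensor_power_rels R V n"
    unfolding tensor_power_rels_def Let_def
    by (rule UnI1, rule CollectI, intro exI, rule conjI[OF refl]) (simp add: w x)
  from T.relation_eq[OF this] w x n
  show "word_tensor R V (us @ (x \<oplus>\<^bsub>V\<^esub> y) # vs) =
      word_tensor R V (us @ x # vs) \<oplus>\<^bsub>tensor_power R V n\<^esub> word_tensor R V (us @ y # vs)"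
    unfolding tensor_power_simps word_tensor_eq
    by (simp add: T.F.quotient_module_add[OF T.N] V.R.free_gen_closed)
next
  fix a x assume x: "a \<in> carrier R" "x \<in> carrier V"
  have w: "us @ z # vs \<in> words V n" if "z \<in> carrier V" for z
    using that us n by (simp add: words_iff)
  have "free_gen R (us @ [a \<odot>\<^bsub>V\<^esub> x] @ vs) \<ominus>\<^bsub>T.F n\<^esub> a \<odot>\<^bsub>T.F n\<^esub> free_gen R (us @ [x] @ vs)
      \<in> tensor_power_rels R V n"
    unfolding tensor_power_rels_def Let_def
    by (rule UnI2, rule CollectI, intro exI, rule conjI[OF refl]) (simp add: w x)
  from T.relation_eq[OF this] w x n
  show "word_tensor R V (us @ (a \<odot>\<^bsub>V\<^esub> x) # vs) = a \<odot>\<^bsub>tensor_power R V n\<^esub> word_tensor R V (us @ x # vs)"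
    unfolding tensor_power_simps word_tensor_eq
    by (simp add: T.F.quotient_module_smult[OF T.N] V.R.free_gen_closed)
qed (use assms in \<open>auto intro!: word_tensor_closed simp: words_iff\<close>)

lemma tensor_power_span:
  "submodule_span R (tensor_power R V n) (word_tensor R V ` words V n) = carrier (tensor_power R V n)"
proof -
  have "word_tensor R V ` words V n = T.gen n ` words V n"
    by (rule image_cong) (auto simp: word_tensor_eq words_iff)
  then show ?thesis
    by (simp add: submodule_span_cong[OF T.Q.module_axioms tensor_power_simps(1,3,2,4)]
        T.gen_span tensor_power_simps)
qed

lemma tensor_power_lift:
  assumes P: "module R P" and \<phi>: "multilinear R V P n \<phi>"
  shows "\<exists>G\<in>linear_maps R (tensor_power R V n) P. \<forall>xs\<in>words V n. G (word_tensor R V xs) = \<phi> xs"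
proof -
  interpret P: module R P by (rule P)
  have "\<exists>G\<in>linear_maps R (T.Q n) P. \<forall>xs\<in>words V n. G (T.gen n xs) = \<phi> xs"
  proof (rule T.lift[OF P])
    fix G s
    assume G: "G \<in> linear_maps R (T.F n) P"
      and gen: "\<And>xs. xs \<in> words V n \<Longrightarrow> G (free_gen R xs) = \<phi> xs"
      and s: "s \<in> tensor_power_rels R V n"
    interpret two_modules R "T.F n" P by (intro two_modulesI T.F.module_axioms P)
    have lin: "(\<lambda>x. \<phi> (us @ x # vs)) \<in> linear_maps R V P"
      if "set us \<subseteq> carrier V" "set vs \<subseteq> carrier V" "Suc (length us + length vs) = n" for us vs
      using \<phi> that by (simp add: multilinear_def)
    have cl: "\<phi> xs \<in> carrier P" if "xs \<in> words V n" for xs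
      using \<phi> that by (simp add: multilinear_def)
    note sm = linear_maps_minus[OF G] linear_maps_add[OF G] linear_maps_smult[OF G] gen
      V.R.free_gen_closed T.F.a_closed T.F.smult_closed cl
    from s show "G s = \<zero>\<^bsub>P\<^esub>"
    proof (cases rule: tensor_power_rels_cases)
      case (add us x y vs)
      then have c: "\<phi> (us @ x # vs) \<in> carrier P" "\<phi> (us @ y # vs) \<in> carrier P"
        by (auto intro!: cl)
      from add have "us @ (x \<oplus>\<^bsub>V\<^esub> y) # vs \<in> words V n" by (auto simp: words_iff)
      then show ?thesis
        using add linear_maps_add[OF lin[of us vs], of x y]
        by (simp add: sm) (simp add: words_iff c P.r_neg a_minus_def[of P])
    next
      case (smult a us x vs)
      then have c: "\<phi> (us @ x # vs) \<in> carrier P"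
        by (auto intro!: cl)
      from smult have "us @ (a \<odot>\<^bsub>V\<^esub> x) # vs \<in> words V n" by (auto simp: words_iff)
      then show ?thesis
        using smult linear_maps_smult[OF lin[of us vs], of a x]
        by (simp add: sm) (simp add: words_iff c P.r_neg a_minus_def[of P])
    qed
  qed (use \<phi> in \<open>auto simp: multilinear_def\<close>)
  then have "\<exists>G\<in>linear_maps R (tensor_power R V n) P. \<forall>xs\<in>words V n. G (T.gen n xs) = \<phi> xs"
    by (simp add: linear_maps_cong_domain[OF tensor_power_simps(1,3,4)])
  moreover have "word_tensor R V xs = T.gen n xs" if "xs \<in> words V n" for xs
    using that by (simp add: word_tensor_eq words_iff)
  ultimately show ?thesis by simp
qed

end

section \<open>Homogeneous components and signs\<close>

definition component :: "('k, 'a, 'm) graded_module_scheme \<Rightarrow> 'a \<Rightarrow> int \<Rightarrow> 'a"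
  where "component M x = (THE c. (\<forall>i. c i \<in> grade M i) \<and> finite {i. c i \<noteq> \<zero>\<^bsub>M\<^esub>} \<and>
          x = (\<Oplus>\<^bsub>M\<^esub>i\<in>{i. c i \<noteq> \<zero>\<^bsub>M\<^esub>}. c i))"

context graded_module
begin

lemma grade_closed: "x \<in> grade M i \<Longrightarrow> x \<in> carrier M"
  using submoduleE(1)[OF grade_submodule] by auto

lemma grade_zero: "\<zero>\<^bsub>M\<^esub> \<in> grade M i"
  by (rule submodule_zero[OF grade_submodule])

lemma grade_add: "\<lbrakk>x \<in> grade M i; y \<in> grade M i\<rbrakk> \<Longrightarrow> x \<oplus>\<^bsub>M\<^esub> y \<in> grade M i"
  by (rule submoduleE(5)[OF grade_submodule])

lemma grade_smult: "\<lbrakk>a \<in> carrier R; x \<in> grade M i\<rbrakk> \<Longrightarrow> a \<odot>\<^bsub>M\<^esub> x \<in> grade M i"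
  by (rule submoduleE(4)[OF grade_submodule])

lemma component:
  assumes "x \<in> carrier M"
  shows "component M x i \<in> grade M i" "finite {i. component M x i \<noteq> \<zero>\<^bsub>M\<^esub>}"
    "(\<Oplus>\<^bsub>M\<^esub>i\<in>{i. component M x i \<noteq> \<zero>\<^bsub>M\<^esub>}. component M x i) = x"
  using theI'[OF grade_decomposition[OF assms]] unfolding component_def[symmetric] by auto

lemma component_closed: "x \<in> carrier M \<Longrightarrow> component M x i \<in> carrier M"
  by (rule grade_closed[OF component(1)])

lemma component_sum:
  assumes "x \<in> carrier M" "finite T" "{i. component M x i \<noteq> \<zero>\<^bsub>M\<^esub>} \<subseteq> T"
  shows "(\<Oplus>\<^bsub>M\<^esub>i\<in>T. component M x i) = x"
proof -
  have "(\<Oplus>\<^bsub>M\<^esub>i\<in>{i. component M x i \<noteq> \<zero>\<^bsub>M\<^esub>}. component M x i) = (\<Oplus>\<^bsub>M\<^esub>i\<in>T. component M x i)"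
    by (rule finsum_eq_superset) (use assms component_closed in auto)
  then show ?thesis using component(3)[OF assms(1)] by simp
qed

lemma component_unique:
  assumes c: "\<And>i. c i \<in> grade M i" and T: "finite T" "{i. c i \<noteq> \<zero>\<^bsub>M\<^esub>} \<subseteq> T"
    and x: "x = (\<Oplus>\<^bsub>M\<^esub>i\<in>T. c i)"
  shows "component M x = c"
proof -
  have xM: "x \<in> carrier M"
    unfolding x using c grade_closed by (intro finsum_closed) auto
  have fin: "finite {i. c i \<noteq> \<zero>\<^bsub>M\<^esub>}" using T finite_subset by blast
  have "x = (\<Oplus>\<^bsub>M\<^esub>i\<in>{i. c i \<noteq> \<zero>\<^bsub>M\<^esub>}. c i)"
    unfolding x by (rule finsum_eq_superset[symmetric]) (use T c grade_closed in auto)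
  then have "(\<forall>i. c i \<in> grade M i) \<and> finite {i. c i \<noteq> \<zero>\<^bsub>M\<^esub>} \<and> x = (\<Oplus>\<^bsub>M\<^esub>i\<in>{i. c i \<noteq> \<zero>\<^bsub>M\<^esub>}. c i)"
    using c fin by simp
  then show ?thesis
    unfolding component_def by (rule the1_equality[OF grade_decomposition[OF xM]])
qed

lemma component_homogeneous:
  assumes "x \<in> grade M d"
  shows "component M x i = (if i = d then x else \<zero>\<^bsub>M\<^esub>)"
proof -
  have "component M x = (\<lambda>i. if i = d then x else \<zero>\<^bsub>M\<^esub>)"
    by (rule component_unique[of _ "{d}"])
      (use assms grade_zero grade_closed in \<open>auto simp: finsum_insert\<close>)
  then show ?thesis by simp
qed

lemma component_add:
  assumes "x \<in> carrier M" "y \<in> carrier M"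
  shows "component M (x \<oplus>\<^bsub>M\<^esub> y) i = component M x i \<oplus>\<^bsub>M\<^esub> component M y i"
proof -
  let ?T = "{i. component M x i \<noteq> \<zero>\<^bsub>M\<^esub>} \<union> {i. component M y i \<noteq> \<zero>\<^bsub>M\<^esub>}"
  have T: "finite ?T" using component(2) assms by simp
  have "component M (x \<oplus>\<^bsub>M\<^esub> y) = (\<lambda>i. component M x i \<oplus>\<^bsub>M\<^esub> component M y i)"
  proof (rule component_unique[OF _ T])
    have "(\<Oplus>\<^bsub>M\<^esub>i\<in>?T. component M x i \<oplus>\<^bsub>M\<^esub> component M y i) =
        (\<Oplus>\<^bsub>M\<^esub>i\<in>?T. component M x i) \<oplus>\<^bsub>M\<^esub> (\<Oplus>\<^bsub>M\<^esub>i\<in>?T. component M y i)"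
      by (rule finsum_addf) (use assms component_closed in auto)
    also have "\<dots> = x \<oplus>\<^bsub>M\<^esub> y"
      by (simp only: component_sum[OF assms(1) T Un_upper1] component_sum[OF assms(2) T Un_upper2])
    finally show "x \<oplus>\<^bsub>M\<^esub> y = (\<Oplus>\<^bsub>M\<^esub>i\<in>?T. component M x i \<oplus>\<^bsub>M\<^esub> component M y i)" ..
  qed (use assms component(1) grade_add in auto)
  then show ?thesis by simp
qed

lemma component_smult:
  assumes "a \<in> carrier R" "x \<in> carrier M"
  shows "component M (a \<odot>\<^bsub>M\<^esub> x) i = a \<odot>\<^bsub>M\<^esub> component M x i"
proof -
  let ?T = "{i. component M x i \<noteq> \<zero>\<^bsub>M\<^esub>}"
  have T: "finite ?T" using component(2) assms by simp
  have "component M (a \<odot>\<^bsub>M\<^esub> x) = (\<lambda>i. a \<odot>\<^bsub>M\<^esub> component M x i)"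
  proof (rule component_unique[OF _ T])
    show "a \<odot>\<^bsub>M\<^esub> x = (\<Oplus>\<^bsub>M\<^esub>i\<in>?T. a \<odot>\<^bsub>M\<^esub> component M x i)"
      using finsum_smult_ldistr[OF T assms(1), of "component M x"] component_closed[OF assms(2)]
      by (simp add: component(3)[OF assms(2)])
  qed (use assms component(1) grade_smult in auto)
  then show ?thesis by simp
qed

lemma component_linear: "(\<lambda>x. component M x i) \<in> linear_maps R M M"
  by (rule linear_mapsI) (simp_all add: component_closed component_add component_smult)

lemma grade_Union_subset: "(\<Union>i. grade M i) \<subseteq> carrier M"
  using grade_closed by auto

lemma grade_span: "submodule_span R M (\<Union>i. grade M i) = carrier M"
proof
  show "carrier M \<subseteq> submodule_span R M (\<Union>i. grade M i)"
  proof
    fix x assume x: "x \<in> carrier M"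
    have "(\<Oplus>\<^bsub>M\<^esub>i\<in>{i. component M x i \<noteq> \<zero>\<^bsub>M\<^esub>}. component M x i) \<in> submodule_span R M (\<Union>i. grade M i)"
      by (intro submodule_finsum submodule_span_submodule grade_Union_subset)
        (use component(1)[OF x] submodule_span_superset in blast)
    then show "x \<in> submodule_span R M (\<Union>i. grade M i)"
      by (simp add: component(3)[OF x])
  qed
qed (intro submodule_span_carrier grade_Union_subset)

lemma koszul_sign_closed [simp]: "koszul_sign R i \<in> carrier R"
  by (simp add: koszul_sign_def)

lemma koszul_sign_add: "koszul_sign R i \<otimes> koszul_sign R j = koszul_sign R (i + j)"
  by (simp add: koszul_sign_def l_minus)

end

text \<open>The sign (-1)^(e i) that a map of degree \<open>e\<close> acquires when it moves past an
  element of degree \<open>i\<close>, extended linearly to inhomogeneous elements. For odd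
  \<open>e\<close> this is the involution \<open>\<tau>\<close>, for even \<open>e\<close> the
  identity.\<close>

definition sgn_map ::
  "('k, 'r) ring_scheme \<Rightarrow> ('k, 'a, 'm) graded_module_scheme \<Rightarrow> int \<Rightarrow> 'a \<Rightarrow> 'a"
  where "sgn_map R M e x =
    (\<Oplus>\<^bsub>M\<^esub>i\<in>{i. component M x i \<noteq> \<zero>\<^bsub>M\<^esub>}. koszul_sign R (e * i) \<odot>\<^bsub>M\<^esub> component M x i)"

context graded_module
begin

lemma sgn_map_sum:
  assumes "x \<in> carrier M" "finite T" "{i. component M x i \<noteq> \<zero>\<^bsub>M\<^esub>} \<subseteq> T"
  shows "sgn_map R M e x = (\<Oplus>\<^bsub>M\<^esub>i\<in>T. koszul_sign R (e * i) \<odot>\<^bsub>M\<^esub> component M x i)"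
  unfolding sgn_map_def by (rule finsum_eq_superset) (use assms component_closed in auto)

lemma sgn_map_linear: "sgn_map R M e \<in> linear_maps R M M"
proof (rule linear_mapsI)
  fix x assume x: "x \<in> carrier M"
  then show "sgn_map R M e x \<in> carrier M"
    unfolding sgn_map_def by (intro finsum_closed) (auto simp: component_closed)
next
  fix x y assume x: "x \<in> carrier M" and y: "y \<in> carrier M"
  let ?T = "{i. component M x i \<noteq> \<zero>\<^bsub>M\<^esub>} \<union> {i. component M y i \<noteq> \<zero>\<^bsub>M\<^esub>}"
  have T: "finite ?T" using component(2) x y by simp
  have sub: "{i. component M (x \<oplus>\<^bsub>M\<^esub> y) i \<noteq> \<zero>\<^bsub>M\<^esub>} \<subseteq> ?T"
    using x y by (auto simp: component_add)
  have "sgn_map R M e (x \<oplus>\<^bsub>M\<^esub> y) = (\<Oplus>\<^bsub>M\<^esub>i\<in>?T. koszul_sign R (e * i) \<odot>\<^bsub>M\<^esub> component M x i \<oplus>\<^bsub>M\<^esub>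
      koszul_sign R (e * i) \<odot>\<^bsub>M\<^esub> component M y i)"
    by (subst sgn_map_sum[OF _ T sub])
      (use x y in \<open>auto simp: component_add component_closed smult_r_distr intro!: finsum_cong'\<close>)
  also have "\<dots> = sgn_map R M e x \<oplus>\<^bsub>M\<^esub> sgn_map R M e y"
    by (subst (1 2) sgn_map_sum[OF _ T]) (use x y in \<open>auto simp: component_closed intro!: finsum_addf\<close>)
  finally show "sgn_map R M e (x \<oplus>\<^bsub>M\<^esub> y) = sgn_map R M e x \<oplus>\<^bsub>M\<^esub> sgn_map R M e y" .
next
  fix a x assume a: "a \<in> carrier R" and x: "x \<in> carrier M"
  let ?T = "{i. component M x i \<noteq> \<zero>\<^bsub>M\<^esub>}"
  have T: "finite ?T" using component(2) x by simp
  have sub: "{i. component M (a \<odot>\<^bsub>M\<^esub> x) i \<noteq> \<zero>\<^bsub>M\<^esub>} \<subseteq> ?T"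
    using a x by (auto simp: component_smult)
  have "sgn_map R M e (a \<odot>\<^bsub>M\<^esub> x) = (\<Oplus>\<^bsub>M\<^esub>i\<in>?T. a \<odot>\<^bsub>M\<^esub> (koszul_sign R (e * i) \<odot>\<^bsub>M\<^esub> component M x i))"
    by (subst sgn_map_sum[OF _ T sub])
      (use a x in \<open>auto simp: component_smult component_closed smult_assoc1[symmetric] m_comm intro!: finsum_cong'\<close>)
  also have "\<dots> = a \<odot>\<^bsub>M\<^esub> sgn_map R M e x"
    unfolding sgn_map_def
    by (rule finsum_smult_ldistr[symmetric]) (use a x T component_closed in auto)
  finally show "sgn_map R M e (a \<odot>\<^bsub>M\<^esub> x) = a \<odot>\<^bsub>M\<^esub> sgn_map R M e x" .
qed

lemma sgn_map_closed: "x \<in> carrier M \<Longrightarrow> sgn_map R M e x \<in> carrier M"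
  by (rule linear_maps_closed[OF sgn_map_linear])

lemma sgn_map_homogeneous:
  assumes "x \<in> grade M d"
  shows "sgn_map R M e x = koszul_sign R (e * d) \<odot>\<^bsub>M\<^esub> x"
proof -
  have "sgn_map R M e x = (\<Oplus>\<^bsub>M\<^esub>i\<in>{d}. koszul_sign R (e * i) \<odot>\<^bsub>M\<^esub> component M x i)"
    by (rule sgn_map_sum) (use assms grade_closed in \<open>auto simp: component_homogeneous\<close>)
  then show ?thesis
    using grade_closed[OF assms] by (simp add: finsum_insert component_homogeneous[OF assms])
qed

lemma sgn_map_grade: "x \<in> grade M d \<Longrightarrow> sgn_map R M e x \<in> grade M d"
  by (simp add: sgn_map_homogeneous grade_smult)

lemma linear_maps_eq_on_grades:
  assumes "module R P" "f \<in> linear_maps R M P" "g \<in> linear_maps R M P"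
    and "\<And>i x. x \<in> grade M i \<Longrightarrow> f x = g x" "x \<in> carrier M"
  shows "f x = g x"
  by (rule linear_maps_eq_on_span[OF module_axioms assms(1-3) grade_Union_subset])
    (use assms(4,5) grade_span in auto)

lemma sgn_map_sgn_map: "x \<in> carrier M \<Longrightarrow> sgn_map R M e (sgn_map R M e x) = x"
proof (rule linear_maps_eq_on_grades[OF module_axioms
      linear_maps_comp[OF sgn_map_linear sgn_map_linear] linear_maps_id])
  fix i x assume x: "x \<in> grade M i"
  then have "sgn_map R M e (sgn_map R M e x) =
      koszul_sign R (e * i) \<odot>\<^bsub>M\<^esub> (koszul_sign R (e * i) \<odot>\<^bsub>M\<^esub> x)"
    using sgn_map_homogeneous[OF sgn_map_grade[OF x]] sgn_map_homogeneous[OF x] by simp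
  also have "\<dots> = x"
    using grade_closed[OF x] by (simp add: smult_assoc1[symmetric] koszul_sign_add) (simp add: koszul_sign_def)
  finally show "sgn_map R M e (sgn_map R M e x) = x" .
qed

lemma sgn_map_even: "even e \<Longrightarrow> x \<in> carrier M \<Longrightarrow> sgn_map R M e x = x"
  by (rule linear_maps_eq_on_grades[OF module_axioms sgn_map_linear linear_maps_id])
    (use grade_closed in \<open>auto simp: sgn_map_homogeneous koszul_sign_def\<close>)

end

lemma (in abelian_group) minus_eq_zero_iff:
  "\<lbrakk>x \<in> carrier G; y \<in> carrier G\<rbrakk> \<Longrightarrow> x \<ominus> y = \<zero> \<longleftrightarrow> x = y"
  by (simp add: a_minus_def add.inv_solve_right')

text \<open>Existence of decompositions is checked on homogeneous elements only, because
  decomposable elements form a submodule. Uniqueness is reduced to the decompositions of zero by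
  subtracting two decompositions of the same element.\<close>

lemma graded_moduleI:
  assumes M: "module R M" and sub: "\<And>i. submodule (grade M i) R M"
    and span: "\<And>x. x \<in> carrier M \<Longrightarrow> x \<in> submodule_span R M (\<Union>i. grade M i)"
    and indep: "\<And>c i. \<lbrakk>\<And>i. c i \<in> grade M i; finite {i. c i \<noteq> \<zero>\<^bsub>M\<^esub>};
        (\<Oplus>\<^bsub>M\<^esub>i\<in>{i. c i \<noteq> \<zero>\<^bsub>M\<^esub>}. c i) = \<zero>\<^bsub>M\<^esub>\<rbrakk> \<Longrightarrow> c i = \<zero>\<^bsub>M\<^esub>"
  shows "graded_module R M"
proof -
  interpret module R M by (rule M)
  have gc: "y \<in> carrier M" if "y \<in> grade M i" for y i
    using that submoduleE(1)[OF sub] by auto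
  have US: "(\<Union>i. grade M i) \<subseteq> carrier M" using gc by auto
  have gz: "\<zero>\<^bsub>M\<^esub> \<in> grade M i" for i by (rule submodule_zero[OF sub])
  have ext: "(\<Oplus>\<^bsub>M\<^esub>i\<in>{i. c i \<noteq> \<zero>\<^bsub>M\<^esub>}. c i) = (\<Oplus>\<^bsub>M\<^esub>i\<in>T. c i)"
    if "\<And>i. c i \<in> grade M i" "finite T" "{i. c i \<noteq> \<zero>\<^bsub>M\<^esub>} \<subseteq> T" for c T
    by (rule finsum_eq_superset) (use that gc in auto)
  let ?dec = "\<lambda>x c. (\<forall>i. c i \<in> grade M i) \<and> finite {i. c i \<noteq> \<zero>\<^bsub>M\<^esub>} \<and>
          x = (\<Oplus>\<^bsub>M\<^esub>i\<in>{i. c i \<noteq> \<zero>\<^bsub>M\<^esub>}. c i)"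
  have ex: "\<exists>c. ?dec x c" if "x \<in> submodule_span R M (\<Union>i. grade M i)" for x
    using that US
  proof (induction rule: submodule_span_induct)
    case zero
    show ?case by (rule exI[of _ "\<lambda>i. \<zero>\<^bsub>M\<^esub>"]) (simp add: gz)
  next
    case (base s)
    then obtain d where d: "s \<in> grade M d" by auto
    let ?c = "\<lambda>i. if i = d then s else \<zero>\<^bsub>M\<^esub>"
    have "(\<Oplus>\<^bsub>M\<^esub>i\<in>{i. ?c i \<noteq> \<zero>\<^bsub>M\<^esub>}. ?c i) = (\<Oplus>\<^bsub>M\<^esub>i\<in>{d}. ?c i)"
      by (rule ext) (use d gz in auto)
    then show ?case
      using d gz gc by (intro exI[of _ ?c]) (auto simp: finsum_insert)
  next
    case (add x y)
    then obtain c c' where c: "?dec x c" "?dec y c'" by blast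
    let ?T = "{i. c i \<noteq> \<zero>\<^bsub>M\<^esub>} \<union> {i. c' i \<noteq> \<zero>\<^bsub>M\<^esub>}"
    have T: "finite ?T" using c by simp
    let ?c = "\<lambda>i. c i \<oplus>\<^bsub>M\<^esub> c' i"
    have c'': "\<And>i. ?c i \<in> grade M i" using c submoduleE(5)[OF sub] by simp
    have s: "{i. ?c i \<noteq> \<zero>\<^bsub>M\<^esub>} \<subseteq> ?T" by auto
    have "x = (\<Oplus>\<^bsub>M\<^esub>i\<in>?T. c i)" "y = (\<Oplus>\<^bsub>M\<^esub>i\<in>?T. c' i)"
      using c ext[of c ?T] ext[of c' ?T] T by auto
    then have "x \<oplus>\<^bsub>M\<^esub> y = (\<Oplus>\<^bsub>M\<^esub>i\<in>?T. ?c i)"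
      using c gc by (subst finsum_addf) auto
    also have "\<dots> = (\<Oplus>\<^bsub>M\<^esub>i\<in>{i. ?c i \<noteq> \<zero>\<^bsub>M\<^esub>}. ?c i)"
      by (rule ext[OF c'' T s, symmetric])
    finally show ?case
      using c'' finite_subset[OF s T] by (intro exI[of _ ?c]) simp
  next
    case (smult a x)
    then obtain c where c: "?dec x c" by blast
    let ?T = "{i. c i \<noteq> \<zero>\<^bsub>M\<^esub>}"
    have T: "finite ?T" using c by simp
    let ?c = "\<lambda>i. a \<odot>\<^bsub>M\<^esub> c i"
    have c'': "\<And>i. ?c i \<in> grade M i" using c smult submoduleE(4)[OF sub] by simp
    have s: "{i. ?c i \<noteq> \<zero>\<^bsub>M\<^esub>} \<subseteq> ?T" using smult by auto
    have "a \<odot>\<^bsub>M\<^esub> x = a \<odot>\<^bsub>M\<^esub> (\<Oplus>\<^bsub>M\<^esub>i\<in>?T. c i)" using c by simp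
    also have "\<dots> = (\<Oplus>\<^bsub>M\<^esub>i\<in>?T. ?c i)"
      by (rule finsum_smult_ldistr) (use T smult c gc in auto)
    also have "\<dots> = (\<Oplus>\<^bsub>M\<^esub>i\<in>{i. ?c i \<noteq> \<zero>\<^bsub>M\<^esub>}. ?c i)"
      by (rule ext[OF c'' T s, symmetric])
    finally show ?case
      using c'' finite_subset[OF s T] by (intro exI[of _ ?c]) simp
  qed
  have uniq: "c = c'" if c: "?dec x c" "?dec x c'" for x c c'
  proof
    fix i
    let ?T = "{i. c i \<noteq> \<zero>\<^bsub>M\<^esub>} \<union> {i. c' i \<noteq> \<zero>\<^bsub>M\<^esub>}"
    have T: "finite ?T" using c by simp
    let ?c = "\<lambda>i. c i \<ominus>\<^bsub>M\<^esub> c' i"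
    have cl: "c i \<in> carrier M" "c' i \<in> carrier M" for i using c gc by auto
    have c'': "\<And>i. ?c i \<in> grade M i"
      unfolding a_minus_def using c submoduleE(5,6)[OF sub] by simp
    have s: "{i. ?c i \<noteq> \<zero>\<^bsub>M\<^esub>} \<subseteq> ?T" by (auto simp: a_minus_def)
    have "x = (\<Oplus>\<^bsub>M\<^esub>i\<in>?T. c i)" "x = (\<Oplus>\<^bsub>M\<^esub>i\<in>?T. c' i)"
      using c ext[of c ?T] ext[of c' ?T] T by auto
    then have "(\<Oplus>\<^bsub>M\<^esub>i\<in>?T. ?c i) = x \<ominus>\<^bsub>M\<^esub> x"
      using cl by (subst finsum_minus) auto
    moreover have xM: "x \<in> carrier M"
      using c gc by (auto intro!: finsum_closed)
    then have "x \<ominus>\<^bsub>M\<^esub> x = \<zero>\<^bsub>M\<^esub>" by (simp add: r_neg M.minus_eq)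
    ultimately have "(\<Oplus>\<^bsub>M\<^esub>i\<in>{i. ?c i \<noteq> \<zero>\<^bsub>M\<^esub>}. ?c i) = \<zero>\<^bsub>M\<^esub>"
      using ext[OF c'' T s] by (simp only:)
    from indep[of ?c i, OF c'' finite_subset[OF s T] this]
    show "c i = c' i"
      using cl by (simp add: M.minus_eq_zero_iff)
  qed
  show ?thesis
  proof (intro graded_module.intro[OF M] graded_module_axioms.intro sub)
    fix x assume x: "x \<in> carrier M"
    show "\<exists>!c. ?dec x c"
      by (rule ex_ex1I[OF ex[OF span[OF x]]]) (rule uniq)
  qed
qed

section \<open>Words over a generating set\<close>

lemma linear_maps_span_into:
  assumes M: "module R M" "module R N" and f: "f \<in> linear_maps R M N" and S: "S \<subseteq> carrier M"
    and H: "submodule H R N" and fS: "\<And>s. s \<in> S \<Longrightarrow> f s \<in> H" and x: "x \<in> submodule_span R M S"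
  shows "f x \<in> H"
proof -
  interpret two_modules R M N using M by (rule two_modulesI)
  have "x \<in> carrier M \<and> f x \<in> H"
    using x S
  proof (induction rule: M.submodule_span_induct)
    case zero
    then show ?case using linear_maps_0[OF f] N.submodule_zero[OF H] by simp
  next
    case (base s)
    then show ?case using S fS by auto
  next
    case (add x y)
    then show ?case by (simp add: linear_maps_add[OF f] N.submoduleE(5)[OF H])
  next
    case (smult a x)
    then show ?case by (simp add: linear_maps_smult[OF f] N.submoduleE(4)[OF H])
  qed
  then show ?thesis by simp
qed

text \<open>Letters are replaced by generators one at a time, from the right: in
  \<open>us @ vs\<close> the part \<open>vs\<close> already consists of generators, and linearity in
  the last slot of \<open>us\<close> moves the boundary one step to the left.\<close>

lemma tensor_power_span_gens:
  assumes V: "module R V" and S: "S \<subseteq> carrier V" "submodule_span R V S = carrier V"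
  shows "submodule_span R (tensor_power R V n) (word_tensor R V ` {xs. length xs = n \<and> set xs \<subseteq> S}) =
    carrier (tensor_power R V n)"
proof
  interpret V: module R V by (rule V)
  interpret T: module R "tensor_power R V n" by (rule tensor_power_module[OF V])
  let ?W = "word_tensor R V ` {xs. length xs = n \<and> set xs \<subseteq> S}"
  let ?H = "submodule_span R (tensor_power R V n) ?W"
  have W: "?W \<subseteq> carrier (tensor_power R V n)"
    using S(1) by (auto intro!: word_tensor_closed[OF V] simp: words_iff)
  note H = T.submodule_span_submodule[OF W]
  show "?H \<subseteq> carrier (tensor_power R V n)"
    by (rule T.submodule_span_carrier[OF W])
  have "word_tensor R V (us @ vs) \<in> ?H"
    if "set us \<subseteq> carrier V" "set vs \<subseteq> S" "length us + length vs = n" for us vs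
    using that
  proof (induction us arbitrary: vs rule: rev_induct)
    case Nil
    then show ?case by (intro subsetD[OF T.submodule_span_superset] imageI) simp
  next
    case (snoc x us)
    have "word_tensor R V (us @ x # vs) \<in> ?H"
    proof (rule linear_maps_span_into[OF V T.module_axioms _ S(1) H])
      show "(\<lambda>x. word_tensor R V (us @ x # vs)) \<in> linear_maps R V (tensor_power R V n)"
        by (rule word_tensor_linear[OF V]) (use snoc.prems S(1) in auto)
      show "word_tensor R V (us @ s # vs) \<in> ?H" if "s \<in> S" for s
        using snoc.IH[of "s # vs"] snoc.prems that by simp
      show "x \<in> submodule_span R V S" using snoc.prems S(2) by simp
    qed
    then show ?case by simp
  qed
  from this[of _ "[]"] have "word_tensor R V ` words V n \<subseteq> ?H"
    by (auto simp: words_iff)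
  then show "carrier (tensor_power R V n) \<subseteq> ?H"
    unfolding tensor_power_span[OF V, symmetric] by (rule T.submodule_span_minimal[OF H])
qed

lemma tensor_power_linear_eqI:
  assumes V: "module R V" and S: "S \<subseteq> carrier V" "submodule_span R V S = carrier V"
    and P: "module R P" "f \<in> linear_maps R (tensor_power R V n) P" "g \<in> linear_maps R (tensor_power R V n) P"
    and eq: "\<And>xs. \<lbrakk>length xs = n; set xs \<subseteq> S\<rbrakk> \<Longrightarrow> f (word_tensor R V xs) = g (word_tensor R V xs)"
    and x: "x \<in> carrier (tensor_power R V n)"
  shows "f x = g x"
proof (rule linear_maps_eq_on_span[OF tensor_power_module[OF V] P])
  show "word_tensor R V ` {xs. length xs = n \<and> set xs \<subseteq> S} \<subseteq> carrier (tensor_power R V n)"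
    using S(1) by (auto intro!: word_tensor_closed[OF V] simp: words_iff)
  show "x \<in> submodule_span R (tensor_power R V n) (word_tensor R V ` {xs. length xs = n \<and> set xs \<subseteq> S})"
    using x by (simp add: tensor_power_span_gens[OF V S])
qed (use eq in auto)

lemma tensor_power_linear_eqI_words:
  assumes V: "module R V"
    and P: "module R P" "f \<in> linear_maps R (tensor_power R V n) P" "g \<in> linear_maps R (tensor_power R V n) P"
    and eq: "\<And>xs. xs \<in> words V n \<Longrightarrow> f (word_tensor R V xs) = g (word_tensor R V xs)"
    and x: "x \<in> carrier (tensor_power R V n)"
  shows "f x = g x"
  by (rule linear_maps_eq_on_span[OF tensor_power_module[OF V] P, of "word_tensor R V ` words V n"])
    (use eq x word_tensor_closed[OF V] in \<open>auto simp: tensor_power_span[OF V]\<close>)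

text \<open>The tensor product of n linear maps, one for each slot. Different maps in different
  slots are needed for the projections onto multidegrees.\<close>

lemma multilinear_map2:
  assumes V: "module R V" and W: "module R W"
    and fs: "length fs = n" "\<And>f. f \<in> set fs \<Longrightarrow> f \<in> linear_maps R V W"
  shows "multilinear R V (tensor_power R W n) n (\<lambda>xs. word_tensor R W (map2 (\<lambda>f x. f x) fs xs))"
  unfolding multilinear_def
proof (intro conjI ballI allI impI)
  have cl: "set (map2 (\<lambda>f x. f x) fs xs) \<subseteq> carrier W"
    if "set xs \<subseteq> carrier V" "set fs \<subseteq> linear_maps R V W" for fs xs
  proof
    fix y assume "y \<in> set (map2 (\<lambda>f x. f x) fs xs)"
    then obtain f x where y: "y = f x" "(f, x) \<in> set (zip fs xs)" by auto
    then have "f \<in> linear_maps R V W" "x \<in> carrier V"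
      using that set_zip_leftD[OF y(2)] set_zip_rightD[OF y(2)] by auto
    then show "y \<in> carrier W" using y(1) linear_maps_closed by metis
  qed
  show "word_tensor R W (map2 (\<lambda>f x. f x) fs xs) \<in> carrier (tensor_power R W n)" if "xs \<in> words V n" for xs
    by (rule word_tensor_closed[OF W]) (use that fs cl[of xs fs] in \<open>simp add: words_iff subset_iff\<close>)
  fix us vs assume us: "set us \<subseteq> carrier V" "set vs \<subseteq> carrier V" "Suc (length us + length vs) = n"
  define k where "k = length us"
  have dec: "fs = take k fs @ fs ! k # drop (Suc k) fs"
    using us fs(1) by (simp add: k_def id_take_nth_drop)
  have fk: "fs ! k \<in> linear_maps R V W"
    using us fs by (simp add: k_def)
  have eq: "map2 (\<lambda>f x. f x) fs (us @ x # vs) =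
      map2 (\<lambda>f x. f x) (take k fs) us @ (fs ! k) x # map2 (\<lambda>f x. f x) (drop (Suc k) fs) vs" for x
    by (subst dec) (use us fs(1) in \<open>simp add: k_def\<close>)
  have sub: "set (take k fs) \<subseteq> linear_maps R V W" "set (drop (Suc k) fs) \<subseteq> linear_maps R V W"
    using fs(2) by (auto dest: in_set_takeD in_set_dropD)
  show "(\<lambda>x. word_tensor R W (map2 (\<lambda>f x. f x) fs (us @ x # vs))) \<in> linear_maps R V (tensor_power R W n)"
    unfolding eq
    by (rule linear_maps_comp[OF fk word_tensor_linear[OF W cl[OF us(1) sub(1)] cl[OF us(2) sub(2)]]])
      (use us fs(1) in \<open>simp add: k_def\<close>)
qed

section \<open>Gradings of tensor powers\<close>

lemma word_tensor_zero:
  assumes V: "module R V" and us: "set us \<subseteq> carrier V" "set vs \<subseteq> carrier V" "n = Suc (length us + length vs)"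
  shows "word_tensor R V (us @ \<zero>\<^bsub>V\<^esub> # vs) = \<zero>\<^bsub>tensor_power R V n\<^esub>"
proof -
  interpret two_modules R V "tensor_power R V n"
    by (intro two_modulesI V tensor_power_module)
  show ?thesis by (rule linear_maps_0[OF word_tensor_linear[OF V us]])
qed

lemma homogeneous_word_Cons:
  "homogeneous_word V (x # xs) ds \<longleftrightarrow> (\<exists>d ds'. ds = d # ds' \<and> x \<in> grade V d \<and> homogeneous_word V xs ds')"
  by (auto simp: homogeneous_word_def list_all2_Cons1)

lemma homogeneous_word_length: "homogeneous_word V xs ds \<Longrightarrow> length ds = length xs"
  by (simp add: homogeneous_word_def list_all2_lengthD)

lemma homogeneous_word_nth: "\<lbrakk>homogeneous_word V xs ds; i < length xs\<rbrakk> \<Longrightarrow> xs ! i \<in> grade V (ds ! i)"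
  by (simp add: homogeneous_word_def list_all2_conv_all_nth)

lemma homogeneous_word_take: "homogeneous_word V xs ds \<Longrightarrow> homogeneous_word V (take n xs) (take n ds)"
  and homogeneous_word_drop: "homogeneous_word V xs ds \<Longrightarrow> homogeneous_word V (drop n xs) (drop n ds)"
  and homogeneous_word_append: "\<lbrakk>homogeneous_word V xs ds; homogeneous_word V ys es\<rbrakk>
      \<Longrightarrow> homogeneous_word V (xs @ ys) (ds @ es)"
  by (auto simp: homogeneous_word_def intro: list_all2_appendI)

context graded_module
begin

lemma homogeneous_word_closed: "homogeneous_word M xs ds \<Longrightarrow> set xs \<subseteq> carrier M"
  using grade_closed by (fastforce simp: homogeneous_word_def list_all2_conv_all_nth in_set_conv_nth)

lemma homogeneous_word_exists:
  assumes "set xs \<subseteq> (\<Union>i. grade M i)"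
  shows "\<exists>ds. homogeneous_word M xs ds"
  using assms
proof (induction xs)
  case (Cons x xs)
  then show ?case by (auto simp: homogeneous_word_Cons)
qed (auto simp: homogeneous_word_def intro: exI[of _ "[]"])

text \<open>The bridge between twisted letters and Koszul signs: the scalars pulled out of the
  letters multiply to the sign of the total degree. The prefix \<open>ps\<close> serves the
  induction, since letters already treated are moved there.\<close>

lemma word_tensor_map_sgn:
  assumes W: "module R W" and incl: "(\<lambda>x. x) \<in> linear_maps R M W"
    and us: "homogeneous_word M us ds" and ps: "set ps \<subseteq> carrier W" and vs: "set vs \<subseteq> carrier W"
    and n: "n = length ps + length us + length vs"
  shows "word_tensor R W (ps @ map (sgn_map R M e) us @ vs) =
    koszul_sign R (e * sum_list ds) \<odot>\<^bsub>tensor_power R W n\<^esub> word_tensor R W (ps @ us @ vs)"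
  using us ps n
proof (induction us arbitrary: ps ds)
  case Nil
  interpret T: module R "tensor_power R W n" by (rule tensor_power_module[OF W])
  have "word_tensor R W (ps @ vs) \<in> carrier (tensor_power R W n)"
    by (rule word_tensor_closed[OF W]) (use Nil vs in \<open>simp add: words_iff\<close>)
  from T.smult_one[OF this] show ?case
    using Nil(1) by (simp add: homogeneous_word_def koszul_sign_def)
next
  case (Cons x us)
  interpret T: module R "tensor_power R W n" by (rule tensor_power_module[OF W])
  obtain d ds' where ds: "ds = d # ds'" "x \<in> grade M d" "homogeneous_word M us ds'"
    using Cons.prems(1) by (auto simp: homogeneous_word_Cons)
  have inW: "y \<in> carrier W" if "y \<in> carrier M" for y
    using linear_maps_closed[OF incl that] .
  have usW: "set us \<subseteq> carrier W"
    using homogeneous_word_closed[OF ds(3)] inW by auto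
  have xW: "x \<in> carrier W" "x \<in> carrier M" using ds(2) grade_closed inW by auto
  have sx: "sgn_map R M e x = koszul_sign R (e * d) \<odot>\<^bsub>W\<^esub> x"
    using sgn_map_homogeneous[OF ds(2)] linear_maps_smult[OF incl, of "koszul_sign R (e * d)" x] xW by simp
  have w: "word_tensor R W (ps @ x # us @ vs) \<in> carrier (tensor_power R W n)"
    by (rule word_tensor_closed[OF W]) (use Cons.prems usW xW vs in \<open>simp add: words_iff\<close>)
  have "word_tensor R W (ps @ map (sgn_map R M e) (x # us) @ vs) =
      word_tensor R W ((ps @ [sgn_map R M e x]) @ map (sgn_map R M e) us @ vs)"
    by simp
  also have "\<dots> = koszul_sign R (e * sum_list ds') \<odot>\<^bsub>tensor_power R W n\<^esub>
      word_tensor R W ((ps @ [sgn_map R M e x]) @ us @ vs)"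
    by (rule Cons.IH[OF ds(3)]) (use Cons.prems xW inW sgn_map_closed in auto)
  also have "word_tensor R W ((ps @ [sgn_map R M e x]) @ us @ vs) =
      koszul_sign R (e * d) \<odot>\<^bsub>tensor_power R W n\<^esub> word_tensor R W (ps @ x # us @ vs)"
    using linear_maps_smult[OF word_tensor_linear[OF W, of ps "us @ vs" n], of "koszul_sign R (e * d)" x]
      Cons.prems usW vs xW by (simp add: sx)
  finally show ?case
    using w by (simp add: T.smult_assoc1[symmetric] koszul_sign_add ds(1) algebra_simps)
qed

end

text \<open>Independence of the grades is the difficult half, since a degree cannot be read off from
  a class in a quotient. Letterwise projection onto a list of degrees is multilinear and hence
  descends to the tensor power; summing these projections over the lists with a given total recovers
  a homogeneous component.\<close>

lemma tensor_power_graded: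
  assumes "graded_module R V"
  shows "graded_module R (tensor_power R V n)"
proof -
  interpret V: graded_module R V by fact
  note Vm = V.module_axioms
  let ?T = "tensor_power R V n"
  interpret T: module R ?T by (rule tensor_power_module[OF Vm])
  let ?S = "\<lambda>m. {word_tensor R V xs | xs. length xs = n \<and> (\<exists>ds. homogeneous_word V xs ds \<and> sum_list ds = m)}"
  have S: "?S m \<subseteq> carrier ?T" for m
    using V.homogeneous_word_closed by (auto intro!: word_tensor_closed[OF Vm] simp: words_iff)
  have sub: "submodule (grade ?T m) R ?T" for m
    unfolding tensor_power_grade[OF Vm] by (rule T.submodule_span_submodule[OF S])
  have gc: "c \<in> carrier ?T" if "c \<in> grade ?T m" for c m
    using that T.submoduleE(1)[OF sub] by auto
  define comp where "comp ds xs = map2 (\<lambda>f x. f x) (map (\<lambda>d x. component V x d) ds) xs" for ds xs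
  have "\<exists>G\<in>linear_maps R ?T ?T. \<forall>xs\<in>words V n. G (word_tensor R V xs) = word_tensor R V (comp ds xs)"
    if "length ds = n" for ds
    unfolding comp_def
    by (rule tensor_power_lift[OF Vm T.module_axioms multilinear_map2[OF Vm Vm]])
      (use that V.component_linear in auto)
  then obtain P where P: "\<And>ds. length ds = n \<Longrightarrow> P ds \<in> linear_maps R ?T ?T"
    "\<And>ds xs. \<lbrakk>length ds = n; xs \<in> words V n\<rbrakk> \<Longrightarrow> P ds (word_tensor R V xs) = word_tensor R V (comp ds xs)"
    by metis
  have P_hom: "P ds (word_tensor R V xs) = (if ds = es then word_tensor R V xs else \<zero>\<^bsub>?T\<^esub>)"
    if lds: "length ds = n" and lxs: "length xs = n" and hom: "homogeneous_word V xs es" for ds xs es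
  proof -
    note that = lds lxs hom
    have len: "length es = n" using homogeneous_word_length[OF that(3)] that by simp
    have cs: "comp ds xs = map2 (\<lambda>d x. component V x d) ds xs"
      by (simp add: comp_def zip_map1 split_def)
    have nth: "comp ds xs ! k = (if ds ! k = es ! k then xs ! k else \<zero>\<^bsub>V\<^esub>)" if "k < n" for k
      using that \<open>length ds = n\<close> \<open>length xs = n\<close>
      by (simp add: cs V.component_homogeneous[OF homogeneous_word_nth[OF \<open>homogeneous_word V xs es\<close>]])
    have lc: "length (comp ds xs) = n" using that by (simp add: cs)
    have xw: "xs \<in> words V n" using that V.homogeneous_word_closed by (auto simp: words_iff)
    show ?thesis
    proof (cases "ds = es")
      case True
      then have "comp ds xs = xs"
        by (intro nth_equalityI) (use lc nth that in auto)
      then show ?thesis using True P(2) xw that by simp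
    next
      case False
      then obtain k where k: "k < n" "ds ! k \<noteq> es ! k"
        using lds len by (metis nth_equalityI)
      have clc: "set (comp ds xs) \<subseteq> carrier V"
        using nth lc xw that by (auto simp: in_set_conv_nth words_iff subset_iff)
      \<comment> \<open>Where the two lists of degrees disagree, the projected letter is zero, and
        then so is the whole tensor.\<close>
      have "comp ds xs = take k (comp ds xs) @ \<zero>\<^bsub>V\<^esub> # drop (Suc k) (comp ds xs)"
        using id_take_nth_drop[of k "comp ds xs"] k lc nth by simp
      moreover have "word_tensor R V (take k (comp ds xs) @ \<zero>\<^bsub>V\<^esub> # drop (Suc k) (comp ds xs)) = \<zero>\<^bsub>?T\<^esub>"
        by (rule word_tensor_zero[OF Vm]) (use clc k lc in \<open>auto dest: in_set_takeD in_set_dropD\<close>)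
      ultimately show ?thesis using False P(2)[OF that(1) xw] by simp
    qed
  qed
  \<comment> \<open>Infinitely many lists of degrees may have the same total. Restricting the
    entries to a finite set \<open>D\<close> makes the sum over them finite.\<close>
  define I where "I m D = {ds :: int list. set ds \<subseteq> D \<and> length ds = n \<and> sum_list ds = m}" for m D
  have finI: "finite (I m D)" if "finite D" for m D
    by (rule finite_subset[OF _ finite_lists_length_eq[OF that, of n]]) (auto simp: I_def)
  define E where "E m D x = (\<Oplus>\<^bsub>?T\<^esub>ds\<in>I m D. P ds x)" for m D x
  interpret TT: two_modules R ?T ?T by (intro two_modulesI T.module_axioms)
  have E: "E m D \<in> linear_maps R ?T ?T" for m D
    unfolding E_def by (rule TT.linear_maps_sum) (use P(1) in \<open>auto simp: I_def\<close>)
  \<comment> \<open>Once \<open>D\<close> is large enough, \<open>E m' D\<close> acts on an element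
    of degree \<open>m\<close> as the projection to degree \<open>m'\<close>. For a single word the
    degrees of its letters are enough; for a sum the two sets are united.\<close>
  have E_grade: "\<exists>D0. finite D0 \<and> (\<forall>D m'. finite D \<longrightarrow> D0 \<subseteq> D \<longrightarrow> E m' D c = (if m' = m then c else \<zero>\<^bsub>?T\<^esub>))"
    if "c \<in> grade ?T m" for c m
  proof -
    let ?Q = "\<lambda>c D0. finite D0 \<and> (\<forall>D m'. finite D \<longrightarrow> D0 \<subseteq> D \<longrightarrow> E m' D c = (if m' = m then c else \<zero>\<^bsub>?T\<^esub>))"
    have "c \<in> submodule_span R ?T (?S m)" using that by (simp add: tensor_power_grade[OF Vm])
    then show ?thesis using S
    proof (induction rule: T.submodule_span_induct)
      case zero
      show ?case by (rule exI[of _ "{}"]) (simp add: TT.linear_maps_0[OF E])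
    next
      case (base s)
      then obtain xs es where xs: "s = word_tensor R V xs" "length xs = n" "homogeneous_word V xs es"
        "sum_list es = m" by auto
      have len: "length es = n" using homogeneous_word_length[OF xs(3)] xs by simp
      have sc: "s \<in> carrier ?T" using base S by auto
      have "E m' D s = (if m' = m then s else \<zero>\<^bsub>?T\<^esub>)" if D: "finite D" "set es \<subseteq> D" for m' D
      proof -
        have "E m' D s = (\<Oplus>\<^bsub>?T\<^esub>ds\<in>I m' D. if ds = es then s else \<zero>\<^bsub>?T\<^esub>)"
          unfolding E_def xs(1)
          by (rule T.finsum_cong') (use P_hom xs sc in \<open>auto simp: I_def\<close>)
        also have "\<dots> = (if m' = m then s else \<zero>\<^bsub>?T\<^esub>)"
        proof (cases "m' = m")
          case True
          then have "es \<in> I m' D" using D len xs by (simp add: I_def)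
          then show ?thesis
            using True sc by (subst T.finsum_single[OF finI[OF D(1)], of es]) auto
        next
          case False
          then have "es \<notin> I m' D" using xs by (simp add: I_def)
          then have "(\<Oplus>\<^bsub>?T\<^esub>ds\<in>I m' D. if ds = es then s else \<zero>\<^bsub>?T\<^esub>) = (\<Oplus>\<^bsub>?T\<^esub>ds\<in>I m' D. \<zero>\<^bsub>?T\<^esub>)"
            by (intro T.finsum_cong') auto
          then show ?thesis using False by simp
        qed
        finally show ?thesis .
      qed
      then show ?case by (intro exI[of _ "set es"]) simp
    next
      case (add x y)
      from add(3) obtain D1 where D1: "?Q x D1" ..
      from add(4) obtain D2 where D2: "?Q y D2" ..
      have xy: "x \<in> carrier ?T" "y \<in> carrier ?T" using add T.submodule_span_carrier[OF S] by auto
      have "E m' D (x \<oplus>\<^bsub>?T\<^esub> y) = (if m' = m then x \<oplus>\<^bsub>?T\<^esub> y else \<zero>\<^bsub>?T\<^esub>)"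
        if "finite D" "D1 \<union> D2 \<subseteq> D" for D m'
        using D1 D2 that xy by (simp add: linear_maps_add[OF E])
      then show ?case using D1 D2 by (intro exI[of _ "D1 \<union> D2"]) simp
    next
      case (smult a x)
      from smult(3) obtain D1 where D1: "?Q x D1" ..
      have x: "x \<in> carrier ?T" using smult T.submodule_span_carrier[OF S] by auto
      have "E m' D (a \<odot>\<^bsub>?T\<^esub> x) = (if m' = m then a \<odot>\<^bsub>?T\<^esub> x else \<zero>\<^bsub>?T\<^esub>)"
        if "finite D" "D1 \<subseteq> D" for D m'
        using D1 that x smult(1) by (simp add: linear_maps_smult[OF E])
      then show ?case using D1 by (intro exI[of _ D1]) simp
    qed
  qed
  show ?thesis
  proof (rule graded_moduleI[OF T.module_axioms sub])
    fix x assume x: "x \<in> carrier ?T"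
    have "word_tensor R V ` {xs. length xs = n \<and> set xs \<subseteq> (\<Union>i. grade V i)} \<subseteq>
        submodule_span R ?T (\<Union>m. grade ?T m)"
    proof
      fix s assume "s \<in> word_tensor R V ` {xs. length xs = n \<and> set xs \<subseteq> (\<Union>i. grade V i)}"
      then obtain xs where xs: "s = word_tensor R V xs" "length xs = n" "set xs \<subseteq> (\<Union>i. grade V i)" by auto
      then obtain ds where ds: "homogeneous_word V xs ds" using V.homogeneous_word_exists by blast
      have "s \<in> grade ?T (sum_list ds)"
        unfolding tensor_power_grade[OF Vm]
        by (rule subsetD[OF T.submodule_span_superset]) (use xs ds in auto)
      then show "s \<in> submodule_span R ?T (\<Union>m. grade ?T m)"
        by (intro subsetD[OF T.submodule_span_superset]) auto
    qed
    then have "submodule_span R ?T (word_tensor R V ` {xs. length xs = n \<and> set xs \<subseteq> (\<Union>i. grade V i)}) \<subseteq>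
        submodule_span R ?T (\<Union>m. grade ?T m)"
      by (intro T.submodule_span_minimal T.submodule_span_submodule) (use gc in auto)
    then show "x \<in> submodule_span R ?T (\<Union>m. grade ?T m)"
      using x by (auto simp: tensor_power_span_gens[OF Vm V.grade_Union_subset V.grade_span])
  next
    fix c i
    assume c: "\<And>i. c i \<in> grade ?T i" and fin: "finite {i. c i \<noteq> \<zero>\<^bsub>?T\<^esub>}"
      and sum: "(\<Oplus>\<^bsub>?T\<^esub>i\<in>{i. c i \<noteq> \<zero>\<^bsub>?T\<^esub>}. c i) = \<zero>\<^bsub>?T\<^esub>"
    let ?I = "{i. c i \<noteq> \<zero>\<^bsub>?T\<^esub>}"
    obtain D0 where D0: "\<And>m. finite (D0 m)"
      "\<And>m D m'. \<lbrakk>finite D; D0 m \<subseteq> D\<rbrakk> \<Longrightarrow> E m' D (c m) = (if m' = m then c m else \<zero>\<^bsub>?T\<^esub>)"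
      using E_grade[OF c] by metis
    \<comment> \<open>One finite set that is large enough for all the nonzero components at
      once.\<close>
    define D where "D = (\<Union>m\<in>?I. D0 m)"
    have D: "finite D" using fin D0(1) by (simp add: D_def)
    have Dsub: "D0 m \<subseteq> D" if "c m \<noteq> \<zero>\<^bsub>?T\<^esub>" for m using that by (auto simp: D_def)
    show "c i = \<zero>\<^bsub>?T\<^esub>"
    proof (rule ccontr)
      assume ci: "c i \<noteq> \<zero>\<^bsub>?T\<^esub>"
      have "\<zero>\<^bsub>?T\<^esub> = E i D (\<Oplus>\<^bsub>?T\<^esub>m\<in>?I. c m)"
        by (simp add: sum TT.linear_maps_0[OF E])
      also have "\<dots> = (\<Oplus>\<^bsub>?T\<^esub>m\<in>?I. E i D (c m))"
        by (rule TT.linear_maps_finsum[OF E]) (use c gc in auto)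
      also have "\<dots> = E i D (c i)"
        by (rule T.finsum_single[OF fin])
          (use ci c gc D0(2)[OF D Dsub] in auto)
      also have "\<dots> = c i" using D0(2)[OF D Dsub[OF ci]] by simp
      finally show False using ci by simp
    qed
  qed
qed

section \<open>Maps given by their values on tensors\<close>

text \<open>A slot lies to the left of the block, inside it or to the right of it, and linearity
  comes from \<open>s\<close>, from \<open>g\<close> or from the inclusion accordingly.\<close>

lemma multilinear_insert:
  assumes V: "module R V" and W: "module R W" and incl: "(\<lambda>x. x) \<in> linear_maps R V W"
    and s: "s \<in> linear_maps R V W" and g: "g \<in> linear_maps R (tensor_power R V i) W"
  shows "multilinear R V (tensor_power R W (j + 1 + m)) (j + i + m)
    (\<lambda>xs. word_tensor R W (map s (take j xs) @ g (word_tensor R V (take i (drop j xs))) # drop (j + i) xs))"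
    (is "multilinear R V ?P ?n ?\<phi>")
  unfolding multilinear_def
proof (intro conjI ballI allI impI)
  have inW: "set xs \<subseteq> carrier W" if "set xs \<subseteq> carrier V" for xs
    using that linear_maps_closed[OF incl] by auto
  have sW: "set (map s xs) \<subseteq> carrier W" if "set xs \<subseteq> carrier V" for xs
    using that linear_maps_closed[OF s] by auto
  have gW: "g (word_tensor R V xs) \<in> carrier W" if "length xs = i" "set xs \<subseteq> carrier V" for xs
    using that by (intro linear_maps_closed[OF g] word_tensor_closed[OF V]) (simp add: words_iff)
  have tk: "set (take p xs) \<subseteq> carrier V" "set (drop p xs) \<subseteq> carrier V" if "set xs \<subseteq> carrier V" for p xs
    using that by (auto dest: in_set_takeD in_set_dropD)
  show "?\<phi> xs \<in> carrier ?P" if "xs \<in> words V ?n" for xs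
  proof (rule word_tensor_closed[OF W])
    have xs: "length xs = ?n" "set xs \<subseteq> carrier V" using that by (auto simp: words_iff)
    show "map s (take j xs) @ g (word_tensor R V (take i (drop j xs))) # drop (j + i) xs \<in> words W (j + 1 + m)"
      using xs sW[OF tk(1)[OF xs(2)]] inW[OF tk(2)[OF xs(2)]] gW[OF _ tk(1)[OF tk(2)[OF xs(2)]]]
      by (simp add: words_iff)
  qed
  fix us vs
  assume us: "set us \<subseteq> carrier V" and vs: "set vs \<subseteq> carrier V" and n: "Suc (length us + length vs) = ?n"
  consider "length us < j" | "j \<le> length us" "length us < j + i" | "j + i \<le> length us" by linarith
  then show "(\<lambda>x. ?\<phi> (us @ x # vs)) \<in> linear_maps R V ?P"
  proof cases
    case 1
    then obtain p where p: "j = Suc (length us + p)" using less_imp_Suc_add by blast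
    have eq: "?\<phi> (us @ x # vs) = word_tensor R W (map s us @ s x # (map s (take p vs) @
        g (word_tensor R V (take i (drop p vs))) # drop (p + i) vs))" for x
      by (simp add: p add.commute add.left_commute)
    show ?thesis
      unfolding eq
    proof (rule linear_maps_comp[OF s word_tensor_linear[OF W]])
      show "set (map s (take p vs) @ g (word_tensor R V (take i (drop p vs))) # drop (p + i) vs) \<subseteq> carrier W"
        using sW[OF tk(1)[OF vs]] inW[OF tk(2)[OF vs]] gW[OF _ tk(1)[OF tk(2)[OF vs]]] n p by simp
    qed (use sW[OF us] n p in auto)
  next
    case 2
    \<comment> \<open>The number of letters of the block that come after the slot.\<close>
    define q where "q = j + i - Suc (length us)"
    have q: "i - (length us - j) = Suc q" "j + i = Suc (length us + q)"
      using 2 by (auto simp: q_def)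
    have all: "take i (drop j us) = drop j us" using 2 by simp
    have eq: "?\<phi> (us @ x # vs) = word_tensor R W (map s (take j us) @
        g (word_tensor R V (drop j us @ x # take q vs)) # drop q vs)" for x
      using 2 by (simp add: q all)
    have "(\<lambda>x. word_tensor R V (drop j us @ x # take q vs)) \<in> linear_maps R V (tensor_power R V i)"
      by (rule word_tensor_linear[OF V tk(2)[OF us] tk(1)[OF vs]]) (use 2 q n in auto)
    then show ?thesis
      unfolding eq
      by (rule linear_maps_comp[OF linear_maps_comp[OF _ g] word_tensor_linear[OF W]])
        (use sW[OF tk(1)[OF us]] inW[OF tk(2)[OF vs]] 2 n q in auto)
  next
    case 3
    have eq: "?\<phi> (us @ x # vs) = word_tensor R W ((map s (take j us) @
        g (word_tensor R V (take i (drop j us))) # drop (j + i) us) @ x # vs)" for x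
      using 3 by simp
    show ?thesis
      unfolding eq
    proof (rule linear_maps_comp[OF incl word_tensor_linear[OF W]])
      show "set (map s (take j us) @ g (word_tensor R V (take i (drop j us))) # drop (j + i) us) \<subseteq> carrier W"
        using sW[OF tk(1)[OF us]] inW[OF tk(2)[OF us]] gW[OF _ tk(1)[OF tk(2)[OF us]]] 3 by simp
    qed (use inW[OF vs] n 3 in auto)
  qed
qed

lemma homogeneous_words_subset:
  assumes "graded_module R V"
  shows "{word_tensor R V xs | xs. length xs = n \<and> (\<exists>ds. homogeneous_word V xs ds)} \<subseteq>
    carrier (tensor_power R V n)"
proof -
  interpret V: graded_module R V by fact
  show ?thesis
    using V.homogeneous_word_closed
    by (auto intro!: word_tensor_closed[OF V.module_axioms] simp: words_iff)
qed

lemma homogeneous_words_span: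
  assumes "graded_module R V"
  shows "submodule_span R (tensor_power R V n)
      {word_tensor R V xs | xs. length xs = n \<and> (\<exists>ds. homogeneous_word V xs ds)} =
    carrier (tensor_power R V n)"
proof -
  interpret V: graded_module R V by fact
  have "{word_tensor R V xs | xs. length xs = n \<and> (\<exists>ds. homogeneous_word V xs ds)} =
      word_tensor R V ` {xs. length xs = n \<and> set xs \<subseteq> (\<Union>i. grade V i)}"
  proof -
    have "(\<exists>ds. homogeneous_word V xs ds) \<longleftrightarrow> set xs \<subseteq> (\<Union>i. grade V i)" for xs
      using V.homogeneous_word_exists homogeneous_word_nth
      by (fastforce simp: in_set_conv_nth)
    then show ?thesis by auto
  qed
  then show ?thesis
    by (simp add: tensor_power_span_gens[OF V.module_axioms V.grade_Union_subset V.grade_span])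
qed

text \<open>Existence comes from the twisted formula, which is multilinear on all words; uniqueness
  holds because homogeneous words span. \<open>V\<close> and \<open>W\<close> are kept apart since a
  multiple of the unit will be inserted into a word of the reduced module.\<close>

lemma insert_map:
  assumes V: "graded_module R V" and W: "module R W" and incl: "(\<lambda>x. x) \<in> linear_maps R V W"
    and g: "g \<in> linear_maps R (tensor_power R V i) W"
  shows insert_map_linear:
      "insert_map R V W e j i m g \<in> linear_maps R (tensor_power R V (j + i + m)) (tensor_power R W (j + 1 + m))"
    and insert_map_word: "\<And>us xs vs. \<lbrakk>length us = j; length xs = i; length vs = m;
        set us \<subseteq> carrier V; set xs \<subseteq> carrier V; set vs \<subseteq> carrier V\<rbrakk> \<Longrightarrow>
      insert_map R V W e j i m g (word_tensor R V (us @ xs @ vs)) =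
        word_tensor R W (map (sgn_map R V e) us @ g (word_tensor R V xs) # vs)"
proof -
  interpret V: graded_module R V by (rule V)
  note Vm = V.module_axioms
  let ?n = "j + i + m"
  let ?P = "tensor_power R W (j + 1 + m)"
  let ?\<phi> = "\<lambda>xs. word_tensor R W (map (sgn_map R V e) (take j xs) @
      g (word_tensor R V (take i (drop j xs))) # drop (j + i) xs)"
  have s: "sgn_map R V e \<in> linear_maps R V W"
    using linear_maps_comp[OF V.sgn_map_linear incl] by simp
  obtain G where G: "G \<in> linear_maps R (tensor_power R V ?n) ?P"
    "\<And>xs. xs \<in> words V ?n \<Longrightarrow> G (word_tensor R V xs) = ?\<phi> xs"
    using tensor_power_lift[OF Vm tensor_power_module[OF W] multilinear_insert[OF Vm W incl s g]] by metis
  have inW: "set xs \<subseteq> carrier W" if "set xs \<subseteq> carrier V" for xs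
    using that linear_maps_closed[OF incl] by auto
  have gW: "g (word_tensor R V xs) \<in> carrier W" if "length xs = i" "set xs \<subseteq> carrier V" for xs
    using that by (intro linear_maps_closed[OF g] word_tensor_closed[OF Vm]) (simp add: words_iff)
  have Gw: "G (word_tensor R V (us @ xs @ vs)) =
      word_tensor R W (map (sgn_map R V e) us @ g (word_tensor R V xs) # vs)"
    if "length us = j" "length xs = i" "length vs = m"
        "set us \<subseteq> carrier V" "set xs \<subseteq> carrier V" "set vs \<subseteq> carrier V" for us xs vs
    by (subst G(2)) (use that in \<open>auto simp: words_iff\<close>)
  have Gh: "G (word_tensor R V (us @ xs @ vs)) =
      koszul_sign R (e * sum_list (take j ds)) \<odot>\<^bsub>?P\<^esub> word_tensor R W (us @ [g (word_tensor R V xs)] @ vs)"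
    if "length us = j" "length xs = i" "length vs = m" "homogeneous_word V (us @ xs @ vs) ds" for us xs vs ds
  proof -
    have "homogeneous_word V us (take j ds)"
      using homogeneous_word_take[OF that(4), of j] that by simp
    moreover have "set us \<subseteq> carrier V" "set xs \<subseteq> carrier V" "set vs \<subseteq> carrier V"
      using V.homogeneous_word_closed[OF that(4)] by auto
    ultimately show ?thesis
      using V.word_tensor_map_sgn[OF W incl, of us "take j ds" "[]" "g (word_tensor R V xs) # vs" "j + 1 + m" e]
        that gW inW by (simp add: Gw)
  qed
  let ?S = "{word_tensor R V xs | xs. length xs = ?n \<and> (\<exists>ds. homogeneous_word V xs ds)}"
  have wc: "word_tensor R V (us @ xs @ vs) \<in> carrier (tensor_power R V ?n)"
    if "length us = j" "length xs = i" "length vs = m" "set (us @ xs @ vs) \<subseteq> carrier V" for us xs vs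
    by (rule word_tensor_closed[OF Vm]) (use that in \<open>simp add: words_iff\<close>)
  have "insert_map R V W e j i m g \<in> linear_maps R (tensor_power R V ?n) ?P \<and>
      (\<forall>x\<in>carrier (tensor_power R V ?n). insert_map R V W e j i m g x = G x)"
    unfolding insert_map_def
  proof (rule the_linear_map_eq[OF tensor_power_module[OF Vm] tensor_power_module[OF W]
        homogeneous_words_subset[OF V] homogeneous_words_span[OF V] G(1)], goal_cases)
    case (1 F)
    show ?case
    proof (intro allI impI)
      fix us xs vs ds
      assume a: "length us = j" "length xs = i" "length vs = m" "homogeneous_word V (us @ xs @ vs) ds"
      have "F (word_tensor R V (us @ xs @ vs)) = G (word_tensor R V (us @ xs @ vs))"
        by (rule 1[OF wc[OF a(1-3) V.homogeneous_word_closed[OF a(4)]]])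
      then show "F (word_tensor R V (us @ xs @ vs)) = koszul_sign R (e * sum_list (take j ds)) \<odot>\<^bsub>?P\<^esub>
          word_tensor R W (us @ [g (word_tensor R V xs)] @ vs)"
        by (simp only: Gh[OF a])
    qed
  next
    case (2 F s)
    then obtain xs ds where xs: "s = word_tensor R V xs" "length xs = ?n" "homogeneous_word V xs ds"
      by auto
    \<comment> \<open>The prescription is stated for words already cut into three pieces, so an
      arbitrary homogeneous word has to be cut first.\<close>
    let ?us = "take j xs" and ?xs = "take i (drop j xs)" and ?vs = "drop i (drop j xs)"
    have dec: "xs = ?us @ ?xs @ ?vs" by (metis append_take_drop_id)
    have len: "length ?us = j" "length ?xs = i" "length ?vs = m" using xs(2) by auto
    have h: "homogeneous_word V (?us @ ?xs @ ?vs) ds" using xs(3) dec by simp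
    have "F (word_tensor R V (?us @ ?xs @ ?vs)) = G (word_tensor R V (?us @ ?xs @ ?vs))"
      using 2(2)[rule_format, OF len h] Gh[OF len h] by simp
    then show ?case using dec xs(1) by simp
  qed
  note main = conjunct1[OF this] bspec[OF conjunct2[OF this]]
  show "insert_map R V W e j i m g \<in> linear_maps R (tensor_power R V ?n) ?P" by (rule main(1))
  show "insert_map R V W e j i m g (word_tensor R V (us @ xs @ vs)) =
        word_tensor R W (map (sgn_map R V e) us @ g (word_tensor R V xs) # vs)"
    if "length us = j" "length xs = i" "length vs = m"
        "set us \<subseteq> carrier V" "set xs \<subseteq> carrier V" "set vs \<subseteq> carrier V" for us xs vs
    using main(2)[OF wc] Gw that by simp
qed

lemma tensor_power_map:
  assumes V: "module R V" and W: "module R W" and \<phi>: "\<phi> \<in> linear_maps R V W"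
  shows tensor_power_map_linear:
      "tensor_power_map R V W n \<phi> \<in> linear_maps R (tensor_power R V n) (tensor_power R W n)"
    and tensor_power_map_word: "\<And>xs. xs \<in> words V n \<Longrightarrow>
      tensor_power_map R V W n \<phi> (word_tensor R V xs) = word_tensor R W (map \<phi> xs)"
proof -
  have map2: "map2 (\<lambda>f x. f x) (replicate n \<phi>) xs = map \<phi> xs" if "length xs = n" for xs
    using that by (auto simp: list_eq_iff_nth_eq)
  obtain G where G: "G \<in> linear_maps R (tensor_power R V n) (tensor_power R W n)"
    "\<And>xs. xs \<in> words V n \<Longrightarrow> G (word_tensor R V xs) = word_tensor R W (map2 (\<lambda>f x. f x) (replicate n \<phi>) xs)"
    using tensor_power_lift[OF V tensor_power_module[OF W] multilinear_map2[OF V W, of "replicate n \<phi>" n]] \<phi>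
    by auto
  have Gw: "G (word_tensor R V xs) = word_tensor R W (map \<phi> xs)" if "xs \<in> words V n" for xs
    using G(2)[OF that] that map2 by (simp add: words_iff)
  have sub: "word_tensor R V ` words V n \<subseteq> carrier (tensor_power R V n)"
    using word_tensor_closed[OF V] by (rule image_subsetI)
  have "tensor_power_map R V W n \<phi> \<in> linear_maps R (tensor_power R V n) (tensor_power R W n) \<and>
      (\<forall>x\<in>carrier (tensor_power R V n). tensor_power_map R V W n \<phi> x = G x)"
    unfolding tensor_power_map_def
    by (rule the_linear_map_eq[OF tensor_power_module[OF V] tensor_power_module[OF W]
        sub tensor_power_span[OF V] G(1)]; auto simp: Gw word_tensor_closed[OF V])
  note main = conjunct1[OF this] bspec[OF conjunct2[OF this]]
  show "tensor_power_map R V W n \<phi> \<in> linear_maps R (tensor_power R V n) (tensor_power R W n)"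
    by (rule main(1))
  show "tensor_power_map R V W n \<phi> (word_tensor R V xs) = word_tensor R W (map \<phi> xs)"
    if "xs \<in> words V n" for xs
    using main(2)[OF word_tensor_closed[OF V that]] Gw[OF that] by simp
qed

section \<open>Maps between tensor products, unitors and the associator\<close>

lemma pure_tensors_subset:
  assumes M: "module R M" and N: "module R N"
  shows "{pure_tensor R M N x y | x y. x \<in> carrier M \<and> y \<in> carrier N} \<subseteq> carrier (tensor R M N)"
  by (auto intro!: pure_tensor_closed[OF M N])

lemma tensor_linear_eqI:
  assumes M: "module R M" and N: "module R N"
    and P: "module R P" "f \<in> linear_maps R (tensor R M N) P" "g \<in> linear_maps R (tensor R M N) P"
    and eq: "\<And>x y. \<lbrakk>x \<in> carrier M; y \<in> carrier N\<rbrakk> \<Longrightarrow> f (pure_tensor R M N x y) = g (pure_tensor R M N x y)"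
    and x: "x \<in> carrier (tensor R M N)"
  shows "f x = g x"
  by (rule linear_maps_eq_on_span[OF tensor_module[OF M N] P pure_tensors_subset[OF M N]])
    (use eq x tensor_span[OF M N] in auto)

text \<open>As with insertions, the sign of moving \<open>g\<close> past the first factor is put on
  that factor by \<open>sgn_map\<close>, which turns the prescription on homogeneous elements into a
  bilinear map.\<close>

lemma tensor_map:
  assumes M: "graded_module R M" and N: "module R N" and M': "module R M'" and N': "module R N'"
    and f: "f \<in> linear_maps R M M'" and g: "g \<in> linear_maps R N N'"
  shows tensor_map_linear: "tensor_map R M N M' N' e f g \<in> linear_maps R (tensor R M N) (tensor R M' N')"
    and tensor_map_pure: "\<And>x y. \<lbrakk>x \<in> carrier M; y \<in> carrier N\<rbrakk> \<Longrightarrow>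
      tensor_map R M N M' N' e f g (pure_tensor R M N x y) = pure_tensor R M' N' (f (sgn_map R M e x)) (g y)"
proof -
  interpret M: graded_module R M by (rule M)
  note Mm = M.module_axioms
  let ?\<phi> = "\<lambda>x y. pure_tensor R M' N' (f (sgn_map R M e x)) (g y)"
  note T' = tensor_module[OF M' N'] and T = tensor_module[OF Mm N]
  have "\<exists>G\<in>linear_maps R (tensor R M N) (tensor R M' N').
      \<forall>x\<in>carrier M. \<forall>y\<in>carrier N. G (pure_tensor R M N x y) = ?\<phi> x y"
  proof (rule tensor_lift[OF Mm N T'])
    show "(\<lambda>x. ?\<phi> x y) \<in> linear_maps R M (tensor R M' N')" if "y \<in> carrier N" for y
      by (rule linear_maps_comp[OF linear_maps_comp[OF M.sgn_map_linear f]
            pure_tensor_linear_left[OF M' N' linear_maps_closed[OF g that]]])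
    show "(\<lambda>y. ?\<phi> x y) \<in> linear_maps R N (tensor R M' N')" if "x \<in> carrier M" for x
      by (rule linear_maps_comp[OF g pure_tensor_linear_right[OF M' N'
              linear_maps_closed[OF f M.sgn_map_closed[OF that]]]])
  qed
  then obtain G where G: "G \<in> linear_maps R (tensor R M N) (tensor R M' N')"
    "\<And>x y. \<lbrakk>x \<in> carrier M; y \<in> carrier N\<rbrakk> \<Longrightarrow> G (pure_tensor R M N x y) = ?\<phi> x y"
    by auto
  have Gh: "G (pure_tensor R M N x y) =
      koszul_sign R (e * i) \<odot>\<^bsub>tensor R M' N'\<^esub> pure_tensor R M' N' (f x) (g y)"
    if "x \<in> grade M i" "y \<in> carrier N" for i x y
  proof -
    have x: "x \<in> carrier M" by (rule M.grade_closed[OF that(1)])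
    show ?thesis
      using G(2)[OF x that(2)] x
      by (simp add: M.sgn_map_homogeneous[OF that(1)] linear_maps_smult[OF f]
          linear_maps_smult[OF pure_tensor_linear_left[OF M' N' linear_maps_closed[OF g that(2)]]]
          linear_maps_closed[OF f])
  qed
  have "tensor_map R M N M' N' e f g \<in> linear_maps R (tensor R M N) (tensor R M' N') \<and>
      (\<forall>x\<in>carrier (tensor R M N). tensor_map R M N M' N' e f g x = G x)"
    unfolding tensor_map_def
  proof (rule the_linear_map_eq[OF T T' pure_tensors_subset[OF Mm N] tensor_span[OF Mm N] G(1)], goal_cases)
    case (1 F)
    then show ?case using Gh M.grade_closed pure_tensor_closed[OF Mm N] by simp
  next
    case (2 F s)
    then obtain x y where xy: "s = pure_tensor R M N x y" "x \<in> carrier M" "y \<in> carrier N" by auto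
    note l = pure_tensor_linear_left[OF Mm N xy(3)]
    have "F (pure_tensor R M N x y) = G (pure_tensor R M N x y)"
      by (rule M.linear_maps_eq_on_grades[OF T' linear_maps_comp[OF l 2(1)] linear_maps_comp[OF l G(1)]])
        (use 2(2) Gh xy in auto)
    then show ?case using xy by simp
  qed
  note main = conjunct1[OF this] bspec[OF conjunct2[OF this]]
  show "tensor_map R M N M' N' e f g \<in> linear_maps R (tensor R M N) (tensor R M' N')" by (rule main(1))
  show "tensor_map R M N M' N' e f g (pure_tensor R M N x y) = ?\<phi> x y"
    if "x \<in> carrier M" "y \<in> carrier N" for x y
    using main(2)[OF pure_tensor_closed[OF Mm N that]] G(2)[OF that] by simp
qed

lemma ground_simps [simp]:
  "carrier (ground R) = carrier R" "zero (ground R) = zero R" "add (ground R) = add R"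
  "smult (ground R) = mult R"
  by (simp_all add: ground_def)

lemma (in cring) ground_module: "module R (ground R)"
proof (rule moduleI)
  show "abelian_group (ground R)"
    by (rule abelian_groupI) (auto simp: a_ac intro: bexI[of _ "\<ominus> x" for x] l_neg)
qed (auto simp: l_distr r_distr m_assoc is_cring)

lemma left_unitor:
  fixes M :: "('k, 'a) graded_module"
  assumes M: "module R M"
  shows left_unitor_linear: "left_unitor R M \<in> linear_maps R (tensor R (ground R) M) M"
    and left_unitor_pure: "\<And>c x. \<lbrakk>c \<in> carrier R; x \<in> carrier M\<rbrakk> \<Longrightarrow>
      left_unitor R M (pure_tensor R (ground R) M c x) = c \<odot>\<^bsub>M\<^esub> x"
proof -
  interpret M: module R M by (rule M)
  note k = M.R.ground_module
  have "\<exists>G\<in>linear_maps R (tensor R (ground R) M) M.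
      \<forall>c\<in>carrier (ground R). \<forall>x\<in>carrier M. G (pure_tensor R (ground R) M c x) = c \<odot>\<^bsub>M\<^esub> x"
    by (rule tensor_lift[OF k M M]; rule linear_mapsI)
      (simp_all add: M.smult_l_distr M.smult_r_distr M.smult_assoc1[symmetric] M.R.m_comm)
  then obtain G where G: "G \<in> linear_maps R (tensor R (ground R) M) M"
    "\<And>c x. \<lbrakk>c \<in> carrier R; x \<in> carrier M\<rbrakk> \<Longrightarrow> G (pure_tensor R (ground R) M c x) = c \<odot>\<^bsub>M\<^esub> x"
    by auto
  have "left_unitor R M \<in> linear_maps R (tensor R (ground R) M) M \<and>
      (\<forall>x\<in>carrier (tensor R (ground R) M). left_unitor R M x = G x)"
    unfolding left_unitor_def
    by (rule the_linear_map_eq[OF tensor_module[OF k M] M pure_tensors_subset[OF k M] tensor_span[OF k M] G(1)];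
        auto simp: G(2) pure_tensor_closed[OF k M])
  note main = conjunct1[OF this] bspec[OF conjunct2[OF this]]
  show "left_unitor R M \<in> linear_maps R (tensor R (ground R) M) M" by (rule main(1))
  show "left_unitor R M (pure_tensor R (ground R) M c x) = c \<odot>\<^bsub>M\<^esub> x"
    if "c \<in> carrier R" "x \<in> carrier M" for c x
    using main(2)[OF pure_tensor_closed[OF k M]] G(2) that by simp
qed

lemma right_unitor:
  fixes M :: "('k, 'a) graded_module"
  assumes M: "module R M"
  shows right_unitor_linear: "right_unitor R M \<in> linear_maps R (tensor R M (ground R)) M"
    and right_unitor_pure: "\<And>c x. \<lbrakk>c \<in> carrier R; x \<in> carrier M\<rbrakk> \<Longrightarrow>
      right_unitor R M (pure_tensor R M (ground R) x c) = c \<odot>\<^bsub>M\<^esub> x"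
proof -
  interpret M: module R M by (rule M)
  note k = M.R.ground_module
  have "\<exists>G\<in>linear_maps R (tensor R M (ground R)) M.
      \<forall>x\<in>carrier M. \<forall>c\<in>carrier (ground R). G (pure_tensor R M (ground R) x c) = c \<odot>\<^bsub>M\<^esub> x"
    by (rule tensor_lift[OF M k M]; rule linear_mapsI)
      (simp_all add: M.smult_l_distr M.smult_r_distr M.smult_assoc1[symmetric] M.R.m_comm)
  then obtain G where G: "G \<in> linear_maps R (tensor R M (ground R)) M"
    "\<And>c x. \<lbrakk>c \<in> carrier R; x \<in> carrier M\<rbrakk> \<Longrightarrow> G (pure_tensor R M (ground R) x c) = c \<odot>\<^bsub>M\<^esub> x"
    by auto
  have "right_unitor R M \<in> linear_maps R (tensor R M (ground R)) M \<and>
      (\<forall>x\<in>carrier (tensor R M (ground R)). right_unitor R M x = G x)"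
    unfolding right_unitor_def
    by (rule the_linear_map_eq[OF tensor_module[OF M k] M pure_tensors_subset[OF M k] tensor_span[OF M k] G(1)];
        auto simp: G(2) pure_tensor_closed[OF M k])
  note main = conjunct1[OF this] bspec[OF conjunct2[OF this]]
  show "right_unitor R M \<in> linear_maps R (tensor R M (ground R)) M" by (rule main(1))
  show "right_unitor R M (pure_tensor R M (ground R) x c) = c \<odot>\<^bsub>M\<^esub> x"
    if "c \<in> carrier R" "x \<in> carrier M" for c x
    using main(2)[OF pure_tensor_closed[OF M k]] G(2) that by simp
qed

text \<open>Only bilinear lifts are at hand, so the trilinear map is lifted in two stages: for each
  fixed third factor to the inner tensor product, and then in the third factor.\<close>

lemma associator:
  fixes L :: "('k, 'a) graded_module" and M :: "('k, 'b) graded_module" and N :: "('k, 'c) graded_module"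
  assumes L: "module R L" and M: "module R M" and N: "module R N"
  shows associator_linear:
      "associator R L M N \<in> linear_maps R (tensor R (tensor R L M) N) (tensor R L (tensor R M N))"
    and associator_pure: "\<And>x y z. \<lbrakk>x \<in> carrier L; y \<in> carrier M; z \<in> carrier N\<rbrakk> \<Longrightarrow>
      associator R L M N (pure_tensor R (tensor R L M) N (pure_tensor R L M x y) z) =
        pure_tensor R L (tensor R M N) x (pure_tensor R M N y z)"
proof -
  note LM = tensor_module[OF L M] and MN = tensor_module[OF M N]
  note D = tensor_module[OF LM N] and E = tensor_module[OF L MN]
  let ?E = "tensor R L (tensor R M N)"
  let ?p = "\<lambda>x y z. pure_tensor R L (tensor R M N) x (pure_tensor R M N y z)"
  interpret LE: two_modules R "tensor R L M" ?E by (intro two_modulesI LM E)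
  interpret N: module R N by (rule N)
  have pc: "?p x y z \<in> carrier ?E" if "x \<in> carrier L" "y \<in> carrier M" "z \<in> carrier N" for x y z
    by (intro pure_tensor_closed[OF L MN] pure_tensor_closed[OF M N] that)
  have px: "(\<lambda>x. ?p x y z) \<in> linear_maps R L ?E" if "y \<in> carrier M" "z \<in> carrier N" for y z
    by (rule pure_tensor_linear_left[OF L MN pure_tensor_closed[OF M N that]])
  have py: "(\<lambda>y. ?p x y z) \<in> linear_maps R M ?E" if "x \<in> carrier L" "z \<in> carrier N" for x z
    by (rule linear_maps_comp[OF pure_tensor_linear_left[OF M N that(2)] pure_tensor_linear_right[OF L MN that(1)]])
  have pz: "(\<lambda>z. ?p x y z) \<in> linear_maps R N ?E" if "x \<in> carrier L" "y \<in> carrier M" for x y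
    by (rule linear_maps_comp[OF pure_tensor_linear_right[OF M N that(2)] pure_tensor_linear_right[OF L MN that(1)]])
  have "\<exists>G\<in>linear_maps R (tensor R L M) ?E. \<forall>x\<in>carrier L. \<forall>y\<in>carrier M. G (pure_tensor R L M x y) = ?p x y z"
    if "z \<in> carrier N" for z
    by (rule tensor_lift[OF L M E]) (use px py that in auto)
  then obtain A where A: "\<And>z. z \<in> carrier N \<Longrightarrow> A z \<in> linear_maps R (tensor R L M) ?E"
    "\<And>x y z. \<lbrakk>x \<in> carrier L; y \<in> carrier M; z \<in> carrier N\<rbrakk> \<Longrightarrow> A z (pure_tensor R L M x y) = ?p x y z"
    by metis
  \<comment> \<open>\<open>A z\<close> was chosen separately for each z. Additivity and homogeneity
    in z are equalities of linear maps on the inner tensor product, so pure tensors decide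
    them.\<close>
  have Az: "(\<lambda>z. A z t) \<in> linear_maps R N ?E" if t: "t \<in> carrier (tensor R L M)" for t
  proof (rule linear_mapsI)
    show "A z t \<in> carrier ?E" if "z \<in> carrier N" for z
      by (rule linear_maps_closed[OF A(1)[OF that] t])
    show "A (z \<oplus>\<^bsub>N\<^esub> z') t = A z t \<oplus>\<^bsub>?E\<^esub> A z' t" if z: "z \<in> carrier N" "z' \<in> carrier N" for z z'
      by (rule tensor_linear_eqI[OF L M E A(1) LE.linear_maps_sum_pair[OF A(1)[OF z(1)] A(1)[OF z(2)]] _ t])
        (use z in \<open>simp_all add: A(2) linear_maps_add[OF pz]\<close>)
    show "A (a \<odot>\<^bsub>N\<^esub> z) t = a \<odot>\<^bsub>?E\<^esub> A z t" if z: "a \<in> carrier R" "z \<in> carrier N" for a z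
      by (rule tensor_linear_eqI[OF L M E A(1) LE.linear_maps_scale[OF A(1)[OF z(2)] z(1)] _ t])
        (use z in \<open>simp_all add: A(2) linear_maps_smult[OF pz]\<close>)
  qed
  obtain G where G: "G \<in> linear_maps R (tensor R (tensor R L M) N) ?E"
    "\<And>t z. \<lbrakk>t \<in> carrier (tensor R L M); z \<in> carrier N\<rbrakk> \<Longrightarrow> G (pure_tensor R (tensor R L M) N t z) = A z t"
    using tensor_lift[OF LM N E, of "\<lambda>t z. A z t"] A(1) Az by auto
  have Gp: "G (pure_tensor R (tensor R L M) N (pure_tensor R L M x y) z) = ?p x y z"
    if "x \<in> carrier L" "y \<in> carrier M" "z \<in> carrier N" for x y z
    using G(2) A(2) that pure_tensor_closed[OF L M] by simp
  have "associator R L M N \<in> linear_maps R (tensor R (tensor R L M) N) ?E \<and>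
      (\<forall>x\<in>carrier (tensor R (tensor R L M) N). associator R L M N x = G x)"
    unfolding associator_def
  proof (rule the_linear_map_eq[OF D E pure_tensors_subset[OF LM N] tensor_span[OF LM N] G(1)], goal_cases)
    case (1 F)
    then show ?case by (simp add: Gp pure_tensor_closed[OF LM N] pure_tensor_closed[OF L M])
  next
    case (2 F s)
    then obtain t z where s: "s = pure_tensor R (tensor R L M) N t z" "t \<in> carrier (tensor R L M)" "z \<in> carrier N"
      by auto
    note l = pure_tensor_linear_left[OF LM N s(3)]
    have "F (pure_tensor R (tensor R L M) N t z) = G (pure_tensor R (tensor R L M) N t z)"
      by (rule tensor_linear_eqI[OF L M E linear_maps_comp[OF l 2(1)] linear_maps_comp[OF l G(1)] _ s(2)])
        (use 2(2) Gp s in auto)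
    then show ?case using s by simp
  qed
  note main = conjunct1[OF this] bspec[OF conjunct2[OF this]]
  show "associator R L M N \<in> linear_maps R (tensor R (tensor R L M) N) ?E" by (rule main(1))
  show "associator R L M N (pure_tensor R (tensor R L M) N (pure_tensor R L M x y) z) = ?p x y z"
    if "x \<in> carrier L" "y \<in> carrier M" "z \<in> carrier N" for x y z
    using main(2)[OF pure_tensor_closed[OF LM N]] Gp that pure_tensor_closed[OF L M] by simp
qed

section \<open>Direct sums and the tensor coalgebra\<close>

lemma direct_sum_simps:
  "carrier (direct_sum I M) = {f \<in> (\<Pi>\<^sub>E i\<in>I. carrier (M i)). finite {i \<in> I. f i \<noteq> \<zero>\<^bsub>M i\<^esub>}}"
  "zero (direct_sum I M) = (\<lambda>i\<in>I. \<zero>\<^bsub>M i\<^esub>)"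
  "add (direct_sum I M) = (\<lambda>f g. \<lambda>i\<in>I. f i \<oplus>\<^bsub>M i\<^esub> g i)"
  "smult (direct_sum I M) = (\<lambda>a f. \<lambda>i\<in>I. a \<odot>\<^bsub>M i\<^esub> f i)"
  "grade (direct_sum I M) d = {f \<in> carrier (direct_sum I M). \<forall>i\<in>I. f i \<in> grade (M i) d}"
  by (simp_all add: direct_sum_def Let_def)

lemma direct_sum_module:
  assumes "cring R" and M: "\<And>i. i \<in> I \<Longrightarrow> module R (M i)"
  shows "module R (direct_sum I M)"
proof -
  interpret R: cring R by fact
  \<comment> \<open>The axioms are collected one index at a time, because \<open>M i\<close> is
    known to be a module only for indices in \<open>I\<close>.\<close>
  have ax0: "\<zero>\<^bsub>M i\<^esub> \<in> carrier (M i)"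
    "\<ominus>\<^bsub>M i\<^esub> \<zero>\<^bsub>M i\<^esub> = \<zero>\<^bsub>M i\<^esub>"
    "\<zero>\<^bsub>M i\<^esub> \<oplus>\<^bsub>M i\<^esub> \<zero>\<^bsub>M i\<^esub> = \<zero>\<^bsub>M i\<^esub>"
    if "i \<in> I" for i
  proof -
    interpret module R "M i" by (rule M[OF that(1)])
    show "\<zero>\<^bsub>M i\<^esub> \<in> carrier (M i)"
    "\<ominus>\<^bsub>M i\<^esub> \<zero>\<^bsub>M i\<^esub> = \<zero>\<^bsub>M i\<^esub>"
    "\<zero>\<^bsub>M i\<^esub> \<oplus>\<^bsub>M i\<^esub> \<zero>\<^bsub>M i\<^esub> = \<zero>\<^bsub>M i\<^esub>"
      using that by (auto simp: M.a_comm)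
  qed
  have ax1: "\<ominus>\<^bsub>M i\<^esub> x \<in> carrier (M i)"
    "\<ominus>\<^bsub>M i\<^esub> x \<oplus>\<^bsub>M i\<^esub> x = \<zero>\<^bsub>M i\<^esub>"
    "\<zero>\<^bsub>M i\<^esub> \<oplus>\<^bsub>M i\<^esub> x = x"
    "\<one>\<^bsub>R\<^esub> \<odot>\<^bsub>M i\<^esub> x = x"
    if "i \<in> I" "x \<in> carrier (M i)" for i x
  proof -
    interpret module R "M i" by (rule M[OF that(1)])
    show "\<ominus>\<^bsub>M i\<^esub> x \<in> carrier (M i)"
    "\<ominus>\<^bsub>M i\<^esub> x \<oplus>\<^bsub>M i\<^esub> x = \<zero>\<^bsub>M i\<^esub>"
    "\<zero>\<^bsub>M i\<^esub> \<oplus>\<^bsub>M i\<^esub> x = x"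
    "\<one>\<^bsub>R\<^esub> \<odot>\<^bsub>M i\<^esub> x = x"
      using that by (auto simp: M.l_neg)
  qed
  have ax2: "x \<oplus>\<^bsub>M i\<^esub> y \<in> carrier (M i)"
    if "i \<in> I" "x \<in> carrier (M i)" "y \<in> carrier (M i)" for i x y
  proof -
    interpret module R "M i" by (rule M[OF that(1)])
    show "x \<oplus>\<^bsub>M i\<^esub> y \<in> carrier (M i)"
      using that by (auto simp: M.a_comm)
  qed
  have comm: "x \<oplus>\<^bsub>M i\<^esub> y = y \<oplus>\<^bsub>M i\<^esub> x"
    if "i \<in> I" "x \<in> carrier (M i)" "y \<in> carrier (M i)" for i x y
  proof -
    interpret module R "M i" by (rule M[OF that(1)])
    show "x \<oplus>\<^bsub>M i\<^esub> y = y \<oplus>\<^bsub>M i\<^esub> x"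
      using that by (auto simp: M.a_comm)
  qed
  have assoc: "x \<oplus>\<^bsub>M i\<^esub> y \<oplus>\<^bsub>M i\<^esub> z = x \<oplus>\<^bsub>M i\<^esub> (y \<oplus>\<^bsub>M i\<^esub> z)"
    if "i \<in> I" "x \<in> carrier (M i)" "y \<in> carrier (M i)" "z \<in> carrier (M i)" for i x y z
  proof -
    interpret module R "M i" by (rule M[OF that(1)])
    show "x \<oplus>\<^bsub>M i\<^esub> y \<oplus>\<^bsub>M i\<^esub> z = x \<oplus>\<^bsub>M i\<^esub> (y \<oplus>\<^bsub>M i\<^esub> z)"
      using that by (auto simp: M.a_assoc)
  qed
  have sm0: "a \<odot>\<^bsub>M i\<^esub> \<zero>\<^bsub>M i\<^esub> = \<zero>\<^bsub>M i\<^esub>"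
    if "i \<in> I" "a \<in> carrier R" for i a
  proof -
    interpret module R "M i" by (rule M[OF that(1)])
    show "a \<odot>\<^bsub>M i\<^esub> \<zero>\<^bsub>M i\<^esub> = \<zero>\<^bsub>M i\<^esub>"
      using that by (auto simp: M.a_assoc)
  qed
  have sm1: "a \<odot>\<^bsub>M i\<^esub> x \<in> carrier (M i)"
    if "i \<in> I" "a \<in> carrier R" "x \<in> carrier (M i)" for i a x
  proof -
    interpret module R "M i" by (rule M[OF that(1)])
    show "a \<odot>\<^bsub>M i\<^esub> x \<in> carrier (M i)"
      using that by (auto simp: M.a_assoc)
  qed
  have sm2: "a \<odot>\<^bsub>M i\<^esub> (x \<oplus>\<^bsub>M i\<^esub> y) = a \<odot>\<^bsub>M i\<^esub> x \<oplus>\<^bsub>M i\<^esub> a \<odot>\<^bsub>M i\<^esub> y"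
    if "i \<in> I" "a \<in> carrier R" "x \<in> carrier (M i)" "y \<in> carrier (M i)" for i a x y
  proof -
    interpret module R "M i" by (rule M[OF that(1)])
    show "a \<odot>\<^bsub>M i\<^esub> (x \<oplus>\<^bsub>M i\<^esub> y) = a \<odot>\<^bsub>M i\<^esub> x \<oplus>\<^bsub>M i\<^esub> a \<odot>\<^bsub>M i\<^esub> y"
      using that by (auto simp: smult_r_distr)
  qed
  have sm3: "(a \<oplus>\<^bsub>R\<^esub> b) \<odot>\<^bsub>M i\<^esub> x = a \<odot>\<^bsub>M i\<^esub> x \<oplus>\<^bsub>M i\<^esub> b \<odot>\<^bsub>M i\<^esub> x"
    "(a \<otimes>\<^bsub>R\<^esub> b) \<odot>\<^bsub>M i\<^esub> x = a \<odot>\<^bsub>M i\<^esub> (b \<odot>\<^bsub>M i\<^esub> x)"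
    if "i \<in> I" "a \<in> carrier R" "b \<in> carrier R" "x \<in> carrier (M i)" for i a b x
  proof -
    interpret module R "M i" by (rule M[OF that(1)])
    show "(a \<oplus>\<^bsub>R\<^esub> b) \<odot>\<^bsub>M i\<^esub> x = a \<odot>\<^bsub>M i\<^esub> x \<oplus>\<^bsub>M i\<^esub> b \<odot>\<^bsub>M i\<^esub> x"
    "(a \<otimes>\<^bsub>R\<^esub> b) \<odot>\<^bsub>M i\<^esub> x = a \<odot>\<^bsub>M i\<^esub> (b \<odot>\<^bsub>M i\<^esub> x)"
      using that by (auto simp: smult_l_distr smult_assoc1)
  qed
  note add_ax = ax0 ax1 ax2 and sm = sm0 sm1 sm2 sm3
  have cl: "f i \<in> carrier (M i)" if "f \<in> carrier (direct_sum I M)" "i \<in> I" for f i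
    using that by (auto simp: direct_sum_simps)
  have fin: "finite {i \<in> I. f i \<noteq> \<zero>\<^bsub>M i\<^esub>}" if "f \<in> carrier (direct_sum I M)" for f
    using that by (auto simp: direct_sum_simps)
  have ext: "f = g" if "f \<in> carrier (direct_sum I M)" "g \<in> carrier (direct_sum I M)" "\<And>i. i \<in> I \<Longrightarrow> f i = g i"
    for f g
    using that by (auto simp: direct_sum_simps intro: PiE_ext)
  have cI: "(\<lambda>i\<in>I. g i) \<in> carrier (direct_sum I M)"
    if "\<And>i. i \<in> I \<Longrightarrow> g i \<in> carrier (M i)" "finite S" "\<And>i. i \<in> I \<Longrightarrow> i \<notin> S \<Longrightarrow> g i = \<zero>\<^bsub>M i\<^esub>" for g S
    using that by (auto simp: direct_sum_simps intro: finite_subset[of _ S])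
  have a_cl: "f \<oplus>\<^bsub>direct_sum I M\<^esub> g \<in> carrier (direct_sum I M)"
    if "f \<in> carrier (direct_sum I M)" "g \<in> carrier (direct_sum I M)" for f g
    unfolding direct_sum_simps(3)
    by (rule cI[of _ "{i \<in> I. f i \<noteq> \<zero>\<^bsub>M i\<^esub>} \<union> {i \<in> I. g i \<noteq> \<zero>\<^bsub>M i\<^esub>}"])
      (use that cl fin add_ax in auto)
  have s_cl: "a \<odot>\<^bsub>direct_sum I M\<^esub> f \<in> carrier (direct_sum I M)"
    if "a \<in> carrier R" "f \<in> carrier (direct_sum I M)" for a f
    unfolding direct_sum_simps(4)
    by (rule cI[of _ "{i \<in> I. f i \<noteq> \<zero>\<^bsub>M i\<^esub>}"]) (use that cl fin sm in auto)
  have z_cl: "\<zero>\<^bsub>direct_sum I M\<^esub> \<in> carrier (direct_sum I M)"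
    unfolding direct_sum_simps(2)
    by (rule cI[of _ "{}"]) (use module.axioms(2)[OF M] abelian_groupE(2) in auto)
  have apply_add: "(f \<oplus>\<^bsub>direct_sum I M\<^esub> g) i = f i \<oplus>\<^bsub>M i\<^esub> g i" if "i \<in> I" for f g i
    using that by (simp add: direct_sum_simps)
  have apply_smult: "(a \<odot>\<^bsub>direct_sum I M\<^esub> f) i = a \<odot>\<^bsub>M i\<^esub> f i" if "i \<in> I" for a f i
    using that by (simp add: direct_sum_simps)
  have apply_zero: "\<zero>\<^bsub>direct_sum I M\<^esub> i = \<zero>\<^bsub>M i\<^esub>" if "i \<in> I" for i
    using that by (simp add: direct_sum_simps)
  note app = apply_add apply_smult apply_zero
  show ?thesis
  proof (rule moduleI)
    show "abelian_group (direct_sum I M)"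
    proof (rule abelian_groupI)
      fix f assume f: "f \<in> carrier (direct_sum I M)"
      let ?g = "\<lambda>i\<in>I. \<ominus>\<^bsub>M i\<^esub> f i"
      have g: "?g \<in> carrier (direct_sum I M)"
        by (rule cI[of _ "{i \<in> I. f i \<noteq> \<zero>\<^bsub>M i\<^esub>}"]) (use f cl fin add_ax in auto)
      have "?g \<oplus>\<^bsub>direct_sum I M\<^esub> f = \<zero>\<^bsub>direct_sum I M\<^esub>"
        by (rule ext[OF a_cl[OF g f] z_cl]) (use f cl add_ax in \<open>auto simp: app\<close>)
      then show "\<exists>g\<in>carrier (direct_sum I M). g \<oplus>\<^bsub>direct_sum I M\<^esub> f = \<zero>\<^bsub>direct_sum I M\<^esub>"
        using g by blast
    next
      fix f g h assume f: "f \<in> carrier (direct_sum I M)" "g \<in> carrier (direct_sum I M)" "h \<in> carrier (direct_sum I M)"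
      show "f \<oplus>\<^bsub>direct_sum I M\<^esub> g \<oplus>\<^bsub>direct_sum I M\<^esub> h = f \<oplus>\<^bsub>direct_sum I M\<^esub> (g \<oplus>\<^bsub>direct_sum I M\<^esub> h)"
        by (rule ext) (use f a_cl cl assoc in \<open>auto simp: app\<close>)
    next
      fix f g assume f: "f \<in> carrier (direct_sum I M)" "g \<in> carrier (direct_sum I M)"
      show "f \<oplus>\<^bsub>direct_sum I M\<^esub> g = g \<oplus>\<^bsub>direct_sum I M\<^esub> f"
        by (rule ext) (use f a_cl cl comm in \<open>auto simp: app\<close>)
    next
      fix f assume f: "f \<in> carrier (direct_sum I M)"
      show "\<zero>\<^bsub>direct_sum I M\<^esub> \<oplus>\<^bsub>direct_sum I M\<^esub> f = f"
        by (rule ext) (use f a_cl z_cl cl add_ax in \<open>auto simp: app\<close>)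
    qed (use a_cl z_cl in auto)
  next
    fix a b f assume f: "a \<in> carrier R" "b \<in> carrier R" "f \<in> carrier (direct_sum I M)"
    show "(a \<oplus>\<^bsub>R\<^esub> b) \<odot>\<^bsub>direct_sum I M\<^esub> f = a \<odot>\<^bsub>direct_sum I M\<^esub> f \<oplus>\<^bsub>direct_sum I M\<^esub> b \<odot>\<^bsub>direct_sum I M\<^esub> f"
      by (rule ext) (use f a_cl s_cl cl sm in \<open>auto simp: app\<close>)
    show "(a \<otimes>\<^bsub>R\<^esub> b) \<odot>\<^bsub>direct_sum I M\<^esub> f = a \<odot>\<^bsub>direct_sum I M\<^esub> (b \<odot>\<^bsub>direct_sum I M\<^esub> f)"
      by (rule ext) (use f a_cl s_cl cl sm in \<open>auto simp: app\<close>)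
  next
    fix a f g assume f: "a \<in> carrier R" "f \<in> carrier (direct_sum I M)" "g \<in> carrier (direct_sum I M)"
    show "a \<odot>\<^bsub>direct_sum I M\<^esub> (f \<oplus>\<^bsub>direct_sum I M\<^esub> g) =
        a \<odot>\<^bsub>direct_sum I M\<^esub> f \<oplus>\<^bsub>direct_sum I M\<^esub> a \<odot>\<^bsub>direct_sum I M\<^esub> g"
      by (rule ext) (use f a_cl s_cl cl sm in \<open>auto simp: app\<close>)
  next
    fix f assume f: "f \<in> carrier (direct_sum I M)"
    show "\<one>\<^bsub>R\<^esub> \<odot>\<^bsub>direct_sum I M\<^esub> f = f"
      by (rule ext) (use f s_cl cl ax1 in \<open>auto simp: app\<close>)
  qed (use s_cl R.is_cring in auto)
qed

section \<open>The graded module underlying the tensor coalgebra\<close>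

locale tensor_coalgebra = graded_module R V
  for R :: "('k, 'r) ring_scheme" (structure) and V :: "('k, 'a) graded_module" (structure)
begin

abbreviation "C \<equiv> T_co R V"
abbreviation "T n \<equiv> tensor_power R V n"
abbreviation "emb n \<equiv> T_co_inj R V n"
abbreviation "wd xs \<equiv> word_tensor R V xs"

text \<open>A word as an element of the coalgebra. Since the index 0 lies outside the direct sum,
  the empty word gives zero.\<close>

definition "W xs = emb (length xs) (wd xs)"

lemmas V_module = module_axioms
lemmas T_module = tensor_power_module[OF module_axioms]

lemma C_module: "module R C"
  unfolding T_co_def by (rule direct_sum_module) (use T_module R.is_cring in auto)

sublocale T: module R "T n" for n by (rule T_module)
sublocale C: module R C by (rule C_module)

lemma CC_two: "two_modules R C C" and TC_two: "two_modules R (T n) C" and CT_two: "two_modules R C (T n)"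
  and VC_two: "two_modules R V C"
  by (intro two_modulesI C_module T_module V_module)+

lemma C_carrier: "t \<in> carrier C \<longleftrightarrow> t \<in> (\<Pi>\<^sub>E n\<in>{1..}. carrier (T n)) \<and> finite {n \<in> {1..}. t n \<noteq> \<zero>\<^bsub>T n\<^esub>}"
  by (simp add: T_co_def direct_sum_simps)

lemma C_proj: "\<lbrakk>t \<in> carrier C; n \<ge> 1\<rbrakk> \<Longrightarrow> t n \<in> carrier (T n)"
  by (auto simp: C_carrier)

lemma C_finite: "t \<in> carrier C \<Longrightarrow> finite {n \<in> {1..}. t n \<noteq> \<zero>\<^bsub>T n\<^esub>}"
  by (simp add: C_carrier)

lemma C_eqI:
  assumes "s \<in> carrier C" "t \<in> carrier C" "\<And>n. n \<ge> 1 \<Longrightarrow> s n = t n"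
  shows "s = t"
  using assms by (auto simp: C_carrier intro: PiE_ext)

lemma proj_linear: "n \<ge> 1 \<Longrightarrow> (\<lambda>t. t n) \<in> linear_maps R C (T n)"
  by (rule linear_mapsI) (auto simp: C_proj, auto simp: T_co_def direct_sum_simps)

lemma emb_closed:
  assumes "n \<ge> 1" "x \<in> carrier (T n)"
  shows "emb n x \<in> carrier C"
proof -
  have "finite {m. (m = n \<longrightarrow> Suc 0 \<le> n \<and> x \<noteq> \<zero>\<^bsub>T n\<^esub>) \<and> m = n}"
    by (rule finite_subset[of _ "{n}"]) auto
  moreover have "{m \<in> {1..}. emb n x m \<noteq> \<zero>\<^bsub>T m\<^esub>} \<subseteq> {n}"
    by (auto simp: T_co_inj_def)
  ultimately show ?thesis
    using assms by (auto simp: C_carrier T_co_inj_def intro: finite_subset)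
qed

lemma emb_apply: "m \<ge> 1 \<Longrightarrow> emb n x m = (if m = n then x else \<zero>\<^bsub>T m\<^esub>)"
  by (simp add: T_co_inj_def)

lemma emb_linear:
  assumes n: "n \<ge> 1"
  shows "emb n \<in> linear_maps R (T n) C"
proof (rule linear_mapsI)
  show "emb n (x \<oplus>\<^bsub>T n\<^esub> y) = emb n x \<oplus>\<^bsub>C\<^esub> emb n y" if "x \<in> carrier (T n)" "y \<in> carrier (T n)" for x y
    by (rule C_eqI)
      (use that n in \<open>simp_all add: emb_closed emb_apply linear_maps_add[OF proj_linear]\<close>)
  show "emb n (a \<odot>\<^bsub>T n\<^esub> x) = a \<odot>\<^bsub>C\<^esub> emb n x" if "a \<in> carrier R" "x \<in> carrier (T n)" for a x
    by (rule C_eqI)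
      (use that n in \<open>simp_all add: emb_closed emb_apply linear_maps_smult[OF proj_linear]\<close>)
qed (use emb_closed n in auto)

lemma C_decomp:
  assumes t: "t \<in> carrier C"
  shows "t = (\<Oplus>\<^bsub>C\<^esub>n\<in>{n \<in> {1..}. t n \<noteq> \<zero>\<^bsub>T n\<^esub>}. emb n (t n))"
    (is "t = ?s")
proof (rule C_eqI[OF t])
  have cl: "emb n (t n) \<in> carrier C" if "n \<ge> 1" for n
    by (rule emb_closed[OF that C_proj[OF t that]])
  show "?s \<in> carrier C" using cl by (intro C.finsum_closed) auto
  fix m :: nat assume m: "m \<ge> 1"
  interpret two_modules R C "T m" by (rule CT_two)
  have "?s m = (\<Oplus>\<^bsub>T m\<^esub>n\<in>{n \<in> {1..}. t n \<noteq> \<zero>\<^bsub>T n\<^esub>}. emb n (t n) m)"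
    by (rule linear_maps_finsum[OF proj_linear[OF m]]) (use cl in auto)
  also have "\<dots> = t m"
  proof (cases "t m = \<zero>\<^bsub>T m\<^esub>")
    case True
    have "(\<Oplus>\<^bsub>T m\<^esub>n\<in>{n \<in> {1..}. t n \<noteq> \<zero>\<^bsub>T n\<^esub>}. emb n (t n) m) =
        (\<Oplus>\<^bsub>T m\<^esub>n\<in>{n \<in> {1..}. t n \<noteq> \<zero>\<^bsub>T n\<^esub>}. \<zero>\<^bsub>T m\<^esub>)"
      by (rule T.finsum_cong') (use m True in \<open>auto simp: emb_apply\<close>)
    then show ?thesis using True by simp
  next
    case False
    then show ?thesis
      using C_proj[OF t m] m
      by (subst T.finsum_single[OF C_finite[OF t], of m]) (auto simp: emb_apply)
  qed
  finally show "t m = ?s m" ..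
qed

lemma W_closed: "\<lbrakk>xs \<noteq> []; set xs \<subseteq> carrier V\<rbrakk> \<Longrightarrow> W xs \<in> carrier C"
  unfolding W_def by (intro emb_closed word_tensor_closed[OF V_module]) (auto simp: words_iff Suc_le_eq)

lemma W_linear:
  assumes "set us \<subseteq> carrier V" "set vs \<subseteq> carrier V"
  shows "(\<lambda>x. W (us @ x # vs)) \<in> linear_maps R V C"
  using linear_maps_comp[OF word_tensor_linear[OF V_module assms refl] emb_linear] by (simp add: W_def)

lemma C_span: "submodule_span R C (W ` {xs. xs \<noteq> [] \<and> set xs \<subseteq> carrier V}) = carrier C"
proof
  have sub: "W ` {xs. xs \<noteq> [] \<and> set xs \<subseteq> carrier V} \<subseteq> carrier C" by (auto simp: W_closed)
  let ?H = "submodule_span R C (W ` {xs. xs \<noteq> [] \<and> set xs \<subseteq> carrier V})"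
  note H = C.submodule_span_submodule[OF sub]
  show "?H \<subseteq> carrier C" by (rule C.submodule_span_carrier[OF sub])
  show "carrier C \<subseteq> ?H"
  proof
    fix t assume t: "t \<in> carrier C"
    have "emb n (t n) \<in> ?H" if n: "n \<ge> 1" for n
    proof (rule linear_maps_span_into[OF T_module C_module emb_linear[OF n] _ H])
      show "word_tensor R V ` words V n \<subseteq> carrier (T n)"
        using word_tensor_closed[OF V_module] by (rule image_subsetI)
      show "t n \<in> submodule_span R (T n) (word_tensor R V ` words V n)"
        unfolding tensor_power_span[OF V_module] by (rule C_proj[OF t n])
      show "emb n s \<in> ?H" if "s \<in> word_tensor R V ` words V n" for s
      proof -
        from that obtain xs where xs: "s = wd xs" "length xs = n" "set xs \<subseteq> carrier V"
          by (auto simp: words_iff)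
        have "W xs \<in> ?H"
          by (rule subsetD[OF C.submodule_span_superset], rule imageI) (use xs n in auto)
        then show ?thesis using xs by (simp add: W_def)
      qed
    qed
    then have "(\<Oplus>\<^bsub>C\<^esub>n\<in>{n \<in> {1..}. t n \<noteq> \<zero>\<^bsub>T n\<^esub>}. emb n (t n)) \<in> ?H"
      by (intro C.submodule_finsum[OF H]) auto
    then show "t \<in> ?H" by (simp only: C_decomp[OF t, symmetric])
  qed
qed

lemma C_linear_eqI:
  assumes "module R P" "f \<in> linear_maps R C P" "g \<in> linear_maps R C P"
    and "\<And>xs. \<lbrakk>xs \<noteq> []; set xs \<subseteq> carrier V\<rbrakk> \<Longrightarrow> f (W xs) = g (W xs)"
    and "t \<in> carrier C"
  shows "f t = g t"
  by (rule linear_maps_eq_on_span[OF C_module assms(1-3), of "W ` {xs. xs \<noteq> [] \<and> set xs \<subseteq> carrier V}"])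
    (use assms(4,5) W_closed C_span in auto)

text \<open>The universal property of the direct sum, with the lifted map written as a sum over the
  support, which is the form in which \<open>Phi_inv\<close> and \<open>neg_desuspension\<close> are
  defined.\<close>

lemma C_lift:
  assumes P: "module R P" and fs: "\<And>n. n \<ge> 1 \<Longrightarrow> fs n \<in> linear_maps R (T n) P"
  shows C_lift_linear: "(\<lambda>t. \<Oplus>\<^bsub>P\<^esub>n\<in>{n \<in> {1..}. t n \<noteq> \<zero>\<^bsub>T n\<^esub>}. fs n (t n)) \<in> linear_maps R C P"
    and C_lift_emb: "\<And>n x. \<lbrakk>n \<ge> 1; x \<in> carrier (T n)\<rbrakk> \<Longrightarrow>
      (\<Oplus>\<^bsub>P\<^esub>m\<in>{m \<in> {1..}. emb n x m \<noteq> \<zero>\<^bsub>T m\<^esub>}. fs m (emb n x m)) = fs n x"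
proof -
  interpret P: module R P by (rule P)
  let ?G = "\<lambda>t. \<Oplus>\<^bsub>P\<^esub>n\<in>{n \<in> {1..}. t n \<noteq> \<zero>\<^bsub>T n\<^esub>}. fs n (t n)"
  have f0: "fs n \<zero>\<^bsub>T n\<^esub> = \<zero>\<^bsub>P\<^esub>" if "n \<ge> 1" for n
  proof -
    interpret two_modules R "T n" P by (intro two_modulesI T_module P)
    show ?thesis by (rule linear_maps_0[OF fs[OF that]])
  qed
  have cl: "fs n (t n) \<in> carrier P" if "t \<in> carrier C" "n \<ge> 1" for n t
    by (rule linear_maps_closed[OF fs[OF that(2)] C_proj[OF that]])
  have G: "?G t = (\<Oplus>\<^bsub>P\<^esub>n\<in>S. fs n (t n))"
    if "t \<in> carrier C" "finite S" "{n \<in> {1..}. t n \<noteq> \<zero>\<^bsub>T n\<^esub>} \<subseteq> S" "S \<subseteq> {1..}" for t S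
    by (rule P.finsum_eq_superset) (use that f0 cl in auto)
  show "?G \<in> linear_maps R C P"
  proof (rule linear_mapsI)
    fix t assume t: "t \<in> carrier C"
    then show "?G t \<in> carrier P" by (intro P.finsum_closed) (auto simp: cl)
  next
    fix s t assume s: "s \<in> carrier C" and t: "t \<in> carrier C"
    let ?S = "{n \<in> {1..}. s n \<noteq> \<zero>\<^bsub>T n\<^esub>} \<union> {n \<in> {1..}. t n \<noteq> \<zero>\<^bsub>T n\<^esub>}"
    have S: "finite ?S" "?S \<subseteq> {1..}" using C_finite s t by auto
    have st: "s \<oplus>\<^bsub>C\<^esub> t \<in> carrier C" using s t by simp
    have app: "(s \<oplus>\<^bsub>C\<^esub> t) n = s n \<oplus>\<^bsub>T n\<^esub> t n" if "n \<ge> 1" for n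
      by (rule linear_maps_add[OF proj_linear[OF that] s t])
    have "?G (s \<oplus>\<^bsub>C\<^esub> t) = (\<Oplus>\<^bsub>P\<^esub>n\<in>?S. fs n ((s \<oplus>\<^bsub>C\<^esub> t) n))"
      by (rule G[OF st S(1) _ S(2)]) (auto simp: app)
    also have "\<dots> = (\<Oplus>\<^bsub>P\<^esub>n\<in>?S. fs n (s n) \<oplus>\<^bsub>P\<^esub> fs n (t n))"
      by (rule P.finsum_cong')
        (use cl s t in \<open>auto simp: app linear_maps_add[OF fs] C_proj\<close>)
    also have "\<dots> = (\<Oplus>\<^bsub>P\<^esub>n\<in>?S. fs n (s n)) \<oplus>\<^bsub>P\<^esub> (\<Oplus>\<^bsub>P\<^esub>n\<in>?S. fs n (t n))"
      by (rule P.finsum_addf) (use cl s t in auto)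
    also have "\<dots> = ?G s \<oplus>\<^bsub>P\<^esub> ?G t"
      using G[OF s S(1) Un_upper1 S(2)] G[OF t S(1) Un_upper2 S(2)] by simp
    finally show "?G (s \<oplus>\<^bsub>C\<^esub> t) = ?G s \<oplus>\<^bsub>P\<^esub> ?G t" .
  next
    fix a t assume a: "a \<in> carrier R" and t: "t \<in> carrier C"
    let ?S = "{n \<in> {1..}. t n \<noteq> \<zero>\<^bsub>T n\<^esub>}"
    have S: "finite ?S" "?S \<subseteq> {1..}" using C_finite t by auto
    have at: "a \<odot>\<^bsub>C\<^esub> t \<in> carrier C" using a t by simp
    have app: "(a \<odot>\<^bsub>C\<^esub> t) n = a \<odot>\<^bsub>T n\<^esub> t n" if "n \<ge> 1" for n
      by (rule linear_maps_smult[OF proj_linear[OF that] a t])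
    have "?G (a \<odot>\<^bsub>C\<^esub> t) = (\<Oplus>\<^bsub>P\<^esub>n\<in>?S. fs n ((a \<odot>\<^bsub>C\<^esub> t) n))"
      by (rule G[OF at S(1) _ S(2)]) (use a in \<open>auto simp: app\<close>)
    also have "\<dots> = (\<Oplus>\<^bsub>P\<^esub>n\<in>?S. a \<odot>\<^bsub>P\<^esub> fs n (t n))"
      by (rule P.finsum_cong')
        (use cl a t in \<open>auto simp: app linear_maps_smult[OF fs] C_proj\<close>)
    also have "\<dots> = a \<odot>\<^bsub>P\<^esub> ?G t"
      by (rule P.finsum_smult_ldistr[symmetric]) (use cl a t S in auto)
    finally show "?G (a \<odot>\<^bsub>C\<^esub> t) = a \<odot>\<^bsub>P\<^esub> ?G t" .
  qed
  show "(\<Oplus>\<^bsub>P\<^esub>m\<in>{m \<in> {1..}. emb n x m \<noteq> \<zero>\<^bsub>T m\<^esub>}. fs m (emb n x m)) = fs n x"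
    if n: "n \<ge> 1" "x \<in> carrier (T n)" for n x
  proof -
    have "?G (emb n x) = (\<Oplus>\<^bsub>P\<^esub>m\<in>{n}. fs m (emb n x m))"
      by (rule G[OF emb_closed[OF n]]) (use n in \<open>auto simp: emb_apply split: if_splits\<close>)
    also have "\<dots> = fs n x"
      using n linear_maps_closed[OF fs[OF n(1)] n(2)] by (simp add: P.finsum_insert emb_apply)
    finally show ?thesis .
  qed
qed

lemma T_graded: "graded_module R (T n)"
  by (rule tensor_power_graded[OF graded_module_axioms])

lemma C_grade: "t \<in> grade C d \<longleftrightarrow> t \<in> carrier C \<and> (\<forall>n\<ge>1. t n \<in> grade (T n) d)"
  unfolding T_co_def direct_sum_simps(5) by auto

lemma emb_grade:
  assumes "n \<ge> 1" "x \<in> grade (T n) d"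
  shows "emb n x \<in> grade C d"
proof -
  interpret T: graded_module R "T m" for m by (rule T_graded)
  show ?thesis
    using assms T.grade_closed T.grade_zero by (auto simp: C_grade emb_closed emb_apply)
qed

lemma word_grade: "homogeneous_word V xs ds \<Longrightarrow> wd xs \<in> grade (T (length xs)) (sum_list ds)"
  unfolding tensor_power_grade[OF V_module]
  by (rule subsetD[OF T.submodule_span_superset]) auto

lemma W_grade: "\<lbrakk>homogeneous_word V xs ds; xs \<noteq> []\<rbrakk> \<Longrightarrow> W xs \<in> grade C (sum_list ds)"
  unfolding W_def by (rule emb_grade[OF _ word_grade]) (auto simp: Suc_le_eq)

lemma C_graded: "graded_module R C"
proof (rule graded_moduleI[OF C_module])
  interpret T: graded_module R "T n" for n by (rule T_graded)
  show sub: "submodule (grade C d) R C" for d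
    unfolding C.submodule_iff
    using T.grade_add T.grade_smult T.grade_zero
    by (auto simp: C_grade linear_maps_add[OF proj_linear] linear_maps_smult[OF proj_linear]
        two_modules.linear_maps_0[OF CT_two proj_linear])
  have gsub: "(\<Union>i. grade C i) \<subseteq> carrier C" by (auto simp: C_grade)
  fix t assume t: "t \<in> carrier C"
  have "emb n (t n) \<in> submodule_span R C (\<Union>i. grade C i)" if n: "n \<ge> 1" for n
  proof (rule linear_maps_span_into[OF T_module C_module emb_linear[OF n] T.grade_Union_subset
        C.submodule_span_submodule[OF gsub]])
    show "t n \<in> submodule_span R (T n) (\<Union>i. grade (T n) i)"
      using C_proj[OF t n] by (simp add: T.grade_span)
    show "emb n s \<in> submodule_span R C (\<Union>i. grade C i)" if "s \<in> (\<Union>i. grade (T n) i)" for s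
    proof -
      from that obtain i where "s \<in> grade (T n) i" by auto
      then have "emb n s \<in> (\<Union>i. grade C i)" using emb_grade[OF n] by auto
      then show ?thesis by (rule subsetD[OF C.submodule_span_superset])
    qed
  qed
  then have "(\<Oplus>\<^bsub>C\<^esub>n\<in>{n \<in> {1..}. t n \<noteq> \<zero>\<^bsub>T n\<^esub>}. emb n (t n)) \<in> submodule_span R C (\<Union>i. grade C i)"
    by (intro C.submodule_finsum[OF C.submodule_span_submodule[OF gsub]]) auto
  then show "t \<in> submodule_span R C (\<Union>i. grade C i)" by (simp only: C_decomp[OF t, symmetric])
next
  interpret T: graded_module R "T n" for n by (rule T_graded)
  fix c i
  assume c: "\<And>i. c i \<in> grade C i" and fin: "finite {i. c i \<noteq> \<zero>\<^bsub>C\<^esub>}"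
    and sum: "(\<Oplus>\<^bsub>C\<^esub>i\<in>{i. c i \<noteq> \<zero>\<^bsub>C\<^esub>}. c i) = \<zero>\<^bsub>C\<^esub>"
  have cC: "c i \<in> carrier C" for i using c by (simp add: C_grade)
  show "c i = \<zero>\<^bsub>C\<^esub>"
  proof (rule C_eqI[OF cC C.zero_closed])
    fix n :: nat assume n: "n \<ge> 1"
    interpret two_modules R C "T n" by (rule CT_two)
    have z: "\<zero>\<^bsub>C\<^esub> n = \<zero>\<^bsub>T n\<^esub>" by (rule linear_maps_0[OF proj_linear[OF n]])
    have "\<zero>\<^bsub>T n\<^esub> = (\<Oplus>\<^bsub>C\<^esub>i\<in>{i. c i \<noteq> \<zero>\<^bsub>C\<^esub>}. c i) n" by (simp add: sum z)
    also have "\<dots> = (\<Oplus>\<^bsub>T n\<^esub>i\<in>{i. c i \<noteq> \<zero>\<^bsub>C\<^esub>}. c i n)"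
      by (rule linear_maps_finsum[OF proj_linear[OF n]]) (rule cC)
    finally have "component (T n) \<zero>\<^bsub>T n\<^esub> = (\<lambda>i. c i n)"
      by (intro T.component_unique[OF _ fin]) (use c n z in \<open>auto simp: C_grade\<close>)
    then have "c i n = component (T n) \<zero>\<^bsub>T n\<^esub> i" by simp
    also have "\<dots> = \<zero>\<^bsub>T n\<^esub>" using T.component_homogeneous[OF T.grade_zero[of n i]] by simp
    finally show "c i n = \<zero>\<^bsub>C\<^esub> n" by (simp add: z)
  qed
qed

text \<open>Degrees of maps out of the coalgebra are decided by homogeneous words: each summand is
  spanned in each degree by such words, and the grades of the target are closed under linear
  combinations.\<close>

lemma C_Hom_degI:
  assumes P: "module R P" and f: "f \<in> linear_maps R C P" and sub: "\<And>d. submodule (grade P d) R P"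
    and W: "\<And>xs ds. \<lbrakk>homogeneous_word V xs ds; xs \<noteq> []\<rbrakk> \<Longrightarrow> f (W xs) \<in> grade P (sum_list ds + e)"
  shows "f \<in> Hom_deg R C P e"
  unfolding Hom_deg_def
proof (intro CollectI conjI allI ballI f)
  fix d t assume t: "t \<in> grade C d"
  then have tC: "t \<in> carrier C" and tn: "\<And>n. n \<ge> 1 \<Longrightarrow> t n \<in> grade (T n) d" by (auto simp: C_grade)
  interpret two_modules R C P by (intro two_modulesI C_module P)
  have "f (emb n (t n)) \<in> grade P (d + e)" if n: "n \<ge> 1" for n
  proof (rule linear_maps_span_into[OF T_module P linear_maps_comp[OF emb_linear[OF n] f] _ sub])
    let ?S = "{wd xs | xs. length xs = n \<and> (\<exists>ds. homogeneous_word V xs ds \<and> sum_list ds = d)}"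
    show "?S \<subseteq> carrier (T n)"
      using homogeneous_word_closed by (auto intro!: word_tensor_closed[OF V_module] simp: words_iff)
    show "t n \<in> submodule_span R (T n) ?S"
      using tn[OF n] by (simp add: tensor_power_grade[OF V_module])
    show "f (emb n s) \<in> grade P (d + e)" if "s \<in> ?S" for s
      using that W n by (auto simp: Suc_le_eq W_def)
  qed
  then have "(\<Oplus>\<^bsub>P\<^esub>n\<in>{n \<in> {1..}. t n \<noteq> \<zero>\<^bsub>T n\<^esub>}. f (emb n (t n))) \<in> grade P (d + e)"
    by (intro N.submodule_finsum[OF sub]) auto
  moreover have "f t = (\<Oplus>\<^bsub>P\<^esub>n\<in>{n \<in> {1..}. t n \<noteq> \<zero>\<^bsub>T n\<^esub>}. f (emb n (t n)))"
    by (subst C_decomp[OF tC], rule linear_maps_finsum[OF f]) (use emb_closed C_proj[OF tC] in auto)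
  ultimately show "f t \<in> grade P (d + e)" by simp
qed

end

lemma finsum_ground:
  assumes "cring R" "\<And>i. i \<in> I \<Longrightarrow> f i \<in> carrier R"
  shows "finsum (ground R) f I = finsum R f I"
proof -
  interpret R: cring R by fact
  interpret G: module R "ground R" by (rule R.ground_module)
  show ?thesis
  proof (cases "finite I")
    case True
    then show ?thesis using assms(2)
      by (induction I rule: finite_induct) (auto simp: G.finsum_insert R.finsum_insert Pi_def)
  qed (simp add: G.finsum_infinite R.finsum_infinite)
qed

section \<open>Comultiplication and coassociativity\<close>

context tensor_coalgebra
begin

abbreviation "C2 \<equiv> tensor R C C"
abbreviation "pure2 \<equiv> pure_tensor R C C"
abbreviation "\<Delta> \<equiv> T_co_comult R V"

lemma C2_module: "module R C2" by (rule tensor_module[OF C_module C_module])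

sublocale C2: module R C2 by (rule C2_module)

lemma C_C2: "two_modules R C C2" and T_C2: "two_modules R (T n) C2"
  by (intro two_modulesI C_module C2_module T_module)+

lemma pure2_closed: "\<lbrakk>x \<in> carrier C; y \<in> carrier C\<rbrakk> \<Longrightarrow> pure2 x y \<in> carrier C2"
  by (rule pure_tensor_closed[OF C_module C_module])

lemmas pure2_left = pure_tensor_linear_left[OF C_module C_module]
lemmas pure2_right = pure_tensor_linear_right[OF C_module C_module]

lemma set_take_drop:
  assumes "set xs \<subseteq> carrier V"
  shows "set (take n xs) \<subseteq> carrier V" "set (drop n xs) \<subseteq> carrier V"
  using assms by (auto dest: in_set_takeD in_set_dropD)

lemma W_take: "\<lbrakk>set xs \<subseteq> carrier V; 1 \<le> p; p \<le> length xs\<rbrakk> \<Longrightarrow> W (take p xs) \<in> carrier C"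
  by (rule W_closed) (auto dest: in_set_takeD)

lemma W_drop: "\<lbrakk>set xs \<subseteq> carrier V; p < length xs\<rbrakk> \<Longrightarrow> W (drop p xs) \<in> carrier C"
  by (rule W_closed) (auto dest: in_set_dropD)

text \<open>Each slot lies on exactly one side of the cut, so only one of the two factors varies
  with it.\<close>

lemma deconcatenation_multilinear:
  assumes p: "1 \<le> p" "p < n"
  shows "multilinear R V C2 n (\<lambda>xs. pure2 (emb p (wd (take p xs))) (emb (n - p) (wd (drop p xs))))"
  unfolding multilinear_def
proof (intro conjI ballI allI impI)
  have c: "emb m (wd xs) \<in> carrier C" if "set xs \<subseteq> carrier V" "length xs = m" "1 \<le> m" for m xs
    using that W_closed[of xs] by (auto simp: W_def Suc_le_eq)
  show "pure2 (emb p (wd (take p xs))) (emb (n - p) (wd (drop p xs))) \<in> carrier C2" if "xs \<in> words V n" for xs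
    using that p by (intro pure2_closed c) (auto simp: words_iff dest: in_set_takeD in_set_dropD)
  fix us vs
  assume us: "set us \<subseteq> carrier V" "set vs \<subseteq> carrier V" and n: "Suc (length us + length vs) = n"
  show "(\<lambda>x. pure2 (emb p (wd (take p (us @ x # vs)))) (emb (n - p) (wd (drop p (us @ x # vs)))))
      \<in> linear_maps R V C2"
  proof (cases "length us < p")
    case True
    then obtain q where q: "p = Suc (length us + q)" using less_imp_Suc_add by blast
    have "(\<lambda>x. emb p (wd (us @ x # take q vs))) \<in> linear_maps R V C"
      using W_linear[OF us(1) set_take_drop(1)[OF us(2)], of q] q n p by (simp add: W_def)
    moreover have "emb (n - p) (wd (drop q vs)) \<in> carrier C"
      using q n p us by (intro c set_take_drop) auto
    ultimately show ?thesis
      using linear_maps_comp[OF _ pure2_left] q by simp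
  next
    case False
    have len: "Suc (length us - p + length vs) = n - p" using False n by auto
    have "(\<lambda>x. emb (n - p) (wd (drop p us @ x # vs))) \<in> linear_maps R V C"
      using W_linear[OF set_take_drop(2)[OF us(1)] us(2), of p] False len by (simp add: W_def)
    moreover have "emb p (wd (take p us)) \<in> carrier C"
      using False n p us by (intro c set_take_drop) auto
    ultimately show ?thesis
      using linear_maps_comp[OF _ pure2_right] False by simp
  qed
qed

lemma comult: "\<Delta> \<in> linear_maps R C C2 \<and> (\<forall>xs. xs \<noteq> [] \<longrightarrow> set xs \<subseteq> carrier V \<longrightarrow>
  \<Delta> (W xs) = (\<Oplus>\<^bsub>C2\<^esub>p\<in>{1..<length xs}. pure2 (W (take p xs)) (W (drop p xs))))"
proof -
  let ?\<phi> = "\<lambda>n p xs. pure2 (emb p (wd (take p xs))) (emb (n - p) (wd (drop p xs)))"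
  let ?Q = "\<lambda>n p G. G \<in> linear_maps R (T n) C2 \<and> (\<forall>xs\<in>words V n. G (wd xs) = ?\<phi> n p xs)"
  \<comment> \<open>One lift is chosen for each length and each cut; their sum over the cuts is then
    assembled over all lengths.\<close>
  define G where "G n p = (SOME G. ?Q n p G)" for n p
  have GQ: "?Q n p (G n p)" if np: "1 \<le> p" "p < n" for n p
  proof -
    have "\<exists>G. ?Q n p G"
      using tensor_power_lift[OF V_module C2_module deconcatenation_multilinear[OF np]] by (simp only: Bex_def)
    then show ?thesis unfolding G_def by (rule someI_ex)
  qed
  then have G: "\<And>n p. \<lbrakk>1 \<le> p; p < n\<rbrakk> \<Longrightarrow> G n p \<in> linear_maps R (T n) C2"
    "\<And>n p xs. \<lbrakk>1 \<le> p; p < n; xs \<in> words V n\<rbrakk> \<Longrightarrow> G n p (wd xs) = ?\<phi> n p xs"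
    by auto
  define g where "g n x = (\<Oplus>\<^bsub>C2\<^esub>p\<in>{1..<n}. G n p x)" for n x
  have g: "g n \<in> linear_maps R (T n) C2" for n
    unfolding g_def by (rule two_modules.linear_maps_sum[OF T_C2]) (use G(1) in auto)
  define D where "D t = (\<Oplus>\<^bsub>C2\<^esub>n\<in>{n \<in> {1..}. t n \<noteq> \<zero>\<^bsub>T n\<^esub>}. g n (t n))" for t
  have D: "D \<in> linear_maps R C C2"
    unfolding D_def by (rule C_lift_linear[OF C2_module g])
  have pc: "?\<phi> n p xs \<in> carrier C2" if "1 \<le> p" "p < n" "xs \<in> words V n" for n p xs
    using deconcatenation_multilinear[OF that(1,2)] that(3) by (simp add: multilinear_def)
  have DW: "D (emb n (wd xs)) = (\<Oplus>\<^bsub>C2\<^esub>p\<in>{1..<n}. ?\<phi> n p xs)" if "n \<ge> 1" "xs \<in> words V n" for n xs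
  proof -
    have "D (emb n (wd xs)) = g n (wd xs)"
      unfolding D_def by (rule C_lift_emb[OF C2_module g that(1) word_tensor_closed[OF V_module that(2)]])
    also have "\<dots> = (\<Oplus>\<^bsub>C2\<^esub>p\<in>{1..<n}. ?\<phi> n p xs)"
      unfolding g_def by (rule C2.finsum_cong') (use G(2) that pc in auto)
    finally show ?thesis .
  qed
  have sub: "W ` {xs. xs \<noteq> [] \<and> set xs \<subseteq> carrier V} \<subseteq> carrier C" by (auto simp: W_closed)
  have wcl: "emb n (wd xs) \<in> carrier C" if "n \<ge> 1" "xs \<in> words V n" for n xs
    by (rule emb_closed[OF that(1) word_tensor_closed[OF V_module that(2)]])
  have main: "\<Delta> \<in> linear_maps R C C2 \<and> (\<forall>t\<in>carrier C. \<Delta> t = D t)"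
    unfolding T_co_comult_def Let_def
  proof (rule the_linear_map_eq[OF C_module C2_module sub C_span D], goal_cases)
    case (1 F)
    show ?case
    proof (intro allI impI ballI)
      fix n xs assume n: "n \<ge> 1" "xs \<in> words V n"
      show "F (emb n (wd xs)) = (\<Oplus>\<^bsub>C2\<^esub>p\<in>{1..<n}. ?\<phi> n p xs)"
        using 1[OF wcl[OF n]] DW[OF n] by simp
    qed
  next
    case (2 F s)
    then obtain xs where xs: "s = W xs" "xs \<noteq> []" "set xs \<subseteq> carrier V" by auto
    then have "length xs \<ge> 1" "xs \<in> words V (length xs)" by (auto simp: words_iff Suc_le_eq)
    then show ?case using 2(2) DW xs(1) by (simp add: W_def)
  qed
  have "\<Delta> (W xs) = (\<Oplus>\<^bsub>C2\<^esub>p\<in>{1..<length xs}. pure2 (W (take p xs)) (W (drop p xs)))"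
    if xs: "xs \<noteq> []" "set xs \<subseteq> carrier V" for xs
  proof -
    have "\<Delta> (W xs) = (\<Oplus>\<^bsub>C2\<^esub>p\<in>{1..<length xs}. ?\<phi> (length xs) p xs)"
      using main W_closed[OF xs] DW[of "length xs" xs] xs by (simp add: words_iff Suc_le_eq W_def)
    also have "\<dots> = (\<Oplus>\<^bsub>C2\<^esub>p\<in>{1..<length xs}. pure2 (W (take p xs)) (W (drop p xs)))"
    proof (rule C2.finsum_cong'[OF refl])
      show "?\<phi> (length xs) p xs = pure2 (W (take p xs)) (W (drop p xs))" if "p \<in> {1..<length xs}" for p
        using that by (simp add: W_def)
    qed (use xs in \<open>auto intro!: pure2_closed W_take W_drop\<close>)
    finally show ?thesis .
  qed
  then show ?thesis using main by blast
qed

lemma comult_linear: "\<Delta> \<in> linear_maps R C C2"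
  and comult_W: "\<lbrakk>xs \<noteq> []; set xs \<subseteq> carrier V\<rbrakk> \<Longrightarrow>
    \<Delta> (W xs) = (\<Oplus>\<^bsub>C2\<^esub>p\<in>{1..<length xs}. pure2 (W (take p xs)) (W (drop p xs)))"
  using comult by blast+

lemma linear_comult_W:
  assumes P: "module R P" and f: "f \<in> linear_maps R C2 P" and xs: "xs \<noteq> []" "set xs \<subseteq> carrier V"
  shows "f (\<Delta> (W xs)) = (\<Oplus>\<^bsub>P\<^esub>p\<in>{1..<length xs}. f (pure2 (W (take p xs)) (W (drop p xs))))"
proof -
  interpret two_modules R C2 P by (intro two_modulesI C2_module P)
  show ?thesis
    unfolding comult_W[OF xs] by (rule linear_maps_finsum[OF f]) (use xs in \<open>auto intro!: pure2_closed W_take W_drop\<close>)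
qed

lemma comult_degree: "\<Delta> \<in> Hom_deg R C C2 0"
proof (rule C_Hom_degI[OF C2_module comult_linear])
  let ?S = "\<lambda>n. {pure2 x y | x y. \<exists>i j. x \<in> grade C i \<and> y \<in> grade C j \<and> i + j = n}"
  interpret gC: graded_module R C by (rule C_graded)
  have S: "?S n \<subseteq> carrier C2" for n using gC.grade_closed by (auto intro!: pure2_closed)
  show sub: "submodule (grade C2 d) R C2" for d
    unfolding tensor_grade[OF C_module C_module] by (rule C2.submodule_span_submodule[OF S])
  fix xs ds assume xs: "homogeneous_word V xs ds" "xs \<noteq> []"
  have sV: "set xs \<subseteq> carrier V" by (rule homogeneous_word_closed[OF xs(1)])
  show "\<Delta> (W xs) \<in> grade C2 (sum_list ds + 0)"
    unfolding comult_W[OF xs(2) sV]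
  proof (rule C2.submodule_finsum[OF sub])
    fix p assume p: "p \<in> {1..<length xs}"
    have "sum_list (take p ds) + sum_list (drop p ds) = sum_list ds"
      by (metis append_take_drop_id sum_list_append)
    moreover have "W (take p xs) \<in> grade C (sum_list (take p ds))"
      by (rule W_grade[OF homogeneous_word_take[OF xs(1)]]) (use p in auto)
    moreover have "W (drop p xs) \<in> grade C (sum_list (drop p ds))"
      by (rule W_grade[OF homogeneous_word_drop[OF xs(1)]]) (use p in auto)
    ultimately show "pure2 (W (take p xs)) (W (drop p xs)) \<in> grade C2 (sum_list ds + 0)"
      unfolding tensor_grade[OF C_module C_module]
      by (intro subsetD[OF C2.submodule_span_superset]) auto
  qed
qed

lemma sgn_C_even: "even e \<Longrightarrow> x \<in> carrier C \<Longrightarrow> sgn_map R C e x = x"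
  by (rule graded_module.sgn_map_even[OF C_graded])

lemma linear_id: "id \<in> linear_maps R C C"
  using linear_maps_id by (simp add: id_def)

text \<open>Both iterated comultiplications run over all ways to cut a word in two places. The left
  one finds the later cut first, the right one the earlier cut.\<close>

lemma coassociative:
  assumes t: "t \<in> carrier C"
  shows "associator R C C C (tensor_map R C C C2 C 0 \<Delta> id (\<Delta> t)) = tensor_map R C C C C2 0 id \<Delta> (\<Delta> t)"
proof -
  let ?C3 = "tensor R C C2" and ?C3' = "tensor R C2 C"
  have C3: "module R ?C3" and C3': "module R ?C3'" by (intro tensor_module C_module C2_module)+
  interpret C3: module R ?C3 by (rule C3)
  let ?L = "tensor_map R C C C2 C 0 \<Delta> id" and ?R = "tensor_map R C C C C2 0 id \<Delta>"
  note a = associator_linear[OF C_module C_module C_module]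
  note L = tensor_map_linear[OF C_graded C_module C2_module C_module comult_linear linear_id, of 0]
  note Rr = tensor_map_linear[OF C_graded C_module C_module C2_module linear_id comult_linear, of 0]
  let ?p = "\<lambda>x y z. pure_tensor R C C2 x (pure2 y z)"
  have pc: "?p x y z \<in> carrier ?C3" if "x \<in> carrier C" "y \<in> carrier C" "z \<in> carrier C" for x y z
    by (intro pure_tensor_closed[OF C_module C2_module] pure2_closed that)
  show ?thesis
  proof (rule C_linear_eqI[OF C3 linear_maps_comp[OF linear_maps_comp[OF comult_linear L] a]
        linear_maps_comp[OF comult_linear Rr] _ t])
    fix xs assume xs: "xs \<noteq> []" "set xs \<subseteq> carrier V"
    let ?n = "length xs"
    have "associator R C C C (?L (\<Delta> (W xs))) =
        (\<Oplus>\<^bsub>?C3\<^esub>p\<in>{1..<?n}. associator R C C C (?L (pure2 (W (take p xs)) (W (drop p xs)))))"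
      by (rule linear_comult_W[OF C3 linear_maps_comp[OF L a] xs])
    also have "\<dots> = (\<Oplus>\<^bsub>?C3\<^esub>p\<in>{1..<?n}. \<Oplus>\<^bsub>?C3\<^esub>q\<in>{1..<p}.
        ?p (W (take q xs)) (W (drop q (take p xs))) (W (drop p xs)))"
    proof (rule C3.finsum_cong')
      fix p assume p: "p \<in> {1..<?n}"
      have tp: "take p xs \<noteq> []" "set (take p xs) \<subseteq> carrier V" "length (take p xs) = p"
        using p xs by (auto dest: in_set_takeD)
      have d: "W (drop p xs) \<in> carrier C" by (rule W_drop) (use p xs in auto)
      interpret CC3: two_modules R C2 ?C3 by (intro two_modulesI C2_module C3)
      note lin = linear_maps_comp[OF pure_tensor_linear_left[OF C2_module C_module d] a]
      have "associator R C C C (?L (pure2 (W (take p xs)) (W (drop p xs)))) =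
          associator R C C C (pure_tensor R C2 C (\<Delta> (W (take p xs))) (W (drop p xs)))"
        using tensor_map_pure[OF C_graded C_module C2_module C_module comult_linear linear_id W_closed[OF tp(1,2)] d, of 0]
        by (simp add: sgn_C_even W_closed[OF tp(1,2)])
      also have "\<dots> = (\<Oplus>\<^bsub>?C3\<^esub>q\<in>{1..<p}. associator R C C C
          (pure_tensor R C2 C (pure2 (W (take q (take p xs))) (W (drop q (take p xs)))) (W (drop p xs))))"
        using linear_comult_W[OF C3 lin tp(1,2)] tp(3) by simp
      also have "\<dots> = (\<Oplus>\<^bsub>?C3\<^esub>q\<in>{1..<p}. ?p (W (take q xs)) (W (drop q (take p xs))) (W (drop p xs)))"
      proof (rule C3.finsum_cong')
        fix q assume q: "q \<in> {1..<p}"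
        have "W (take q xs) \<in> carrier C" "W (drop q (take p xs)) \<in> carrier C"
          using W_take[OF xs(2), of q] W_drop[OF tp(2), of q] p q tp(3) by auto
        then show "associator R C C C (pure_tensor R C2 C (pure2 (W (take q (take p xs))) (W (drop q (take p xs)))) (W (drop p xs))) =
            ?p (W (take q xs)) (W (drop q (take p xs))) (W (drop p xs))"
          using associator_pure[OF C_module C_module C_module _ _ d] p q by (simp add: min_absorb1)
      qed (use p xs d W_take[OF xs(2)] W_drop[OF tp(2)] tp(3) in \<open>auto intro!: pc\<close>)
      finally show "associator R C C C (?L (pure2 (W (take p xs)) (W (drop p xs)))) =
          (\<Oplus>\<^bsub>?C3\<^esub>q\<in>{1..<p}. ?p (W (take q xs)) (W (drop q (take p xs))) (W (drop p xs)))" .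
    next
      show "(\<lambda>p. \<Oplus>\<^bsub>?C3\<^esub>q\<in>{1..<p}. ?p (W (take q xs)) (W (drop q (take p xs))) (W (drop p xs))) \<in> {1..<?n} \<rightarrow> carrier ?C3"
        using xs by (auto intro!: C3.finsum_closed pc W_take W_drop dest: in_set_takeD)
    qed simp
    also have "\<dots> = finsum ?C3 (\<lambda>(p, q). ?p (W (take q xs)) (W (drop q (take p xs))) (W (drop p xs)))
        (Sigma {1..<?n} (\<lambda>p. {1..<p}))"
      by (rule C3.finsum_Sigma)
        (use xs in \<open>auto intro!: pc W_take W_drop dest: in_set_takeD\<close>)
    also have "\<dots> = finsum ?C3 (\<lambda>(p, q). ?p (W (take p xs)) (W (take q (drop p xs))) (W (drop (p + q) xs)))
        (Sigma {1..<?n} (\<lambda>p. {1..<?n - p}))"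
    \<comment> \<open>A pair of cuts q < p is encoded on the right by the earlier cut q and the
      length p - q of the middle piece.\<close>
    proof (rule C3.finsum_bij_betw[where \<sigma> = "\<lambda>(p, q). (q, p - q)"])
      show "bij_betw (\<lambda>(p, q). (q, p - q)) (Sigma {1..<?n} (\<lambda>p. {1..<p})) (Sigma {1..<?n} (\<lambda>p. {1..<?n - p}))"
        by (rule bij_betw_byWitness[where f' = "\<lambda>(p, q). (p + q, p)"]) auto
    qed (use xs in \<open>auto intro!: pc W_take W_drop simp: drop_take dest: in_set_dropD\<close>)
    also have "\<dots> = (\<Oplus>\<^bsub>?C3\<^esub>p\<in>{1..<?n}. \<Oplus>\<^bsub>?C3\<^esub>q\<in>{1..<?n - p}.
        ?p (W (take p xs)) (W (take q (drop p xs))) (W (drop (p + q) xs)))"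
      by (rule C3.finsum_Sigma[symmetric])
        (use xs in \<open>auto intro!: pc W_take W_drop dest: in_set_dropD\<close>)
    also have "\<dots> = (\<Oplus>\<^bsub>?C3\<^esub>p\<in>{1..<?n}. ?R (pure2 (W (take p xs)) (W (drop p xs))))"
    proof (rule C3.finsum_cong'[symmetric])
      fix p assume p: "p \<in> {1..<?n}"
      have dp: "drop p xs \<noteq> []" "set (drop p xs) \<subseteq> carrier V" "length (drop p xs) = ?n - p"
        using p xs by (auto dest: in_set_dropD)
      have w: "W (take p xs) \<in> carrier C" by (rule W_take) (use p xs in auto)
      have "?R (pure2 (W (take p xs)) (W (drop p xs))) = pure_tensor R C C2 (W (take p xs)) (\<Delta> (W (drop p xs)))"
        using tensor_map_pure[OF C_graded C_module C_module C2_module linear_id comult_linear w W_closed[OF dp(1,2)], of 0]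
        using sgn_C_even[OF _ w, of 0] by simp
      also have "\<dots> = (\<Oplus>\<^bsub>?C3\<^esub>q\<in>{1..<?n - p}. ?p (W (take p xs)) (W (take q (drop p xs))) (W (drop q (drop p xs))))"
        using linear_comult_W[OF C3 pure_tensor_linear_right[OF C_module C2_module w] dp(1,2)] dp(3) by simp
      finally show "?R (pure2 (W (take p xs)) (W (drop p xs))) = (\<Oplus>\<^bsub>?C3\<^esub>q\<in>{1..<?n - p}.
        ?p (W (take p xs)) (W (take q (drop p xs))) (W (drop (p + q) xs)))"
        by (simp add: add.commute)
    qed (use xs in \<open>auto intro!: C3.finsum_closed pc W_take W_drop dest: in_set_dropD\<close>)
    also have "\<dots> = ?R (\<Delta> (W xs))"
      by (rule linear_comult_W[OF C3 Rr xs, symmetric])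
    finally show "associator R C C C (?L (\<Delta> (W xs))) = ?R (\<Delta> (W xs))" .
  qed
qed

lemma graded_coalgebra: "graded_coalgebra R C \<Delta>"
  unfolding graded_coalgebra_def using C_graded comult_degree coassociative by simp

text \<open>Degrees add up along a word, so the sign of a word is the product of the signs of its
  letters. This expresses the Koszul sign in the tensor product of the identity with the
  coderivation by twisting the letters of the first factor.\<close>

lemma sgn_map_W:
  assumes xs: "xs \<noteq> []" "set xs \<subseteq> carrier V"
  shows "sgn_map R C e (W xs) = W (map (sgn_map R V e) xs)"
proof -
  interpret gC: graded_module R C by (rule C_graded)
  let ?n = "length xs"
  have n: "?n \<ge> 1" using xs by (simp add: Suc_le_eq)
  let ?g = "\<lambda>x. emb ?n (tensor_power_map R V V ?n (sgn_map R V e) x)"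
  have g: "?g \<in> linear_maps R (T ?n) C"
    by (rule linear_maps_comp[OF tensor_power_map_linear[OF V_module V_module sgn_map_linear] emb_linear[OF n]])
  have "sgn_map R C e (W xs) = ?g (wd xs)"
    unfolding W_def
  proof (rule tensor_power_linear_eqI[OF V_module grade_Union_subset grade_span C_module
        linear_maps_comp[OF emb_linear[OF n] gC.sgn_map_linear] g])
    fix ys assume ys: "length ys = ?n" "set ys \<subseteq> (\<Union>i. grade V i)"
    then obtain ds where ds: "homogeneous_word V ys ds" using homogeneous_word_exists by blast
    have yV: "set ys \<subseteq> carrier V" by (rule homogeneous_word_closed[OF ds])
    have yn: "ys \<noteq> []" using ys(1) n by auto
    have yw: "ys \<in> words V ?n" using ys yV by (simp add: words_iff)
    have "?g (wd ys) = emb ?n (wd (map (sgn_map R V e) ys))"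
      by (simp add: tensor_power_map_word[OF V_module V_module sgn_map_linear yw])
    also have "wd (map (sgn_map R V e) ys) = koszul_sign R (e * sum_list ds) \<odot>\<^bsub>T ?n\<^esub> wd ys"
      using word_tensor_map_sgn[OF V_module linear_maps_id ds, of "[]" "[]" ?n e] ys by simp
    also have "emb ?n \<dots> = koszul_sign R (e * sum_list ds) \<odot>\<^bsub>C\<^esub> emb ?n (wd ys)"
      by (rule linear_maps_smult[OF emb_linear[OF n] _ word_tensor_closed[OF V_module yw]]) simp
    also have "\<dots> = sgn_map R C e (emb ?n (wd ys))"
      using gC.sgn_map_homogeneous[OF W_grade[OF ds yn], of e] ys(1) by (simp add: W_def)
    finally show "sgn_map R C e (emb ?n (wd ys)) = ?g (wd ys)" ..
  qed (use xs in \<open>auto intro!: word_tensor_closed[OF V_module] simp: words_iff\<close>)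
  also have "\<dots> = W (map (sgn_map R V e) xs)"
    using xs by (subst tensor_power_map_word[OF V_module V_module sgn_map_linear]) (auto simp: words_iff W_def)
  finally show ?thesis .
qed

end

section \<open>The coderivation of a cochain of degree -1\<close>

text \<open>A pair (j, i) stands for the nonempty block of i consecutive letters that starts at
  position j.\<close>

definition blocks :: "nat \<Rightarrow> (nat \<times> nat) set"
  where "blocks n = {(j, i). 1 \<le> i \<and> j + i \<le> n}"

lemma blocks_iff: "(j, i) \<in> blocks n \<longleftrightarrow> 1 \<le> i \<and> j + i \<le> n"
  by (simp add: blocks_def)

lemma finite_blocks [simp]: "finite (blocks n)"
  by (rule finite_subset[of _ "{..n} \<times> {..n}"]) (auto simp: blocks_def)

locale odd_cochain = tensor_coalgebra R V
  for R :: "('k, 'r) ring_scheme" (structure) and V :: "('k, 'a) graded_module" (structure) +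
  fixes f :: "('k, 'a, 'a) cochain"
  assumes cochain: "n \<ge> 1 \<Longrightarrow> f n \<in> Hom_deg R (T n) V (- 1)"
begin

abbreviation "\<tau> \<equiv> sgn_map R V (- 1)"
abbreviation "d \<equiv> Phi_inv R V (- 1) f"

definition "F ys = f (length ys) (wd ys)"

text \<open>The effect of the cochain on one block of a word, with the Koszul sign of moving it past
  the letters on the left absorbed into \<open>\<tau>\<close>.\<close>

definition "ins xs j i = map \<tau> (take j xs) @ F (take i (drop j xs)) # drop (j + i) xs"

lemma f_linear: "n \<ge> 1 \<Longrightarrow> f n \<in> linear_maps R (T n) V"
  using cochain by (simp add: Hom_deg_def)

lemma F_closed: "\<lbrakk>ys \<noteq> []; set ys \<subseteq> carrier V\<rbrakk> \<Longrightarrow> F ys \<in> carrier V"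
  unfolding F_def
  by (rule linear_maps_closed[OF f_linear word_tensor_closed[OF V_module]]) (auto simp: words_iff Suc_le_eq)

lemma F_linear:
  assumes "set us \<subseteq> carrier V" "set vs \<subseteq> carrier V"
  shows "(\<lambda>x. F (us @ x # vs)) \<in> linear_maps R V V"
  using linear_maps_comp[OF word_tensor_linear[OF V_module assms refl] f_linear] by (simp add: F_def)

lemma F_grade:
  assumes "homogeneous_word V ys ds" "ys \<noteq> []"
  shows "F ys \<in> grade V (sum_list ds - 1)"
  using cochain[of "length ys"] word_grade[OF assms(1)] assms(2) by (simp add: Hom_deg_def F_def Suc_le_eq)

lemma tau_closed: "x \<in> carrier V \<Longrightarrow> \<tau> x \<in> carrier V"
  by (rule sgn_map_closed)

lemma tau_tau: "x \<in> carrier V \<Longrightarrow> \<tau> (\<tau> x) = x"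
  by (rule sgn_map_sgn_map)

lemma set_map_tau: "set xs \<subseteq> carrier V \<Longrightarrow> set (map \<tau> xs) \<subseteq> carrier V"
  using tau_closed by auto

lemma map_tau_tau: "set xs \<subseteq> carrier V \<Longrightarrow> map \<tau> (map \<tau> xs) = xs"
  by (rule nth_equalityI) (auto simp: tau_tau subset_iff)

text \<open>The cochain lowers degrees by one, so input and output have opposite parity. Every
  cancellation of signs below goes back to this rule.\<close>

lemma F_odd:
  assumes ys: "ys \<noteq> []" "set ys \<subseteq> carrier V"
  shows "F (map \<tau> ys) = \<ominus>\<^bsub>V\<^esub> \<tau> (F ys)"
proof -
  let ?n = "length ys"
  have n: "?n \<ge> 1" using ys by (simp add: Suc_le_eq)
  interpret VV: two_modules R V V by (intro two_modulesI V_module)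
  interpret TV: two_modules R "T ?n" V by (intro two_modulesI V_module T_module)
  have l: "(\<lambda>x. f ?n (tensor_power_map R V V ?n \<tau> x)) \<in> linear_maps R (T ?n) V"
    by (rule linear_maps_comp[OF tensor_power_map_linear[OF V_module V_module sgn_map_linear] f_linear[OF n]])
  have r: "(\<lambda>x. \<ominus>\<^bsub>V\<^esub> \<tau> (f ?n x)) \<in> linear_maps R (T ?n) V"
    by (rule TV.linear_maps_uminus[OF linear_maps_comp[OF f_linear[OF n] sgn_map_linear]])
  have "f ?n (tensor_power_map R V V ?n \<tau> (wd ys)) = \<ominus>\<^bsub>V\<^esub> \<tau> (f ?n (wd ys))"
  proof (rule tensor_power_linear_eqI[OF V_module grade_Union_subset grade_span V_module l r])
    fix zs assume zs: "length zs = ?n" "set zs \<subseteq> (\<Union>i. grade V i)"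
    then obtain ds where ds: "homogeneous_word V zs ds" using homogeneous_word_exists by blast
    have zV: "set zs \<subseteq> carrier V" by (rule homogeneous_word_closed[OF ds])
    have zw: "zs \<in> words V ?n" using zs zV by (simp add: words_iff)
    have zn: "zs \<noteq> []" using zs(1) n by auto
    have Fz: "f ?n (wd zs) = F zs" using zs(1) by (simp add: F_def)
    have FV: "F zs \<in> carrier V" by (rule F_closed[OF zn zV])
    have "f ?n (tensor_power_map R V V ?n \<tau> (wd zs)) = f ?n (wd (map \<tau> zs))"
      by (simp add: tensor_power_map_word[OF V_module V_module sgn_map_linear zw])
    also have "wd (map \<tau> zs) = koszul_sign R (- sum_list ds) \<odot>\<^bsub>T ?n\<^esub> wd zs"
      using word_tensor_map_sgn[OF V_module linear_maps_id ds, of "[]" "[]" ?n "- 1"] zs by simp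
    also have "f ?n \<dots> = koszul_sign R (- sum_list ds) \<odot>\<^bsub>V\<^esub> F zs"
      using linear_maps_smult[OF f_linear[OF n] _ word_tensor_closed[OF V_module zw]] by (simp add: Fz)
    \<comment> \<open>The degree of the value is one less than the total degree of the word, and a
      shift by one flips the sign.\<close>
    also have "\<dots> = \<ominus>\<^bsub>V\<^esub> (koszul_sign R (- 1 * (sum_list ds - 1)) \<odot>\<^bsub>V\<^esub> F zs)"
      using FV by (auto simp: koszul_sign_def smult_l_minus)
    also have "\<dots> = \<ominus>\<^bsub>V\<^esub> \<tau> (f ?n (wd zs))"
      using sgn_map_homogeneous[OF F_grade[OF ds zn], of "- 1"] by (simp add: Fz)
    finally show "f ?n (tensor_power_map R V V ?n \<tau> (wd zs)) = \<ominus>\<^bsub>V\<^esub> \<tau> (f ?n (wd zs))" .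
  qed (use ys in \<open>auto intro!: word_tensor_closed[OF V_module] simp: words_iff\<close>)
  moreover have "tensor_power_map R V V ?n \<tau> (wd ys) = wd (map \<tau> ys)"
    by (rule tensor_power_map_word[OF V_module V_module sgn_map_linear]) (use ys in \<open>simp add: words_iff\<close>)
  ultimately show ?thesis by (simp add: F_def)
qed

lemma ins_append: "\<lbrakk>xs = us @ ys @ vs; length us = j; length ys = i\<rbrakk> \<Longrightarrow> ins xs j i = map \<tau> us @ F ys # vs"
  by (auto simp: ins_def)

lemma ins_length: "(j, i) \<in> blocks (length xs) \<Longrightarrow> length (ins xs j i) = length xs - i + 1"
  by (auto simp: ins_def blocks_iff)

lemma ins_closed:
  assumes "(j, i) \<in> blocks (length xs)" "set xs \<subseteq> carrier V"
  shows "set (ins xs j i) \<subseteq> carrier V"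
proof -
  have "F (take i (drop j xs)) \<in> carrier V"
    using assms by (intro F_closed set_take_drop) (auto simp: blocks_iff)
  then show ?thesis
    using assms set_map_tau[OF set_take_drop(1)[OF assms(2)]] set_take_drop(2)[OF assms(2)] by (simp add: ins_def)
qed

lemma ins_not_Nil [simp]: "ins xs j i \<noteq> []"
  by (simp add: ins_def)

lemma W_ins_closed: "\<lbrakk>(j, i) \<in> blocks (length xs); set xs \<subseteq> carrier V\<rbrakk> \<Longrightarrow> W (ins xs j i) \<in> carrier C"
  by (rule W_closed[OF ins_not_Nil ins_closed])

lemma Phi_inv_W:
  shows d_linear: "d \<in> linear_maps R C C"
    and d_W: "\<And>xs. \<lbrakk>xs \<noteq> []; set xs \<subseteq> carrier V\<rbrakk> \<Longrightarrow>
      d (W xs) = finsum C (\<lambda>(j, i). W (ins xs j i)) (blocks (length xs))"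
proof -
  define g where "g n x = (\<Oplus>\<^bsub>C\<^esub>i\<in>{1..n}. \<Oplus>\<^bsub>C\<^esub>j\<in>{0..n - i}.
        emb (n - i + 1) (insert_map R V V (- 1) j i (n - i - j) (f i) x))" for n x
  have d_eq: "d = (\<lambda>t. \<Oplus>\<^bsub>C\<^esub>n\<in>{n \<in> {1..}. t n \<noteq> \<zero>\<^bsub>T n\<^esub>}. g n (t n))"
    by (simp add: fun_eq_iff Phi_inv_def g_def)
  have im: "insert_map R V V (- 1) j i (n - i - j) (f i) \<in> linear_maps R (T n) (T (n - i + 1))"
    if "i \<in> {1..n}" "j \<in> {0..n - i}" for n i j
  proof -
    have "j + i + (n - i - j) = n" "j + 1 + (n - i - j) = n - i + 1" using that by auto
    then show ?thesis
      using insert_map_linear[OF graded_module_axioms V_module linear_maps_id f_linear, of i "- 1" j "n - i - j"] that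
      by simp
  qed
  have g: "g n \<in> linear_maps R (T n) C" for n
    unfolding g_def
    by (intro two_modules.linear_maps_sum[OF TC_two] linear_maps_comp[OF im emb_linear]) auto
  show "d \<in> linear_maps R C C"
    unfolding d_eq by (rule C_lift_linear[OF C_module g])
  fix xs assume xs: "xs \<noteq> []" "set xs \<subseteq> carrier V"
  let ?n = "length xs"
  have n: "?n \<ge> 1" using xs by (simp add: Suc_le_eq)
  have "d (W xs) = g ?n (wd xs)"
    unfolding d_eq W_def
    by (rule C_lift_emb[OF C_module g n]) (use xs in \<open>auto intro!: word_tensor_closed[OF V_module] simp: words_iff\<close>)
  also have "\<dots> = (\<Oplus>\<^bsub>C\<^esub>i\<in>{1..?n}. \<Oplus>\<^bsub>C\<^esub>j\<in>{0..?n - i}. W (ins xs j i))"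
    unfolding g_def
  proof (intro C.finsum_cong'[OF refl])
    fix i j assume i: "i \<in> {1..?n}" and j: "j \<in> {0..?n - i}"
    have dec: "xs = take j xs @ take i (drop j xs) @ drop (j + i) xs"
      by (metis append_take_drop_id drop_drop add.commute)
    have ji: "(j, i) \<in> blocks ?n" using i j by (auto simp: blocks_iff)
    have lenb: "length (take i (drop j xs)) = i" using i j by auto
    have "insert_map R V V (- 1) j i (?n - i - j) (f i) (wd (take j xs @ take i (drop j xs) @ drop (j + i) xs)) =
        wd (map \<tau> (take j xs) @ f i (wd (take i (drop j xs))) # drop (j + i) xs)"
      by (rule insert_map_word[OF graded_module_axioms V_module linear_maps_id f_linear])
        (use i j xs set_take_drop in auto)
    then have "insert_map R V V (- 1) j i (?n - i - j) (f i) (wd xs) = wd (ins xs j i)"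
      using dec lenb by (simp add: ins_def F_def)
    then show "emb (?n - i + 1) (insert_map R V V (- 1) j i (?n - i - j) (f i) (wd xs)) = W (ins xs j i)"
      using ins_length[OF ji] by (simp add: W_def)
  qed (use xs in \<open>auto intro!: C.finsum_closed W_ins_closed simp: blocks_iff\<close>)
  also have "\<dots> = finsum C (\<lambda>(i, j). W (ins xs j i)) (Sigma {1..?n} (\<lambda>i. {0..?n - i}))"
    by (rule C.finsum_Sigma) (use xs in \<open>auto intro!: W_ins_closed simp: blocks_iff\<close>)
  also have "\<dots> = finsum C (\<lambda>(j, i). W (ins xs j i)) (blocks ?n)"
  proof (rule C.finsum_bij_betw[where \<sigma> = "\<lambda>(i, j). (j, i)"])
    show "bij_betw (\<lambda>(i, j). (j, i)) (Sigma {1..?n} (\<lambda>i. {0..?n - i})) (blocks ?n)"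
      by (rule bij_betw_byWitness[where f' = "\<lambda>(i, j). (j, i)"]) (auto simp: blocks_iff)
  qed (use xs in \<open>auto intro!: W_ins_closed\<close>)
  finally show "d (W xs) = finsum C (\<lambda>(j, i). W (ins xs j i)) (blocks (length xs))" .
qed

lemma linear_d_W:
  assumes P: "module R P" and g: "g \<in> linear_maps R C P" and xs: "xs \<noteq> []" "set xs \<subseteq> carrier V"
  shows "g (d (W xs)) = finsum P (\<lambda>(j, i). g (W (ins xs j i))) (blocks (length xs))"
proof -
  interpret CP: two_modules R C P by (intro two_modulesI C_module P)
  have "g (d (W xs)) = finsum P (\<lambda>p. g (case p of (j, i) \<Rightarrow> W (ins xs j i))) (blocks (length xs))"
    unfolding d_W[OF xs]
    by (rule CP.linear_maps_finsum[OF g]) (use W_ins_closed xs in auto)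
  also have "(\<lambda>p. g (case p of (j, i) \<Rightarrow> W (ins xs j i))) = (\<lambda>(j, i). g (W (ins xs j i)))"
    by auto
  finally show ?thesis .
qed

lemma ins_homogeneous:
  assumes "homogeneous_word V xs ds" "(j, i) \<in> blocks (length xs)"
  shows "homogeneous_word V (ins xs j i) (take j ds @ (sum_list (take i (drop j ds)) - 1) # drop (j + i) ds)"
proof -
  have "homogeneous_word V (map \<tau> us) es" if "homogeneous_word V us es" for us es
    using that sgn_map_grade by (auto simp: homogeneous_word_def list_all2_conv_all_nth)
  moreover have "F (take i (drop j xs)) \<in> grade V (sum_list (take i (drop j ds)) - 1)"
    by (rule F_grade[OF homogeneous_word_take[OF homogeneous_word_drop[OF assms(1)]]])
      (use assms(2) in \<open>auto simp: blocks_iff\<close>)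
  ultimately show ?thesis
    unfolding ins_def
    by (intro homogeneous_word_append) (auto simp: homogeneous_word_Cons intro: homogeneous_word_take homogeneous_word_drop assms)
qed

lemma d_degree: "d \<in> Hom_deg R C C (- 1)"
proof (rule C_Hom_degI[OF C_module d_linear])
  interpret gC: graded_module R C by (rule C_graded)
  show sub: "submodule (grade C e) R C" for e by (rule gC.grade_submodule)
  fix xs ds assume xs: "homogeneous_word V xs ds" "xs \<noteq> []"
  have sV: "set xs \<subseteq> carrier V" by (rule homogeneous_word_closed[OF xs(1)])
  show "d (W xs) \<in> grade C (sum_list ds + - 1)"
    unfolding d_W[OF xs(2) sV]
  proof (rule C.submodule_finsum[OF sub])
    fix p assume p: "p \<in> blocks (length xs)"
    obtain j i where ji: "p = (j, i)" by (cases p)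
    have "sum_list ds = sum_list (take j ds @ take i (drop j ds) @ drop (j + i) ds)"
      by (metis append_take_drop_id drop_drop add.commute)
    then have e: "sum_list (take j ds @ (sum_list (take i (drop j ds)) - 1) # drop (j + i) ds) = sum_list ds + - 1"
      by simp
    show "(case p of (j, i) \<Rightarrow> W (ins xs j i)) \<in> grade C (sum_list ds + - 1)"
      using W_grade[OF ins_homogeneous[OF xs(1)] ins_not_Nil, of j i] p unfolding ji e by simp
  qed
qed

text \<open>A cut that does not come after the block leaves the insertion entirely in the second
  piece, while the first piece is only twisted.\<close>

lemma ins_take_left:
  assumes "(j, i) \<in> blocks (length xs)" "q \<le> j"
  shows "take q (ins xs j i) = map \<tau> (take q xs)" "drop q (ins xs j i) = ins (drop q xs) (j - q) i"
  using assms by (auto simp: ins_def blocks_iff take_map drop_map drop_take min_def)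

text \<open>If the inserted letter comes before the cut, the insertion happens in the first piece.
  The cut of the original word lies i - 1 places further to the right, since i letters have become
  one.\<close>

lemma ins_take_right:
  assumes "(j, i) \<in> blocks (length xs)" "j < q"
  shows "take q (ins xs j i) = ins (take (q + i - 1) xs) j i" "drop q (ins xs j i) = drop (q + i - 1) xs"
proof -
  obtain r where r: "q = Suc (j + r)" using less_imp_Suc_add[OF assms(2)] by blast
  have "drop (j + i) (take (q + i - 1) xs) = take r (drop (j + i) xs)"
    by (simp add: r drop_take)
  moreover have "take i (drop j (take (q + i - 1) xs)) = take i (drop j xs)"
    by (simp add: r drop_take min_def)
  moreover have "take j (take (q + i - 1) xs) = take j xs"
    by (simp add: r min_def)
  ultimately show "take q (ins xs j i) = ins (take (q + i - 1) xs) j i"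
    using assms(1) by (simp add: ins_def r blocks_iff)
  show "drop q (ins xs j i) = drop (q + i - 1) xs"
    using assms(1) by (simp add: ins_def r blocks_iff add.commute add.left_commute)
qed

text \<open>A cut of a word after an insertion either has the new letter on its left, which gives a
  term of \<open>d\<close> on the first factor, or on its right. In the second case the twist of the
  first piece is exactly the Koszul sign of moving \<open>d\<close> past the first factor.\<close>

lemma coderivation: "coderivation R C \<Delta> (- 1) d"
  unfolding coderivation_def
proof (intro conjI ballI d_degree)
  fix t assume t: "t \<in> carrier C"
  let ?L = "tensor_map R C C C C 0 d id" and ?R = "tensor_map R C C C C (- 1) id d"
  note L = tensor_map_linear[OF C_graded C_module C_module C_module d_linear linear_id, of 0]
  note Rr = tensor_map_linear[OF C_graded C_module C_module C_module linear_id d_linear, of "- 1"]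
  interpret CC2: two_modules R C C2 by (rule C_C2)
  have lin: "(\<lambda>t. ?L (\<Delta> t) \<oplus>\<^bsub>C2\<^esub> ?R (\<Delta> t)) \<in> linear_maps R C C2"
    by (intro CC2.linear_maps_sum_pair linear_maps_comp[OF comult_linear] L Rr)
  show "?L (\<Delta> t) \<oplus>\<^bsub>C2\<^esub> ?R (\<Delta> t) = \<Delta> (d t)"
  proof (rule C_linear_eqI[OF C2_module lin linear_maps_comp[OF d_linear comult_linear] _ t])
    fix xs assume xs: "xs \<noteq> []" "set xs \<subseteq> carrier V"
    let ?n = "length xs"
    define S where "S = Sigma (blocks ?n) (\<lambda>(j, i). {1..<?n - i + 1})"
    define G where "G = (\<lambda>((j, i), q). pure2 (W (take q (ins xs j i))) (W (drop q (ins xs j i))))"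
    \<comment> \<open>\<open>?S1\<close> collects the cuts with the new letter in the first piece,
      \<open>?S2\<close> those with the new letter in the second.\<close>
    let ?S1 = "{((j, i), q) \<in> S. j < q}" and ?S2 = "{((j, i), q) \<in> S. q \<le> j}"
    have finS: "finite S" unfolding S_def by auto
    have Gc: "G s \<in> carrier C2" if "s \<in> S" for s
    proof -
      obtain j i q where s: "s = ((j, i), q)" by (metis prod.collapse)
      have ji: "(j, i) \<in> blocks ?n" and q: "1 \<le> q" "q < ?n - i + 1" using that by (auto simp: S_def s)
      have "W (take q (ins xs j i)) \<in> carrier C" "W (drop q (ins xs j i)) \<in> carrier C"
        by (rule W_take[OF ins_closed[OF ji xs(2)]] W_drop[OF ins_closed[OF ji xs(2)]];
            use q ins_length[OF ji] in simp)+
      then show ?thesis by (simp add: s G_def pure2_closed)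
    qed
    have "\<Delta> (d (W xs)) = finsum C2 (\<lambda>(j, i). \<Delta> (W (ins xs j i))) (blocks ?n)"
      by (rule linear_d_W[OF C2_module comult_linear xs])
    also have "\<dots> = finsum C2 (\<lambda>p. finsum C2 (\<lambda>q. G (p, q)) ((\<lambda>(j, i). {1..<?n - i + 1}) p)) (blocks ?n)"
    proof (rule C2.finsum_cong'[OF refl])
      show "(\<lambda>p. finsum C2 (\<lambda>q. G (p, q)) ((\<lambda>(j, i). {1..<?n - i + 1}) p)) \<in> blocks ?n \<rightarrow> carrier C2"
        using Gc by (intro Pi_I C2.finsum_closed) (auto simp: S_def)
      fix p assume p: "p \<in> blocks ?n"
      obtain j i where ji: "p = (j, i)" by (cases p)
      show "(case p of (j, i) \<Rightarrow> \<Delta> (W (ins xs j i))) = finsum C2 (\<lambda>q. G (p, q)) ((\<lambda>(j, i). {1..<?n - i + 1}) p)"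
        using comult_W[OF ins_not_Nil ins_closed[of j i xs]] ins_length[of j i xs] p xs
        by (simp add: ji G_def)
    qed
    also have "\<dots> = finsum C2 (\<lambda>(p, q). G (p, q)) S"
      unfolding S_def by (rule C2.finsum_Sigma) (use Gc in \<open>auto simp: S_def\<close>)
    also have "\<dots> = finsum C2 G (?S1 \<union> ?S2)"
      by (rule C2.finsum_cong') (use Gc in auto)
    also have "\<dots> = finsum C2 G ?S1 \<oplus>\<^bsub>C2\<^esub> finsum C2 G ?S2"
      by (rule C2.finsum_Un_disjoint) (use finS Gc in \<open>auto intro: finite_subset[OF _ finS]\<close>)
    also have "finsum C2 G ?S1 = ?L (\<Delta> (W xs))"
    proof -
      have "?L (\<Delta> (W xs)) = (\<Oplus>\<^bsub>C2\<^esub>p\<in>{1..<?n}. ?L (pure2 (W (take p xs)) (W (drop p xs))))"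
        by (rule linear_comult_W[OF C2_module L xs])
      also have "\<dots> = (\<Oplus>\<^bsub>C2\<^esub>p\<in>{1..<?n}. finsum C2 (\<lambda>(j, i). pure2 (W (ins (take p xs) j i)) (W (drop p xs))) (blocks p))"
      proof (rule C2.finsum_cong'[OF refl])
        show "(\<lambda>p. finsum C2 (\<lambda>(j, i). pure2 (W (ins (take p xs) j i)) (W (drop p xs))) (blocks p)) \<in> {1..<?n} \<rightarrow> carrier C2"
          using xs by (auto intro!: C2.finsum_closed pure2_closed W_ins_closed W_drop dest: in_set_takeD)
        fix p assume p: "p \<in> {1..<?n}"
        have tp: "take p xs \<noteq> []" "set (take p xs) \<subseteq> carrier V" "length (take p xs) = p"
          using p xs by (auto dest: in_set_takeD)
        have dr: "W (drop p xs) \<in> carrier C" by (rule W_drop) (use p xs in auto)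
        have "?L (pure2 (W (take p xs)) (W (drop p xs))) = pure2 (d (W (take p xs))) (W (drop p xs))"
          using tensor_map_pure[OF C_graded C_module C_module C_module d_linear linear_id W_closed[OF tp(1,2)] dr, of 0]
          by (simp add: sgn_C_even W_closed[OF tp(1,2)])
        then show "?L (pure2 (W (take p xs)) (W (drop p xs))) =
            finsum C2 (\<lambda>(j, i). pure2 (W (ins (take p xs) j i)) (W (drop p xs))) (blocks p)"
          using linear_d_W[OF C2_module pure2_left[OF dr] tp(1,2)] tp(3) by simp
      qed
      also have "\<dots> = finsum C2 (\<lambda>(p, b). (\<lambda>(j, i). pure2 (W (ins (take p xs) j i)) (W (drop p xs))) b) (Sigma {1..<?n} blocks)"
        by (rule C2.finsum_Sigma)
          (use xs in \<open>auto intro!: pure2_closed W_ins_closed W_drop dest: in_set_takeD\<close>)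
      also have "\<dots> = finsum C2 G ?S1"
      \<comment> \<open>A cut at p of the original word, behind the block, becomes a cut at p - i +
        1 once the block is one letter.\<close>
      proof (rule C2.finsum_bij_betw[where \<sigma> = "\<lambda>(p, (j, i)). ((j, i), p - i + 1)"])
        show "bij_betw (\<lambda>(p, (j, i)). ((j, i), p - i + 1)) (Sigma {1..<?n} blocks) ?S1"
          by (rule bij_betw_byWitness[where f' = "\<lambda>((j, i), q). (q + i - 1, (j, i))"])
            (auto simp: S_def blocks_iff)
        fix x assume x: "x \<in> Sigma {1..<?n} blocks"
        obtain p j i where px: "x = (p, (j, i))" by (metis prod.collapse)
        have ji: "(j, i) \<in> blocks ?n" and q: "j < p - i + 1" and e: "p - i + 1 + i - 1 = p"
          using x by (auto simp: px blocks_iff)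
        show "(case x of (p, b) \<Rightarrow> (\<lambda>(j, i). pure2 (W (ins (take p xs) j i)) (W (drop p xs))) b) =
            G ((\<lambda>(p, (j, i)). ((j, i), p - i + 1)) x)"
          using ins_take_right[OF ji q] unfolding e by (simp add: px G_def)
      qed (use Gc in auto)
      finally show ?thesis ..
    qed
    also have "finsum C2 G ?S2 = ?R (\<Delta> (W xs))"
    proof -
      have "?R (\<Delta> (W xs)) = (\<Oplus>\<^bsub>C2\<^esub>p\<in>{1..<?n}. ?R (pure2 (W (take p xs)) (W (drop p xs))))"
        by (rule linear_comult_W[OF C2_module Rr xs])
      also have "\<dots> = (\<Oplus>\<^bsub>C2\<^esub>p\<in>{1..<?n}. finsum C2 (\<lambda>(j, i). pure2 (W (map \<tau> (take p xs))) (W (ins (drop p xs) j i))) (blocks (?n - p)))"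
      proof (rule C2.finsum_cong'[OF refl])
        show "(\<lambda>p. finsum C2 (\<lambda>(j, i). pure2 (W (map \<tau> (take p xs))) (W (ins (drop p xs) j i))) (blocks (?n - p))) \<in> {1..<?n} \<rightarrow> carrier C2"
        proof (intro Pi_I C2.finsum_closed, clarify)
          fix p j i assume p: "p \<in> {1..<?n}" "(j, i) \<in> blocks (?n - p)"
          show "pure2 (W (map \<tau> (take p xs))) (W (ins (drop p xs) j i)) \<in> carrier C2"
            by (intro pure2_closed W_ins_closed W_closed set_map_tau set_take_drop xs) (use p xs in auto)
        qed
        fix p assume p: "p \<in> {1..<?n}"
        have dp: "drop p xs \<noteq> []" "set (drop p xs) \<subseteq> carrier V" "length (drop p xs) = ?n - p"
          using p xs by (auto dest: in_set_dropD)
        have tp: "take p xs \<noteq> []" "set (take p xs) \<subseteq> carrier V"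
          using p xs by (auto dest: in_set_takeD)
        have w: "W (map \<tau> (take p xs)) \<in> carrier C"
          by (intro W_closed set_map_tau tp) (use tp in simp)
        have "?R (pure2 (W (take p xs)) (W (drop p xs))) = pure2 (W (map \<tau> (take p xs))) (d (W (drop p xs)))"
          using tensor_map_pure[OF C_graded C_module C_module C_module linear_id d_linear W_closed[OF tp] W_closed[OF dp(1,2)], of "- 1"]
          by (simp add: sgn_map_W[OF tp])
        then show "?R (pure2 (W (take p xs)) (W (drop p xs))) =
            finsum C2 (\<lambda>(j, i). pure2 (W (map \<tau> (take p xs))) (W (ins (drop p xs) j i))) (blocks (?n - p))"
          using linear_d_W[OF C2_module pure2_right[OF w] dp(1,2)] dp(3) by simp
      qed
      also have "\<dots> = finsum C2 (\<lambda>(p, b). (\<lambda>(j, i). pure2 (W (map \<tau> (take p xs))) (W (ins (drop p xs) j i))) b)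
          (Sigma {1..<?n} (\<lambda>p. blocks (?n - p)))"
      proof (rule C2.finsum_Sigma, simp, simp, clarify)
        fix p j i assume p: "p \<in> {1..<?n}" "(j, i) \<in> blocks (?n - p)"
        show "pure2 (W (map \<tau> (take p xs))) (W (ins (drop p xs) j i)) \<in> carrier C2"
          by (intro pure2_closed W_ins_closed W_closed set_map_tau set_take_drop xs) (use p xs in auto)
      qed
      also have "\<dots> = finsum C2 G ?S2"
      \<comment> \<open>A block that starts at j in the second piece starts at j + p in the whole
        word; the cut itself does not move.\<close>
      proof (rule C2.finsum_bij_betw[where \<sigma> = "\<lambda>(p, (j, i)). ((j + p, i), p)"])
        show "bij_betw (\<lambda>(p, (j, i)). ((j + p, i), p)) (Sigma {1..<?n} (\<lambda>p. blocks (?n - p))) ?S2"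
          by (rule bij_betw_byWitness[where f' = "\<lambda>((j, i), q). (q, (j - q, i))"])
            (auto simp: S_def blocks_iff)
        fix x assume x: "x \<in> Sigma {1..<?n} (\<lambda>p. blocks (?n - p))"
        obtain p j i where px: "x = (p, (j, i))" by (metis prod.collapse)
        have ji: "(j + p, i) \<in> blocks ?n" and q: "p \<le> j + p" and e: "j + p - p = j"
          using x by (auto simp: px blocks_iff)
        show "(case x of (p, b) \<Rightarrow> (\<lambda>(j, i). pure2 (W (map \<tau> (take p xs))) (W (ins (drop p xs) j i))) b) =
            G ((\<lambda>(p, (j, i)). ((j + p, i), p)) x)"
          using ins_take_left[OF ji q] unfolding e by (simp add: px G_def)
      qed (use Gc in auto)
      finally show ?thesis ..
    qed
    finally show "?L (\<Delta> (W xs)) \<oplus>\<^bsub>C2\<^esub> ?R (\<Delta> (W xs)) = \<Delta> (d (W xs))" ..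
  qed
qed

end

section \<open>The square of the coderivation\<close>

lemma (in abelian_group) finsum_telescope:
  assumes "\<And>i. i \<le> n \<Longrightarrow> g i \<in> carrier G"
  shows "finsum G (\<lambda>i. g i \<ominus> g (Suc i)) {..<n} = g 0 \<ominus> g n"
  using assms
proof (induction n)
  case 0
  then show ?case by (simp add: a_minus_def r_neg)
next
  case (Suc n)
  have c: "g i \<in> carrier G" if "i \<le> Suc n" for i using Suc.prems that by simp
  have "finsum G (\<lambda>i. g i \<ominus> g (Suc i)) {..<Suc n} =
      (g n \<ominus> g (Suc n)) \<oplus> finsum G (\<lambda>i. g i \<ominus> g (Suc i)) {..<n}"
    unfolding lessThan_Suc by (rule finsum_insert) (use c in auto)
  also have "\<dots> = (g n \<ominus> g (Suc n)) \<oplus> (g 0 \<ominus> g n)"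
    using Suc.IH c by simp
  also have "\<dots> = g 0 \<ominus> g (Suc n)"
  proof -
    have "g n \<in> carrier G" "g (Suc n) \<in> carrier G" "g 0 \<in> carrier G" using c by auto
    then have "(g n \<ominus> g (Suc n)) \<oplus> (g 0 \<ominus> g n) = (g 0 \<ominus> g (Suc n)) \<oplus> (g n \<oplus> \<ominus> g n)"
      by (simp add: a_minus_def a_ac)
    then show ?thesis
      using c by (simp add: r_neg)
  qed
  finally show ?case .
qed

context odd_cochain
begin

text \<open>The value of the Gerstenhaber square on a word, indexed by the block to which the inner
  operation is applied.\<close>

definition "MM ys = finsum V (\<lambda>(k, i). F (ins ys k i)) (blocks (length ys))"

lemma F_ins_closed: "\<lbrakk>(j, i) \<in> blocks (length xs); set xs \<subseteq> carrier V\<rbrakk> \<Longrightarrow> F (ins xs j i) \<in> carrier V"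
  by (rule F_closed[OF ins_not_Nil ins_closed])

lemma MM_closed: "set ys \<subseteq> carrier V \<Longrightarrow> MM ys \<in> carrier V"
  unfolding MM_def by (rule finsum_closed) (auto intro: F_ins_closed)

lemma W_slot_closed:
  assumes "set xs \<subseteq> carrier V" "x \<in> carrier V"
  shows "W (take a xs @ x # drop b xs) \<in> carrier C"
  by (rule linear_maps_closed[OF W_linear[OF set_take_drop[OF assms(1)]] assms(2)])

lemma block_closed: "set xs \<subseteq> carrier V \<Longrightarrow> set (take l (drop a xs)) \<subseteq> carrier V"
  by (intro set_take_drop)

lemma W_neg:
  assumes "set us \<subseteq> carrier V" "set vs \<subseteq> carrier V" "x \<in> carrier V"
  shows "W (us @ (\<ominus>\<^bsub>V\<^esub> x) # vs) = \<ominus>\<^bsub>C\<^esub> W (us @ x # vs)"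
  by (rule two_modules.linear_maps_neg[OF VC_two W_linear[OF assms(1,2)] assms(3)])

text \<open>Compare the two orders. If the right block is treated first, the letters of the left
  block are twisted before \<open>F\<close> sees them, and \<open>F_odd\<close> produces minus the
  twisted value. If the left block is treated first, its value is twisted afterwards without a minus
  sign. The rest of the two words agrees.\<close>

lemma ins_ins_commute:
  assumes xs: "set xs \<subseteq> carrier V" and ji: "(j, i) \<in> blocks (length xs)"
    and ji': "1 \<le> i'" "j' + i' \<le> j"
  shows "W (ins (ins xs j i) j' i') = \<ominus>\<^bsub>C\<^esub> W (ins (ins xs j' i') (j - i' + 1) i)"
proof -
  define a where "a = take j' xs"
  define b' where "b' = take i' (drop j' xs)"
  define c where "c = take (j - j' - i') (drop (j' + i') xs)"
  define b where "b = take i (drop j xs)"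
  define e where "e = drop (j + i) xs"
  have e1: "xs = a @ b' @ drop (j' + i') xs"
    unfolding a_def b'_def by (metis append_take_drop_id drop_drop add.commute)
  have "drop (j - j' - i') (drop (j' + i') xs) = drop j xs"
    using ji' by simp
  then have e2: "drop (j' + i') xs = c @ drop j xs"
    unfolding c_def by (metis append_take_drop_id)
  have e3: "drop j xs = b @ e"
    unfolding b_def e_def by (metis append_take_drop_id drop_drop add.commute)
  have dec: "xs = a @ b' @ c @ b @ e"
    by (rule trans[OF e1]) (simp only: e2 e3)
  have len: "length a = j'" "length b' = i'" "length c = j - j' - i'" "length b = i"
    using ji ji' by (auto simp: a_def b'_def c_def b_def blocks_iff)
  have V: "set a \<subseteq> carrier V" "set b' \<subseteq> carrier V" "set c \<subseteq> carrier V" "set b \<subseteq> carrier V" "set e \<subseteq> carrier V"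
    using xs dec by auto
  have ne: "b \<noteq> []" "b' \<noteq> []" using len ji ji' by (auto simp: blocks_iff)
  have Fc: "F b \<in> carrier V" "F b' \<in> carrier V" by (intro F_closed ne V)+
  have "ins xs j i = map \<tau> (a @ b' @ c) @ F b # e"
    by (rule ins_append) (use dec len ji' in auto)
  then have "ins (ins xs j i) j' i' = map \<tau> (map \<tau> a) @ F (map \<tau> b') # (map \<tau> c @ F b # e)"
    by (intro ins_append) (use len in auto)
  then have l: "ins (ins xs j i) j' i' = a @ (\<ominus>\<^bsub>V\<^esub> \<tau> (F b')) # (map \<tau> c @ F b # e)"
    by (simp only: map_tau_tau[OF V(1)] F_odd[OF ne(2) V(2)])
  have "ins xs j' i' = map \<tau> a @ F b' # (c @ b @ e)"
    by (rule ins_append) (use dec len in auto)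
  \<comment> \<open>The left block has shrunk from i' letters to one, so the right block now starts
    at j - i' + 1.\<close>
  then have "ins (ins xs j' i') (j - i' + 1) i = map \<tau> (map \<tau> a @ F b' # c) @ F b # e"
    by (intro ins_append) (use len ji' in auto)
  then have r: "ins (ins xs j' i') (j - i' + 1) i = a @ \<tau> (F b') # (map \<tau> c @ F b # e)"
    using map_tau_tau[OF V(1)] by simp
  show ?thesis
    unfolding l r
    by (rule W_neg) (use V set_map_tau[OF V(3)] Fc tau_closed in auto)
qed

text \<open>The letters to the left of the outer block are twisted twice, hence not at all: a
  composite of two odd operations is even and moves past them without sign.\<close>

lemma ins_ins_nested:
  assumes xs: "set xs \<subseteq> carrier V" and al: "(a, l) \<in> blocks (length xs)" and ki: "(k, i) \<in> blocks l"
  shows "ins (ins xs (a + k) i) a (l - i + 1) =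
    take a xs @ F (ins (take l (drop a xs)) k i) # drop (a + l) xs"
proof -
  let ?b = "take l (drop a xs)"
  define b1 where "b1 = take k ?b"
  define b2 where "b2 = take i (drop k ?b)"
  define b3 where "b3 = drop (k + i) ?b"
  have b: "?b = b1 @ b2 @ b3"
    unfolding b1_def b2_def b3_def by (metis append_take_drop_id drop_drop add.commute)
  have dec: "xs = take a xs @ ?b @ drop (a + l) xs"
    by (metis append_take_drop_id drop_drop add.commute)
  have len: "length (take a xs) = a" "length b1 = k" "length b2 = i" "length b3 = l - k - i"
    using al ki by (auto simp: b1_def b2_def b3_def blocks_iff)
  have "ins xs (a + k) i = map \<tau> (take a xs @ b1) @ F b2 # (b3 @ drop (a + l) xs)"
    by (rule ins_append) (use dec b len in auto)
  then have "ins (ins xs (a + k) i) a (l - i + 1) =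
      map \<tau> (map \<tau> (take a xs)) @ F (map \<tau> b1 @ F b2 # b3) # drop (a + l) xs"
    by (intro ins_append) (use len ki in \<open>auto simp: blocks_iff\<close>)
  moreover have "ins ?b k i = map \<tau> b1 @ F b2 # b3"
    by (rule ins_append[OF b]) (use len in auto)
  ultimately show ?thesis
    using map_tau_tau[OF set_take_drop(1)[OF xs]] by simp
qed

lemma dd_W:
  assumes xs: "xs \<noteq> []" "set xs \<subseteq> carrier V"
  shows "d (d (W xs)) =
    finsum C (\<lambda>(a, l). W (take a xs @ MM (take l (drop a xs)) # drop (a + l) xs)) (blocks (length xs))"
proof -
  let ?n = "length xs"
  define S where "S = Sigma (blocks ?n) (\<lambda>(j, i). blocks (?n - i + 1))"
  define G where "G = (\<lambda>((j, i), (j', i')). W (ins (ins xs j i) j' i'))"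
  \<comment> \<open>The first insertion leaves its new letter at position j. The second block lies
    to the left of this letter in \<open>?L\<close>, to the right of it in \<open>?M\<close>, and
    contains it in \<open>?N\<close>.\<close>
  let ?L = "{((j, i), (j', i')) \<in> S. j' + i' \<le> j}"
  let ?M = "{((j, i), (j', i')) \<in> S. j' > j}"
  let ?N = "{((j, i), (j', i')) \<in> S. j' \<le> j \<and> j < j' + i'}"
  have finS: "finite S" unfolding S_def by auto
  have fin: "finite ?L" "finite ?M" "finite ?N"
    by (auto intro: finite_subset[OF _ finS])
  have Gc: "G s \<in> carrier C" if "s \<in> S" for s
  proof -
    obtain j i j' i' where s: "s = ((j, i), (j', i'))" by (metis prod.collapse)
    have "(j, i) \<in> blocks ?n" "(j', i') \<in> blocks (?n - i + 1)" using that by (auto simp: S_def s)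
    then show ?thesis
      using W_ins_closed[of j' i' "ins xs j i"] ins_closed[OF _ xs(2), of j i] ins_length[of j i xs]
      by (simp add: s G_def)
  qed
  have "d (d (W xs)) = finsum C (\<lambda>(j, i). d (W (ins xs j i))) (blocks ?n)"
    by (rule linear_d_W[OF C_module d_linear xs])
  also have "\<dots> = finsum C (\<lambda>p. finsum C (\<lambda>q. G (p, q)) ((\<lambda>(j, i). blocks (?n - i + 1)) p)) (blocks ?n)"
  proof (rule C.finsum_cong'[OF refl])
    show "(\<lambda>p. finsum C (\<lambda>q. G (p, q)) ((\<lambda>(j, i). blocks (?n - i + 1)) p)) \<in> blocks ?n \<rightarrow> carrier C"
      using Gc by (intro Pi_I C.finsum_closed) (auto simp: S_def)
    fix p assume p: "p \<in> blocks ?n"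
    obtain j i where ji: "p = (j, i)" by (cases p)
    have "d (W (ins xs j i)) = finsum C (\<lambda>(j', i'). W (ins (ins xs j i) j' i')) (blocks (?n - i + 1))"
      using d_W[OF ins_not_Nil ins_closed[of j i xs]] ins_length[of j i xs] p xs by (simp add: ji)
    also have "(\<lambda>(j', i'). W (ins (ins xs j i) j' i')) = (\<lambda>q. G (p, q))"
      by (auto simp: G_def ji)
    finally show "(case p of (j, i) \<Rightarrow> d (W (ins xs j i))) = finsum C (\<lambda>q. G (p, q)) ((\<lambda>(j, i). blocks (?n - i + 1)) p)"
      by (simp add: ji)
  qed
  also have "\<dots> = finsum C (\<lambda>(p, q). G (p, q)) S"
    unfolding S_def by (rule C.finsum_Sigma) (use Gc in \<open>auto simp: S_def\<close>)
  also have "\<dots> = finsum C G ((?L \<union> ?M) \<union> ?N)"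
    by (rule C.finsum_cong') (use Gc in auto)
  also have "\<dots> = finsum C G (?L \<union> ?M) \<oplus>\<^bsub>C\<^esub> finsum C G ?N"
    by (rule C.finsum_Un_disjoint) (use fin Gc in auto)
  also have "finsum C G (?L \<union> ?M) = finsum C G ?L \<oplus>\<^bsub>C\<^esub> finsum C G ?M"
    by (rule C.finsum_Un_disjoint) (use fin Gc in \<open>auto simp: S_def blocks_iff\<close>)
  \<comment> \<open>Exchanging the order of two disjoint insertions matches \<open>?L\<close> with
    \<open>?M\<close> and reverses the sign.\<close>
  also have "finsum C G ?L = finsum C (\<lambda>s. \<ominus>\<^bsub>C\<^esub> G s) ?M"
  proof (rule C.finsum_bij_betw[where \<sigma> = "\<lambda>((j, i), (j', i')). ((j', i'), (j - i' + 1, i))"])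
    show "bij_betw (\<lambda>((j, i), (j', i')). ((j', i'), (j - i' + 1, i))) ?L ?M"
      by (rule bij_betw_byWitness[where f' = "\<lambda>((a, b), (a', b')). ((a' + b - 1, b'), (a, b))"])
        (auto simp: S_def blocks_iff)
    fix s assume s: "s \<in> ?L"
    obtain j i j' i' where ss: "s = ((j, i), (j', i'))" by (metis prod.collapse)
    have "W (ins (ins xs j i) j' i') = \<ominus>\<^bsub>C\<^esub> W (ins (ins xs j' i') (j - i' + 1) i)"
      by (rule ins_ins_commute[OF xs(2)]) (use s ss in \<open>auto simp: S_def blocks_iff\<close>)
    then show "G s = \<ominus>\<^bsub>C\<^esub> G ((\<lambda>((j, i), (j', i')). ((j', i'), (j - i' + 1, i))) s)"
      by (simp add: ss G_def)
  qed (use Gc in auto)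
  also have "\<dots> = \<ominus>\<^bsub>C\<^esub> finsum C G ?M"
    by (rule C.finsum_neg) (use Gc in auto)
  also have "\<ominus>\<^bsub>C\<^esub> finsum C G ?M \<oplus>\<^bsub>C\<^esub> finsum C G ?M = \<zero>\<^bsub>C\<^esub>"
    by (rule C.l_neg) (use Gc in \<open>auto intro!: C.finsum_closed\<close>)
  also have "\<zero>\<^bsub>C\<^esub> \<oplus>\<^bsub>C\<^esub> finsum C G ?N = finsum C G ?N"
    by (rule C.l_zero) (use Gc in \<open>auto intro!: C.finsum_closed\<close>)
  also have "\<dots> = finsum C (\<lambda>(p, q). (\<lambda>(a, l) (k, i). W (take a xs @ F (ins (take l (drop a xs)) k i) # drop (a + l) xs)) p q)
      (Sigma (blocks ?n) (\<lambda>(a, l). blocks l))"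
  \<comment> \<open>Here (a, l) is the outer block in the original word and (k, i) the inner block
    relative to it. After the inner insertion the outer block has l - i + 1 letters.\<close>
  proof (rule C.finsum_bij_betw[symmetric, where \<sigma> = "\<lambda>((a, l), (k, i)). ((a + k, i), (a, l - i + 1))"])
    show "bij_betw (\<lambda>((a, l), (k, i)). ((a + k, i), (a, l - i + 1))) (Sigma (blocks ?n) (\<lambda>(a, l). blocks l)) ?N"
      by (rule bij_betw_byWitness[where f' = "\<lambda>((j, i), (j', i')). ((j', i + i' - 1), (j - j', i))"])
        (auto simp: S_def blocks_iff)
    fix s assume s: "s \<in> Sigma (blocks ?n) (\<lambda>(a, l). blocks l)"
    obtain a l k i where ss: "s = ((a, l), (k, i))" by (metis prod.collapse)
    show "(case s of (p, q) \<Rightarrow> (\<lambda>(a, l) (k, i). W (take a xs @ F (ins (take l (drop a xs)) k i) # drop (a + l) xs)) p q) =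
        G ((\<lambda>((a, l), (k, i)). ((a + k, i), (a, l - i + 1))) s)"
      using ins_ins_nested[OF xs(2), of a l k i] s by (simp add: ss G_def)
  qed (use Gc in auto)
  also have "\<dots> = finsum C (\<lambda>p. finsum C ((\<lambda>(a, l) (k, i). W (take a xs @ F (ins (take l (drop a xs)) k i) # drop (a + l) xs)) p)
      ((\<lambda>(a, l). blocks l) p)) (blocks ?n)"
  proof (rule C.finsum_Sigma[symmetric])
    fix p q assume p: "p \<in> blocks ?n" and q: "q \<in> (case p of (a, l) \<Rightarrow> blocks l)"
    obtain a l k i where pq: "p = (a, l)" "q = (k, i)" by (metis prod.collapse)
    have "F (ins (take l (drop a xs)) k i) \<in> carrier V"
      by (intro F_closed ins_closed set_take_drop xs) (use p q pq in \<open>auto simp: blocks_iff\<close>)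
    then show "(\<lambda>(a, l) (k, i). W (take a xs @ F (ins (take l (drop a xs)) k i) # drop (a + l) xs)) p q \<in> carrier C"
      using W_slot_closed[OF xs(2)] by (simp add: pq)
  qed auto
  also have "\<dots> = finsum C (\<lambda>(a, l). W (take a xs @ MM (take l (drop a xs)) # drop (a + l) xs)) (blocks ?n)"
  proof (rule C.finsum_cong'[OF refl])
    show "(\<lambda>(a, l). W (take a xs @ MM (take l (drop a xs)) # drop (a + l) xs)) \<in> blocks ?n \<rightarrow> carrier C"
      using W_slot_closed[OF xs(2) MM_closed[OF block_closed[OF xs(2)]]] by auto
    fix p assume p: "p \<in> blocks ?n"
    obtain a l where al: "p = (a, l)" by (cases p)
    have len: "length (take l (drop a xs)) = l" using p by (auto simp: al blocks_iff)
    have b: "set (take l (drop a xs)) \<subseteq> carrier V" by (intro set_take_drop xs)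
    interpret VC: two_modules R V C by (rule VC_two)
    have "W (take a xs @ MM (take l (drop a xs)) # drop (a + l) xs) =
        finsum C (\<lambda>q. W (take a xs @ (case q of (k, i) \<Rightarrow> F (ins (take l (drop a xs)) k i)) # drop (a + l) xs)) (blocks l)"
      unfolding MM_def len
      by (rule VC.linear_maps_finsum[OF W_linear]) (use set_take_drop[OF xs(2)] F_ins_closed[OF _ b] len in auto)
    also have "\<dots> = finsum C (\<lambda>(k, i). W (take a xs @ F (ins (take l (drop a xs)) k i) # drop (a + l) xs)) (blocks l)"
      by (simp add: split_def)
    finally show "finsum C ((\<lambda>(a, l) (k, i). W (take a xs @ F (ins (take l (drop a xs)) k i) # drop (a + l) xs)) p)
        (case p of (a, l) \<Rightarrow> blocks l) =
        (case p of (a, l) \<Rightarrow> W (take a xs @ MM (take l (drop a xs)) # drop (a + l) xs))"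
      by (simp add: al)
  qed
  finally show ?thesis .
qed

end

section \<open>Curvature\<close>

locale curved_cochain = odd_cochain R V f
  for R :: "('k, 'r) ring_scheme" (structure) and V :: "('k, 'a) graded_module" (structure) and f +
  fixes h :: "('k, 'a, 'k) cochain"
  assumes curvature: "n \<ge> 1 \<Longrightarrow> h n \<in> Hom_deg R (T n) (\<Pi> (ground R)) (- 1)"
begin

abbreviation "\<xi> \<equiv> neg_desuspension R V h"

text \<open>The convention that \<open>h\<close> vanishes in arity 0 is built in, because the
  component of a cochain at 0 is arbitrary.\<close>

definition "H ys = (if ys = [] then \<zero> else h (length ys) (wd ys))"

lemma suspension_ground_linear: "linear_maps R N (\<Pi> (ground R)) = linear_maps R N (ground R)"
  by (simp add: linear_maps_def hom_def suspension_def)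

lemma h_linear: "n \<ge> 1 \<Longrightarrow> h n \<in> linear_maps R (T n) (ground R)"
  using curvature by (simp add: Hom_deg_def suspension_ground_linear)

lemma H_closed: "set ys \<subseteq> carrier V \<Longrightarrow> H ys \<in> carrier R"
  using linear_maps_closed[OF h_linear[of "length ys"] word_tensor_closed[OF V_module, of ys]]
  by (auto simp: H_def words_iff Suc_le_eq)

lemma k_module: "module R (ground R)"
  by (rule R.ground_module)

lemma xi_linear: "\<xi> \<in> linear_maps R C (ground R)"
  and xi_W: "\<lbrakk>xs \<noteq> []; set xs \<subseteq> carrier V\<rbrakk> \<Longrightarrow> \<xi> (W xs) = \<ominus> H xs"
proof -
  interpret Ck: two_modules R C "ground R" by (intro two_modulesI C_module k_module)
  let ?g = "\<lambda>t. finsum (ground R) (\<lambda>n. h n (t n)) {n \<in> {1..}. t n \<noteq> \<zero>\<^bsub>T n\<^esub>}"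
  have g: "?g \<in> linear_maps R C (ground R)"
    by (rule C_lift_linear[OF k_module h_linear])
  have neg: "\<ominus>\<^bsub>ground R\<^esub> c = \<ominus> c" if "c \<in> carrier R" for c
    using Ck.N.minus_equality[of "\<ominus> c" c] that by (simp add: R.l_neg)
  have eq: "\<xi> t = \<ominus>\<^bsub>ground R\<^esub> ?g t" if t: "t \<in> carrier C" for t
  proof -
    have "?g t = finsum R (\<lambda>n. h n (t n)) {n \<in> {1..}. t n \<noteq> \<zero>\<^bsub>T n\<^esub>}"
      by (rule finsum_ground[OF R.is_cring])
        (use linear_maps_closed[OF h_linear C_proj[OF t]] in auto)
    moreover have "?g t \<in> carrier R"
      using linear_maps_closed[OF g t] by simp
    ultimately show ?thesis by (simp add: neg neg_desuspension_def)
  qed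
  show "\<xi> \<in> linear_maps R C (ground R)"
    by (rule linear_maps_cong[OF Ck.linear_maps_uminus[OF g] eq C_module])
  show "\<xi> (W xs) = \<ominus> H xs" if xs: "xs \<noteq> []" "set xs \<subseteq> carrier V"
  proof -
    have "?g (W xs) = h (length xs) (wd xs)"
      unfolding W_def
      by (rule C_lift_emb[OF k_module h_linear])
        (use xs in \<open>auto intro!: word_tensor_closed[OF V_module] simp: words_iff Suc_le_eq\<close>)
    then have "?g (W xs) = H xs" using xs by (simp add: H_def)
    then show ?thesis using eq[OF W_closed[OF xs]] neg[OF H_closed[OF xs(2)]] by simp
  qed
qed

text \<open>The degree is -1 from \<open>h\<close> and a further -1 from undoing the suspension of
  the ground ring.\<close>

lemma xi_degree: "\<xi> \<in> Hom_deg R C (ground R) (- 2)"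
proof (rule C_Hom_degI[OF k_module xi_linear])
  interpret k: module R "ground R" by (rule k_module)
  show sub: "submodule (grade (ground R) e) R (ground R)" for e
    unfolding k.submodule_iff by (auto simp: ground_def)
  fix xs ds assume xs: "homogeneous_word V xs ds" "xs \<noteq> []"
  have sV: "set xs \<subseteq> carrier V" by (rule homogeneous_word_closed[OF xs(1)])
  have "H xs \<in> grade (\<Pi> (ground R)) (sum_list ds - 1)"
    using curvature[of "length xs"] word_grade[OF xs(1)] xs(2) by (simp add: Hom_deg_def H_def Suc_le_eq)
  then have "H xs \<in> grade (ground R) (sum_list ds + - 2)"
    by (simp add: suspension_def)
  then show "\<xi> (W xs) \<in> grade (ground R) (sum_list ds + - 2)"
    by (auto simp: xi_W[OF xs(2) sV] ground_def split: if_splits)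
qed

abbreviation "ad \<equiv> coalgebra_ad R C \<Delta> (- 2) \<xi>"

text \<open>The letters at positions a to a + l - 1 are fed to \<open>h\<close> and deleted. The two
  curvature terms on a block and the two halves of \<open>ad\<close> are all of this shape, which is
  what lets them cancel.\<close>

definition "G xs a l = H (take l (drop a xs)) \<odot>\<^bsub>C\<^esub> W (take a xs @ drop (a + l) xs)"

lemma G_closed: "\<lbrakk>set xs \<subseteq> carrier V; l < length xs; a + l \<le> length xs\<rbrakk> \<Longrightarrow> G xs a l \<in> carrier C"
  unfolding G_def using set_take_drop
  by (intro C.smult_closed H_closed W_closed) auto

lemma G_0: "\<lbrakk>set xs \<subseteq> carrier V; xs \<noteq> []; a \<le> length xs\<rbrakk> \<Longrightarrow> G xs a 0 = \<zero>\<^bsub>C\<^esub>"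
  using W_closed[of xs] by (simp add: G_def H_def)

text \<open>All signs of moving the curvature are trivial because its degree is even. Cutting a word
  and evaluating one piece is the deletion of a prefix or of a suffix; the minus sign in the
  curvature makes the suffixes positive.\<close>

lemma ad_linear: "ad \<in> linear_maps R C C"
  and ad_W: "\<And>xs. \<lbrakk>xs \<noteq> []; set xs \<subseteq> carrier V\<rbrakk> \<Longrightarrow>
    ad (W xs) = finsum C (\<lambda>l. G xs (length xs - l) l \<ominus>\<^bsub>C\<^esub> G xs 0 l) {..<length xs}"
proof -
  interpret CC: two_modules R C C by (rule CC_two)
  let ?L = "\<lambda>y. left_unitor R C (tensor_map R C C (ground R) C 0 \<xi> id y)"
  let ?R = "\<lambda>y. right_unitor R C (tensor_map R C C C (ground R) (- 2) id \<xi> y)"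
  have L: "?L \<in> linear_maps R C2 C"
    by (rule linear_maps_comp[OF tensor_map_linear[OF C_graded C_module k_module C_module xi_linear linear_id]
          left_unitor_linear[OF C_module]])
  have Rr: "?R \<in> linear_maps R C2 C"
    by (rule linear_maps_comp[OF tensor_map_linear[OF C_graded C_module C_module k_module linear_id xi_linear]
          right_unitor_linear[OF C_module]])
  have Lp: "?L (pure2 x y) = \<xi> x \<odot>\<^bsub>C\<^esub> y" if "x \<in> carrier C" "y \<in> carrier C" for x y
    using tensor_map_pure[OF C_graded C_module k_module C_module xi_linear linear_id that, of 0]
      left_unitor_pure[OF C_module _ that(2)] linear_maps_closed[OF xi_linear that(1)] that
    by (simp add: sgn_C_even)
  have Rp: "?R (pure2 x y) = \<xi> y \<odot>\<^bsub>C\<^esub> x" if "x \<in> carrier C" "y \<in> carrier C" for x y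
    using tensor_map_pure[OF C_graded C_module C_module k_module linear_id xi_linear that, of "- 2"]
      right_unitor_pure[OF C_module _ that(1)] linear_maps_closed[OF xi_linear that(2)] that
    by (simp add: sgn_C_even)
  have ad: "ad = (\<lambda>x. ?L (\<Delta> x) \<ominus>\<^bsub>C\<^esub> ?R (\<Delta> x))"
    by (simp add: fun_eq_iff coalgebra_ad_def)
  show "ad \<in> linear_maps R C C"
    unfolding ad
    by (rule CC.linear_maps_diff[OF linear_maps_comp[OF comult_linear L] linear_maps_comp[OF comult_linear Rr]])
  fix xs assume xs: "xs \<noteq> []" "set xs \<subseteq> carrier V"
  let ?n = "length xs"
  have L_eq: "?L (\<Delta> (W xs)) = finsum C (\<lambda>l. \<ominus>\<^bsub>C\<^esub> G xs 0 l) {1..<?n}"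
  proof -
    have "?L (\<Delta> (W xs)) = finsum C (\<lambda>p. ?L (pure2 (W (take p xs)) (W (drop p xs)))) {1..<?n}"
      by (rule linear_comult_W[OF C_module L xs])
    also have "\<dots> = finsum C (\<lambda>l. \<ominus>\<^bsub>C\<^esub> G xs 0 l) {1..<?n}"
    proof (rule C.finsum_cong'[OF refl])
      fix p assume p: "p \<in> {1..<?n}"
      have w: "W (take p xs) \<in> carrier C" "W (drop p xs) \<in> carrier C" "H (take p xs) \<in> carrier R"
        by (rule W_take W_drop H_closed; use p xs set_take_drop in auto)+
      have "\<xi> (W (take p xs)) = \<ominus> H (take p xs)"
        by (rule xi_W) (use p xs set_take_drop in auto)
      then show "?L (pure2 (W (take p xs)) (W (drop p xs))) = \<ominus>\<^bsub>C\<^esub> G xs 0 p"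
        using w Lp by (simp add: G_def C.smult_l_minus)
    qed (use xs G_closed in auto)
    finally show ?thesis .
  qed
  have R_eq: "?R (\<Delta> (W xs)) = finsum C (\<lambda>l. \<ominus>\<^bsub>C\<^esub> G xs (?n - l) l) {1..<?n}"
  proof -
    have "?R (\<Delta> (W xs)) = finsum C (\<lambda>p. ?R (pure2 (W (take p xs)) (W (drop p xs)))) {1..<?n}"
      by (rule linear_comult_W[OF C_module Rr xs])
    also have "\<dots> = finsum C (\<lambda>l. \<ominus>\<^bsub>C\<^esub> G xs (?n - l) l) {1..<?n}"
    proof (rule C.finsum_bij_betw[where \<sigma> = "\<lambda>p. ?n - p"])
      show "bij_betw (\<lambda>p. ?n - p) {1..<?n} {1..<?n}"
        by (rule bij_betw_byWitness[where f' = "\<lambda>p. ?n - p"]) auto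
      fix p assume p: "p \<in> {1..<?n}"
      have w: "W (take p xs) \<in> carrier C" "W (drop p xs) \<in> carrier C" "H (drop p xs) \<in> carrier R"
        by (rule W_take W_drop H_closed; use p xs set_take_drop in auto)+
      have "\<xi> (W (drop p xs)) = \<ominus> H (drop p xs)"
        by (rule xi_W) (use p xs set_take_drop in auto)
      then show "?R (pure2 (W (take p xs)) (W (drop p xs))) = \<ominus>\<^bsub>C\<^esub> G xs (?n - (?n - p)) (?n - p)"
        using w Rp p by (simp add: G_def C.smult_l_minus)
    qed (use xs G_closed in auto)
    finally show ?thesis .
  qed
  have "ad (W xs) = finsum C (\<lambda>l. (\<ominus>\<^bsub>C\<^esub> G xs 0 l) \<ominus>\<^bsub>C\<^esub> (\<ominus>\<^bsub>C\<^esub> G xs (?n - l) l)) {1..<?n}"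
    unfolding ad L_eq R_eq
    by (rule C.finsum_minus[symmetric]) (use xs G_closed in auto)
  also have "\<dots> = finsum C (\<lambda>l. G xs (?n - l) l \<ominus>\<^bsub>C\<^esub> G xs 0 l) {1..<?n}"
    by (rule C.finsum_cong'[OF refl]) (use xs G_closed in \<open>auto simp: a_minus_def C.a_comm\<close>)
  \<comment> \<open>The value l = 0, which is not a cut, is added at no cost since
    \<open>H []\<close> is zero. The telescoping sum has the same range.\<close>
  also have "\<dots> = finsum C (\<lambda>l. G xs (?n - l) l \<ominus>\<^bsub>C\<^esub> G xs 0 l) {..<?n}"
  proof (rule C.finsum_eq_superset)
    fix l assume "l \<in> {..<?n} - {1..<?n}"
    then have "l = 0" by auto
    then show "G xs (?n - l) l \<ominus>\<^bsub>C\<^esub> G xs 0 l = \<zero>\<^bsub>C\<^esub>"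
      using xs by (simp add: G_0 a_minus_def)
  qed (use xs G_closed in auto)
  finally show "ad (W xs) = finsum C (\<lambda>l. G xs (?n - l) l \<ominus>\<^bsub>C\<^esub> G xs 0 l) {..<?n}" .
qed

text \<open>The left side of the first equation on a word. The minus sign arises because
  \<open>h\<close> is odd: moved past the first letter it twists that letter, and multiplication by
  the unit from the right is minus the twist, so minus the untwisted letter remains.\<close>

definition "E ys = MM ys \<oplus>\<^bsub>V\<^esub> (H (butlast ys) \<odot>\<^bsub>V\<^esub> last ys \<ominus>\<^bsub>V\<^esub> H (tl ys) \<odot>\<^bsub>V\<^esub> hd ys)"

lemma hd_last_closed:
  assumes "ys \<noteq> []" "set ys \<subseteq> carrier V"
  shows "hd ys \<in> carrier V" "last ys \<in> carrier V" "set (butlast ys) \<subseteq> carrier V" "set (tl ys) \<subseteq> carrier V"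
  using assms by (auto dest: in_set_butlastD list.set_sel(2) simp: subset_iff)

lemma E_closed:
  assumes "ys \<noteq> []" "set ys \<subseteq> carrier V"
  shows "E ys \<in> carrier V"
  using hd_last_closed[OF assms] MM_closed[OF assms(2)] H_closed by (simp add: E_def)

text \<open>Removing all letters of the block but the last deletes l - 1 letters from position a on;
  removing all but the first deletes l - 1 letters from position a + 1 on.\<close>

lemma W_E:
  assumes xs: "set xs \<subseteq> carrier V" and al: "(a, l) \<in> blocks (length xs)"
  shows "W (take a xs @ E (take l (drop a xs)) # drop (a + l) xs) =
    W (take a xs @ MM (take l (drop a xs)) # drop (a + l) xs) \<oplus>\<^bsub>C\<^esub> (G xs a (l - 1) \<ominus>\<^bsub>C\<^esub> G xs (Suc a) (l - 1))"
proof -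
  let ?b = "take l (drop a xs)"
  interpret VC: two_modules R V C by (rule VC_two)
  have bne: "?b \<noteq> []" using al by (auto simp: blocks_iff)
  have bV: "set ?b \<subseteq> carrier V" by (intro set_take_drop xs)
  have lenb: "length ?b = l" using al by (auto simp: blocks_iff)
  note hl = hd_last_closed[OF bne bV]
  note lin = W_linear[OF set_take_drop(1)[OF xs] set_take_drop(2)[OF xs], of a "a + l"]
  have "W (take a xs @ E ?b # drop (a + l) xs) = W (take a xs @ MM ?b # drop (a + l) xs) \<oplus>\<^bsub>C\<^esub>
      (H (butlast ?b) \<odot>\<^bsub>C\<^esub> W (take a xs @ last ?b # drop (a + l) xs) \<ominus>\<^bsub>C\<^esub>
       H (tl ?b) \<odot>\<^bsub>C\<^esub> W (take a xs @ hd ?b # drop (a + l) xs))"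
    unfolding E_def using hl MM_closed[OF bV] H_closed
    by (simp add: linear_maps_add[OF lin] VC.linear_maps_minus[OF lin] linear_maps_smult[OF lin])
  moreover have "butlast ?b = take (l - 1) (drop a xs)"
    unfolding butlast_conv_take lenb by (simp add: min_absorb1)
  moreover have "take a xs @ last ?b # drop (a + l) xs = take a xs @ drop (a + (l - 1)) xs"
  proof -
    have "drop (a + (l - 1)) xs = xs ! (a + (l - 1)) # drop (Suc (a + (l - 1))) xs"
      using al by (intro Cons_nth_drop_Suc[symmetric]) (auto simp: blocks_iff)
    moreover have "last ?b = xs ! (a + (l - 1))"
      unfolding last_conv_nth[OF bne] lenb using al by (simp add: blocks_iff)
    ultimately show ?thesis using al by (simp add: blocks_iff)
  qed
  moreover have "tl ?b = take (l - 1) (drop (Suc a) xs)"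
    using al by (simp add: tl_take tl_drop drop_Suc[symmetric] blocks_iff)
  moreover have "take a xs @ hd ?b # drop (a + l) xs = take (Suc a) xs @ drop (Suc a + (l - 1)) xs"
    using al by (simp add: take_Suc_conv_app_nth hd_drop_conv_nth hd_take blocks_iff)
  ultimately show ?thesis by (simp add: G_def)
qed

lemma dd_minus_ad:
  assumes xs: "xs \<noteq> []" "set xs \<subseteq> carrier V"
  shows "d (d (W xs)) \<ominus>\<^bsub>C\<^esub> ad (W xs) =
    finsum C (\<lambda>(a, l). W (take a xs @ E (take l (drop a xs)) # drop (a + l) xs)) (blocks (length xs))"
proof -
  let ?n = "length xs"
  let ?M = "\<lambda>(a, l). W (take a xs @ MM (take l (drop a xs)) # drop (a + l) xs)"
  let ?K = "\<lambda>(a, l). G xs a (l - 1) \<ominus>\<^bsub>C\<^esub> G xs (Suc a) (l - 1)"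
  have Mc: "?M p \<in> carrier C" if "p \<in> blocks ?n" for p
    using W_slot_closed[OF xs(2) MM_closed[OF block_closed[OF xs(2)]]] by (auto split: prod.split)
  have Kc: "?K p \<in> carrier C" if "p \<in> blocks ?n" for p
    using that xs by (cases p) (auto simp: blocks_iff intro!: C.minus_closed G_closed)
  have "finsum C (\<lambda>(a, l). W (take a xs @ E (take l (drop a xs)) # drop (a + l) xs)) (blocks ?n) =
      finsum C (\<lambda>p. ?M p \<oplus>\<^bsub>C\<^esub> ?K p) (blocks ?n)"
  proof (rule C.finsum_cong'[OF refl])
    show "(\<lambda>p. ?M p \<oplus>\<^bsub>C\<^esub> ?K p) \<in> blocks ?n \<rightarrow> carrier C" by (intro Pi_I C.a_closed Mc Kc)
  qed (use W_E[OF xs(2)] in auto)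
  also have "\<dots> = finsum C ?M (blocks ?n) \<oplus>\<^bsub>C\<^esub> finsum C ?K (blocks ?n)"
    by (rule C.finsum_addf) (intro Pi_I Mc Kc; assumption)+
  also have "finsum C ?M (blocks ?n) = d (d (W xs))"
    by (rule dd_W[OF xs, symmetric])
  \<comment> \<open>Grouping by the number of deleted letters, one less than the length of the
    block, puts the sum in telescoping form.\<close>
  also have "finsum C ?K (blocks ?n) = finsum C (\<lambda>(l, a). G xs a l \<ominus>\<^bsub>C\<^esub> G xs (Suc a) l) (Sigma {..<?n} (\<lambda>l. {..<?n - l}))"
  proof (rule C.finsum_bij_betw[where \<sigma> = "\<lambda>(a, l). (l - 1, a)"])
    show "bij_betw (\<lambda>(a, l). (l - 1, a)) (blocks ?n) (Sigma {..<?n} (\<lambda>l. {..<?n - l}))"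
      by (rule bij_betw_byWitness[where f' = "\<lambda>(l, a). (a, l + 1)"]) (auto simp: blocks_iff)
  qed (use xs in \<open>auto intro!: C.minus_closed G_closed\<close>)
  also have "\<dots> = finsum C (\<lambda>l. finsum C (\<lambda>a. G xs a l \<ominus>\<^bsub>C\<^esub> G xs (Suc a) l) {..<?n - l}) {..<?n}"
    by (rule C.finsum_Sigma[symmetric]) (use xs in \<open>auto intro!: C.minus_closed G_closed\<close>)
  also have "\<dots> = finsum C (\<lambda>l. G xs 0 l \<ominus>\<^bsub>C\<^esub> G xs (?n - l) l) {..<?n}"
  proof (rule C.finsum_cong'[OF refl])
    fix l assume "l \<in> {..<?n}"
    then show "finsum C (\<lambda>a. G xs a l \<ominus>\<^bsub>C\<^esub> G xs (Suc a) l) {..<?n - l} = G xs 0 l \<ominus>\<^bsub>C\<^esub> G xs (?n - l) l"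
      by (intro C.finsum_telescope G_closed[OF xs(2)]) auto
  qed (use xs in \<open>auto intro!: C.minus_closed G_closed\<close>)
  \<comment> \<open>What survives is the deletion of prefixes minus the deletion of suffixes,
    opposite to the order in \<open>ad_W\<close>.\<close>
  also have "\<dots> = \<ominus>\<^bsub>C\<^esub> ad (W xs)"
  proof -
    have c: "G xs 0 l \<in> carrier C" "G xs (?n - l) l \<in> carrier C" if "l < ?n" for l
      using that by (auto intro!: G_closed xs)
    have "\<ominus>\<^bsub>C\<^esub> ad (W xs) = finsum C (\<lambda>l. \<ominus>\<^bsub>C\<^esub> (G xs (?n - l) l \<ominus>\<^bsub>C\<^esub> G xs 0 l)) {..<?n}"
      unfolding ad_W[OF xs] by (rule C.finsum_neg[symmetric]) (use c in auto)
    also have "\<dots> = finsum C (\<lambda>l. G xs 0 l \<ominus>\<^bsub>C\<^esub> G xs (?n - l) l) {..<?n}"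
      by (rule C.finsum_cong'[OF refl]) (use c in \<open>auto simp: a_minus_def C.minus_add C.a_comm\<close>)
    finally show ?thesis ..
  qed
  finally show ?thesis by (simp add: a_minus_def)
qed

text \<open>The map \<open>hd\<close> is multilinear in one letter and inverts the passage from a
  letter to its word of length one.\<close>

lemma word_singleton_eq_zero:
  assumes "x \<in> carrier V" "wd [x] = \<zero>\<^bsub>T 1\<^esub>"
  shows "x = \<zero>\<^bsub>V\<^esub>"
proof -
  have "multilinear R V V 1 hd"
    unfolding multilinear_def using linear_maps_id by (auto simp: words_iff length_Suc_conv)
  then obtain g where g: "g \<in> linear_maps R (T 1) V" "\<And>xs. xs \<in> words V 1 \<Longrightarrow> g (wd xs) = hd xs"
    using tensor_power_lift[OF V_module V_module] by blast
  interpret TV: two_modules R "T 1" V by (intro two_modulesI T_module V_module)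
  have "x = g (wd [x])" using g(2)[of "[x]"] assms(1) by (simp add: words_iff)
  then show ?thesis using assms(2) TV.linear_maps_0[OF g(1)] by simp
qed

lemma W_apply_1: "length zs \<noteq> 1 \<Longrightarrow> W zs 1 = \<zero>\<^bsub>T 1\<^esub>"
  by (simp add: W_def emb_apply)

lemma dd_eq_ad_iff:
  "(\<forall>t\<in>carrier C. d (d t) = ad t) \<longleftrightarrow> (\<forall>xs. xs \<noteq> [] \<longrightarrow> set xs \<subseteq> carrier V \<longrightarrow> E xs = \<zero>\<^bsub>V\<^esub>)"
proof (intro iffI allI impI ballI)
  fix xs assume eq: "\<forall>t\<in>carrier C. d (d t) = ad t" and xs: "xs \<noteq> []" "set xs \<subseteq> carrier V"
  let ?n = "length xs"
  let ?t = "\<lambda>(a, l). W (take a xs @ E (take l (drop a xs)) # drop (a + l) xs)"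
  have tc: "?t p \<in> carrier C" if "p \<in> blocks ?n" for p
  proof -
    obtain a l where p: "p = (a, l)" by (cases p)
    have "E (take l (drop a xs)) \<in> carrier V"
      by (rule E_closed) (use that p xs set_take_drop in \<open>auto simp: blocks_iff\<close>)
    then show ?thesis using W_slot_closed[OF xs(2)] by (simp add: p)
  qed
  have c: "W xs \<in> carrier C" by (rule W_closed[OF xs])
  have "\<zero>\<^bsub>C\<^esub> = d (d (W xs)) \<ominus>\<^bsub>C\<^esub> ad (W xs)"
    using eq c linear_maps_closed[OF ad_linear c] by (simp add: a_minus_def C.r_neg)
  then have z: "\<zero>\<^bsub>C\<^esub> = finsum C ?t (blocks ?n)" by (simp add: dd_minus_ad[OF xs])
  interpret CT: two_modules R C "T 1" by (rule CT_two)
  have "\<zero>\<^bsub>T 1\<^esub> = \<zero>\<^bsub>C\<^esub> 1" by (rule CT.linear_maps_0[OF proj_linear, symmetric]) simp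
  also have "\<dots> = finsum (T 1) (\<lambda>p. ?t p 1) (blocks ?n)"
    unfolding z by (rule CT.linear_maps_finsum[OF proj_linear]) (use tc in auto)
  \<comment> \<open>Replacing any proper block by one letter leaves a word of length at least two,
    which has no component in length one.\<close>
  also have "\<dots> = ?t (0, ?n) 1"
  proof (rule T.finsum_single[OF finite_blocks])
    show "(0, ?n) \<in> blocks ?n" using xs by (simp add: blocks_iff Suc_le_eq)
    then show "?t (0, ?n) 1 \<in> carrier (T 1)" by (rule C_proj[OF tc order_refl])
    fix p assume p: "p \<in> blocks ?n" "p \<noteq> (0, ?n)"
    obtain a l where al: "p = (a, l)" by (cases p)
    have "length (take a xs @ E (take l (drop a xs)) # drop (a + l) xs) \<noteq> 1"
      using p al by (auto simp: blocks_iff)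
    then show "?t p 1 = \<zero>\<^bsub>T 1\<^esub>"
      unfolding al prod.case by (rule W_apply_1)
  qed
  also have "\<dots> = wd [E xs]" by (simp add: W_def emb_apply)
  finally show "E xs = \<zero>\<^bsub>V\<^esub>"
    using word_singleton_eq_zero[OF E_closed[OF xs]] by simp
next
  fix t assume E: "\<forall>xs. xs \<noteq> [] \<longrightarrow> set xs \<subseteq> carrier V \<longrightarrow> E xs = \<zero>\<^bsub>V\<^esub>" and t: "t \<in> carrier C"
  show "d (d t) = ad t"
  proof (rule C_linear_eqI[OF C_module linear_maps_comp[OF d_linear d_linear] ad_linear _ t])
    fix xs assume xs: "xs \<noteq> []" "set xs \<subseteq> carrier V"
    interpret VC: two_modules R V C by (rule VC_two)
    have "d (d (W xs)) \<ominus>\<^bsub>C\<^esub> ad (W xs) = finsum C (\<lambda>p. \<zero>\<^bsub>C\<^esub>) (blocks (length xs))"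
      unfolding dd_minus_ad[OF xs]
    proof (rule C.finsum_cong'[OF refl])
      fix p assume p: "p \<in> blocks (length xs)"
      obtain a l where al: "p = (a, l)" by (cases p)
      have "E (take l (drop a xs)) = \<zero>\<^bsub>V\<^esub>"
        using E p al xs set_take_drop(1)[OF set_take_drop(2)[OF xs(2)]] by (auto simp: blocks_iff)
      then show "(case p of (a, l) \<Rightarrow> W (take a xs @ E (take l (drop a xs)) # drop (a + l) xs)) = \<zero>\<^bsub>C\<^esub>"
        using VC.linear_maps_0[OF W_linear[OF set_take_drop(1)[OF xs(2)] set_take_drop(2)[OF xs(2)]]] by (simp add: al)
    qed auto
    then show "d (d (W xs)) = ad (W xs)"
      using C.minus_eq_zero_iff linear_maps_closed[OF ad_linear W_closed[OF xs]]
        linear_maps_closed[OF d_linear linear_maps_closed[OF d_linear W_closed[OF xs]]] by simp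
  qed
qed

text \<open>The Gerstenhaber product of \<open>h\<close> with the cochain, evaluated on a word: the
  left side of the second equation.\<close>

definition "MH ys = finsum R (\<lambda>(k, i). H (ins ys k i)) (blocks (length ys))"

lemma xi_d_iff:
  "(\<forall>t\<in>carrier C. \<xi> (d t) = \<zero>) \<longleftrightarrow> (\<forall>xs. xs \<noteq> [] \<longrightarrow> set xs \<subseteq> carrier V \<longrightarrow> MH xs = \<zero>)"
proof -
  interpret Ck: two_modules R C "ground R" by (intro two_modulesI C_module k_module)
  have HI: "H (ins xs j i) \<in> carrier R" if "(j, i) \<in> blocks (length xs)" "set xs \<subseteq> carrier V" for xs j i
    by (rule H_closed[OF ins_closed[OF that]])
  have eq: "\<xi> (d (W xs)) = \<ominus> MH xs" if xs: "xs \<noteq> []" "set xs \<subseteq> carrier V" for xs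
  proof -
    have "\<xi> (d (W xs)) = finsum (ground R) (\<lambda>(j, i). \<xi> (W (ins xs j i))) (blocks (length xs))"
      by (rule linear_d_W[OF k_module xi_linear xs])
    also have "\<dots> = finsum R (\<lambda>(j, i). \<xi> (W (ins xs j i))) (blocks (length xs))"
      by (rule finsum_ground[OF R.is_cring])
        (use linear_maps_closed[OF xi_linear W_ins_closed[OF _ xs(2)]] in auto)
    also have "\<dots> = finsum R (\<lambda>p. \<ominus> (case p of (j, i) \<Rightarrow> H (ins xs j i))) (blocks (length xs))"
      by (rule R.finsum_cong'[OF refl]) (use HI xs xi_W[OF ins_not_Nil ins_closed[OF _ xs(2)]] in auto)
    also have "\<dots> = \<ominus> MH xs"
      unfolding MH_def by (rule R.finsum_neg) (use HI xs in auto)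
    finally show ?thesis .
  qed
  have MHc: "MH xs \<in> carrier R" if "set xs \<subseteq> carrier V" for xs
    unfolding MH_def using HI that by (intro R.finsum_closed) auto
  show ?thesis
  proof (intro iffI allI impI ballI)
    fix xs assume eq0: "\<forall>t\<in>carrier C. \<xi> (d t) = \<zero>" and xs: "xs \<noteq> []" "set xs \<subseteq> carrier V"
    then have "\<ominus> MH xs = \<zero>" using eq[OF xs] W_closed[OF xs] by simp
    then show "MH xs = \<zero>" using MHc[OF xs(2)] R.minus_minus[of "MH xs"] by simp
  next
    fix t assume "\<forall>xs. xs \<noteq> [] \<longrightarrow> set xs \<subseteq> carrier V \<longrightarrow> MH xs = \<zero>" and t: "t \<in> carrier C"
    then have "\<xi> (d t) = (\<lambda>t. \<zero>\<^bsub>ground R\<^esub>) t"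
      by (intro C_linear_eqI[OF k_module linear_maps_comp[OF d_linear xi_linear] Ck.linear_maps_const_0 _ t])
        (simp add: eq)
    then show "\<xi> (d t) = \<zero>" by simp
  qed
qed

lemma curved_dg_coalgebra_iff:
  "curved_dg_coalgebra R C \<Delta> d \<xi> \<longleftrightarrow>
    (\<forall>xs. xs \<noteq> [] \<longrightarrow> set xs \<subseteq> carrier V \<longrightarrow> E xs = \<zero>\<^bsub>V\<^esub> \<and> MH xs = \<zero>)"
  unfolding curved_dg_coalgebra_def dd_eq_ad_iff xi_d_iff
  using graded_coalgebra coderivation xi_degree by blast

end

section \<open>Suspension and reduction\<close>

lemma suspension_simps [simp]:
  "carrier (\<Pi> M) = carrier M" "zero (\<Pi> M) = zero M" "add (\<Pi> M) = add M" "smult (\<Pi> M) = smult M"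
  "grade (\<Pi> M) i = grade M (i - 1)"
  by (simp_all add: suspension_def)

lemma suspension_a_inv [simp]: "a_inv (\<Pi> M) = a_inv M"
  by (simp add: a_inv_def)

lemma suspension_a_minus [simp]: "a_minus (\<Pi> M) = a_minus M"
  by (simp add: a_minus_def[abs_def])

lemma suspension_finsum [simp]: "finsum (\<Pi> M) = finsum M"
  by (simp add: finsum_def[abs_def])

lemma suspension_linear_maps [simp]:
  "linear_maps R (\<Pi> M) N = linear_maps R M N" "linear_maps R N (\<Pi> M) = linear_maps R N M"
  by (simp_all add: linear_maps_def hom_def)

lemma (in graded_module) independent:
  assumes "\<And>i. c i \<in> grade M i" "finite {i. c i \<noteq> \<zero>\<^bsub>M\<^esub>}" "(\<Oplus>\<^bsub>M\<^esub>i\<in>{i. c i \<noteq> \<zero>\<^bsub>M\<^esub>}. c i) = \<zero>\<^bsub>M\<^esub>"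
  shows "c i = \<zero>\<^bsub>M\<^esub>"
proof -
  have "component M \<zero>\<^bsub>M\<^esub> = c"
    by (rule component_unique[OF assms(1,2) subset_refl assms(3)[symmetric]])
  then show ?thesis using component_homogeneous[OF grade_zero[of i], of i] by simp
qed

lemma suspension_graded:
  fixes M :: "('k, 'a) graded_module"
  assumes "graded_module R M"
  shows "graded_module R (\<Pi> M)"
proof -
  interpret M: graded_module R M by fact
  have mod: "module R (\<Pi> M)" by (rule module_cong[OF M.module_axioms]) simp_all
  interpret S: module R "\<Pi> M" by (rule mod)
  show ?thesis
  proof (rule graded_moduleI[OF mod])
    show "submodule (grade (\<Pi> M) i) R (\<Pi> M)" for i
      using M.grade_submodule[of "i - 1"] unfolding S.submodule_iff M.submodule_iff by simp
    have "(\<Union>i. grade (\<Pi> M) i) = (\<Union>i. grade M i)"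
      by (auto simp: image_iff) (metis add_diff_cancel_right')
    then show "x \<in> submodule_span R (\<Pi> M) (\<Union>i. grade (\<Pi> M) i)" if "x \<in> carrier (\<Pi> M)" for x
      using that submodule_span_cong[OF M.module_axioms, of "\<Pi> M" "\<Union>i. grade M i"] by (simp add: M.grade_span)
    fix c i
    assume c: "\<And>i. c i \<in> grade (\<Pi> M) i" and fin: "finite {i. c i \<noteq> \<zero>\<^bsub>\<Pi> M\<^esub>}"
      and sum: "(\<Oplus>\<^bsub>\<Pi> M\<^esub>i\<in>{i. c i \<noteq> \<zero>\<^bsub>\<Pi> M\<^esub>}. c i) = \<zero>\<^bsub>\<Pi> M\<^esub>"
    let ?c = "\<lambda>i. c (i + 1)"
    have b: "bij_betw (\<lambda>i. i + 1) {i. ?c i \<noteq> \<zero>\<^bsub>M\<^esub>} {i. c i \<noteq> \<zero>\<^bsub>M\<^esub>}"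
      by (rule bij_betw_byWitness[where f' = "\<lambda>i. i - 1"]) auto
    have c': "?c i \<in> grade M i" for i using c[of "i + 1"] by simp
    have "?c (i - 1) = \<zero>\<^bsub>M\<^esub>"
    proof (rule M.independent[where c = ?c, OF c'])
      show "finite {i. ?c i \<noteq> \<zero>\<^bsub>M\<^esub>}" using bij_betw_finite[OF b] fin by simp
      have "(\<Oplus>\<^bsub>M\<^esub>i\<in>{i. ?c i \<noteq> \<zero>\<^bsub>M\<^esub>}. ?c i) = (\<Oplus>\<^bsub>M\<^esub>i\<in>{i. c i \<noteq> \<zero>\<^bsub>M\<^esub>}. c i)"
        by (rule M.finsum_bij_betw[OF b]) (use c M.grade_closed in auto)
      then show "(\<Oplus>\<^bsub>M\<^esub>i\<in>{i. ?c i \<noteq> \<zero>\<^bsub>M\<^esub>}. ?c i) = \<zero>\<^bsub>M\<^esub>" using sum by simp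
    qed
    then show "c i = \<zero>\<^bsub>\<Pi> M\<^esub>" by simp
  qed
qed

section \<open>The reduced module, its suspension and the product with the unit\<close>

context graded_module_with_split_element
begin

abbreviation "A' \<equiv> reduced R A \<epsilon>"

lemma A_module: "module R A" ..

lemma A_graded: "graded_module R A" ..

lemma reduced_simps [simp]:
  "carrier A' = {a \<in> carrier A. \<epsilon> a = \<zero>}" "zero A' = zero A" "add A' = add A" "smult A' = smult A"
  "grade A' i = {a \<in> grade A i. \<epsilon> a = \<zero>}"
  by (simp_all add: reduced_def)

lemma u_closed: "u \<in> carrier A"
  by (rule grade_closed[OF split_element_degree])

lemma eps_linear: "\<epsilon> \<in> linear_maps R A (ground R)"
  using splitting by (simp add: Hom_deg_def)

lemma eps_closed: "a \<in> carrier A \<Longrightarrow> \<epsilon> a \<in> carrier R"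
  using linear_maps_closed[OF eps_linear] by simp

lemma eps_add: "\<lbrakk>a \<in> carrier A; b \<in> carrier A\<rbrakk> \<Longrightarrow> \<epsilon> (a \<oplus>\<^bsub>A\<^esub> b) = \<epsilon> a \<oplus> \<epsilon> b"
  using linear_maps_add[OF eps_linear] by simp

lemma eps_smult: "\<lbrakk>c \<in> carrier R; a \<in> carrier A\<rbrakk> \<Longrightarrow> \<epsilon> (c \<odot>\<^bsub>A\<^esub> a) = c \<otimes> \<epsilon> a"
  using linear_maps_smult[OF eps_linear] by simp

lemma A_k: "two_modules R A (ground R)"
  by (intro two_modulesI A_module R.ground_module)

lemma eps_zero [simp]: "\<epsilon> \<zero>\<^bsub>A\<^esub> = \<zero>"
  using two_modules.linear_maps_0[OF A_k eps_linear] by simp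

lemma reduced_module: "module R A'"
proof -
  have "submodule {a \<in> carrier A. \<epsilon> a = \<zero>} R A"
    unfolding submodule_iff by (auto simp: eps_add eps_smult)
  then have "module R (A\<lparr>carrier := {a \<in> carrier A. \<epsilon> a = \<zero>}\<rparr>)"
    by (rule submodule.submodule_is_module[OF _ A_module])
  then show ?thesis by (rule module_cong) simp_all
qed

lemma reduced_incl: "(\<lambda>x. x) \<in> linear_maps R A' A"
  by (rule linear_mapsI) auto

lemma reduced_A: "two_modules R A' A"
  by (intro two_modulesI A_module reduced_module)

lemma reduced_finsum: "(\<And>i. i \<in> I \<Longrightarrow> f i \<in> carrier A') \<Longrightarrow> finsum A' f I = finsum A f I"
  by (rule two_modules.linear_maps_finsum[OF reduced_A reduced_incl])

text \<open>The splitting has degree 0 and the ground ring sits in degree 0, so only the component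
  of degree 0 can have a nonzero value, and that value is the one of the whole element.\<close>

lemma component_reduced:
  assumes "x \<in> carrier A" "\<epsilon> x = \<zero>"
  shows "\<epsilon> (component A x i) = \<zero>"
proof -
  interpret k: module R "ground R" by (rule R.ground_module)
  have ne: "\<epsilon> (component A x j) = \<zero>" if "j \<noteq> 0" for j
  proof -
    have "\<epsilon> (component A x j) \<in> grade (ground R) (j + 0)"
      using splitting component(1)[OF assms(1), of j] unfolding Hom_deg_def by blast
    then show ?thesis using that by (simp add: ground_def)
  qed
  let ?T = "insert 0 {i. component A x i \<noteq> \<zero>\<^bsub>A\<^esub>}"
  have T: "finite ?T" using component(2)[OF assms(1)] by simp
  have "\<zero> = \<epsilon> (\<Oplus>\<^bsub>A\<^esub>i\<in>?T. component A x i)"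
    by (simp only: component_sum[OF assms(1) T subset_insertI] assms(2))
  also have "\<dots> = finsum (ground R) (\<lambda>i. \<epsilon> (component A x i)) ?T"
    by (rule two_modules.linear_maps_finsum[OF A_k eps_linear component_closed[OF assms(1)]])
  also have "\<dots> = \<epsilon> (component A x 0)"
    by (rule k.finsum_single[OF T]) (use ne eps_closed[OF component_closed[OF assms(1)]] in auto)
  finally show ?thesis using ne by (cases "i = 0") auto
qed

lemma reduced_graded: "graded_module R A'"
proof (rule graded_moduleI[OF reduced_module])
  interpret A': module R A' by (rule reduced_module)
  show "submodule (grade A' i) R A'" for i
    unfolding A'.submodule_iff
    using grade_closed[of _ i] grade_zero[of i] grade_add[of _ i] grade_smult[of _ _ i]
    by (auto simp: eps_add eps_smult)
  have gs: "(\<Union>i. grade A' i) \<subseteq> carrier A'" using grade_closed by auto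
  fix x assume "x \<in> carrier A'"
  then have x: "x \<in> carrier A" "\<epsilon> x = \<zero>" by auto
  have "component A x i \<in> grade A' i" for i
    using component(1)[OF x(1)] component_reduced[OF x] by simp
  then have "component A x i \<in> (\<Union>i. grade A' i)" for i by blast
  then have sp: "component A x i \<in> submodule_span R A' (\<Union>i. grade A' i)" for i
    using A'.submodule_span_superset by (rule subsetD[rotated])
  have "finsum A' (component A x) {i. component A x i \<noteq> \<zero>\<^bsub>A\<^esub>} = x"
    using reduced_finsum[of _ "component A x"] component_closed[OF x(1)] component_reduced[OF x]
      component(3)[OF x(1)] by simp
  moreover have "finsum A' (component A x) {i. component A x i \<noteq> \<zero>\<^bsub>A\<^esub>} \<in> submodule_span R A' (\<Union>i. grade A' i)"
    by (rule A'.submodule_finsum[OF A'.submodule_span_submodule[OF gs] sp])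
  ultimately show "x \<in> submodule_span R A' (\<Union>i. grade A' i)" by (simp only:)
next
  fix c i
  assume c: "\<And>i. c i \<in> grade A' i" and fin: "finite {i. c i \<noteq> \<zero>\<^bsub>A'\<^esub>}"
    and sum: "(\<Oplus>\<^bsub>A'\<^esub>i\<in>{i. c i \<noteq> \<zero>\<^bsub>A'\<^esub>}. c i) = \<zero>\<^bsub>A'\<^esub>"
  have "c i = \<zero>\<^bsub>A\<^esub>"
  proof (rule independent)
    show "c i \<in> grade A i" for i using c by simp
    show "finite {i. c i \<noteq> \<zero>\<^bsub>A\<^esub>}" using fin by simp
    have cA: "c i \<in> carrier A'" for i
      using c[of i] grade_closed by auto
    show "(\<Oplus>\<^bsub>A\<^esub>i\<in>{i. c i \<noteq> \<zero>\<^bsub>A\<^esub>}. c i) = \<zero>\<^bsub>A\<^esub>"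
      using sum reduced_finsum[OF cA, of "\<lambda>i. i" "{i. c i \<noteq> \<zero>\<^bsub>A\<^esub>}"] by simp
  qed
  then show "c i = \<zero>\<^bsub>A'\<^esub>" by simp
qed

abbreviation "B \<equiv> \<Pi> A"
abbreviation "V \<equiv> \<Pi> A'"

lemma B_graded: "graded_module R B"
  by (rule suspension_graded[OF A_graded])

lemma V_graded: "graded_module R V"
  by (rule suspension_graded[OF reduced_graded])

lemma B_module: "module R B"
  by (rule graded_module.axioms(1)[OF B_graded])

lemma V_module: "module R V"
  by (rule graded_module.axioms(1)[OF V_graded])

lemma V_incl: "(\<lambda>x. x) \<in> linear_maps R V B"
  using reduced_incl by simp

abbreviation "r \<equiv> reduction A u \<epsilon>"

lemma r_linear: "r \<in> linear_maps R B V"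
proof -
  have cl: "r a \<in> carrier A" if "a \<in> carrier A" for a
    using that u_closed eps_closed by (simp add: reduction_def)
  have e: "\<epsilon> (r a) = \<zero>" if "a \<in> carrier A" for a
    using that u_closed eps_closed
    by (simp add: reduction_def a_minus_def eps_add smult_l_minus[symmetric] eps_smult splitting_split_element R.r_neg)
  have "r (x \<oplus>\<^bsub>A\<^esub> y) = r x \<oplus>\<^bsub>A\<^esub> r y" if "x \<in> carrier A" "y \<in> carrier A" for x y
    using that u_closed eps_closed
    by (simp add: reduction_def a_minus_def eps_add smult_l_distr M.minus_add M.a_ac)
  moreover have "r (c \<odot>\<^bsub>A\<^esub> x) = c \<odot>\<^bsub>A\<^esub> r x" if "c \<in> carrier R" "x \<in> carrier A" for c x
    using that u_closed eps_closed
    by (simp add: reduction_def a_minus_def eps_smult smult_assoc1 smult_r_distr smult_r_minus)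
  ultimately show ?thesis using cl e by (intro linear_mapsI) auto
qed

lemma r_reduced: "a \<in> carrier A' \<Longrightarrow> r a = a"
  using u_closed by (simp add: reduction_def a_minus_def)

lemma r_decomp:
  assumes "a \<in> carrier A"
  shows "a = r a \<oplus>\<^bsub>A\<^esub> \<epsilon> a \<odot>\<^bsub>A\<^esub> u"
  using assms u_closed eps_closed by (simp add: reduction_def a_minus_def M.a_assoc M.l_neg)

text \<open>A word in these letters either contains \<open>u\<close> or lies entirely in the reduced
  module. The vanishing of a multilinear expression can therefore be tested on these two kinds of
  words.\<close>

abbreviation "gens \<equiv> insert u (\<Union>i. grade A' i)"

lemma gens_closed: "gens \<subseteq> carrier B"
  using u_closed grade_closed by auto

lemma gens_span: "submodule_span R B gens = carrier B"
proof
  interpret B: module R B by (rule B_module)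
  interpret A': graded_module R A' by (rule reduced_graded)
  note H = B.submodule_span_submodule[OF gens_closed]
  show "submodule_span R B gens \<subseteq> carrier B" by (rule B.submodule_span_carrier[OF gens_closed])
  show "carrier B \<subseteq> submodule_span R B gens"
  proof
    fix a assume "a \<in> carrier B"
    then have a: "a \<in> carrier A" by simp
    have "r a \<in> carrier A'" using linear_maps_closed[OF r_linear] a by simp
    then have ra: "r a \<in> submodule_span R A' (\<Union>i. grade A' i)" by (simp only: A'.grade_span)
    have "r a \<in> submodule_span R B gens"
    proof (rule linear_maps_span_into[OF reduced_module B_module _ A'.grade_Union_subset H _ ra])
      show "(\<lambda>x. x) \<in> linear_maps R A' B" using reduced_incl by simp
      show "s \<in> submodule_span R B gens" if "s \<in> (\<Union>i. grade A' i)" for s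
        by (rule subsetD[OF B.submodule_span_superset]) (use that in blast)
    qed
    moreover have "u \<in> submodule_span R B gens"
      by (rule subsetD[OF B.submodule_span_superset]) simp
    ultimately have "r a \<oplus>\<^bsub>B\<^esub> \<epsilon> a \<odot>\<^bsub>B\<^esub> u \<in> submodule_span R B gens"
      using a eps_closed by (intro B.submoduleE(5)[OF H] B.submoduleE(4)[OF H]) auto
    then show "a \<in> submodule_span R B gens" using r_decomp[OF a] by simp
  qed
qed

text \<open>The description prescribes values on overlapping families of words, so a bilinear map
  realizing all of them has to be exhibited. Since \<open>sgn_map\<close> on the suspension sees a
  degree that is larger by one, (-1)^|a| a is minus the twist of a.\<close>

lemma mu_su_2:
  shows mu_su_linear: "mu_su R A u \<epsilon> 2 \<in> linear_maps R (tensor_power R B 2) A"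
    and mu_su_left: "\<And>a. a \<in> carrier A \<Longrightarrow> mu_su R A u \<epsilon> 2 (word_tensor R B [u, a]) = a"
    and mu_su_right: "\<And>a. a \<in> carrier A \<Longrightarrow> mu_su R A u \<epsilon> 2 (word_tensor R B [a, u]) = \<ominus>\<^bsub>A\<^esub> sgn_map R B (- 1) a"
    and mu_su_reduced: "\<And>a b. \<lbrakk>a \<in> carrier A'; b \<in> carrier A'\<rbrakk> \<Longrightarrow>
      mu_su R A u \<epsilon> 2 (word_tensor R B [a, b]) = \<zero>\<^bsub>A\<^esub>"
proof -
  interpret B: graded_module R B by (rule B_graded)
  interpret BA: two_modules R B A by (intro two_modulesI B_module A_module)
  interpret AA: two_modules R A A by (intro two_modulesI A_module)
  let ?s = "\<lambda>a. \<ominus>\<^bsub>A\<^esub> sgn_map R B (- 1) a"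
  \<comment> \<open>The first term handles the unit on the left and the second the unit on the
    right. The word of two units is counted by both, and the last term corrects this.\<close>
  let ?\<phi> = "\<lambda>a b. \<epsilon> a \<odot>\<^bsub>A\<^esub> b \<oplus>\<^bsub>A\<^esub> (\<epsilon> b \<odot>\<^bsub>A\<^esub> ?s a \<ominus>\<^bsub>A\<^esub> \<epsilon> a \<odot>\<^bsub>A\<^esub> (\<epsilon> b \<odot>\<^bsub>A\<^esub> u))"
  have s: "?s \<in> linear_maps R A A"
    using AA.linear_maps_uminus B.sgn_map_linear[of "- 1"] by simp
  have scl: "?s a \<in> carrier A" if "a \<in> carrier A" for a
    by (rule linear_maps_closed[OF s that])
  have eu: "(\<lambda>a. \<epsilon> a \<odot>\<^bsub>A\<^esub> c) \<in> linear_maps R A A" if "c \<in> carrier A" for c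
    by (rule linear_mapsI) (use that eps_closed in \<open>simp_all add: eps_add eps_smult smult_l_distr smult_assoc1\<close>)
  have l: "(\<lambda>a. ?\<phi> a b) \<in> linear_maps R A A" if "b \<in> carrier A" for b
    using that eps_closed u_closed
    by (intro AA.linear_maps_sum_pair AA.linear_maps_diff AA.linear_maps_scale eu s) auto
  have rr: "(\<lambda>b. ?\<phi> a b) \<in> linear_maps R A A" if "a \<in> carrier A" for a
    using that eps_closed u_closed scl
    by (intro AA.linear_maps_sum_pair AA.linear_maps_diff AA.linear_maps_scale eu linear_maps_id) auto
  have "multilinear R B A 2 (\<lambda>xs. ?\<phi> (xs ! 0) (xs ! 1))"
    unfolding multilinear_def
  proof (intro conjI ballI allI impI)
    fix xs assume "xs \<in> words B 2"
    then have "xs ! 0 \<in> carrier A" "xs ! 1 \<in> carrier A"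
      using nth_mem[of 0 xs] nth_mem[of 1 xs] by (auto simp: words_iff simp del: nth_mem)
    then show "?\<phi> (xs ! 0) (xs ! 1) \<in> carrier A"
      by (rule linear_maps_closed[OF l, rotated])
  next
    fix us vs assume us: "set us \<subseteq> carrier B" "set vs \<subseteq> carrier B" "Suc (length us + length vs) = 2"
    then consider b where "us = []" "vs = [b]" | a where "us = [a]" "vs = []"
      by (cases us; cases vs) auto
    then show "(\<lambda>x. ?\<phi> ((us @ x # vs) ! 0) ((us @ x # vs) ! 1)) \<in> linear_maps R B A"
      using l rr us by cases auto
  qed
  then obtain G where G: "G \<in> linear_maps R (tensor_power R B 2) A"
    "\<And>xs. xs \<in> words B 2 \<Longrightarrow> G (word_tensor R B xs) = ?\<phi> (xs ! 0) (xs ! 1)"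
    using tensor_power_lift[OF B_module A_module] by blast
  have Gw: "G (word_tensor R B [a, b]) = ?\<phi> a b" if "a \<in> carrier A" "b \<in> carrier A" for a b
    using G(2)[of "[a, b]"] that by (simp add: words_iff)
  have Gl: "G (word_tensor R B [u, a]) = a" if a: "a \<in> carrier A" for a
  proof -
    have "sgn_map R B (- 1) u = koszul_sign R (- 1 * 1) \<odot>\<^bsub>A\<^esub> u"
      using B.sgn_map_homogeneous[of u 1 "- 1"] split_element_degree by simp
    then have "?s u = u" using u_closed by (simp add: koszul_sign_def smult_l_minus)
    then show ?thesis
      using a u_closed eps_closed[OF a] by (simp add: Gw splitting_split_element M.r_neg M.minus_eq)
  qed
  have Gr: "G (word_tensor R B [a, u]) = ?s a" if a: "a \<in> carrier A" for a
    using a u_closed eps_closed[OF a] scl[OF a]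
    by (simp add: Gw splitting_split_element M.minus_eq M.a_lcomm[of _ "?s a"] M.r_neg)
  have G0: "G (word_tensor R B [a, b]) = \<zero>\<^bsub>A\<^esub>" if "a \<in> carrier A'" "b \<in> carrier A'" for a b
    using that u_closed scl by (simp add: Gw M.minus_eq)
  have sh: "?s a = koszul_sign R i \<odot>\<^bsub>A\<^esub> a" if "a \<in> grade A i" for a i
    using B.sgn_map_homogeneous[of a "i + 1" "- 1"] that grade_closed[OF that]
    by (auto simp: koszul_sign_def smult_l_minus)
  have sub: "word_tensor R B ` {xs. length xs = 2 \<and> set xs \<subseteq> gens} \<subseteq> carrier (tensor_power R B 2)"
    using subset_trans[OF _ gens_closed]
    by (intro image_subsetI word_tensor_closed[OF B_module]) (simp only: words_iff mem_Collect_eq)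
  have GB: "G \<in> linear_maps R (tensor_power R B 2) B" using G(1) by simp
  have "mu_su R A u \<epsilon> 2 \<in> linear_maps R (tensor_power R B 2) B \<and>
      (\<forall>x\<in>carrier (tensor_power R B 2). mu_su R A u \<epsilon> 2 x = G x)"
    unfolding mu_su_def if_P[OF refl]
  proof (rule the_linear_map_eq[OF tensor_power_module[OF B_module] B_module sub
        tensor_power_span_gens[OF B_module gens_closed gens_span] GB], goal_cases)
    case (1 F)
    have w: "word_tensor R B [a, b] \<in> carrier (tensor_power R B 2)" if "a \<in> carrier A" "b \<in> carrier A" for a b
      by (rule word_tensor_closed[OF B_module]) (use that in \<open>simp add: words_iff\<close>)
    show ?case
      using 1 w u_closed grade_closed Gl Gr G0 sh by simp
  next
    case (2 F s)
    note prem = 2(2)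
    from 2 obtain xs where xs: "s = word_tensor R B xs" "length xs = 2" "set xs \<subseteq> gens" by auto
    then obtain a b where ab: "xs = [a, b]" "a \<in> gens" "b \<in> gens"
      by (auto simp: numeral_2_eq_2 length_Suc_conv)
    from ab(2,3) consider "a = u" "b = u" | i where "a = u" "b \<in> grade A' i" | i where "a \<in> grade A' i" "b = u"
      | i j where "a \<in> grade A' i" "b \<in> grade A' j" by auto
    then have "F (word_tensor R B [a, b]) = G (word_tensor R B [a, b])"
    proof cases
      case 1
      then show ?thesis using prem split_element_degree u_closed Gl[OF u_closed] by (auto simp: koszul_sign_def)
    next
      case 2
      then show ?thesis using prem Gl[of b] grade_closed[of b i] by auto
    next
      case 3
      then show ?thesis using prem Gr[of a] sh[of a i] grade_closed[of a i] by auto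
    next
      case 4
      then show ?thesis using prem G0[of a b] grade_closed[of a i] grade_closed[of b j] by auto
    qed
    then show ?case using xs(1) ab(1) by simp
  qed
  note main = conjunct1[OF this] bspec[OF conjunct2[OF this]]
  have w: "word_tensor R B [a, b] \<in> carrier (tensor_power R B 2)" if "a \<in> carrier A" "b \<in> carrier A" for a b
    by (rule word_tensor_closed[OF B_module]) (use that in \<open>simp add: words_iff\<close>)
  show "mu_su R A u \<epsilon> 2 \<in> linear_maps R (tensor_power R B 2) A" using main(1) by simp
  show "mu_su R A u \<epsilon> 2 (word_tensor R B [u, a]) = a" if "a \<in> carrier A" for a
    using main(2)[OF w] Gl that u_closed by simp
  show "mu_su R A u \<epsilon> 2 (word_tensor R B [a, u]) = ?s a" if "a \<in> carrier A" for a
    using main(2)[OF w] Gr that u_closed by simp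
  show "mu_su R A u \<epsilon> 2 (word_tensor R B [a, b]) = \<zero>\<^bsub>A\<^esub>" if "a \<in> carrier A'" "b \<in> carrier A'" for a b
    using main(2)[OF w] G0 that by simp
qed

end

text \<open>The Gerstenhaber product is indexed by the arity i of the outer operation, so the inner
  block has n - i + 1 letters; reindexing gives a sum over blocks. The outer operation
  \<open>g\<close> is arbitrary in order to cover \<open>h\<close> as well, and \<open>J\<close>
  allows for the two ways, {0..<i} and {0..i - 1}, in which the range of j is written.\<close>

lemma (in odd_cochain) gerstenhaber_W:
  assumes P: "module R P" and g: "\<And>i. i \<ge> 1 \<Longrightarrow> g i \<in> linear_maps R (T i) P"
    and J: "\<And>i. i \<ge> 1 \<Longrightarrow> J i = {0..<i}"
  defines "\<Gamma> n x \<equiv> \<Oplus>\<^bsub>P\<^esub>i\<in>{1..n}. \<Oplus>\<^bsub>P\<^esub>j\<in>J i. g i (insert_map R V V (- 1) j (n - i + 1) (i - j - 1) (f (n - i + 1)) x)"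
  shows gerstenhaber_linear: "\<Gamma> n \<in> linear_maps R (T n) P"
    and gerstenhaber_word: "xs \<noteq> [] \<Longrightarrow> set xs \<subseteq> carrier V \<Longrightarrow> \<Gamma> (length xs) (wd xs) =
      finsum P (\<lambda>(k, i). g (length (ins xs k i)) (wd (ins xs k i))) (blocks (length xs))"
proof -
  interpret P: module R P by (rule P)
  have im: "insert_map R V V (- 1) j (n - i + 1) (i - j - 1) (f (n - i + 1)) \<in> linear_maps R (T n) (T i)"
    if "i \<in> {1..n}" "j \<in> J i" for n i j
  proof -
    have "j + (n - i + 1) + (i - j - 1) = n" "j + 1 + (i - j - 1) = i" using that J[of i] by auto
    then show ?thesis
      using insert_map_linear[OF graded_module_axioms V_module linear_maps_id f_linear, of "n - i + 1" "- 1" j "i - j - 1"]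
      by simp
  qed
  show "\<Gamma> n \<in> linear_maps R (T n) P"
    unfolding \<Gamma>_def
    by (intro two_modules.linear_maps_sum[OF two_modulesI[OF T_module P]] linear_maps_comp[OF im g]) auto
  assume xs: "xs \<noteq> []" "set xs \<subseteq> carrier V"
  let ?n = "length xs"
  let ?g = "\<lambda>ys. g (length ys) (wd ys)"
  have gc: "?g (ins xs k i) \<in> carrier P" if "(k, i) \<in> blocks ?n" for k i
    by (rule linear_maps_closed[OF g word_tensor_closed[OF V_module]])
      (use ins_closed[OF that xs(2)] ins_length[OF that] in \<open>simp_all add: words_iff\<close>)
  have "\<Gamma> ?n (wd xs) = (\<Oplus>\<^bsub>P\<^esub>i\<in>{1..?n}. \<Oplus>\<^bsub>P\<^esub>j\<in>J i. ?g (ins xs j (?n - i + 1)))"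
    unfolding \<Gamma>_def
  proof (intro P.finsum_cong'[OF refl])
    fix i j assume i: "i \<in> {1..?n}" and "j \<in> J i"
    then have j: "j < i" using J[of i] by simp
    let ?m = "?n - i + 1"
    have ji: "(j, ?m) \<in> blocks ?n" using i j by (auto simp: blocks_iff)
    have dec: "xs = take j xs @ take ?m (drop j xs) @ drop (j + ?m) xs"
      by (metis append_take_drop_id drop_drop add.commute)
    have lenb: "length (take ?m (drop j xs)) = ?m" using i j by auto
    have "insert_map R V V (- 1) j ?m (i - j - 1) (f ?m) (wd (take j xs @ take ?m (drop j xs) @ drop (j + ?m) xs)) =
        wd (map \<tau> (take j xs) @ f ?m (wd (take ?m (drop j xs))) # drop (j + ?m) xs)"
      by (rule insert_map_word[OF graded_module_axioms V_module linear_maps_id f_linear])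
        (use i j xs set_take_drop block_closed in auto)
    then have "insert_map R V V (- 1) j ?m (i - j - 1) (f ?m) (wd xs) = wd (ins xs j ?m)"
      using dec lenb by (simp only: ins_def F_def)
    moreover have "length (ins xs j ?m) = i" using ins_length[OF ji] i by simp
    ultimately show "g i (insert_map R V V (- 1) j ?m (i - j - 1) (f ?m) (wd xs)) = ?g (ins xs j ?m)"
      by simp
  qed (auto intro!: P.finsum_closed gc simp: blocks_iff J)
  also have "\<dots> = finsum P (\<lambda>(i, j). ?g (ins xs j (?n - i + 1))) (Sigma {1..?n} J)"
    by (rule P.finsum_Sigma) (auto intro!: gc simp: blocks_iff J)
  also have "\<dots> = finsum P (\<lambda>(k, i). ?g (ins xs k i)) (blocks ?n)"
  proof (rule P.finsum_bij_betw[where \<sigma> = "\<lambda>(i, j). (j, ?n - i + 1)"])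
    show "bij_betw (\<lambda>(i, j). (j, ?n - i + 1)) (Sigma {1..?n} J) (blocks ?n)"
      by (rule bij_betw_byWitness[where f' = "\<lambda>(j, i). (?n - i + 1, j)"]) (auto simp: blocks_iff J)
  qed (use gc in auto)
  finally show "\<Gamma> ?n (wd xs) = finsum P (\<lambda>(k, i). ?g (ins xs k i)) (blocks ?n)" .
qed

section \<open>Strictly unital cochains\<close>

locale strictly_unital_cochain = graded_module_with_split_element R A u \<epsilon>
  for R :: "('k, 'r) ring_scheme" (structure)
  and A :: "('k, 'a) graded_module" (structure) and u \<epsilon> +
  fixes \<mu> :: "('k, 'a, 'a) cochain" and h :: "('k, 'a, 'k) cochain"
  assumes mu: "\<mu> \<in> CC R (reduced R A \<epsilon>) (reduced R A \<epsilon>) (- 1)"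
    and h: "h \<in> CC R (reduced R A \<epsilon>) (ground R) (- 1)"
    and unital: "strictly_unital R A u (unital_sum R A u \<epsilon> \<mu> h)"
begin

abbreviation "\<nu> \<equiv> unital_sum R A u \<epsilon> \<mu> h"

text \<open>The calculus of insertions is used twice: here for the reduced cochain with its
  curvature, and as \<open>BB\<close> for the full cochain on the whole module. What remains is to
  compare the two on words.\<close>

sublocale VV: curved_cochain R "\<Pi> (reduced R A \<epsilon>)" \<mu> h
proof (intro curved_cochain.intro odd_cochain.intro tensor_coalgebra.intro V_graded
    odd_cochain_axioms.intro curved_cochain_axioms.intro)
  show "\<mu> n \<in> Hom_deg R (tensor_power R V n) V (- 1)" if "1 \<le> n" for n
    using mu that by (simp add: CC_def)
  show "h n \<in> Hom_deg R (tensor_power R V n) (\<Pi> (ground R)) (- 1)" if "1 \<le> n" for n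
    using h that by (simp add: CC_def)
qed

lemma nu_CC: "\<nu> \<in> CC R A A (- 1)"
  using unital by (simp add: strictly_unital_def)

sublocale BB: odd_cochain R "\<Pi> A" "unital_sum R A u \<epsilon> \<mu> h"
proof (intro odd_cochain.intro tensor_coalgebra.intro B_graded odd_cochain_axioms.intro)
  show "\<nu> n \<in> Hom_deg R (tensor_power R B n) B (- 1)" if "1 \<le> n" for n
    using nu_CC that by (simp add: CC_def)
qed

abbreviation "red xs \<equiv> set xs \<subseteq> carrier (reduced R A \<epsilon>)"

lemma redD: "red xs \<Longrightarrow> set xs \<subseteq> carrier A"
  by auto

lemma VV_A: "set xs \<subseteq> carrier V \<Longrightarrow> set xs \<subseteq> carrier A"
  by auto

lemma F_closed: "\<lbrakk>ys \<noteq> []; set ys \<subseteq> carrier A\<rbrakk> \<Longrightarrow> BB.F ys \<in> carrier A"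
  using BB.F_closed[of ys] by simp

lemma F_slot:
  assumes "set us \<subseteq> carrier A" "set vs \<subseteq> carrier A"
  shows "(\<lambda>x. BB.F (us @ x # vs)) \<in> linear_maps R A A"
  using BB.F_linear[of us vs] assms by simp

lemma AA: "two_modules R A A"
  by (intro two_modulesI A_module)

lemma F_slot_zero: "\<lbrakk>set us \<subseteq> carrier A; set vs \<subseteq> carrier A\<rbrakk> \<Longrightarrow> BB.F (us @ \<zero>\<^bsub>A\<^esub> # vs) = \<zero>\<^bsub>A\<^esub>"
  by (rule two_modules.linear_maps_0[OF AA F_slot])

lemma F_slot_neg: "\<lbrakk>set us \<subseteq> carrier A; set vs \<subseteq> carrier A; x \<in> carrier A\<rbrakk>
    \<Longrightarrow> BB.F (us @ (\<ominus>\<^bsub>A\<^esub> x) # vs) = \<ominus>\<^bsub>A\<^esub> BB.F (us @ x # vs)"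
  by (rule two_modules.linear_maps_neg[OF AA F_slot])

lemma tau_closed: "x \<in> carrier A \<Longrightarrow> BB.\<tau> x \<in> carrier A"
  using BB.tau_closed by simp

lemma tau_tau: "x \<in> carrier A \<Longrightarrow> BB.\<tau> (BB.\<tau> x) = x"
  using BB.tau_tau by simp

text \<open>The unit has degree 0, hence degree 1 in the suspension.\<close>

lemma tau_u: "BB.\<tau> u = \<ominus>\<^bsub>A\<^esub> u"
  using BB.sgn_map_homogeneous[of u 1 "- 1"] split_element_degree u_closed
  by (simp add: koszul_sign_def smult_l_minus)

lemma tau_grade: "a \<in> grade A i \<Longrightarrow> BB.\<tau> a = \<ominus>\<^bsub>A\<^esub> (koszul_sign R i \<odot>\<^bsub>A\<^esub> a)"
  using BB.sgn_map_homogeneous[of a "i + 1" "- 1"] grade_closed[of a i]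
  by (auto simp: koszul_sign_def smult_l_minus)

text \<open>The grading of the reduced module is the restricted one, so both involutions give the
  same sign on homogeneous elements.\<close>

lemma tau_reduced: "a \<in> carrier V \<Longrightarrow> VV.\<tau> a = BB.\<tau> a"
proof (rule VV.linear_maps_eq_on_grades[OF B_module _ linear_maps_comp[OF V_incl BB.sgn_map_linear]])
  show "VV.\<tau> \<in> linear_maps R V B"
    using linear_maps_comp[OF VV.sgn_map_linear V_incl] .
  show "VV.\<tau> x = BB.\<tau> x" if "x \<in> grade V i" for i x
    using VV.sgn_map_homogeneous[OF that, of "- 1"] BB.sgn_map_homogeneous[of x i "- 1"] that by simp
qed

lemma F_unit_left: "a \<in> carrier A \<Longrightarrow> BB.F [u, a] = a"
proof (rule linear_maps_eq_on_grades[OF A_module _ linear_maps_id])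
  show "(\<lambda>a. BB.F [u, a]) \<in> linear_maps R A A" using F_slot[of "[u]" "[]"] u_closed by simp
  show "BB.F [u, a] = a" if "a \<in> grade A i" for a i
    using unital that by (simp add: strictly_unital_def BB.F_def numeral_2_eq_2)
qed

text \<open>Strict unitality fixes the value up to the sign of the unsuspended degree, which is
  opposite to the sign of the suspended degree in \<open>\<tau>\<close>.\<close>

lemma F_unit_right: "a \<in> carrier A \<Longrightarrow> BB.F [a, u] = \<ominus>\<^bsub>A\<^esub> BB.\<tau> a"
proof (rule linear_maps_eq_on_grades[where f = "\<lambda>a. BB.F [a, u]" and g = "\<lambda>a. \<ominus>\<^bsub>A\<^esub> BB.\<tau> a", OF A_module])
  show lin: "(\<lambda>a. BB.F [a, u]) \<in> linear_maps R A A" using F_slot[of "[]" "[u]"] u_closed by simp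
  show "(\<lambda>a. \<ominus>\<^bsub>A\<^esub> BB.\<tau> a) \<in> linear_maps R A A"
    using two_modules.linear_maps_uminus[OF AA, of BB.\<tau>] BB.sgn_map_linear[of "- 1"] by simp
  fix i a assume a: "a \<in> grade A i"
  have aA: "a \<in> carrier A" by (rule grade_closed[OF a])
  have Fc: "BB.F [a, u] \<in> carrier A" by (rule linear_maps_closed[OF lin aA])
  have "koszul_sign R i \<odot>\<^bsub>A\<^esub> BB.F [a, u] = a"
    using unital a by (simp add: strictly_unital_def BB.F_def numeral_2_eq_2)
  then have "koszul_sign R i \<odot>\<^bsub>A\<^esub> a = koszul_sign R i \<odot>\<^bsub>A\<^esub> (koszul_sign R i \<odot>\<^bsub>A\<^esub> BB.F [a, u])"
    by simp
  also have "\<dots> = BB.F [a, u]"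
    using Fc by (simp add: smult_assoc1[symmetric] koszul_sign_add) (simp add: koszul_sign_def)
  finally show "BB.F [a, u] = \<ominus>\<^bsub>A\<^esub> BB.\<tau> a"
    using aA Fc by (simp add: tau_grade[OF a])
qed

lemma F_unit_zero: "\<lbrakk>u \<in> set ys; set ys \<subseteq> carrier A; length ys \<noteq> 2\<rbrakk> \<Longrightarrow> BB.F ys = \<zero>\<^bsub>A\<^esub>"
proof -
  assume ys: "u \<in> set ys" "set ys \<subseteq> carrier A" "length ys \<noteq> 2"
  then have "1 \<le> length ys" by (cases ys) auto
  then show ?thesis
    using unital ys by (simp add: strictly_unital_def BB.F_def words_iff)
qed

text \<open>On reduced words the projection to the reduced module is the identity and the product
  with the unit vanishes, so only the components in the reduced module and in k remain.\<close>

lemma F_reduced: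
  assumes ys: "ys \<noteq> []" "red ys"
  shows "BB.F ys = VV.F ys \<oplus>\<^bsub>A\<^esub> VV.H ys \<odot>\<^bsub>A\<^esub> u"
proof -
  let ?n = "length ys"
  have "map r ys = ys" using ys(2) r_reduced by (intro map_idI) auto
  then have t: "tensor_power_map R B V ?n r (word_tensor R B ys) = word_tensor R V ys"
    using tensor_power_map_word[OF B_module V_module r_linear, of ys ?n] redD[OF ys(2)] by (simp add: words_iff)
  have m: "mu_su R A u \<epsilon> ?n (word_tensor R B ys) = \<zero>\<^bsub>A\<^esub>"
  proof (cases "?n = 2")
    case True
    then obtain a b where "ys = [a, b]" by (auto simp: numeral_2_eq_2 length_Suc_conv)
    then show ?thesis using mu_su_reduced[of a b] ys(2) by (simp add: numeral_2_eq_2)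
  qed (simp add: mu_su_def)
  have "VV.F ys \<in> carrier A" "VV.H ys \<in> carrier R"
    using VV.F_closed[of ys] VV.H_closed[of ys] ys by auto
  then show ?thesis
    using ys(1) u_closed by (simp add: BB.F_def unital_sum_def extend_by_zero_def t m VV.F_def VV.H_def)
qed

text \<open>The inner value splits into a reduced element and a multiple of \<open>u\<close>, and
  the outer operation is linear in the slot where it is inserted. With the reduced element inserted
  the word is again reduced, so the outer value splits once more.\<close>

lemma block_term:
  assumes xs: "red xs" and ki: "(k, i) \<in> blocks (length xs)"
  shows "BB.F (BB.ins xs k i) = (VV.F (VV.ins xs k i) \<oplus>\<^bsub>A\<^esub> VV.H (VV.ins xs k i) \<odot>\<^bsub>A\<^esub> u) \<oplus>\<^bsub>A\<^esub>
    VV.H (take i (drop k xs)) \<odot>\<^bsub>A\<^esub> BB.F (map BB.\<tau> (take k xs) @ u # drop (k + i) xs)"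
proof -
  let ?b = "take i (drop k xs)" and ?us = "map BB.\<tau> (take k xs)" and ?vs = "drop (k + i) xs"
  have xV: "set xs \<subseteq> carrier V" using xs by simp
  have b: "?b \<noteq> []" "red ?b" using VV.block_closed[OF xV] ki by (auto simp: blocks_iff)
  have us: "?us = map VV.\<tau> (take k xs)"
    using tau_reduced subsetD[OF VV.set_take_drop(1)[OF xV]] by (metis (no_types, lifting) map_cong)
  have c: "set ?us \<subseteq> carrier A" "set ?vs \<subseteq> carrier A"
    unfolding us
    by (rule VV_A[OF VV.set_map_tau[OF VV.set_take_drop(1)[OF xV]]] VV_A[OF VV.set_take_drop(2)[OF xV]])+
  have bc: "VV.F ?b \<in> carrier A" "VV.H ?b \<in> carrier R"
    using VV.F_closed[of ?b] VV.H_closed[of ?b] b by auto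
  have "BB.F (BB.ins xs k i) = BB.F (?us @ (VV.F ?b \<oplus>\<^bsub>A\<^esub> VV.H ?b \<odot>\<^bsub>A\<^esub> u) # ?vs)"
    by (simp only: BB.ins_def F_reduced[OF b])
  also have "\<dots> = BB.F (?us @ VV.F ?b # ?vs) \<oplus>\<^bsub>A\<^esub> VV.H ?b \<odot>\<^bsub>A\<^esub> BB.F (?us @ u # ?vs)"
    using bc u_closed by (simp add: linear_maps_add[OF F_slot[OF c]] linear_maps_smult[OF F_slot[OF c]])
  also have "?us @ VV.F ?b # ?vs = VV.ins xs k i"
    by (simp add: VV.ins_def us)
  also have "BB.F (VV.ins xs k i) = VV.F (VV.ins xs k i) \<oplus>\<^bsub>A\<^esub> VV.H (VV.ins xs k i) \<odot>\<^bsub>A\<^esub> u"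
    by (rule F_reduced[OF VV.ins_not_Nil]) (use VV.ins_closed[OF ki xV] in simp)
  finally show ?thesis .
qed

text \<open>An operation with an entry \<open>u\<close> survives only in arity two. The inner block
  therefore has n - 1 letters, and it omits either the last letter or the first; these are the two
  curvature terms.\<close>

lemma unit_terms:
  assumes xs: "xs \<noteq> []" "red xs"
  shows "finsum A (\<lambda>(k, i). VV.H (take i (drop k xs)) \<odot>\<^bsub>A\<^esub> BB.F (map BB.\<tau> (take k xs) @ u # drop (k + i) xs))
      (blocks (length xs)) =
    VV.H (butlast xs) \<odot>\<^bsub>A\<^esub> last xs \<ominus>\<^bsub>A\<^esub> VV.H (tl xs) \<odot>\<^bsub>A\<^esub> hd xs"
    (is "finsum A ?K (blocks ?n) = ?r")
proof -
  have xV: "set xs \<subseteq> carrier V" using xs by simp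
  have c: "set (map BB.\<tau> (take k xs)) \<subseteq> carrier A" "set (drop k xs) \<subseteq> carrier A" for k
    using BB.set_map_tau[of "take k xs"] VV_A[OF VV.set_take_drop(1)[OF xV]] VV_A[OF VV.set_take_drop(2)[OF xV]]
    by simp_all
  have zero: "?K (k, i) = \<zero>\<^bsub>A\<^esub>" if "(k, i) \<in> blocks ?n" "?n - i + 1 \<noteq> 2" for k i
  proof -
    have "BB.F (map BB.\<tau> (take k xs) @ u # drop (k + i) xs) = \<zero>\<^bsub>A\<^esub>"
      by (rule F_unit_zero) (use that c u_closed in \<open>auto simp: blocks_iff\<close>)
    then show ?thesis using VV.H_closed[OF VV.block_closed[OF xV]] by simp
  qed
  have hl: "hd xs \<in> carrier A" "last xs \<in> carrier A" "red (butlast xs)" "red (tl xs)"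
    using VV.hd_last_closed[OF xs(1) xV] by auto
  have Hc: "VV.H (butlast xs) \<in> carrier R" "VV.H (tl xs) \<in> carrier R"
    using hl by (intro VV.H_closed; simp)+
  show ?thesis
  proof (cases "?n = 1")
    \<comment> \<open>For a single letter the outer operation is unary and vanishes on
      \<open>u\<close>; on the other side both terms contain \<open>H []\<close>.\<close>
    case True
    then obtain x where x: "xs = [x]" by (auto simp: length_Suc_conv)
    have "finsum A ?K (blocks ?n) = finsum A (\<lambda>_. \<zero>\<^bsub>A\<^esub>) (blocks ?n)"
    proof (rule M.finsum_cong'[OF refl])
      fix p assume p: "p \<in> blocks ?n"
      obtain k i where ki: "p = (k, i)" by (cases p)
      show "?K p = \<zero>\<^bsub>A\<^esub>" unfolding ki by (rule zero) (use p ki True in \<open>auto simp: blocks_iff\<close>)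
    qed auto
    also have "\<dots> = ?r" using hl by (simp add: x VV.H_def M.minus_eq)
    finally show ?thesis .
  next
    case False
    then have n: "?n \<ge> 2" using xs(1) by (cases xs) (auto simp: Suc_le_eq)
    have K0: "?K (0, ?n - 1) = VV.H (butlast xs) \<odot>\<^bsub>A\<^esub> last xs"
    proof -
      have "drop (0 + (?n - 1)) xs = [last xs]"
        using n by (metis add_0 append_butlast_last_id append_eq_conv_conj length_butlast xs(1))
      then show ?thesis using F_unit_left[OF hl(2)] by (simp add: butlast_conv_take)
    qed
    \<comment> \<open>The omitted first letter is twisted by the insertion and once more by
      multiplication with the unit from the right; the twists cancel and the minus sign
      remains.\<close>
    have K1: "?K (1, ?n - 1) = \<ominus>\<^bsub>A\<^esub> (VV.H (tl xs) \<odot>\<^bsub>A\<^esub> hd xs)"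
    proof -
      obtain x ys where x: "xs = x # ys" using xs(1) by (cases xs) auto
      have "x \<in> carrier A" using hl x by simp
      then have "BB.F [BB.\<tau> x, u] = \<ominus>\<^bsub>A\<^esub> x"
        using F_unit_right[OF tau_closed] by (simp add: tau_tau)
      then show ?thesis using hl Hc by (simp add: x smult_r_minus)
    qed
    have "finsum A ?K {(0, ?n - 1), (1, ?n - 1)} = finsum A ?K (blocks ?n)"
    proof (rule M.finsum_eq_superset)
      show "{(0, ?n - 1), (1, ?n - 1)} \<subseteq> blocks ?n" using n by (auto simp: blocks_iff)
      fix p assume p: "p \<in> blocks ?n - {(0, ?n - 1), (1, ?n - 1)}"
      obtain k i where ki: "p = (k, i)" by (cases p)
      show "?K p = \<zero>\<^bsub>A\<^esub>"
        unfolding ki by (rule zero) (use p ki n in \<open>auto simp: blocks_iff\<close>)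
    next
      fix p :: "nat \<times> nat" assume "p \<in> {(0, ?n - 1), (1, ?n - 1)}"
      then show "?K p \<in> carrier A" using hl Hc K0 K1 by auto
    qed simp
    moreover have "finsum A ?K {(0, ?n - 1), (1, ?n - 1)} = ?K (0, ?n - 1) \<oplus>\<^bsub>A\<^esub> ?K (1, ?n - 1)"
      using hl Hc K0 K1 by (subst M.finsum_insert) (auto simp: M.finsum_insert)
    ultimately show ?thesis using K0 K1 by (simp add: M.minus_eq)
  qed
qed

text \<open>Negation in a record is chosen within its carrier, so a difference formed in the reduced
  module has to be identified with the difference formed in the full module.\<close>

lemma E_reduced:
  assumes xs: "xs \<noteq> []" "red xs"
  shows "VV.E xs = VV.MM xs \<oplus>\<^bsub>A\<^esub> (VV.H (butlast xs) \<odot>\<^bsub>A\<^esub> last xs \<ominus>\<^bsub>A\<^esub> VV.H (tl xs) \<odot>\<^bsub>A\<^esub> hd xs)"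
  proof -
    have xV: "set xs \<subseteq> carrier V" using xs by simp
    interpret A': module R A' by (rule reduced_module)
    have c: "last xs \<in> carrier A'" "hd xs \<in> carrier A'" "VV.H (butlast xs) \<in> carrier R" "VV.H (tl xs) \<in> carrier R"
      using VV.hd_last_closed[OF xs(1) xV] VV.H_closed by simp_all
    from two_modules.linear_maps_minus[OF reduced_A reduced_incl A'.smult_closed[OF c(3,1)] A'.smult_closed[OF c(4,2)]]
    show ?thesis unfolding VV.E_def by simp
  qed

text \<open>Of the three contributions in \<open>block_term\<close>, the first sums to the square of
  the reduced cochain, the second to a multiple of \<open>u\<close>, and the third is evaluated by
  \<open>unit_terms\<close>.\<close>

lemma MM_reduced:
  assumes xs: "xs \<noteq> []" "red xs"
  shows "BB.MM xs = VV.E xs \<oplus>\<^bsub>A\<^esub> VV.MH xs \<odot>\<^bsub>A\<^esub> u"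
proof -
  let ?n = "length xs"
  have xV: "set xs \<subseteq> carrier V" using xs by simp
  let ?K = "\<lambda>(k, i). VV.H (take i (drop k xs)) \<odot>\<^bsub>A\<^esub> BB.F (map BB.\<tau> (take k xs) @ u # drop (k + i) xs)"
  let ?F = "\<lambda>(k, i). VV.F (VV.ins xs k i)" and ?H = "\<lambda>(k, i). VV.H (VV.ins xs k i)"
  have Fc: "?F p \<in> carrier A'" if "p \<in> blocks ?n" for p
    using VV.F_ins_closed[OF _ xV] that by (cases p) auto
  have Hc: "?H p \<in> carrier R" if "p \<in> blocks ?n" for p
    using VV.H_closed[OF VV.ins_closed[OF _ xV]] that by (cases p) auto
  have Kc: "?K p \<in> carrier A" if "p \<in> blocks ?n" for p
  proof -
    obtain k i where ki: "p = (k, i)" by (cases p)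
    have "BB.F (map BB.\<tau> (take k xs) @ u # drop (k + i) xs) \<in> carrier A"
      using BB.set_map_tau[of "take k xs"] VV_A[OF VV.set_take_drop(1)[OF xV]] VV_A[OF VV.set_take_drop(2)[OF xV]]
        u_closed by (intro F_closed) simp_all
    then show ?thesis using VV.H_closed[OF VV.block_closed[OF xV]] by (simp add: ki)
  qed
  have "BB.MM xs = finsum A (\<lambda>p. (?F p \<oplus>\<^bsub>A\<^esub> ?H p \<odot>\<^bsub>A\<^esub> u) \<oplus>\<^bsub>A\<^esub> ?K p) (blocks ?n)"
    unfolding BB.MM_def suspension_finsum
  proof (rule M.finsum_cong'[OF refl])
    show "(\<lambda>p. (?F p \<oplus>\<^bsub>A\<^esub> ?H p \<odot>\<^bsub>A\<^esub> u) \<oplus>\<^bsub>A\<^esub> ?K p) \<in> blocks ?n \<rightarrow> carrier A"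
      using Fc Hc Kc u_closed by (intro Pi_I M.a_closed smult_closed) auto
    fix p assume p: "p \<in> blocks ?n"
    obtain k i where ki: "p = (k, i)" by (cases p)
    show "(case p of (k, i) \<Rightarrow> BB.F (BB.ins xs k i)) = (?F p \<oplus>\<^bsub>A\<^esub> ?H p \<odot>\<^bsub>A\<^esub> u) \<oplus>\<^bsub>A\<^esub> ?K p"
      using block_term[OF xs(2)] p by (simp add: ki)
  qed
  also have "\<dots> = finsum A (\<lambda>p. ?F p \<oplus>\<^bsub>A\<^esub> ?H p \<odot>\<^bsub>A\<^esub> u) (blocks ?n) \<oplus>\<^bsub>A\<^esub> finsum A ?K (blocks ?n)"
    by (rule M.finsum_addf) (use Fc Hc Kc u_closed in \<open>auto intro!: M.a_closed smult_closed\<close>)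
  also have "finsum A (\<lambda>p. ?F p \<oplus>\<^bsub>A\<^esub> ?H p \<odot>\<^bsub>A\<^esub> u) (blocks ?n) =
      finsum A ?F (blocks ?n) \<oplus>\<^bsub>A\<^esub> finsum A (\<lambda>p. ?H p \<odot>\<^bsub>A\<^esub> u) (blocks ?n)"
    by (rule M.finsum_addf) (use Fc Hc u_closed in auto)
  also have "finsum A ?F (blocks ?n) = VV.MM xs"
    unfolding VV.MM_def suspension_finsum by (rule reduced_finsum[OF Fc, symmetric])
  also have "finsum A (\<lambda>p. ?H p \<odot>\<^bsub>A\<^esub> u) (blocks ?n) = VV.MH xs \<odot>\<^bsub>A\<^esub> u"
  proof -
    have lin: "(\<lambda>c. c \<odot>\<^bsub>A\<^esub> u) \<in> linear_maps R (ground R) A"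
      by (rule linear_mapsI) (use u_closed in \<open>simp_all add: smult_l_distr smult_assoc1\<close>)
    interpret kA: two_modules R "ground R" A by (intro two_modulesI R.ground_module A_module)
    have "VV.MH xs = finsum (ground R) ?H (blocks ?n)"
      unfolding VV.MH_def by (rule finsum_ground[symmetric, OF R.is_cring Hc])
    then show ?thesis
      using kA.linear_maps_finsum[OF lin, of "blocks ?n" ?H] Hc by simp
  qed
  also have "finsum A ?K (blocks ?n) = VV.H (butlast xs) \<odot>\<^bsub>A\<^esub> last xs \<ominus>\<^bsub>A\<^esub> VV.H (tl xs) \<odot>\<^bsub>A\<^esub> hd xs"
    by (rule unit_terms[OF xs])
  finally have eq: "BB.MM xs = (VV.MM xs \<oplus>\<^bsub>A\<^esub> VV.MH xs \<odot>\<^bsub>A\<^esub> u) \<oplus>\<^bsub>A\<^esub>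
      (VV.H (butlast xs) \<odot>\<^bsub>A\<^esub> last xs \<ominus>\<^bsub>A\<^esub> VV.H (tl xs) \<odot>\<^bsub>A\<^esub> hd xs)" .
  have "VV.MM xs \<in> carrier A" using VV.MM_closed[OF xV] by simp
  moreover have "VV.MH xs \<in> carrier R"
    unfolding VV.MH_def using Hc by (intro R.finsum_closed) auto
  moreover have "VV.H (butlast xs) \<odot>\<^bsub>A\<^esub> last xs \<ominus>\<^bsub>A\<^esub> VV.H (tl xs) \<odot>\<^bsub>A\<^esub> hd xs \<in> carrier A"
    using VV.hd_last_closed[OF xs(1) xV] VV.H_closed by auto
  ultimately show ?thesis
    unfolding eq E_reduced[OF xs] using u_closed by (simp add: M.a_assoc M.a_comm[of "VV.MH xs \<odot>\<^bsub>A\<^esub> u"])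
qed

lemma MM_reduced_eq_zero_iff:
  assumes xs: "xs \<noteq> []" "red xs"
  shows "BB.MM xs = \<zero>\<^bsub>A\<^esub> \<longleftrightarrow> VV.E xs = \<zero>\<^bsub>A\<^esub> \<and> VV.MH xs = \<zero>"
proof -
  have xV: "set xs \<subseteq> carrier V" using xs by simp
  have E: "VV.E xs \<in> carrier A" "\<epsilon> (VV.E xs) = \<zero>" using VV.E_closed[OF xs(1) xV] by auto
  have M: "VV.MH xs \<in> carrier R"
    unfolding VV.MH_def using VV.H_closed[OF VV.ins_closed[OF _ xV]] by (intro R.finsum_closed) auto
  \<comment> \<open>The splitting isolates the coefficient of \<open>u\<close>, because the other
    summand lies in its kernel.\<close>
  have "\<epsilon> (BB.MM xs) = VV.MH xs"
    using E M u_closed by (simp add: MM_reduced[OF xs] eps_add eps_smult splitting_split_element)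
  then have MH: "VV.MH xs = \<zero>" if "BB.MM xs = \<zero>\<^bsub>A\<^esub>" using that by simp
  have "BB.MM xs = VV.E xs" if "VV.MH xs = \<zero>"
    using E(1) u_closed by (simp add: MM_reduced[OF xs] that)
  then show ?thesis using MH by auto
qed

text \<open>
  The terms that survive apply the binary operation, as the inner or the outer one, to a pair
  containing the letter \<open>u\<close>. There are none or two of them, with opposite signs.
\<close>

lemma MM_unit:
  assumes xs: "u \<in> set xs" "set xs \<subseteq> carrier A"
  shows "BB.MM xs = \<zero>\<^bsub>A\<^esub>"
proof -
  obtain a b where ab: "xs = a @ u # b" using xs(1) by (auto simp: in_set_conv_decomp)
  have V: "set a \<subseteq> carrier A" "set b \<subseteq> carrier A" using xs(2) ab by auto
  have xB: "set xs \<subseteq> carrier B" using xs(2) by simp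
  let ?n = "length xs" and ?p = "length a"
  have n: "?n = Suc (?p + length b)" using ab by simp
  let ?t = "\<lambda>(k, i). BB.F (BB.ins xs k i)"
  have tc: "?t q \<in> carrier A" if "q \<in> blocks ?n" for q
    using BB.F_ins_closed[OF _ xB] that by (cases q) auto
  \<comment> \<open>The chosen occurrence of \<open>u\<close> at position \<open>?p\<close> belongs
    to the block, so the inner operation vanishes unless it is binary.\<close>
  have inside: "?t (k, i) = \<zero>\<^bsub>A\<^esub>" if ki: "(k, i) \<in> blocks ?n" "k \<le> ?p" "?p < k + i" "i \<noteq> 2" for k i
  proof -
    have "take i (drop k xs) ! (?p - k) = xs ! ?p"
      using ki by (subst nth_take, linarith, subst nth_drop) (auto simp: blocks_iff)
    then have "u = take i (drop k xs) ! (?p - k)" by (simp only: ab nth_append_length)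
    moreover have "?p - k < length (take i (drop k xs))" using ki n by (auto simp: blocks_iff)
    ultimately have "u \<in> set (take i (drop k xs))" using nth_mem by metis
    then have "BB.F (take i (drop k xs)) = \<zero>\<^bsub>A\<^esub>"
      by (rule F_unit_zero) (use BB.block_closed[OF xB] ki in \<open>auto simp: blocks_iff\<close>)
    moreover have "set (map BB.\<tau> (take k xs)) \<subseteq> carrier A" "set (drop (k + i) xs) \<subseteq> carrier A"
      using BB.set_map_tau[OF BB.set_take_drop(1)[OF xB]] BB.set_take_drop(2)[OF xB] by auto
    ultimately show ?thesis by (simp add: BB.ins_def F_slot_zero)
  qed
  \<comment> \<open>The chosen occurrence of \<open>u\<close> is an entry of the outer operation,
    whose arity is n - i + 1.\<close>
  have outside: "?t (k, i) = \<zero>\<^bsub>A\<^esub>" if ki: "(k, i) \<in> blocks ?n" "?p < k \<or> k + i \<le> ?p" "?n - i + 1 \<noteq> 2" for k i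
  proof -
    have len: "length (BB.ins xs k i) \<noteq> 2" using BB.ins_length[OF ki(1)] ki(3) by simp
    have cl: "set (BB.ins xs k i) \<subseteq> carrier A" using BB.ins_closed[OF ki(1) xB] by simp
    from ki(2) show ?thesis
    proof
      \<comment> \<open>To the left of the block the unit is twisted into its negative, and
        linearity in that slot takes the sign out.\<close>
      assume k: "?p < k"
      let ?us = "map BB.\<tau> a" and ?vs = "drop (Suc ?p) (BB.ins xs k i)"
      have nth: "BB.ins xs k i ! ?p = \<ominus>\<^bsub>A\<^esub> u"
        using k ki(1) ab by (simp add: BB.ins_def nth_append blocks_iff tau_u)
      have tk: "take ?p (BB.ins xs k i) = ?us"
        using BB.ins_take_left(1)[OF ki(1), of ?p] k ab by simp
      have "?p < length (BB.ins xs k i)" using BB.ins_length[OF ki(1)] k ki(1) by (auto simp: blocks_iff)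
      then have dec: "BB.ins xs k i = ?us @ (\<ominus>\<^bsub>A\<^esub> u) # ?vs"
        using id_take_nth_drop[of ?p "BB.ins xs k i"] by (simp add: nth tk)
      have c: "set ?us \<subseteq> carrier A" "set ?vs \<subseteq> carrier A"
        using cl tau_closed V BB.set_take_drop(2)[of "BB.ins xs k i"] by auto
      have "BB.F (?us @ u # ?vs) = \<zero>\<^bsub>A\<^esub>"
      proof (rule F_unit_zero)
        have "length (?us @ u # ?vs) = length (BB.ins xs k i)"
          using \<open>?p < length (BB.ins xs k i)\<close> by simp
        then show "length (?us @ u # ?vs) \<noteq> 2" using len by simp
      qed (use c u_closed in auto)
      then have "BB.F (?us @ (\<ominus>\<^bsub>A\<^esub> u) # ?vs) = \<zero>\<^bsub>A\<^esub>"
        using F_slot_neg[OF c u_closed] by simp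
      then show ?thesis using dec by simp
    next
      assume k: "k + i \<le> ?p"
      then have "u \<in> set (BB.ins xs k i)" by (simp add: BB.ins_def ab)
      from F_unit_zero[OF this cl len] show ?thesis by simp
    qed
  qed
  have two: "finsum A ?t (blocks ?n) = ?t q \<oplus>\<^bsub>A\<^esub> ?t q'"
    if q: "q \<in> blocks ?n" "q' \<in> blocks ?n" "q \<noteq> q'"
      and z: "\<And>k i. \<lbrakk>(k, i) \<in> blocks ?n; (k, i) \<noteq> q; (k, i) \<noteq> q'\<rbrakk> \<Longrightarrow>
        (k \<le> ?p \<and> ?p < k + i \<and> i \<noteq> 2) \<or> ((?p < k \<or> k + i \<le> ?p) \<and> ?n - i + 1 \<noteq> 2)" for q q'
  proof -
    have "finsum A ?t {q, q'} = finsum A ?t (blocks ?n)"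
    proof (rule M.finsum_eq_superset)
      fix s assume s: "s \<in> blocks ?n - {q, q'}"
      obtain k i where ki: "s = (k, i)" by (cases s)
      show "?t s = \<zero>\<^bsub>A\<^esub>" using z[of k i] inside[of k i] outside[of k i] s ki by auto
    qed (use q tc in auto)
    moreover have "finsum A ?t {q, q'} = ?t q \<oplus>\<^bsub>A\<^esub> ?t q'"
      using q tc by (subst M.finsum_insert) (auto simp: M.finsum_insert)
    ultimately show ?thesis by simp
  qed
  \<comment> \<open>The unit is absorbed by its right neighbour. The neighbour is left as it is, and
    the letters before the unit stay twisted.\<close>
  have left: "?t (?p, 2) = BB.F (map BB.\<tau> a @ b)" if "b \<noteq> []"
  proof -
    obtain y ys where b: "b = y # ys" using \<open>b \<noteq> []\<close> by (cases b) auto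
    have "BB.ins xs ?p 2 = map BB.\<tau> a @ BB.F [u, y] # ys"
      by (rule BB.ins_append) (simp_all add: ab b)
    then show ?thesis using F_unit_left V by (simp add: b)
  qed
  \<comment> \<open>The unit is absorbed by its left neighbour. This neighbour is not twisted by the
    insertion, but right multiplication by the unit twists it with a minus sign, so the same word
    results with the opposite sign.\<close>
  have right: "?t (?p - 1, 2) = \<ominus>\<^bsub>A\<^esub> BB.F (map BB.\<tau> a @ b)" if "a \<noteq> []"
  proof -
    obtain zs z where a: "a = zs @ [z]" using \<open>a \<noteq> []\<close> by (cases a rule: rev_cases) auto
    have z: "z \<in> carrier A" "set zs \<subseteq> carrier A" using V a by auto
    have "BB.ins xs (?p - 1) 2 = map BB.\<tau> zs @ BB.F [z, u] # b"
      by (rule BB.ins_append) (simp_all add: ab a)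
    also have "\<dots> = map BB.\<tau> zs @ (\<ominus>\<^bsub>A\<^esub> BB.\<tau> z) # b" using F_unit_right[OF z(1)] by simp
    finally show ?thesis
      using F_slot_neg[of "map BB.\<tau> zs" b "BB.\<tau> z"] z V tau_closed by (auto simp: a)
  qed
  have "BB.MM xs = finsum A ?t (blocks ?n)"
    by (simp add: BB.MM_def)
  also have "\<dots> = \<zero>\<^bsub>A\<^esub>"
  \<comment> \<open>Inside the word the unit is absorbed from both sides. At an end of the word one
    of these terms is missing; the outer product of the unit with the operation on all remaining
    letters takes its place.\<close>
  proof (cases "a = []")
    case True
    show ?thesis
    proof (cases "b = []")
      case True
      have "finsum A ?t (blocks ?n) = finsum A (\<lambda>_. \<zero>\<^bsub>A\<^esub>) (blocks ?n)"
      proof (rule M.finsum_cong'[OF refl])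
        fix s assume s: "s \<in> blocks ?n"
        obtain k i where ki: "s = (k, i)" by (cases s)
        have "k = 0" "i = 1" using s ki \<open>a = []\<close> True n by (auto simp: blocks_iff)
        then show "?t s = \<zero>\<^bsub>A\<^esub>" using inside[of k i] s ki \<open>a = []\<close> by simp
      qed auto
      then show ?thesis by simp
    next
      case False
      have bl: "length b \<ge> 1" using False by (cases b) auto
      have Fb: "BB.F b \<in> carrier A" by (rule F_closed[OF False V(2)])
      have "BB.ins xs 1 (length b) = map BB.\<tau> [u] @ BB.F b # []"
        by (rule BB.ins_append) (simp_all add: ab \<open>a = []\<close>)
      then have "?t (1, length b) = \<ominus>\<^bsub>A\<^esub> BB.F b"
        using F_slot_neg[of "[]" "[BB.F b]" u] F_unit_left[OF Fb] Fb u_closed by (simp add: tau_u)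
      moreover have "?t (0, 2) = BB.F b" using left[OF False] \<open>a = []\<close> by simp
      moreover have "finsum A ?t (blocks ?n) = ?t (0, 2) \<oplus>\<^bsub>A\<^esub> ?t (1, length b)"
        by (rule two) (use bl n \<open>a = []\<close> in \<open>auto simp: blocks_iff\<close>)
      ultimately show ?thesis using Fb by (simp add: M.r_neg)
    qed
  next
    case False
    have al: "?p \<ge> 1" using False by (cases a) auto
    have mc: "set (map BB.\<tau> a @ b) \<subseteq> carrier A" using V tau_closed by auto
    have Fab: "BB.F (map BB.\<tau> a @ b) \<in> carrier A" by (rule F_closed) (use False mc in auto)
    show ?thesis
    proof (cases "b = []")
      case True
      have Fa: "BB.F a \<in> carrier A" by (rule F_closed[OF False V(1)])
      have "BB.ins xs 0 ?p = map BB.\<tau> [] @ BB.F a # [u]"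
        by (rule BB.ins_append) (simp_all add: ab True)
      then have "?t (0, ?p) = BB.F (map BB.\<tau> a @ b)"
        \<comment> \<open>The minus sign of right multiplication by the unit and the one from
          \<open>F_odd\<close> combine, so twisting the value is the same as twisting the
          entries.\<close>
        using F_unit_right[OF Fa] BB.F_odd[OF False] V True by simp
      moreover have "finsum A ?t (blocks ?n) = ?t (?p - 1, 2) \<oplus>\<^bsub>A\<^esub> ?t (0, ?p)"
        by (rule two) (use al n True in \<open>auto simp: blocks_iff\<close>)
      ultimately show ?thesis using right[OF False] Fab by (simp add: M.l_neg)
    next
      case b: False
      have bl: "length b \<ge> 1" using b by (cases b) auto
      have "finsum A ?t (blocks ?n) = ?t (?p - 1, 2) \<oplus>\<^bsub>A\<^esub> ?t (?p, 2)"
        by (rule two) (use al bl n in \<open>auto simp: blocks_iff\<close>)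
      then show ?thesis using right[OF False] left[OF b] Fab by (simp add: M.l_neg)
    qed
  qed
  finally show ?thesis .
qed

end

section \<open>Reduction of the three conditions to words in the reduced module\<close>

context strictly_unital_cochain
begin

text \<open>By multilinearity the square is tested on words over \<open>gens\<close>. Words
  containing \<open>u\<close> contribute no condition by \<open>MM_unit\<close>, and on the others
  the square splits into the two expressions on the right.\<close>

lemma A_infinity_iff:
  "A_infinity_structure R A \<nu> \<longleftrightarrow> (\<forall>xs. xs \<noteq> [] \<longrightarrow> red xs \<longrightarrow> VV.E xs = \<zero>\<^bsub>A\<^esub> \<and> VV.MH xs = \<zero>)"
proof -
  have g: "\<nu> i \<in> linear_maps R (tensor_power R B i) B" if "i \<ge> 1" for i
    by (rule BB.f_linear[OF that])
  let ?G = "\<lambda>n x. gerstenhaber R A A (- 1) \<nu> \<nu> n x"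
  have lin: "?G n \<in> linear_maps R (tensor_power R B n) B" for n
    unfolding gerstenhaber_def
    by (rule BB.gerstenhaber_linear[OF B_module g, where J = "\<lambda>i. {0..<i}"]) auto
  have word: "?G (length xs) (word_tensor R B xs) = BB.MM xs" if "xs \<noteq> []" "set xs \<subseteq> carrier A" for xs
    unfolding gerstenhaber_def BB.MM_def BB.F_def
    by (rule BB.gerstenhaber_word[OF B_module g, where J = "\<lambda>i. {0..<i}"]) (use that in auto)
  have wc: "word_tensor R B xs \<in> carrier (tensor_power R B (length xs))" if "set xs \<subseteq> carrier A" for xs
    by (rule word_tensor_closed[OF B_module]) (use that in \<open>simp add: words_iff\<close>)
  show ?thesis
  proof
    assume "A_infinity_structure R A \<nu>"
    then have z: "\<And>n x. \<lbrakk>n \<ge> 1; x \<in> carrier (tensor_power R B n)\<rbrakk> \<Longrightarrow> ?G n x = \<zero>\<^bsub>A\<^esub>"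
      by (simp add: A_infinity_structure_def)
    show "\<forall>xs. xs \<noteq> [] \<longrightarrow> red xs \<longrightarrow> VV.E xs = \<zero>\<^bsub>A\<^esub> \<and> VV.MH xs = \<zero>"
    proof (intro allI impI)
      fix xs assume xs: "xs \<noteq> []" "red xs"
      have "1 \<le> length xs" using xs(1) by (simp add: Suc_le_eq)
      then have "BB.MM xs = \<zero>\<^bsub>A\<^esub>"
        using z[OF _ wc[OF redD[OF xs(2)]]] word[OF xs(1) redD[OF xs(2)]] by simp
      then show "VV.E xs = \<zero>\<^bsub>A\<^esub> \<and> VV.MH xs = \<zero>" using MM_reduced_eq_zero_iff[OF xs] by simp
    qed
  next
    assume eq: "\<forall>xs. xs \<noteq> [] \<longrightarrow> red xs \<longrightarrow> VV.E xs = \<zero>\<^bsub>A\<^esub> \<and> VV.MH xs = \<zero>"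
    have "?G n x = \<zero>\<^bsub>A\<^esub>" if n: "n \<ge> 1" and x: "x \<in> carrier (tensor_power R B n)" for n x
    proof -
      interpret TB: two_modules R "tensor_power R B n" B by (intro two_modulesI tensor_power_module B_module)
      have "?G n x = (\<lambda>_. \<zero>\<^bsub>B\<^esub>) x"
      proof (rule tensor_power_linear_eqI[OF B_module gens_closed gens_span B_module lin TB.linear_maps_const_0 _ x])
        fix xs assume xs: "length xs = n" "set xs \<subseteq> gens"
        have xA: "set xs \<subseteq> carrier A" using subset_trans[OF xs(2) gens_closed] by simp
        have ne: "xs \<noteq> []" using xs(1) n by auto
        have "BB.MM xs = \<zero>\<^bsub>A\<^esub>"
        proof (cases "u \<in> set xs")
          case True
          then show ?thesis by (rule MM_unit[OF _ xA])
        next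
          case False
          then have "red xs" using xs(2) grade_closed by auto
          then show ?thesis using MM_reduced_eq_zero_iff[OF ne] eq ne by simp
        qed
        then show "?G n (word_tensor R B xs) = \<zero>\<^bsub>B\<^esub>" using word[OF ne xA] xs(1) by simp
      qed
      then show ?thesis by simp
    qed
    then show "A_infinity_structure R A \<nu>"
      by (simp add: A_infinity_structure_def nu_CC)
  qed
qed

section \<open>The displayed equations evaluated on words\<close>

abbreviation "h0 \<equiv> h(0 := (\<lambda>_. \<zero>))"

lemma h0_linear: "(\<lambda>y. h0 n y \<odot>\<^bsub>A\<^esub> u) \<in> linear_maps R (tensor_power R V n) B"
proof (cases "n = 0")
  case True
  interpret two_modules R "tensor_power R V n" B by (intro two_modulesI tensor_power_module B_module V_module)
  show ?thesis using linear_maps_const_0 True u_closed by simp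
next
  case False
  have "(\<lambda>c. c \<odot>\<^bsub>A\<^esub> u) \<in> linear_maps R (ground R) A"
    by (rule linear_mapsI) (use u_closed in \<open>simp_all add: smult_l_distr smult_assoc1\<close>)
  then show ?thesis
    using linear_maps_comp[OF VV.h_linear[of n]] False by simp
qed

lemma h0_word: "red ys \<Longrightarrow> h0 (length ys) (word_tensor R V ys) = VV.H ys"
  by (simp add: VV.H_def)

text \<open>Here \<open>h\<close> acts on the first letters, so no letter is moved past and no sign
  appears.\<close>

lemma left_term:
  assumes n: "n \<ge> 1"
  defines "L \<equiv> \<lambda>x. mu_su R A u \<epsilon> 2 (insert_map R V B (- 1) 0 (n - 1) 1 (\<lambda>y. h0 (n - 1) y \<odot>\<^bsub>A\<^esub> u) x)"
  shows left_term_linear: "L \<in> linear_maps R (tensor_power R V n) A"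
    and left_term_word: "\<And>xs. \<lbrakk>length xs = n; red xs\<rbrakk> \<Longrightarrow>
      L (word_tensor R V xs) = VV.H (butlast xs) \<odot>\<^bsub>A\<^esub> last xs"
proof -
  have dim: "0 + (n - 1) + 1 = n" "0 + 1 + 1 = (2::nat)" using n by auto
  note im = insert_map[OF V_graded B_module V_incl h0_linear, where e = "- 1" and j = 0 and m = 1 and i = "n - 1", unfolded dim]
  show "L \<in> linear_maps R (tensor_power R V n) A"
    unfolding L_def by (rule linear_maps_comp[OF im(1) mu_su_linear])
  fix xs assume xs: "length xs = n" "red xs"
  have ne: "xs \<noteq> []" using xs n by auto
  have hl: "red (butlast xs)" "last xs \<in> carrier A'"
    using VV.hd_last_closed[OF ne] xs by auto
  have H: "VV.H (butlast xs) \<in> carrier R" using VV.H_closed[of "butlast xs"] hl by simp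
  have lb: "length (butlast xs) = n - 1" using xs by simp
  have "insert_map R V B (- 1) 0 (n - 1) 1 (\<lambda>y. h0 (n - 1) y \<odot>\<^bsub>A\<^esub> u) (word_tensor R V ([] @ butlast xs @ [last xs])) =
      word_tensor R B (map VV.\<tau> [] @ (h0 (n - 1) (word_tensor R V (butlast xs)) \<odot>\<^bsub>A\<^esub> u) # [last xs])"
    by (rule im(2)) (use hl lb in simp_all)
  then have "L (word_tensor R V xs) = mu_su R A u \<epsilon> 2 (word_tensor R B ([] @ (VV.H (butlast xs) \<odot>\<^bsub>A\<^esub> u) # [last xs]))"
    using ne h0_word[OF hl(1)] unfolding lb L_def by simp
  also have "\<dots> = VV.H (butlast xs) \<odot>\<^bsub>A\<^esub> mu_su R A u \<epsilon> 2 (word_tensor R B ([] @ u # [last xs]))"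
    using linear_maps_smult[OF linear_maps_comp[OF word_tensor_linear[OF B_module, of "[]" "[last xs]" 2] mu_su_linear] H, of u]
      hl u_closed by simp
  finally show "L (word_tensor R V xs) = VV.H (butlast xs) \<odot>\<^bsub>A\<^esub> last xs"
    using mu_su_left[of "last xs"] hl by simp
qed

text \<open>Moving the odd \<open>h\<close> past the first letter twists it, and multiplication by
  the unit from the right is minus another twist. The twists cancel, which leaves the minus sign
  seen in \<open>E\<close>.\<close>

lemma right_term:
  assumes n: "n \<ge> 1"
  defines "L \<equiv> \<lambda>x. mu_su R A u \<epsilon> 2 (insert_map R V B (- 1) 1 (n - 1) 0 (\<lambda>y. h0 (n - 1) y \<odot>\<^bsub>A\<^esub> u) x)"
  shows right_term_linear: "L \<in> linear_maps R (tensor_power R V n) A"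
    and right_term_word: "\<And>xs. \<lbrakk>length xs = n; red xs\<rbrakk> \<Longrightarrow>
      L (word_tensor R V xs) = \<ominus>\<^bsub>A\<^esub> (VV.H (tl xs) \<odot>\<^bsub>A\<^esub> hd xs)"
proof -
  have dim: "1 + (n - 1) + 0 = n" "1 + 1 + 0 = (2::nat)" using n by auto
  note im = insert_map[OF V_graded B_module V_incl h0_linear, where e = "- 1" and j = 1 and m = 0 and i = "n - 1", unfolded dim]
  show "L \<in> linear_maps R (tensor_power R V n) A"
    unfolding L_def by (rule linear_maps_comp[OF im(1) mu_su_linear])
  fix xs assume xs: "length xs = n" "red xs"
  have ne: "xs \<noteq> []" using xs n by auto
  have hl: "red (tl xs)" "hd xs \<in> carrier A'"
    using VV.hd_last_closed[OF ne] xs by auto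
  have H: "VV.H (tl xs) \<in> carrier R" using VV.H_closed[of "tl xs"] hl by simp
  have lb: "length (tl xs) = n - 1" using xs by simp
  have t: "VV.\<tau> (hd xs) = BB.\<tau> (hd xs)" using tau_reduced hl by simp
  have tA: "BB.\<tau> (hd xs) \<in> carrier A" using tau_closed hl by simp
  have "insert_map R V B (- 1) 1 (n - 1) 0 (\<lambda>y. h0 (n - 1) y \<odot>\<^bsub>A\<^esub> u) (word_tensor R V ([hd xs] @ tl xs @ [])) =
      word_tensor R B (map VV.\<tau> [hd xs] @ (h0 (n - 1) (word_tensor R V (tl xs)) \<odot>\<^bsub>A\<^esub> u) # [])"
    by (rule im(2)) (use hl lb in simp_all)
  then have "L (word_tensor R V xs) = mu_su R A u \<epsilon> 2 (word_tensor R B ([BB.\<tau> (hd xs)] @ (VV.H (tl xs) \<odot>\<^bsub>A\<^esub> u) # []))"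
    using ne h0_word[OF hl(1)] t unfolding lb L_def by simp
  also have "\<dots> = VV.H (tl xs) \<odot>\<^bsub>A\<^esub> mu_su R A u \<epsilon> 2 (word_tensor R B ([BB.\<tau> (hd xs)] @ u # []))"
    using linear_maps_smult[OF linear_maps_comp[OF word_tensor_linear[OF B_module, of "[BB.\<tau> (hd xs)]" "[]" 2] mu_su_linear] H, of u]
      tA u_closed by simp
  finally show "L (word_tensor R V xs) = \<ominus>\<^bsub>A\<^esub> (VV.H (tl xs) \<odot>\<^bsub>A\<^esub> hd xs)"
    using mu_su_right[OF tA] hl H tau_tau[of "hd xs"] by (simp add: smult_r_minus)
qed

text \<open>\<open>eq1\<close> and \<open>eq2\<close> reproduce the two equations of the theorem
  symbol by symbol, so that unfolding them yields its statement.\<close>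

definition "eq1 n x \<longleftrightarrow>
  (\<Oplus>\<^bsub>A\<^esub>i\<in>{1..n}. \<Oplus>\<^bsub>A\<^esub>j\<in>{0..i - 1}.
      \<mu> i (insert_map R V V (- 1) j (n - i + 1) (i - j - 1) (\<mu> (n - i + 1)) x))
    \<oplus>\<^bsub>A\<^esub> mu_su R A u \<epsilon> 2 (insert_map R V B (- 1) 0 (n - 1) 1 (\<lambda>y. h0 (n - 1) y \<odot>\<^bsub>A\<^esub> u) x)
    \<oplus>\<^bsub>A\<^esub> mu_su R A u \<epsilon> 2 (insert_map R V B (- 1) 1 (n - 1) 0 (\<lambda>y. h0 (n - 1) y \<odot>\<^bsub>A\<^esub> u) x) = \<zero>\<^bsub>A\<^esub>"

definition "eq2 n x \<longleftrightarrow>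
  (\<Oplus>\<^bsub>R\<^esub>i\<in>{1..n}. \<Oplus>\<^bsub>R\<^esub>j\<in>{0..i - 1}.
      h i (insert_map R V V (- 1) j (n - i + 1) (i - j - 1) (\<mu> (n - i + 1)) x)) = \<zero>"

lemma eq1_iff:
  assumes n: "n \<ge> 1"
  shows "(\<forall>x\<in>carrier (tensor_power R V n). eq1 n x) \<longleftrightarrow>
    (\<forall>xs. length xs = n \<longrightarrow> red xs \<longrightarrow> VV.E xs = \<zero>\<^bsub>A\<^esub>)"
proof -
  let ?G = "\<lambda>x. (\<Oplus>\<^bsub>A\<^esub>i\<in>{1..n}. \<Oplus>\<^bsub>A\<^esub>j\<in>{0..i - 1}.
      \<mu> i (insert_map R V V (- 1) j (n - i + 1) (i - j - 1) (\<mu> (n - i + 1)) x))"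
  let ?L = "\<lambda>x. mu_su R A u \<epsilon> 2 (insert_map R V B (- 1) 0 (n - 1) 1 (\<lambda>y. h0 (n - 1) y \<odot>\<^bsub>A\<^esub> u) x)"
  let ?R = "\<lambda>x. mu_su R A u \<epsilon> 2 (insert_map R V B (- 1) 1 (n - 1) 0 (\<lambda>y. h0 (n - 1) y \<odot>\<^bsub>A\<^esub> u) x)"
  interpret TA: two_modules R "tensor_power R V n" A by (intro two_modulesI tensor_power_module V_module A_module)
  have g: "\<mu> i \<in> linear_maps R (tensor_power R V i) A" if "i \<ge> 1" for i
    using linear_maps_comp[OF VV.f_linear[OF that] V_incl] by simp
  have J: "{0..i - 1} = {0..<i}" if "i \<ge> 1" for i :: nat using that by auto
  have lin: "(\<lambda>x. ?G x \<oplus>\<^bsub>A\<^esub> ?L x \<oplus>\<^bsub>A\<^esub> ?R x) \<in> linear_maps R (tensor_power R V n) A"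
    by (intro TA.linear_maps_sum_pair left_term_linear[OF n] right_term_linear[OF n]
        VV.gerstenhaber_linear[OF A_module g J])
  have word: "?G (word_tensor R V xs) \<oplus>\<^bsub>A\<^esub> ?L (word_tensor R V xs) \<oplus>\<^bsub>A\<^esub> ?R (word_tensor R V xs) = VV.E xs"
    if xs: "length xs = n" "red xs" for xs
  proof -
    have ne: "xs \<noteq> []" using xs n by auto
    have xV: "set xs \<subseteq> carrier V" using xs by simp
    have "?G (word_tensor R V xs) = finsum A (\<lambda>(k, i). VV.F (VV.ins xs k i)) (blocks (length xs))"
      unfolding VV.F_def xs(1)[symmetric] by (rule VV.gerstenhaber_word[OF A_module g J ne xV])
    also have "\<dots> = VV.MM xs"
      unfolding VV.MM_def suspension_finsum
      by (rule reduced_finsum[symmetric]) (use VV.F_ins_closed[OF _ xV] in auto)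
    finally have G: "?G (word_tensor R V xs) = VV.MM xs" .
    have c: "VV.MM xs \<in> carrier A" "last xs \<in> carrier A'" "hd xs \<in> carrier A'"
      "VV.H (butlast xs) \<in> carrier R" "VV.H (tl xs) \<in> carrier R"
      using VV.MM_closed[OF xV] VV.hd_last_closed[OF ne xV] VV.H_closed by simp_all
    then show ?thesis
      unfolding G left_term_word[OF n xs] right_term_word[OF n xs] E_reduced[OF ne xs(2)]
      by (simp add: M.a_assoc M.minus_eq)
  qed
  have wc: "word_tensor R V xs \<in> carrier (tensor_power R V n)" if "length xs = n" "red xs" for xs
    by (rule word_tensor_closed[OF V_module]) (use that in \<open>simp add: words_iff\<close>)
  show ?thesis
  proof (intro iffI allI impI ballI)
    fix xs assume "\<forall>x\<in>carrier (tensor_power R V n). eq1 n x" "length xs = n" "red xs"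
    then show "VV.E xs = \<zero>\<^bsub>A\<^esub>" using wc word by (simp add: eq1_def)
  next
    fix x assume E: "\<forall>xs. length xs = n \<longrightarrow> red xs \<longrightarrow> VV.E xs = \<zero>\<^bsub>A\<^esub>" and x: "x \<in> carrier (tensor_power R V n)"
    have "?G x \<oplus>\<^bsub>A\<^esub> ?L x \<oplus>\<^bsub>A\<^esub> ?R x = (\<lambda>_. \<zero>\<^bsub>A\<^esub>) x"
    proof (rule tensor_power_linear_eqI_words[OF V_module A_module lin TA.linear_maps_const_0 _ x])
      fix xs assume "xs \<in> words V n"
      then have "length xs = n" "red xs" by (simp_all add: words_iff)
      then show "?G (word_tensor R V xs) \<oplus>\<^bsub>A\<^esub> ?L (word_tensor R V xs) \<oplus>\<^bsub>A\<^esub> ?R (word_tensor R V xs) = \<zero>\<^bsub>A\<^esub>"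
        using word E by simp
    qed
    then show "eq1 n x" by (simp add: eq1_def)
  qed
qed

lemma eq2_iff:
  assumes n: "n \<ge> 1"
  shows "(\<forall>x\<in>carrier (tensor_power R V n). eq2 n x) \<longleftrightarrow>
    (\<forall>xs. length xs = n \<longrightarrow> red xs \<longrightarrow> VV.MH xs = \<zero>)"
proof -
  let ?I = "\<lambda>i j x. insert_map R V V (- 1) j (n - i + 1) (i - j - 1) (\<mu> (n - i + 1)) x"
  \<comment> \<open>Linearity of the sum is available for the module \<open>ground R\<close>; the
    sum in the ring \<open>R\<close> that the equation uses is identified with it in
    \<open>G\<close> below.\<close>
  let ?G = "\<lambda>x. finsum (ground R) (\<lambda>i. finsum (ground R) (\<lambda>j. h i (?I i j x)) {0..i - 1}) {1..n}"
  interpret k: module R "ground R" by (rule R.ground_module)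
  interpret TA: two_modules R "tensor_power R V n" "ground R"
    by (intro two_modulesI tensor_power_module V_module R.ground_module)
  have J: "{0..i - 1} = {0..<i}" if "i \<ge> 1" for i :: nat using that by auto
  have lin: "?G \<in> linear_maps R (tensor_power R V n) (ground R)"
    by (rule VV.gerstenhaber_linear[OF R.ground_module VV.h_linear J])
  have hI: "h i (?I i j x) \<in> carrier R"
    if "i \<in> {1..n}" "j \<in> {0..i - 1}" "x \<in> carrier (tensor_power R V n)" for i j x
  proof -
    have "j + (n - i + 1) + (i - j - 1) = n" "j + 1 + (i - j - 1) = i" using that by auto
    then have "?I i j \<in> linear_maps R (tensor_power R V n) (tensor_power R V i)"
      using insert_map_linear[OF V_graded V_module linear_maps_id VV.f_linear, of "n - i + 1" "- 1" j "i - j - 1"] by simp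
    then show ?thesis
      using linear_maps_closed[OF linear_maps_comp[OF _ VV.h_linear[of i]] that(3)] that(1) by simp
  qed
  have G: "(\<Oplus>\<^bsub>R\<^esub>i\<in>{1..n}. \<Oplus>\<^bsub>R\<^esub>j\<in>{0..i - 1}. h i (?I i j x)) = ?G x"
    if x: "x \<in> carrier (tensor_power R V n)" for x
  proof -
    have "(\<Oplus>\<^bsub>R\<^esub>i\<in>{1..n}. \<Oplus>\<^bsub>R\<^esub>j\<in>{0..i - 1}. h i (?I i j x)) =
        (\<Oplus>\<^bsub>R\<^esub>i\<in>{1..n}. finsum (ground R) (\<lambda>j. h i (?I i j x)) {0..i - 1})"
      by (rule R.finsum_cong'[OF refl])
        (use hI[OF _ _ x] finsum_ground[OF R.is_cring, of "{0..i - 1}" "\<lambda>j. h i (?I i j x)" for i]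
          in \<open>auto intro!: R.finsum_closed simp del: suspension_simps\<close>)
    also have "\<dots> = ?G x"
      by (rule finsum_ground[OF R.is_cring, symmetric])
        (use hI[OF _ _ x] in \<open>auto intro!: k.finsum_closed[simplified]\<close>)
    finally show ?thesis .
  qed
  have word: "?G (word_tensor R V xs) = VV.MH xs" if xs: "length xs = n" "red xs" for xs
  proof -
    have ne: "xs \<noteq> []" using xs n by auto
    have xV: "set xs \<subseteq> carrier V" using xs by simp
    have "?G (word_tensor R V xs) = finsum (ground R) (\<lambda>(k, i). h (length (VV.ins xs k i)) (word_tensor R V (VV.ins xs k i))) (blocks (length xs))"
      unfolding xs(1)[symmetric] by (rule VV.gerstenhaber_word[OF R.ground_module VV.h_linear J ne xV])
    also have "(\<lambda>(k, i). h (length (VV.ins xs k i)) (word_tensor R V (VV.ins xs k i))) = (\<lambda>(k, i). VV.H (VV.ins xs k i))"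
      by (simp add: VV.H_def)
    also have "finsum (ground R) \<dots> (blocks (length xs)) = VV.MH xs"
      unfolding VV.MH_def
      by (rule finsum_ground[OF R.is_cring]) (use VV.H_closed[OF VV.ins_closed[OF _ xV]] in auto)
    finally show ?thesis .
  qed
  have wc: "word_tensor R V xs \<in> carrier (tensor_power R V n)" if "length xs = n" "red xs" for xs
    by (rule word_tensor_closed[OF V_module]) (use that in \<open>simp add: words_iff\<close>)
  show ?thesis
  proof (intro iffI allI impI ballI)
    fix xs assume eq: "\<forall>x\<in>carrier (tensor_power R V n). eq2 n x" and xs: "length xs = n" "red xs"
    have "eq2 n (word_tensor R V xs)" using eq wc[OF xs] by (rule bspec)
    then have "?G (word_tensor R V xs) = \<zero>" unfolding eq2_def G[OF wc[OF xs]] .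
    then show "VV.MH xs = \<zero>" unfolding word[OF xs] .
  next
    fix x assume E: "\<forall>xs. length xs = n \<longrightarrow> red xs \<longrightarrow> VV.MH xs = \<zero>" and x: "x \<in> carrier (tensor_power R V n)"
    have "?G x = (\<lambda>_. \<zero>\<^bsub>ground R\<^esub>) x"
    proof (rule tensor_power_linear_eqI_words[OF V_module R.ground_module lin TA.linear_maps_const_0 _ x])
      fix xs assume "xs \<in> words V n"
      then have "length xs = n" "red xs" by (simp_all add: words_iff)
      then show "?G (word_tensor R V xs) = \<zero>\<^bsub>ground R\<^esub>" using word E by simp
    qed
    then show "eq2 n x" using G[OF x] by (simp add: eq2_def)
  qed
qed

lemma equations_iff:
  "(\<forall>n\<ge>1. \<forall>x\<in>carrier (tensor_power R V n). eq1 n x \<and> eq2 n x) \<longleftrightarrow>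
    (\<forall>xs. xs \<noteq> [] \<longrightarrow> red xs \<longrightarrow> VV.E xs = \<zero>\<^bsub>A\<^esub> \<and> VV.MH xs = \<zero>)"
proof -
  have "(\<forall>n\<ge>1. \<forall>x\<in>carrier (tensor_power R V n). eq1 n x \<and> eq2 n x) \<longleftrightarrow>
      (\<forall>n\<ge>1. \<forall>xs. length xs = n \<longrightarrow> red xs \<longrightarrow> VV.E xs = \<zero>\<^bsub>A\<^esub> \<and> VV.MH xs = \<zero>)"
    using eq1_iff eq2_iff by (simp add: ball_conj_distrib) blast
  also have "\<dots> \<longleftrightarrow> (\<forall>xs. xs \<noteq> [] \<longrightarrow> red xs \<longrightarrow> VV.E xs = \<zero>\<^bsub>A\<^esub> \<and> VV.MH xs = \<zero>)"
    by (auto simp: Suc_le_eq)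
  finally show ?thesis .
qed

lemma curved_iff:
  "curved_dg_coalgebra R (T_co R V) (T_co_comult R V) (Phi_inv R V (- 1) \<mu>) (neg_desuspension R V h) \<longleftrightarrow>
    (\<forall>xs. xs \<noteq> [] \<longrightarrow> red xs \<longrightarrow> VV.E xs = \<zero>\<^bsub>A\<^esub> \<and> VV.MH xs = \<zero>)"
  using VV.curved_dg_coalgebra_iff by simp

end

theorem corollary4p11:
  fixes R :: "('k, 'r) ring_scheme"
    and A :: "('k, 'a) graded_module"
    and u :: 'a and \<epsilon> :: "'a \<Rightarrow> 'k"
    and \<mu> :: "('k, 'a, 'a) cochain" and h :: "('k, 'a, 'k) cochain"
  defines "A' \<equiv> reduced R A \<epsilon>"
    and "h0 \<equiv> h(0 := (\<lambda>_. \<zero>\<^bsub>R\<^esub>))"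
  assumes "cring R"
    and "graded_module_with_split_element R A u \<epsilon>"
    and "\<mu> \<in> CC R A' A' (- 1)"
    and "h \<in> CC R A' (ground R) (- 1)"
    and "strictly_unital R A u (unital_sum R A u \<epsilon> \<mu> h)"
  shows
    "(A_infinity_structure R A (unital_sum R A u \<epsilon> \<mu> h) \<longleftrightarrow>
      curved_dg_coalgebra R (T_co R (\<Pi> A')) (T_co_comult R (\<Pi> A'))
        (Phi_inv R (\<Pi> A') (- 1) \<mu>) (neg_desuspension R (\<Pi> A') h)) \<and>
     (A_infinity_structure R A (unital_sum R A u \<epsilon> \<mu> h) \<longleftrightarrow>
      (\<forall>n\<ge>1. \<forall>x\<in>carrier (tensor_power R (\<Pi> A') n).
        (\<Oplus>\<^bsub>A\<^esub>i\<in>{1..n}. \<Oplus>\<^bsub>A\<^esub>j\<in>{0..i - 1}.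
            \<mu> i (insert_map R (\<Pi> A') (\<Pi> A') (- 1) j (n - i + 1) (i - j - 1) (\<mu> (n - i + 1)) x))
          \<oplus>\<^bsub>A\<^esub> mu_su R A u \<epsilon> 2
                (insert_map R (\<Pi> A') (\<Pi> A) (- 1) 0 (n - 1) 1 (\<lambda>y. h0 (n - 1) y \<odot>\<^bsub>A\<^esub> u) x)
          \<oplus>\<^bsub>A\<^esub> mu_su R A u \<epsilon> 2
                (insert_map R (\<Pi> A') (\<Pi> A) (- 1) 1 (n - 1) 0 (\<lambda>y. h0 (n - 1) y \<odot>\<^bsub>A\<^esub> u) x)
          = \<zero>\<^bsub>A\<^esub> \<and>
        (\<Oplus>\<^bsub>R\<^esub>i\<in>{1..n}. \<Oplus>\<^bsub>R\<^esub>j\<in>{0..i - 1}.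
            h i (insert_map R (\<Pi> A') (\<Pi> A') (- 1) j (n - i + 1) (i - j - 1) (\<mu> (n - i + 1)) x))
          = \<zero>\<^bsub>R\<^esub>))"
proof -
  interpret S: strictly_unital_cochain R A u \<epsilon> \<mu> h
    using assms unfolding A'_def by (intro strictly_unital_cochain.intro strictly_unital_cochain_axioms.intro)
  show ?thesis
    unfolding A'_def h0_def
    using S.A_infinity_iff S.curved_iff S.equations_iff[unfolded S.eq1_def S.eq2_def] by simp
qed

end
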